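(* Let $(K\times J\subseteq\mathbb{R}^2,\ g_S=dy^2-f^2(y)dx^2)$ be a static spacetime, and let $(y_0,x_0)$, $(y_0',x_0')$ be two distinct points of it with $y_0\le y_0'$. They are (i) spacelike related if and only if $\int_{y_0}^{y_0'}f^{-1}>d(x_0,x_0')$. In this case there exists a unique geodesic which joins them; this geodesic is necessarily spacelike and without conjugate points. (ii) lightlike related if and only if $\int_{y_0}^{y_0'}f^{-1}=d(x_0,x_0')$. In this case there exists a unique geodesic which joins them; this geodesic is necessarily lightlike and without conjugate points. (iii) timelike related if and only if $\int_{y_0}^{y_0'}f^{-1}<d(x_0,x_0')$. All pairs of points which are timelike related can be joined by a geodesic (necessarily timelike) if and only if Condition (C) or Condition (R) holds.
   Context: $K=(a,b)$ and $J$ are open intervals of $\mathbb{R}$ ($-\infty\le a<b\le\infty$), $f:K\to(0,\infty)$ is smooth, $d(x_0,x_0')=|x_0-x_0'|$. The metric $g_S=dy^2-f(y)^2dx^2$ is the opposite of the GRW metric $-dy^2+f(y)^2dx^2$ with base $I=K$ and fiber $(F,g)=(J,dx^2)$; below $\mathrm{diam}(F)$ is the length of $J$, and Conditions (C), (R) refer to $f$ on $(a,b)$. With respect to $g_S$, a vector $X$ is timelike, lightlike, spacelike if $g_S(X,X)<0,=0,>0$ respectively. Two points are *spacelike* [resp. *timelike*, *lightlike*] *related* iff there exists a (smooth) spacelike [resp. timelike, lightlike with non-vanishing derivative] curve joining them. Uniqueness of geodesics is up to reparametrization. **Turning points.** For a base point $\tau_0\in(a,b)$ and $D\in\mathbb{R}$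 with $1/f^2(\tau_0)\ge D$ put $A_+=\{\tau\in(a,b):\tau\ge\tau_0,\ 1/f^2(\tau)=D\}\cup\{b\}$ and $A_-=\{\tau\in(a,b):\tau\le\tau_0,\ 1/f^2(\tau)=D\}\cup\{a\}$. Define $a_*=a_*(D)$, $b_*=b_*(D)$ as follows: if $\frac{d}{d\tau}\frac1{f^2}(\tau_0)>0$, $b_*=\min(A_+\setminus\{\tau_0\})$, $a_*=\max A_-$; if it is $<0$, $b_*=\min A_+$, $a_*=\max(A_-\setminus\{\tau_0\})$; if it is $0$, $b_*=\min A_+$, $a_*=\max A_-$. **Relative minima at the extremes.** Put $m_b=\liminf_{\tau\to b}1/f^2(\tau)$, $m_a=\liminf_{\tau\to a}1/f^2(\tau)$, $m=\inf_{(a,b)}1/f^2$. The function $1/f^2$ *reaches a relative minimum at $b$* if: when $b<\infty$, there is $\epsilon>0$ with $1/f^2(b-\epsilon')>m_b$ for all $0<\epsilon'<\epsilon$; when $b=\infty$, there is $M>0$ with $1/f^2(M')>m_b$ for all $M'>M$. Analogously at $a$ (with $a+\epsilon'$, resp. $-M'$, and $m_a$). A point $c$ is *close to* $b$ if $c\in(b-\epsilon,b)$ (resp. $c>M$) with such $\epsilon$, $M$; analogously for $a$. **The numbers $d_b,d_a$.** If $1/f^2$ reaches a relative minimum at $b$ and $\int_c^b f^{-2}(\frac1{f^2}-m_b)^{-1/2}d\tau<\infty$ for some $c$ close to $b$, define $$d_b=\limsup_{D\to m_b}\Big(\int_c^{b_*(D)}f^{-2}\big(\tfrac1{f^2}-D\big)^{-1/2}d\tau\Big)-\int_c^bf^{-2}\big(\tfrac1{f^2}-m_b\big)^{-1/2}d\tau\in[0,\infty]$$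 ($b_*(D)$ taken with base point $c$; this is independent of $c$). Analogously, when $1/f^2$ reaches a relative minimum at $a$ and $\int_a^cf^{-2}(\frac1{f^2}-m_a)^{-1/2}<\infty$, $d_a=\limsup_{D\to m_a}\big(\int_{a_*(D)}^{c}f^{-2}(\frac1{f^2}-D)^{-1/2}\big)-\int_a^cf^{-2}(\frac1{f^2}-m_a)^{-1/2}$. **The numbers $i_b,i_a$.** If moreover $2d_b<\mathrm{diam}(F)$ and $m<m_b$, define $i_b=\inf_{D\in(m,m_b]}\int_{a_*(D)}^{b}f^{-2}(\frac1{f^2}-D)^{-1/2}d\tau$, with $a_*(D)$ taken with a base point $\tau_0$ close to $b$ (independent of the choice). Analogously, if $2d_a<\mathrm{diam}(F)$ and $m<m_a$, $i_a=\inf_{D\in(m,m_a]}\int_a^{b_*(D)}f^{-2}(\frac1{f^2}-D)^{-1/2}d\tau$ with base point close to $a$. **Condition (C)** holds if, at the extreme $b$, one of the following holds: $1/f^2$ does not reach a relative minimum at $b$; or $\int_c^bf^{-2}(\frac1{f^2}-m_b)^{-1/2}=\infty$ for some $c$ close to $b$; or $2d_b\ge\mathrm{diam}(F)$; or $i_b$ is defined and $d_b\ge i_b$; and the analogous alternative holds at $a$ (with $\int_a^c f^{-2}(\frac1{f^2}-m_a)^{-1/2}$, $d_a$, $i_a$). **Condition (R).** Suppose $1/f^2>m$ on $(a,b)$ and $m_a=m_b=m$. For $\tau_0\in(a,b)$ and $D>m$ near $m$, with $a_*,b_*$ computed from base point $\tau_0$ and $h=f^{-2}(\frac1{f^2}-D)^{-1/2}$,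 put $R=\int_{\tau_0}^{b_*}h$, $\Lambda=\int_{a_*}^{\tau_0}h$, $W=\Lambda+R$. For $n\ge0$, let $E_n=R$ if $n$ is even and $E_n=\Lambda$ if $n$ is odd; let $G_n=\Lambda$ if $n$ is even and $G_n=R$ if $n$ is odd. For $n\ge1$ define $r_i^n(\tau_0)=\lim_{\epsilon\searrow0}\liminf_{D\searrow m}\{E_n+(n-1)W+\int_{a_*}^{b-\epsilon}h\}$ and $l_i^n(\tau_0)=\lim_{\epsilon\searrow0}\liminf_{D\searrow m}\{G_n+(n-1)W+\int_{a+\epsilon}^{b_*}h\}$; put $r_i^0(\tau_0)=\lim_{\epsilon\searrow0}\liminf_{D\searrow m}\int_{\tau_0}^{b-\epsilon}h$ and $l_i^0(\tau_0)=\lim_{\epsilon\searrow0}\liminf_{D\searrow m}\int_{a+\epsilon}^{\tau_0}h$; and for $n\ge0$ $r_s^n(\tau_0)=\lim_{\epsilon\searrow0}\limsup_{D\searrow m}\{E_n+nW+\int_{b-\epsilon}^{b_*}h\}$, $l_s^n(\tau_0)=\lim_{\epsilon\searrow0}\limsup_{D\searrow m}\{G_n+nW+\int_{a_*}^{a+\epsilon}h\}$. (If $b=\infty$, resp. $a=-\infty$, replace $b-\epsilon$ by $M$, resp. $a+\epsilon$ by $-M$, and $\epsilon\searrow0$ by $M\to\infty$.) Condition (R) holds if $1/f^2>m$ on $(a,b)$, $m_a=m_b=m$ and, for every $\tau_0\in(a,b)$, $$[r_i^0(\tau_0),\mathrm{diam}(F)]\subseteq\bigcup_{n\ge0}[r_i^n(\tau_0),r_s^n(\tau_0)],\qquad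 [l_i^0(\tau_0),\mathrm{diam}(F)]\subseteq\bigcup_{n\ge0}[l_i^n(\tau_0),l_s^n(\tau_0)],$$ where the intervals are sets of (finite) real numbers and an interval is empty if its left end exceeds its right end. *)

theory Defs
  imports "HOL-Analysis.Analysis"
begin

section \<open>Smooth curves in an open subset of Euclidean space\<close>

definition smooth_on :: "real set \<Rightarrow> (real \<Rightarrow> 'a::real_normed_vector) \<Rightarrow> bool" where
  "smooth_on U F \<longleftrightarrow>
     (\<forall>n. \<forall>t\<in>U. ((\<lambda>G t. vector_derivative G (at t)) ^^ n) F differentiable (at t))"

text \<open>Smoothness on the compact parameter interval means smoothness on an open neighbourhood
  of it, so that all derivatives below can be taken two-sided.\<close>

definition smooth_on_unit :: "(real \<Rightarrow> 'a::real_normed_vector) \<Rightarrow> bool" where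
  "smooth_on_unit F \<longleftrightarrow> (\<exists>U. open U \<and> {0..1} \<subseteq> U \<and> smooth_on U F)"

text \<open>Curves are parametrized by \<open>[0,1]\<close>; an affine change of parameter, which preserves
  geodesics and causal character, brings any compact parameter interval to this form.\<close>

definition joins :: "('a::real_normed_vector) set \<Rightarrow> (real \<Rightarrow> 'a) \<Rightarrow> 'a \<Rightarrow> 'a \<Rightarrow> bool" where
  "joins M \<gamma> p q \<longleftrightarrow> smooth_on_unit \<gamma> \<and> \<gamma> ` {0..1} \<subseteq> M \<and> \<gamma> 0 = p \<and> \<gamma> 1 = q"


section \<open>Semi-Riemannian geometry in one coordinate chart\<close>

text \<open>A metric is given by its matrix of components \<open>g p $ i $ j\<close>.\<close>

type_synonym 'n metric = "real ^ 'n \<Rightarrow> real ^ 'n ^ 'n"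

definition metric_form :: "'n::finite metric \<Rightarrow> real ^ 'n \<Rightarrow> real ^ 'n \<Rightarrow> real ^ 'n \<Rightarrow> real" where
  "metric_form g p X Y = X \<bullet> (g p *v Y)"

definition velocity :: "(real \<Rightarrow> real ^ 'n::finite) \<Rightarrow> real \<Rightarrow> real ^ 'n" where
  "velocity \<gamma> t = vector_derivative \<gamma> (at t)"

definition partial_deriv :: "'n::finite \<Rightarrow> (real ^ 'n \<Rightarrow> real) \<Rightarrow> real ^ 'n \<Rightarrow> real" where
  "partial_deriv i F p = deriv (\<lambda>s. F (p + s *\<^sub>R axis i 1)) 0"

definition christoffel :: "'n::finite metric \<Rightarrow> real ^ 'n \<Rightarrow> 'n \<Rightarrow> 'n \<Rightarrow> 'n \<Rightarrow> real" where
  "christoffel g p k i j =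
     (1 / 2) * (\<Sum>l\<in>UNIV. matrix_inv (g p) $ k $ l *
        (partial_deriv i (\<lambda>q. g q $ j $ l) p + partial_deriv j (\<lambda>q. g q $ i $ l) p
          - partial_deriv l (\<lambda>q. g q $ i $ j) p))"

text \<open>Covariant derivative of a vector field \<open>V\<close> along \<open>\<gamma>\<close> for the Levi-Civita connection.\<close>

definition cov_deriv ::
    "'n::finite metric \<Rightarrow> (real \<Rightarrow> real ^ 'n) \<Rightarrow> (real \<Rightarrow> real ^ 'n) \<Rightarrow> real \<Rightarrow> real ^ 'n" where
  "cov_deriv g \<gamma> V t = vector_derivative V (at t) +
     (\<chi> k. \<Sum>i\<in>UNIV. \<Sum>j\<in>UNIV. christoffel g (\<gamma> t) k i j * velocity \<gamma> t $ i * V t $ j)"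

text \<open>\<open>riemann g p l k i j\<close> is the \<open>l\<close>-th component of \<open>R(\<partial>\<^sub>i, \<partial>\<^sub>j) \<partial>\<^sub>k\<close>, with the sign convention
  \<open>R(X,Y)Z = \<nabla>\<^sub>X \<nabla>\<^sub>Y Z - \<nabla>\<^sub>Y \<nabla>\<^sub>X Z - \<nabla>\<^bsub>[X,Y]\<^esub> Z\<close>.\<close>

definition riemann :: "'n::finite metric \<Rightarrow> real ^ 'n \<Rightarrow> 'n \<Rightarrow> 'n \<Rightarrow> 'n \<Rightarrow> 'n \<Rightarrow> real" where
  "riemann g p l k i j =
     partial_deriv i (\<lambda>q. christoffel g q l j k) p - partial_deriv j (\<lambda>q. christoffel g q l i k) p
     + (\<Sum>m\<in>UNIV. christoffel g p m j k * christoffel g p l i m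
                 - christoffel g p m i k * christoffel g p l j m)"

text \<open>\<open>curvature g p X Y Z\<close> is \<open>R(X,Y)Z\<close>.\<close>

definition curvature ::
    "'n::finite metric \<Rightarrow> real ^ 'n \<Rightarrow> real ^ 'n \<Rightarrow> real ^ 'n \<Rightarrow> real ^ 'n \<Rightarrow> real ^ 'n" where
  "curvature g p X Y Z =
     (\<chi> l. \<Sum>i\<in>UNIV. \<Sum>j\<in>UNIV. \<Sum>k\<in>UNIV. riemann g p l k i j * X $ i * Y $ j * Z $ k)"

definition geodesic_joins ::
    "'n::finite metric \<Rightarrow> (real ^ 'n) set \<Rightarrow> (real \<Rightarrow> real ^ 'n) \<Rightarrow> real ^ 'n \<Rightarrow> real ^ 'n \<Rightarrow> bool" where
  "geodesic_joins g M \<gamma> p q \<longleftrightarrow>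
     joins M \<gamma> p q \<and> (\<forall>t\<in>{0..1}. cov_deriv g \<gamma> (velocity \<gamma>) t = 0)"

definition jacobi_field ::
    "'n::finite metric \<Rightarrow> (real \<Rightarrow> real ^ 'n) \<Rightarrow> (real \<Rightarrow> real ^ 'n) \<Rightarrow> bool" where
  "jacobi_field g \<gamma> V \<longleftrightarrow> smooth_on_unit V \<and>
     (\<forall>t\<in>{0..1}. cov_deriv g \<gamma> (cov_deriv g \<gamma> V) t
                   + curvature g (\<gamma> t) (V t) (velocity \<gamma> t) (velocity \<gamma> t) = 0)"

definition no_conjugate_points :: "'n::finite metric \<Rightarrow> (real \<Rightarrow> real ^ 'n) \<Rightarrow> bool" where
  "no_conjugate_points g \<gamma> \<longleftrightarrow>
     \<not> (\<exists>s\<in>{0..1}. \<exists>t\<in>{0..1}. s \<noteq> t \<and>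
          (\<exists>V. jacobi_field g \<gamma> V \<and> V s = 0 \<and> V t = 0 \<and> (\<exists>u\<in>{0..1}. V u \<noteq> 0)))"

definition timelike_curve :: "'n::finite metric \<Rightarrow> (real \<Rightarrow> real ^ 'n) \<Rightarrow> bool" where
  "timelike_curve g \<gamma> \<longleftrightarrow> (\<forall>t\<in>{0..1}. metric_form g (\<gamma> t) (velocity \<gamma> t) (velocity \<gamma> t) < 0)"

definition spacelike_curve :: "'n::finite metric \<Rightarrow> (real \<Rightarrow> real ^ 'n) \<Rightarrow> bool" where
  "spacelike_curve g \<gamma> \<longleftrightarrow> (\<forall>t\<in>{0..1}. metric_form g (\<gamma> t) (velocity \<gamma> t) (velocity \<gamma> t) > 0)"

definition lightlike_curve :: "'n::finite metric \<Rightarrow> (real \<Rightarrow> real ^ 'n) \<Rightarrow> bool" where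
  "lightlike_curve g \<gamma> \<longleftrightarrow>
     (\<forall>t\<in>{0..1}. metric_form g (\<gamma> t) (velocity \<gamma> t) (velocity \<gamma> t) = 0 \<and> velocity \<gamma> t \<noteq> 0)"

definition timelike_related ::
    "'n::finite metric \<Rightarrow> (real ^ 'n) set \<Rightarrow> real ^ 'n \<Rightarrow> real ^ 'n \<Rightarrow> bool" where
  "timelike_related g M p q \<longleftrightarrow> (\<exists>\<gamma>. joins M \<gamma> p q \<and> timelike_curve g \<gamma>)"

definition spacelike_related ::
    "'n::finite metric \<Rightarrow> (real ^ 'n) set \<Rightarrow> real ^ 'n \<Rightarrow> real ^ 'n \<Rightarrow> bool" where
  "spacelike_related g M p q \<longleftrightarrow> (\<exists>\<gamma>. joins M \<gamma> p q \<and> spacelike_curve g \<gamma>)"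

definition lightlike_related ::
    "'n::finite metric \<Rightarrow> (real ^ 'n) set \<Rightarrow> real ^ 'n \<Rightarrow> real ^ 'n \<Rightarrow> bool" where
  "lightlike_related g M p q \<longleftrightarrow> (\<exists>\<gamma>. joins M \<gamma> p q \<and> lightlike_curve g \<gamma>)"

text \<open>Uniqueness up to reparametrization: a reparametrization between two geodesics that are not
  constant is affine, so with domain \<open>[0,1]\<close> and ordered endpoints it is the identity.\<close>

definition unique_geodesic ::
    "'n::finite metric \<Rightarrow> (real ^ 'n) set \<Rightarrow> real ^ 'n \<Rightarrow> real ^ 'n \<Rightarrow> bool" where
  "unique_geodesic g M p q \<longleftrightarrow>
     (\<exists>\<gamma>. geodesic_joins g M \<gamma> p q) \<and>
     (\<forall>\<gamma> \<delta>. geodesic_joins g M \<gamma> p q \<and> geodesic_joins g M \<delta> p q \<longrightarrow> (\<forall>t\<in>{0..1}. \<gamma> t = \<delta> t))"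


section \<open>The static metric \<open>dy\<^sup>2 - f(y)\<^sup>2 dx\<^sup>2\<close>\<close>

text \<open>Coordinate 1 is \<open>y\<close> and coordinate 2 is \<open>x\<close>.\<close>

definition static_metric :: "(real \<Rightarrow> real) \<Rightarrow> 2 metric" where
  "static_metric f p = vector [vector [1, 0], vector [0, - (f (p $ 1))\<^sup>2]]"

definition strip :: "real set \<Rightarrow> real set \<Rightarrow> (real ^ 2) set" where
  "strip K J = {p. p $ 1 \<in> K \<and> p $ 2 \<in> J}"


section \<open>Turning points and the integrals between them\<close>

text \<open>The base interval is \<open>einterval a b\<close>. Points of \<open>[a,b]\<close> that may be extremes, such as turning
  points, are extended reals.\<close>

definition inv_sq :: "(real \<Rightarrow> real) \<Rightarrow> real \<Rightarrow> real" where
  "inv_sq f \<tau> = 1 / (f \<tau>)\<^sup>2"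

definition hint :: "(real \<Rightarrow> real) \<Rightarrow> real \<Rightarrow> ereal \<Rightarrow> ereal \<Rightarrow> ereal" where
  "hint f D u v =
     enn2ereal (\<integral>\<^sup>+ \<tau> \<in> einterval u v. ennreal (inv_sq f \<tau> / sqrt (inv_sq f \<tau> - D)) \<partial>lborel)"

definition A_plus :: "ereal \<Rightarrow> ereal \<Rightarrow> (real \<Rightarrow> real) \<Rightarrow> real \<Rightarrow> real \<Rightarrow> ereal set" where
  "A_plus a b f \<tau>0 D = ereal ` {\<tau> \<in> einterval a b. \<tau> \<ge> \<tau>0 \<and> inv_sq f \<tau> = D} \<union> {b}"

definition A_minus :: "ereal \<Rightarrow> ereal \<Rightarrow> (real \<Rightarrow> real) \<Rightarrow> real \<Rightarrow> real \<Rightarrow> ereal set" where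
  "A_minus a b f \<tau>0 D = ereal ` {\<tau> \<in> einterval a b. \<tau> \<le> \<tau>0 \<and> inv_sq f \<tau> = D} \<union> {a}"

text \<open>For smooth positive \<open>f\<close> and \<open>D \<le> inv_sq f \<tau>0\<close> the infima and suprema below are attained.\<close>

definition b_star :: "ereal \<Rightarrow> ereal \<Rightarrow> (real \<Rightarrow> real) \<Rightarrow> real \<Rightarrow> real \<Rightarrow> ereal" where
  "b_star a b f \<tau>0 D =
     (if deriv (inv_sq f) \<tau>0 > 0 then Inf (A_plus a b f \<tau>0 D - {ereal \<tau>0})
      else Inf (A_plus a b f \<tau>0 D))"

definition a_star :: "ereal \<Rightarrow> ereal \<Rightarrow> (real \<Rightarrow> real) \<Rightarrow> real \<Rightarrow> real \<Rightarrow> ereal" where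
  "a_star a b f \<tau>0 D =
     (if deriv (inv_sq f) \<tau>0 < 0 then Sup (A_minus a b f \<tau>0 D - {ereal \<tau>0})
      else Sup (A_minus a b f \<tau>0 D))"


section \<open>Condition (C)\<close>

definition m_inf :: "ereal \<Rightarrow> ereal \<Rightarrow> (real \<Rightarrow> real) \<Rightarrow> real" where
  "m_inf a b f = (INF \<tau>\<in>einterval a b. inv_sq f \<tau>)"

definition m_right :: "ereal \<Rightarrow> (real \<Rightarrow> real) \<Rightarrow> ereal" where
  "m_right b f = Liminf (at_left b) (\<lambda>\<tau>. ereal (inv_sq f (real_of_ereal \<tau>)))"

definition m_left :: "ereal \<Rightarrow> (real \<Rightarrow> real) \<Rightarrow> ereal" where
  "m_left a f = Liminf (at_right a) (\<lambda>\<tau>. ereal (inv_sq f (real_of_ereal \<tau>)))"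

text \<open>Here \<open>s\<close> plays the role of \<open>b - \<epsilon>\<close> if \<open>b < \<infinity>\<close> and of \<open>M\<close> if \<open>b = \<infinity>\<close>; similarly at \<open>a\<close>.\<close>

definition above_right :: "ereal \<Rightarrow> ereal \<Rightarrow> (real \<Rightarrow> real) \<Rightarrow> real \<Rightarrow> bool" where
  "above_right a b f s \<longleftrightarrow> a \<le> ereal s \<and> ereal s < b \<and>
     (\<forall>\<tau>. s < \<tau> \<and> ereal \<tau> < b \<longrightarrow> ereal (inv_sq f \<tau>) > m_right b f)"

definition above_left :: "ereal \<Rightarrow> ereal \<Rightarrow> (real \<Rightarrow> real) \<Rightarrow> real \<Rightarrow> bool" where
  "above_left a b f s \<longleftrightarrow> a < ereal s \<and> ereal s \<le> b \<and>
     (\<forall>\<tau>. a < ereal \<tau> \<and> \<tau> < s \<longrightarrow> ereal (inv_sq f \<tau>) > m_left a f)"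

definition rel_min_right :: "ereal \<Rightarrow> ereal \<Rightarrow> (real \<Rightarrow> real) \<Rightarrow> bool" where
  "rel_min_right a b f \<longleftrightarrow> (\<exists>s. above_right a b f s)"

definition rel_min_left :: "ereal \<Rightarrow> ereal \<Rightarrow> (real \<Rightarrow> real) \<Rightarrow> bool" where
  "rel_min_left a b f \<longleftrightarrow> (\<exists>s. above_left a b f s)"

definition close_right :: "ereal \<Rightarrow> ereal \<Rightarrow> (real \<Rightarrow> real) \<Rightarrow> real \<Rightarrow> bool" where
  "close_right a b f c \<longleftrightarrow> (\<exists>s. above_right a b f s \<and> s < c \<and> ereal c < b)"

definition close_left :: "ereal \<Rightarrow> ereal \<Rightarrow> (real \<Rightarrow> real) \<Rightarrow> real \<Rightarrow> bool" where
  "close_left a b f c \<longleftrightarrow> (\<exists>s. above_left a b f s \<and> c < s \<and> a < ereal c)"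

text \<open>The numbers \<open>d_right\<close>, \<open>i_right\<close> (and their analogues at \<open>a\<close>) do not depend on the base point
  chosen close to the extreme. They are meaningful only under the side conditions stated in
  \<open>d_right_defined\<close> and \<open>i_right_defined\<close>; a relative minimum at the extreme makes
  \<open>m_right b f\<close> finite.\<close>

definition d_right_defined :: "ereal \<Rightarrow> ereal \<Rightarrow> (real \<Rightarrow> real) \<Rightarrow> bool" where
  "d_right_defined a b f \<longleftrightarrow> rel_min_right a b f \<and>
     (\<exists>c. close_right a b f c \<and> hint f (real_of_ereal (m_right b f)) (ereal c) b < \<infinity>)"

definition d_left_defined :: "ereal \<Rightarrow> ereal \<Rightarrow> (real \<Rightarrow> real) \<Rightarrow> bool" where
  "d_left_defined a b f \<longleftrightarrow> rel_min_left a b f \<and>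
     (\<exists>c. close_left a b f c \<and> hint f (real_of_ereal (m_left a f)) a (ereal c) < \<infinity>)"

definition d_right :: "ereal \<Rightarrow> ereal \<Rightarrow> (real \<Rightarrow> real) \<Rightarrow> ereal" where
  "d_right a b f = (let c = (SOME c. close_right a b f c); mb = real_of_ereal (m_right b f) in
     Limsup (at mb) (\<lambda>D. hint f D (ereal c) (b_star a b f c D)) - hint f mb (ereal c) b)"

definition d_left :: "ereal \<Rightarrow> ereal \<Rightarrow> (real \<Rightarrow> real) \<Rightarrow> ereal" where
  "d_left a b f = (let c = (SOME c. close_left a b f c); ma = real_of_ereal (m_left a f) in
     Limsup (at ma) (\<lambda>D. hint f D (a_star a b f c D) (ereal c)) - hint f ma a (ereal c))"

definition i_right_defined :: "ereal \<Rightarrow> ereal \<Rightarrow> (real \<Rightarrow> real) \<Rightarrow> ereal \<Rightarrow> bool" where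
  "i_right_defined a b f diamF \<longleftrightarrow>
     d_right_defined a b f \<and> 2 * d_right a b f < diamF \<and> ereal (m_inf a b f) < m_right b f"

definition i_left_defined :: "ereal \<Rightarrow> ereal \<Rightarrow> (real \<Rightarrow> real) \<Rightarrow> ereal \<Rightarrow> bool" where
  "i_left_defined a b f diamF \<longleftrightarrow>
     d_left_defined a b f \<and> 2 * d_left a b f < diamF \<and> ereal (m_inf a b f) < m_left a f"

definition i_right :: "ereal \<Rightarrow> ereal \<Rightarrow> (real \<Rightarrow> real) \<Rightarrow> ereal" where
  "i_right a b f = (let c = (SOME c. close_right a b f c) in
     INF D\<in>{m_inf a b f <.. real_of_ereal (m_right b f)}. hint f D (a_star a b f c D) b)"

definition i_left :: "ereal \<Rightarrow> ereal \<Rightarrow> (real \<Rightarrow> real) \<Rightarrow> ereal" where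
  "i_left a b f = (let c = (SOME c. close_left a b f c) in
     INF D\<in>{m_inf a b f <.. real_of_ereal (m_left a f)}. hint f D a (b_star a b f c D))"

definition condition_C :: "ereal \<Rightarrow> ereal \<Rightarrow> (real \<Rightarrow> real) \<Rightarrow> ereal \<Rightarrow> bool" where
  "condition_C a b f diamF \<longleftrightarrow>
     (\<not> rel_min_right a b f
      \<or> (\<exists>c. close_right a b f c \<and> hint f (real_of_ereal (m_right b f)) (ereal c) b = \<infinity>)
      \<or> (d_right_defined a b f \<and> 2 * d_right a b f \<ge> diamF)
      \<or> (i_right_defined a b f diamF \<and> d_right a b f \<ge> i_right a b f))
   \<and> (\<not> rel_min_left a b f
      \<or> (\<exists>c. close_left a b f c \<and> hint f (real_of_ereal (m_left a f)) a (ereal c) = \<infinity>)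
      \<or> (d_left_defined a b f \<and> 2 * d_left a b f \<ge> diamF)
      \<or> (i_left_defined a b f diamF \<and> d_left a b f \<ge> i_left a b f))"


section \<open>Condition (R)\<close>

definition R_int :: "ereal \<Rightarrow> ereal \<Rightarrow> (real \<Rightarrow> real) \<Rightarrow> real \<Rightarrow> real \<Rightarrow> ereal" where
  "R_int a b f \<tau>0 D = hint f D (ereal \<tau>0) (b_star a b f \<tau>0 D)"

definition L_int :: "ereal \<Rightarrow> ereal \<Rightarrow> (real \<Rightarrow> real) \<Rightarrow> real \<Rightarrow> real \<Rightarrow> ereal" where
  "L_int a b f \<tau>0 D = hint f D (a_star a b f \<tau>0 D) (ereal \<tau>0)"

definition W_int :: "ereal \<Rightarrow> ereal \<Rightarrow> (real \<Rightarrow> real) \<Rightarrow> real \<Rightarrow> real \<Rightarrow> ereal" where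
  "W_int a b f \<tau>0 D = L_int a b f \<tau>0 D + R_int a b f \<tau>0 D"

definition E_int :: "ereal \<Rightarrow> ereal \<Rightarrow> (real \<Rightarrow> real) \<Rightarrow> real \<Rightarrow> nat \<Rightarrow> real \<Rightarrow> ereal" where
  "E_int a b f \<tau>0 n D = (if even n then R_int a b f \<tau>0 D else L_int a b f \<tau>0 D)"

definition G_int :: "ereal \<Rightarrow> ereal \<Rightarrow> (real \<Rightarrow> real) \<Rightarrow> real \<Rightarrow> nat \<Rightarrow> real \<Rightarrow> ereal" where
  "G_int a b f \<tau>0 n D = (if even n then L_int a b f \<tau>0 D else R_int a b f \<tau>0 D)"

text \<open>The limits in \<open>\<epsilon>\<close> (or \<open>M\<close>) are taken over \<open>s = b - \<epsilon>\<close> (or \<open>s = M\<close>) tending to \<open>b\<close> from the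
  left in the extended reals, and over \<open>s = a + \<epsilon>\<close> (or \<open>s = -M\<close>) tending to \<open>a\<close> from the right;
  they are limits of monotone functions. Note that \<open>0 * \<infinity> = 0\<close> in the extended reals.\<close>

definition r_i :: "ereal \<Rightarrow> ereal \<Rightarrow> (real \<Rightarrow> real) \<Rightarrow> real \<Rightarrow> nat \<Rightarrow> ereal" where
  "r_i a b f \<tau>0 n =
     (if n = 0 then
        Lim (at_left b) (\<lambda>s. Liminf (at_right (m_inf a b f)) (\<lambda>D. hint f D (ereal \<tau>0) s))
      else
        Lim (at_left b) (\<lambda>s. Liminf (at_right (m_inf a b f)) (\<lambda>D.
          E_int a b f \<tau>0 n D + ereal (real (n - 1)) * W_int a b f \<tau>0 D
            + hint f D (a_star a b f \<tau>0 D) s)))"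

definition l_i :: "ereal \<Rightarrow> ereal \<Rightarrow> (real \<Rightarrow> real) \<Rightarrow> real \<Rightarrow> nat \<Rightarrow> ereal" where
  "l_i a b f \<tau>0 n =
     (if n = 0 then
        Lim (at_right a) (\<lambda>s. Liminf (at_right (m_inf a b f)) (\<lambda>D. hint f D s (ereal \<tau>0)))
      else
        Lim (at_right a) (\<lambda>s. Liminf (at_right (m_inf a b f)) (\<lambda>D.
          G_int a b f \<tau>0 n D + ereal (real (n - 1)) * W_int a b f \<tau>0 D
            + hint f D s (b_star a b f \<tau>0 D))))"

definition r_s :: "ereal \<Rightarrow> ereal \<Rightarrow> (real \<Rightarrow> real) \<Rightarrow> real \<Rightarrow> nat \<Rightarrow> ereal" where
  "r_s a b f \<tau>0 n =
     Lim (at_left b) (\<lambda>s. Limsup (at_right (m_inf a b f)) (\<lambda>D.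
       E_int a b f \<tau>0 n D + ereal (real n) * W_int a b f \<tau>0 D
         + hint f D s (b_star a b f \<tau>0 D)))"

definition l_s :: "ereal \<Rightarrow> ereal \<Rightarrow> (real \<Rightarrow> real) \<Rightarrow> real \<Rightarrow> nat \<Rightarrow> ereal" where
  "l_s a b f \<tau>0 n =
     Lim (at_right a) (\<lambda>s. Limsup (at_right (m_inf a b f)) (\<lambda>D.
       G_int a b f \<tau>0 n D + ereal (real n) * W_int a b f \<tau>0 D
         + hint f D (a_star a b f \<tau>0 D) s))"

definition real_Icc :: "ereal \<Rightarrow> ereal \<Rightarrow> real set" where
  "real_Icc u v = {x. u \<le> ereal x \<and> ereal x \<le> v}"

definition condition_R :: "ereal \<Rightarrow> ereal \<Rightarrow> (real \<Rightarrow> real) \<Rightarrow> ereal \<Rightarrow> bool" where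
  "condition_R a b f diamF \<longleftrightarrow>
     (\<forall>\<tau>\<in>einterval a b. inv_sq f \<tau> > m_inf a b f)
   \<and> m_left a f = ereal (m_inf a b f) \<and> m_right b f = ereal (m_inf a b f)
   \<and> (\<forall>\<tau>0\<in>einterval a b.
        real_Icc (r_i a b f \<tau>0 0) diamF \<subseteq> (\<Union>n. real_Icc (r_i a b f \<tau>0 n) (r_s a b f \<tau>0 n))
      \<and> real_Icc (l_i a b f \<tau>0 0) diamF \<subseteq> (\<Union>n. real_Icc (l_i a b f \<tau>0 n) (l_s a b f \<tau>0 n)))"

end

theory Submission
 imports Defs
begin

text \<open>Write \<open>V = 1 / f\<^sup>2\<close> and \<open>F\<close> for a primitive of \<open>1 / f\<close>. The bounds \<open>\<bar>dx\<bar> < \<bar>dF\<bar>\<close>, \<open>=\<close>, \<open>>\<close> along a curve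
 decide how its end points can be related, and straight segments in the coordinates \<open>(F, x)\<close> realise each case.
 Geodesics preserve \<open>f\<^sup>2 x'\<close> and the length of the velocity, so the ones that are not timelike are given by
 quadratures; the displacement in \<open>x\<close> is strictly monotone in the momentum, which yields existence and
 uniqueness.

 A timelike geodesic is a graph \<open>y(x)\<close> with \<open>y' = p / V\<close>, \<open>p' = V' / (2 V)\<close> and first integral \<open>D = V - p\<^sup>2\<close>; it
 oscillates between the turning points \<open>V = D\<close>, and the \<open>x\<close>-time spent between two heights is the integral
 of \<open>V / sqrt (V - D)\<close>. Two heights are joined in time \<open>\<Delta>\<close> by shooting in \<open>p(0)\<close>: the value at time \<open>\<Delta>\<close> passes
 continuously from below the target to above it, unless the trajectory escapes through an end on the way.
 Condition (C) at an end says that a trajectory passing close to it can be kept from escaping; if it fails,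
 returning to the starting height close to that end takes the wrong time for every \<open>D\<close>. When \<open>V\<close> has its
 infimum as limit at both ends, and only there, trajectories may oscillate any number of times before
 escaping, and Condition (R) says that the times of presence near an end, over all numbers of oscillations,
 leave no gap.\<close>

section \<open>Preliminaries on real functions\<close>

text \<open>The obstacle is escape: \<open>V\<close> lives on the open interval \<open>K\<close>
  only, a trajectory may leave \<open>K\<close> in finite time, and its value at time \<Delta> then
  makes no sense. Hence \<open>V\<close> is frozen outside a compact \<open>[l, r]\<close> in
  \<open>K\<close>, which gives a global flow, and the final value is replaced by a condition on the
  whole curve: it reaches \<open>r\<close>, or ends above the target, before meeting
  \<open>l\<close>. This condition is open in \<open>p(0)\<close> except at a trajectory that grazes
  \<open>r\<close> from below and is still back at the target in time. Such a trajectory has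
  \<open>p = 0\<close> at \<open>r\<close>, so its level is \<open>V r\<close> and its time is at
  least the integral on any level up to \<open>V r\<close>; this is how the integrals enter. The
  work at an end is to find barriers near it that are not grazed, or a smaller range of momenta that
  avoids grazing. Only the right end is treated, the left one being the right end for
  \<open>f (- y)\<close>. The converse for (C) starts close to \<open>b\<close> and needs every
  excursion away from \<open>b\<close> to be slow.\<close>

lemma first_time:
 fixes u :: "real => 'a::topological_space"
 assumes "continuous_on {l..X} u" "closed S" "x0 \<in> {l..X}" "u x0 \<in> S"
 obtains x where "l <= x" "x <= x0" "u x \<in> S" "!!x'. l <= x' ==> x' < x ==> u x' \<notin> S"
proof -
 have c: "continuous_on {l..x0} u" using assms(1,3) continuous_on_subset by fastforce
 have "compact {x \<in> {l..x0}. u x \<in> S}"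
 proof -
  have "closed ({l..x0} \<inter> u -` S)" by (rule continuous_closed_preimage[OF c _ assms(2)]) simp
  moreover have "{x \<in> {l..x0}. u x \<in> S} = {l..x0} \<inter> ({l..x0} \<inter> u -` S)" by auto
  ultimately show ?thesis using compact_Int_closed by (metis compact_Icc)
 qed
 moreover have "x0 \<in> {x \<in> {l..x0}. u x \<in> S}" using assms by auto
 ultimately obtain x where x: "x \<in> {l..x0}" "u x \<in> S"
  and m: "!!t. t \<in> {x \<in> {l..x0}. u x \<in> S} ==> x <= t"
  using compact_attains_inf[of "{x \<in> {l..x0}. u x \<in> S}"] by blast
 show ?thesis using x m by (intro that[of x]) (auto, force)
qed

text \<open>The inverse is given on an open interval around \<open>[g w, g v]\<close>, because
  smoothness on a compact parameter interval means smoothness on a neighbourhood: derivatives have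
  to be two-sided at the ends as well.\<close>

lemma real_inverse_function:
 fixes g g' :: "real => real"
 assumes der: "!!x. l < x ==> x < u ==> DERIV g x :> g' x"
  and pos: "!!x. l < x ==> x < u ==> g' x > 0" and ab: "l < w" "w <= v" "v < u"
 obtains h s t where "s < g w" "g v < t"
  "!!r. s < r ==> r < t ==> l < h r \<and> h r < u \<and> g (h r) = r
      \<and> (DERIV h r :> inverse (g' (h r)))" "!!x. l < x ==> x < u ==> h (g x) = x"
proof -
 have mono: "g x < g y" if "l < x" "x < y" "y < u" for x y
 proof (rule DERIV_pos_imp_increasing[of x y g])
  show "\<exists>d. DERIV g z :> d \<and> d > 0" if "x <= z" "z <= y" for z
   using der[of z] pos[of z] that \<open>l < x\<close> \<open>y < u\<close> by force
 qed fact
 have inj: "inj_on g {l<..<u}" using mono by (metis greaterThanLessThan_iff inj_onI linorder_neqE_linordered_idom order_less_irrefl)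
 define h where "h = the_inv_into {l<..<u} g"
 have h: "h (g x) = x" if "l < x" "x < u" for x unfolding h_def using inj that by (intro the_inv_into_f_f) auto
 have cont: "continuous_on {l<..<u} g" using der by (intro DERIV_continuous_on) (auto intro: has_field_derivative_at_within)
 define p q where "p = (l + w) / 2" and "q = (u + v) / 2"
 have o: "l < p" "p < w" "v < q" "q < u" unfolding p_def q_def using ab by auto
 show ?thesis
 proof (rule that[of "g p" "g q" h])
  show "g p < g w" "g v < g q" using mono o ab by auto
  fix r assume r: "g p < r" "r < g q"
  have "continuous_on {p..q} g" using cont by (rule continuous_on_subset) (use o in auto)
  then obtain x where x: "p <= x" "x <= q" "g x = r" using IVT'[of g p r q] r o ab by auto
  have xx: "l < x" "x < u" using x o by auto
  have "(h has_derivative (*) (inverse (g' x))) (at (g x))"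
  proof (rule has_derivative_inverse_strong[of "{l<..<u}" x g h "(*) (g' x)"])
   show "(g has_derivative (*) (g' x)) (at x)" using der[OF xx] by (simp add: has_field_derivative_def)
   show "(*) (g' x) \<circ> (*) (inverse (g' x)) = id" using pos[OF xx] by (auto simp: fun_eq_iff)
  qed (use xx cont h in auto)
  then show "l < h r \<and> h r < u \<and> g (h r) = r
      \<and> (DERIV h r :> inverse (g' (h r)))" using xx x h by (auto simp: has_field_derivative_def)
 qed (use h in auto)
qed

section \<open>Ordinary differential equations\<close>

text \<open>\<open>exp (-2 * L * t) * (w t \<bullet> w t)\<close> does not increase, by
  Cauchy-Schwarz and the Lipschitz bound. Working with the square keeps the argument differentiable
  where the two curves meet.\<close>

lemma gronwall:
 fixes z1 z2 :: "real => 'a::real_inner"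
 assumes d1: "!!t. t \<in> {0..T} ==> (z1 has_vector_derivative f1 t) (at t within {0..T})"
  and d2: "!!t. t \<in> {0..T} ==> (z2 has_vector_derivative f2 t) (at t within {0..T})"
  and Lip: "!!t. t \<in> {0..T} ==> norm (f1 t - f2 t) <= L * norm (z1 t - z2 t)" and t: "t \<in> {0..T}"
 shows "norm (z1 t - z2 t) <= exp (L * t) * norm (z1 0 - z2 0)"
proof -
 define w where "w t = z1 t - z2 t" for t
 have dw: "(w has_vector_derivative (f1 t - f2 t)) (at t within {0..T})" if "t \<in> {0..T}" for t
  unfolding w_def using d1 d2 that by (intro derivative_intros)
 define u where "u t = exp (-2 * L * t) * (w t \<bullet> w t)" for t
 have du: "(u has_real_derivative (exp (-2 * L * t) * (2 * (w t \<bullet> (f1 t - f2 t))) - 2 * L * exp (-2 * L * t) * (w t \<bullet> w t))) (at t within {0..T})"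
  if "t \<in> {0..T}" for t
 proof -
  have "((\<lambda>t. w t \<bullet> w t) has_vector_derivative (w t \<bullet> (f1 t - f2 t) + (f1 t - f2 t) \<bullet> w t)) (at t within {0..T})"
   using dw[OF that] unfolding has_vector_derivative_def by (auto intro!: derivative_eq_intros simp: algebra_simps inner_simps)
  then have *: "((\<lambda>t. w t \<bullet> w t) has_real_derivative (2 * (w t \<bullet> (f1 t - f2 t)))) (at t within {0..T})"
   by (simp add: has_real_derivative_iff_has_vector_derivative inner_commute)
  show ?thesis unfolding u_def by (rule derivative_eq_intros * refl | simp)+
 qed
 have le: "u t <= u 0"
 proof (cases "t = 0")
  case False
  show ?thesis
  proof (rule DERIV_nonpos_imp_decreasing_open[of 0 t u])
   show "0 <= t" using t by auto
   have "continuous_on {0..T} u" using du by (rule DERIV_continuous_on)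
   then show "continuous_on {0..t} u" using t continuous_on_subset by fastforce
   fix x assume x: "0 < x" "x < t"
   have xT: "x \<in> {0..T}" "x \<in> interior {0..T}" using x t by auto
   have "w x \<bullet> (f1 x - f2 x) <= norm (w x) * (L * norm (w x))" using Lip[OF xT(1)] norm_cauchy_schwarz[of "w x" "f1 x - f2 x"]
    by (metis mult_left_mono norm_ge_zero order_trans w_def)
   then have "exp (-2 * L * x) * (2 * (w x \<bullet> (f1 x - f2 x))) - 2 * L * exp (-2 * L * x) * (w x \<bullet> w x) <= 0"
   proof -
    assume "w x \<bullet> (f1 x - f2 x) <= norm (w x) * (L * norm (w x))"
    then have "exp (-2 * L * x) * (2 * (w x \<bullet> (f1 x - f2 x) - L * (w x \<bullet> w x))) <= 0"
     by (intro mult_nonneg_nonpos) (auto simp: power2_norm_eq_inner[symmetric] power2_eq_square algebra_simps)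
    then show ?thesis by (simp add: algebra_simps)
   qed
   then show "\<exists>y. DERIV u x :> y \<and> y <= 0" using du[OF xT(1)] at_within_interior[OF xT(2)] by metis
  qed
 qed auto
 have "(norm (w t))\<^sup>2 <= (exp (L * t) * norm (w 0))\<^sup>2"
 proof -
  have e: "exp (2 * L * t) * u t = (norm (w t))\<^sup>2" unfolding u_def by (simp add: power2_norm_eq_inner exp_minus field_simps)
  have "exp (2 * L * t) * u t <= exp (2 * L * t) * u 0" using le by simp
  then show ?thesis unfolding e by (simp add: u_def power2_norm_eq_inner[symmetric] power_mult_distrib exp_double[symmetric] mult.assoc)
 qed
 then show ?thesis unfolding w_def by (rule power2_le_imp_le) simp
qed

text \<open>Picard iteration with the weight \<open>exp (- 2 * L * t)\<close>: in the weighted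
  supremum norm the integral operator contracts by 1/2 on all of \<open>[0, T]\<close>, so short
  intervals need not be patched together. The fixed point \<open>w\<close> is the weighted solution,
  in the complete space of bounded continuous functions.\<close>

lemma ode_forward:
 fixes F :: "'a::euclidean_space => 'a"
 assumes L: "L > 0" and Lip: "!!x y. norm (F x - F y) <= L * norm (x - y)" and T: "T \<ge> 0"
 obtains z where "z 0 = z0" "!!t. t \<in> {0..T} ==> (z has_vector_derivative F (z t)) (at t within {0..T})"
proof -
 have contF: "continuous_on UNIV F" by (rule lipschitz_on_continuous_on[OF lipschitz_onI[of UNIV F L]])
   (use Lip L in \<open>auto simp: dist_norm\<close>)
 \<comment> \<open>Bounded continuous functions live on the whole line; evaluation at the clamped
   time extends the image of the operator constantly beyond \<open>[0, T]\<close>.\<close>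
 define cl where "cl t = max 0 (min T t)" for t :: real
 have cl: "cl t \<in> {0..T}" for t unfolding cl_def using T by auto
 have cl_id: "cl t = t" if "t \<in> {0..T}" for t unfolding cl_def using that by auto
 have contcl: "continuous_on UNIV cl" unfolding cl_def by (intro continuous_intros)
 define G where "G w r = F (exp (2 * L * r) *\<^sub>R apply_bcontfun w r)" for w :: "real \<Rightarrow>\<^sub>C 'a" and r
 have contG: "continuous_on S (G w)" for w S unfolding G_def by (rule continuous_on_compose2[OF contF]) (auto intro!: continuous_intros)
 define g where "g w t = exp (- 2 * L * t) *\<^sub>R (z0 + integral {0..t} (G w))" for w t
 have contg: "continuous_on {0..T} (g w)" for w
  unfolding g_def by (intro continuous_intros indefinite_integral_continuous_1 integrable_continuous_real contG)
 have inb: "(\<lambda>t. g w (cl t)) \<in> bcontfun" for w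
 proof -
  have "continuous_on UNIV (\<lambda>t. g w (cl t))" by (rule continuous_on_compose2[OF contg contcl]) (use cl in auto)
  moreover have "bounded (g w ` {0..T})" using compact_continuous_image[OF contg] compact_imp_bounded by auto
  then have "bounded (range (\<lambda>t. g w (cl t)))" by (rule bounded_subset) (use cl in auto)
  ultimately show ?thesis by (simp add: bcontfun_def)
 qed
 define Q where "Q w = Bcontfun (\<lambda>t. g w (cl t))" for w
 have Q: "apply_bcontfun (Q w) t = g w (cl t)" for w t unfolding Q_def using inb by (simp add: Bcontfun_inverse)
 have contr: "dist (Q w) (Q v) <= 1/2 * dist w v" for w v
 proof (rule dist_bound)
  fix t
  define s where "s = cl t"
  have s: "0 <= s" using cl[of t] unfolding s_def by auto
  have ints: "G w integrable_on {0..s}" "G v integrable_on {0..s}" by (intro integrable_continuous_real contG)+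
  have I: "((\<lambda>r. L * (exp (2 * L * r) * dist w v)) has_integral
    (exp (2 * L * s) / 2 * dist w v - exp (2 * L * 0) / 2 * dist w v)) {0..s}" using s by (intro fundamental_theorem_of_calculus)
    (auto intro!: derivative_eq_intros simp: has_real_derivative_iff_has_vector_derivative[symmetric])
  have "norm (integral {0..s} (\<lambda>r. G w r - G v r)) <= integral {0..s} (\<lambda>r. L * (exp (2 * L * r) * dist w v))"
  proof (rule integral_norm_bound_integral)
   fix r assume "r \<in> {0..s}"
   have "norm (G w r - G v r) <= L * norm (exp (2 * L * r) *\<^sub>R w r - exp (2 * L * r) *\<^sub>R v r)"
    unfolding G_def by (rule Lip)
   also have "\<dots> = L * (exp (2 * L * r) * dist (w r) (v r))" by (simp add: scaleR_diff_right[symmetric] dist_norm)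
   also have "\<dots> <= L * (exp (2 * L * r) * dist w v)" using L dist_bounded[of w r v] by simp
   finally show "norm (G w r - G v r) <= L * (exp (2 * L * r) * dist w v)" .
  qed (use ints I in \<open>auto intro: integrable_diff\<close>)
  also have "\<dots> <= exp (2 * L * s) / 2 * dist w v" using integral_unique[OF I] by simp
  finally have *: "norm (integral {0..s} (G w) - integral {0..s} (G v)) <= exp (2 * L * s) / 2 * dist w v"
   using ints by (simp add: integral_diff)
  have "dist (g w s) (g v s) = exp (- 2 * L * s) * norm (integral {0..s} (G w) - integral {0..s} (G v))"
   unfolding g_def dist_norm by (simp add: scaleR_diff_right[symmetric])
  also have "\<dots> <= exp (- 2 * L * s) * (exp (2 * L * s) / 2 * dist w v)" using * by (intro mult_left_mono) auto
  also have "\<dots> = 1/2 * dist w v" by (simp add: exp_minus field_simps)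
  finally show "dist (Q w t) (Q v t) <= 1/2 * dist w v" unfolding Q s_def .
 qed
 obtain w where w: "Q w = w" using banach_fix_type[of "1/2" Q] contr by auto
 define z where "z t = exp (2 * L * t) *\<^sub>R w t" for t
 have zeq: "z t = z0 + integral {0..t} (\<lambda>r. F (z r))" if "t \<in> {0..T}" for t
 proof -
  have "w t = g w t" using Q[of w t] w cl_id[OF that] by simp
  then show ?thesis unfolding z_def g_def G_def by (simp add: exp_minus)
 qed
 have contz: "continuous_on {0..T} (\<lambda>r. F (z r))" using contG[of "{0..T}" w] unfolding G_def z_def .
 show ?thesis
 proof (rule that[of z])
  show "z 0 = z0" using zeq[of 0] T by simp
  fix t assume t: "t \<in> {0..T}"
  have "((\<lambda>t. z0 + integral {0..t} (\<lambda>r. F (z r))) has_vector_derivative F (z t)) (at t within {0..T})"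
   using integral_has_vector_derivative[OF contz t] by (auto intro!: derivative_eq_intros)
  then show "(z has_vector_derivative F (z t)) (at t within {0..T})" by (rule has_vector_derivative_transform[OF t zeq, rotated])
 qed
qed

lemma ode_two_sided:
 fixes F :: "'a::euclidean_space => 'a"
 assumes L: "L > 0" and Lip: "!!x y. norm (F x - F y) <= L * norm (x - y)" and T: "T > 0"
 obtains z where "z 0 = z0" "!!t. t \<in> {-T<..<T} ==> (z has_vector_derivative F (z t)) (at t)"
proof -
 obtain zp where zp: "zp 0 = z0" "!!t. t \<in> {0..T} ==> (zp has_vector_derivative F (zp t)) (at t within {0..T})"
  using ode_forward[OF L Lip, of T z0] T by (metis less_imp_le)
 have Lip': "norm (- F x - - F y) <= L * norm (x - y)" for x y using Lip[of x y] by (simp add: norm_minus_commute)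
 obtain zm where zm: "zm 0 = z0" "!!t. t \<in> {0..T} ==> (zm has_vector_derivative - F (zm t)) (at t within {0..T})"
  using ode_forward[OF L Lip', of T z0] T by (metis less_imp_le)
 define zn where "zn t = zm (- t)" for t
 have zn: "(zn has_vector_derivative F (zn t)) (at t within {-T..0})" if "t \<in> {-T..0}" for t
 proof -
  have "((zm \<circ> uminus) has_vector_derivative (-1) *\<^sub>R (- F (zm (- t)))) (at t within {-T..0})"
   by (rule vector_diff_chain_within) (use zm(2)[of "-t"] that in \<open>auto intro!: derivative_eq_intros\<close>)
  then show ?thesis unfolding zn_def by (simp add: o_def)
 qed
 define z where "z t = (if t <= 0 then zn t else zp t)" for t
 show ?thesis
 proof (rule that[of z])
  show "z 0 = z0" by (simp add: z_def zn_def zm)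
  fix t assume t: "t \<in> {-T<..<T}"
  have 1: "(z has_vector_derivative F (z t)) (at t within {-T..0})" if "t \<in> {-T..0}"
   by (rule has_vector_derivative_transform[OF that, rotated, of zn])
    (use zn[OF that] that in \<open>auto simp: z_def\<close>)
  have zz: "z t = zp t" if "t \<in> {0..T}" for t using that zp(1) zm(1) by (auto simp: z_def zn_def)
  have 2: "(z has_vector_derivative F (z t)) (at t within {0..T})" if "t \<in> {0..T}"
   by (rule has_vector_derivative_transform[OF that, rotated, of zp])
    (use zp(2)[OF that] that in \<open>auto simp: zz\<close>)
  consider "t < 0" | "t = 0" | "t > 0" by linarith
  then show "(z has_vector_derivative F (z t)) (at t)"
  proof cases
   case c: 1
   then have "t \<in> interior {-T..0}" "t \<in> {-T..0}" using t by auto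
   then show ?thesis using 1 at_within_interior by metis
  next
   case 3
   then have "t \<in> interior {0..T}" "t \<in> {0..T}" using t by auto
   then show ?thesis using 2 at_within_interior by metis
  next
   case c: 2
   have "(z has_vector_derivative F (z t)) (at t within {-T..0} \<union> {0..T})"
    using 1 2 c T unfolding has_vector_derivative_def has_derivative_within by (auto simp: Lim_within_Un)
   moreover have "t \<in> interior ({-T..0} \<union> {0..T})"
   proof -
    have "{-T..0} \<union> {0..T} = {-T..T}" using T by auto
    then show ?thesis using c T by simp
   qed
   ultimately show ?thesis using at_within_interior by metis
  qed
 qed
qed

section \<open>A shooting principle\<close>

text \<open>Overshooting: \<open>u\<close> escapes through the upper barrier, or ends above the
  target, before it touches the lower barrier. Reaching \<open>b'\<close> counts even if
  \<open>u\<close> comes back, since beyond the barriers a clamped curve is not a trajectory.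
  Undershooting is the same predicate for \<open>- u\<close>, with the barriers negated and
  exchanged.\<close>

definition ahead :: "real => real => real => real => (real => real) => bool" where
 "ahead a' b' y1 X u \<longleftrightarrow>
   (\<exists>x\<in>{0..X}. (\<forall>x'\<in>{0..x}. a' < u x') \<and> (b' <= u x \<or> (x = X \<and> y1 < u x)))"

text \<open>Strict inequalities persist for nearby parameters, so only a curve with
  \<open>Y p x = b'\<close> is delicate. If it comes down to \<open>y1\<close> by time
  \<open>X\<close>, then \<open>nob\<close> forces it to have been strictly above \<open>b'\<close>
  at some time, which is a strict witness; if it does not come down, it is strictly above
  \<open>y1\<close> at time \<open>X\<close>.\<close>

lemma ahead_open:
 fixes Y :: "real => real => real"
 assumes cont: "!!p. p \<in> I ==> continuous_on {0..X} (Y p)"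
  and dep: "!!p q x. p \<in> I ==> q \<in> I ==> x \<in> {0..X} ==> \<bar>Y p x - Y q x\<bar> <= C * \<bar>p - q\<bar>"
  and X: "0 <= X" and y1: "a' < y1" "y1 < b'"
  and nob: "!!T x1. 0 <= T ==> T <= x1 ==> x1 <= X ==>
      (\<forall>x\<in>{0..x1}. a' <= Y p x \<and> Y p x <= b') ==> Y p T = b' ==> Y p x1 = y1 ==> False"
  and p: "p \<in> I" and ah: "ahead a' b' y1 X (Y p)"
 shows "\<exists>e>0. \<forall>q\<in>I. \<bar>q - p\<bar> < e --> ahead a' b' y1 X (Y q)"
proof -
 have strict: ?thesis
  if x: "x \<in> {0..X}" and g: "\<forall>x'\<in>{0..x}. a' < Y p x'" and s: "b' < Y p x \<or> (x = X \<and> y1 < Y p x)" for x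
 proof -
  have "continuous_on {0..x} (Y p)" using cont[OF p] x continuous_on_subset by fastforce
  then obtain xm where xm: "xm \<in> {0..x}" "\<forall>x'\<in>{0..x}. Y p xm <= Y p x'"
   using continuous_attains_inf[of "{0..x}" "Y p"] x by auto
  define r where "r = (if b' < Y p x then Y p x - b' else Y p x - y1)"
  have r: "r > 0" unfolding r_def using s by auto
  define e where "e = min (Y p xm - a') r / (\<bar>C\<bar> + 1)"
  have e: "e > 0" unfolding e_def using r g xm by (auto intro!: divide_pos_pos)
  show ?thesis
  proof (intro exI[of _ e] conjI ballI impI e)
   fix q assume q: "q \<in> I" "\<bar>q - p\<bar> < e"
   have b: "\<bar>Y p x' - Y q x'\<bar> < min (Y p xm - a') r" if "x' \<in> {0..X}" for x'
   proof -
    have "\<bar>Y p x' - Y q x'\<bar> <= C * \<bar>p - q\<bar>" by (rule dep) (use p q that in auto)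
    also have "\<dots> <= (\<bar>C\<bar> + 1) * \<bar>p - q\<bar>" by (intro mult_right_mono) auto
    also have "\<dots> < (\<bar>C\<bar> + 1) * e" using q by (intro mult_strict_left_mono) auto
    also have "\<dots> = min (Y p xm - a') r" unfolding e_def by simp
    finally show ?thesis .
   qed
   have "a' < Y q x'" if "x' \<in> {0..x}" for x' using b[of x'] xm(2) that x by fastforce
   moreover have "b' <= Y q x \<or> (x = X \<and> y1 < Y q x)" using b[OF x] s unfolding r_def by (auto split: if_splits)
   ultimately show "ahead a' b' y1 X (Y q)" unfolding ahead_def using x by blast
  qed
 qed
 obtain x where x: "x \<in> {0..X}" "\<forall>x'\<in>{0..x}. a' < Y p x'" "b' <= Y p x \<or> (x = X \<and> y1 < Y p x)"
  using ah unfolding ahead_def by blast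
 show ?thesis
 proof (cases "Y p x = b'")
  case False
  then show ?thesis using strict[OF x(1,2)] x(3) by auto
 next
  case True
  show ?thesis
  proof (cases "\<exists>x1\<in>{x..X}. Y p x1 <= y1")
   case ex: True
   then obtain x0 where x0: "x0 \<in> {x..X}" "Y p x0 \<in> {..y1}" by auto
   have c: "continuous_on {x..X} (Y p)" using cont[OF p] x continuous_on_subset by fastforce
   obtain x1 where x1: "x <= x1" "x1 <= x0" "Y p x1 <= y1" "!!x'. x <= x' ==> x' < x1 ==> y1 < Y p x'"
   proof (rule first_time[OF c _ x0(1,2)])
    fix x1 assume *: "x <= x1" "x1 <= x0" "Y p x1 \<in> {..y1}"
     "!!x'. x <= x' ==> x' < x1 ==> Y p x' \<notin> {..y1}"
    show thesis by (rule that[of x1]) (use * in \<open>auto simp: not_le\<close>)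
   qed simp
   have xx: "x < x1" using x1(1,3) True y1 by (cases "x = x1") auto
   have eq: "Y p x1 = y1"
   proof (rule ccontr)
    assume "Y p x1 \<noteq> y1"
    then have "Y p x1 < y1" using x1 by auto
    moreover have "continuous_on {x..x1} (Y p)" using c x1 x0 continuous_on_subset by fastforce
    ultimately obtain x2 where "x <= x2" "x2 <= x1" "Y p x2 = y1" using IVT2'[of "Y p" x1 y1 x] True y1 xx by auto
    then show False using x1(4)[of x2] \<open>Y p x1 < y1\<close> by (cases "x2 = x1") auto
   qed
   have above: "\<forall>x'\<in>{0..x1}. a' < Y p x'"
   proof
    fix x' assume "x' \<in> {0..x1}"
    then consider "x' \<in> {0..x}" | "x <= x'" "x' < x1" | "x' = x1" by fastforce
    then show "a' < Y p x'" using x(2) x1(4) eq y1 by cases fastforce+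
   qed
   show ?thesis
   proof (cases "\<exists>x2\<in>{0..x1}. b' < Y p x2")
    case True
    then obtain x2 where x2: "x2 \<in> {0..x1}" "b' < Y p x2" by auto
    have "x2 \<in> {0..X}" using x2 x1 x0 by auto
    moreover have "\<forall>x'\<in>{0..x2}. a' < Y p x'" using above x2 by simp
    ultimately show ?thesis using strict x2 by blast
   next
    case False
    then have "False" using nob[of x x1] x x1 x0 above True eq by (force intro: less_imp_le simp: not_less)
    then show ?thesis ..
   qed
  next
   case nex: False
   have *: "a' < Y p x'" if "x' \<in> {0..X}" for x'
   proof (cases "x' <= x")
    case True
    then show ?thesis using that x(2) by auto
   next
    case False
    then have "y1 < Y p x'" using nex that by (meson atLeastAtMost_iff linear not_le)
    then show ?thesis using y1 by simp
   qed
   show ?thesis by (rule strict[of X]) (use * X nex x in \<open>auto simp: not_le\<close>)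
  qed
 qed
qed

text \<open>If no parameter hits the target inside the barriers, overshooting and undershooting
  split \<open>[i, j]\<close> into two open sets, against connectedness. They cover because the
  first exit from \<open>(a', b')\<close> decides; they are disjoint because the earlier of the two
  witnesses excludes the later one.\<close>

lemma shooting:
 fixes Y :: "real => real => real"
 assumes cont: "!!p. p \<in> {i..j} ==> continuous_on {0..X} (Y p)"
  and dep: "!!p q x. p \<in> {i..j} ==> q \<in> {i..j} ==> x \<in> {0..X} ==> \<bar>Y p x - Y q x\<bar> <= C * \<bar>p - q\<bar>"
  and X: "0 <= X" and y1: "a' < y1" "y1 < b'" and y0: "!!p. p \<in> {i..j} ==> a' < Y p 0 \<and> Y p 0 < b'"
  and nob: "!!p T x1. p \<in> {i..j} ==> 0 <= T ==> T <= x1 ==> x1 <= X ==>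
      (\<forall>x\<in>{0..x1}. a' <= Y p x \<and> Y p x <= b') ==> Y p T = b' ==> Y p x1 = y1 ==> False"
  and noa: "!!p T x1. p \<in> {i..j} ==> 0 <= T ==> T <= x1 ==> x1 <= X ==>
      (\<forall>x\<in>{0..x1}. a' <= Y p x \<and> Y p x <= b') ==> Y p T = a' ==> Y p x1 = y1 ==> False"
  and pp: "pp \<in> {i..j}" "ahead a' b' y1 X (Y pp)" and pm: "pm \<in> {i..j}" "ahead (- b') (- a') (- y1) X (\<lambda>x. - Y pm x)"
 shows "\<exists>p\<in>{i..j}. Y p X = y1 \<and> (\<forall>x\<in>{0..X}. a' < Y p x \<and> Y p x < b')"
proof (rule ccontr)
 assume nex: "\<not> ?thesis"
 let ?I = "{i..j}"
 define A where "A = {p \<in> ?I. ahead a' b' y1 X (Y p)}"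
 define B where "B = {p \<in> ?I. ahead (- b') (- a') (- y1) X (\<lambda>x. - Y p x)}"
 have oA: "openin (top_of_set ?I) A" unfolding openin_euclidean_subtopology_iff A_def
 proof (safe, goal_cases)
  case (1 p)
  have "\<exists>e>0. \<forall>q\<in>?I. \<bar>q - p\<bar> < e --> ahead a' b' y1 X (Y q)"
   by (rule ahead_open[OF cont dep X y1 nob]) (use 1 in auto)
  then show ?case unfolding dist_real_def by blast
 qed
 have oB: "openin (top_of_set ?I) B" unfolding openin_euclidean_subtopology_iff B_def
 proof (safe, goal_cases)
  case (1 p)
  have "\<exists>e>0. \<forall>q\<in>?I. \<bar>q - p\<bar> < e --> ahead (- b') (- a') (- y1) X (\<lambda>x. - Y q x)"
  proof (rule ahead_open[where I = ?I and C = C and Y = "\<lambda>p x. - Y p x"])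
   show "continuous_on {0..X} (\<lambda>x. - Y p x)" if "p \<in> ?I" for p using cont[OF that] by (intro continuous_intros)
   show "\<bar>- Y p x - - Y q x\<bar> <= C * \<bar>p - q\<bar>" if "p \<in> ?I" "q \<in> ?I" "x \<in> {0..X}" for p q x
    using dep[OF that] by (simp add: abs_minus_commute)
   fix T x1
   assume h: "0 <= T" "T <= x1" "x1 <= X" "\<forall>x\<in>{0..x1}. - b' <= - Y p x \<and> - Y p x <= - a'"
    "- Y p T = - a'" "- Y p x1 = - y1"
   show False by (rule noa[of p T x1]) (use h 1 in auto)
  qed (use 1 X y1 in auto)
  then show ?case unfolding dist_real_def by blast
 qed
 have disj: "A \<inter> B = {}"
 proof -
  have False if p: "p \<in> A" "p \<in> B" for p
  proof -
   obtain x where x: "x \<in> {0..X}" "\<forall>x'\<in>{0..x}. a' < Y p x'" "b' <= Y p x \<or> (x = X \<and> y1 < Y p x)"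
    using p(1) unfolding A_def ahead_def by blast
   obtain z where z: "z \<in> {0..X}" "\<forall>x'\<in>{0..z}. - b' < - Y p x'" "- a' <= - Y p z \<or> (z = X \<and> - y1 < - Y p z)"
    using p(2) unfolding B_def ahead_def by blast
   show False
   proof (cases "x <= z")
    case True
    then have "Y p x < b'" using z(2) x(1) by auto
    then have "x = X" "y1 < Y p x" using x(3) by auto
    then show False using z True y1 by (auto simp: not_less)
   next
    case False
    then have "a' < Y p z" using x(2) z(1) by auto
    then show False using z x False by auto
   qed
  qed
  then show ?thesis by blast
 qed
 have cover: "?I \<subseteq> A \<union> B"
 proof
  fix p assume p: "p \<in> ?I"
  show "p \<in> A \<union> B"
  proof (cases "\<exists>x\<in>{0..X}. Y p x \<in> {..a'} \<union> {b'..}")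
   case True
   then obtain x0 where x0: "x0 \<in> {0..X}" "Y p x0 \<in> {..a'} \<union> {b'..}" by blast
   obtain x where x: "0 <= x" "x <= x0" "Y p x \<in> {..a'} \<union> {b'..}"
    "!!x'. 0 <= x' ==> x' < x ==> Y p x' \<notin> {..a'} \<union> {b'..}"
    using first_time[OF cont[OF p] _ x0] by (metis closed_Un closed_atLeast closed_atMost)
   have before: "a' < Y p x' \<and> Y p x' < b'" if "0 <= x'" "x' < x" for x' using x(4)[OF that] by auto
   from x(3) show ?thesis
   proof
    assume "Y p x \<in> {b'..}"
    then have "\<forall>x'\<in>{0..x}. a' < Y p x'" using before y1 by (force simp: le_less)
    then have "p \<in> A" unfolding A_def ahead_def using p x x0 \<open>Y p x \<in> {b'..}\<close> by auto
    then show ?thesis ..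
   next
    assume a: "Y p x \<in> {..a'}"
    then have "\<forall>x'\<in>{0..x}. - b' < - Y p x'" using before y1 by (force simp: le_less)
    then have "p \<in> B" unfolding B_def ahead_def using p x x0 a by auto
    then show ?thesis ..
   qed
  next
   case False
   then have in_: "\<forall>x\<in>{0..X}. a' < Y p x \<and> Y p x < b'" by force
   then have "Y p X \<noteq> y1" using nex p by blast
   then consider "y1 < Y p X" | "Y p X < y1" by linarith
   then show ?thesis
   proof cases
    case 1
    then have "p \<in> A" unfolding A_def ahead_def using p in_ X by auto
    then show ?thesis ..
   next
    case 2
    then have "p \<in> B" unfolding B_def ahead_def using p in_ X by auto
    then show ?thesis ..
   qed
  qed
 qed
 have ne: "A \<noteq> {}" "B \<noteq> {}" unfolding A_def B_def using pp pm by auto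
 show False using connected_openin[of ?I] oA oB disj cover ne connected_Icc[of i j] by blast
qed

section \<open>The integrals of the time element\<close>

text \<open>The element of \<open>x\<close>-time on level \<open>D\<close>, from
  \<open>dy/dx = sqrt (V - D) / V\<close>. Where \<open>V = D\<close> the quotient is 0 by division
  by zero, and where \<open>V < D\<close> it is not positive; \<open>ennreal\<close> maps both cases
  to 0.\<close>

definition helem :: "(real => real) => real => real => real" where
 "helem f D t = inv_sq f t / sqrt (inv_sq f t - D)"

lemma hint_helem: "hint f D u v = enn2ereal (\<integral>\<^sup>+ t \<in> einterval u v. ennreal (helem f D t) \<partial>lborel)"
 unfolding hint_def helem_def ..

lemma hint_nonneg: "0 <= hint f D u v" unfolding hint_def by simp

lemma hint_empty: "v <= u ==> hint f D u v = 0"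
proof -
 assume "v <= u"
 then have "einterval u v = {}" by (auto simp: einterval_def dest: order_less_trans)
 then show ?thesis unfolding hint_def by (simp add: zero_ennreal.rep_eq)
qed

lemma hint_mono_set:
 assumes "u' <= u" "v <= v'"
 shows "hint f D u v <= hint f D u' v'"
proof -
 have "einterval u v \<subseteq> einterval u' v'" using assms unfolding einterval_def by (auto intro: le_less_trans less_le_trans)
 then have "(\<integral>\<^sup>+ t \<in> einterval u v. ennreal (helem f D t) \<partial>lborel) <= (\<integral>\<^sup>+ t \<in> einterval u' v'. ennreal (helem f D t) \<partial>lborel)"
  by (intro nn_integral_mono) (auto simp: indicator_def)
 then show ?thesis unfolding hint_helem by (simp add: less_eq_ennreal.rep_eq)
qed

lemma helem_mono:
 assumes "D <= D'" "D' < inv_sq f t"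
 shows "helem f D t <= helem f D' t"
 unfolding helem_def using assms by (intro divide_left_mono) (auto simp: inv_sq_def intro!: mult_pos_pos)

lemma hint_mono_D:
 assumes "D <= D'" "!!t. u < ereal t ==> ereal t < v ==> D' < inv_sq f t"
 shows "hint f D u v <= hint f D' u v"
proof -
 have "(\<integral>\<^sup>+ t \<in> einterval u v. ennreal (helem f D t) \<partial>lborel) <= (\<integral>\<^sup>+ t \<in> einterval u v. ennreal (helem f D' t) \<partial>lborel)"
  using assms by (intro nn_integral_mono) (auto simp: indicator_def einterval_iff intro!: ennreal_leI helem_mono)
 then show ?thesis unfolding hint_helem by (simp add: less_eq_ennreal.rep_eq)
qed

lemma einterval_reflect: "x \<in> einterval (-v) (-u) \<longleftrightarrow> - x \<in> einterval u v" unfolding einterval_iff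
 by (metis ereal_less_uminus_reorder ereal_uminus_less_reorder uminus_ereal.simps(1))

lemma inv_sq_reflect: "inv_sq (\<lambda>y. f (- y)) t = inv_sq f (- t)" unfolding inv_sq_def ..

text \<open>The dynamics sees \<open>V\<close> and two derivatives: continuity of \<open>V2\<close>
  makes the field of the system Lipschitz on compact intervals. With the derivatives as parameters,
  the reflected data form an instance as well.\<close>

locale warped =
 fixes a b :: ereal and f V1 V2 :: "real => real"
 assumes ab: "a < b" and fpos: "!!y. y \<in> einterval a b ==> f y > 0"
  and V1: "!!y. y \<in> einterval a b ==> DERIV (inv_sq f) y :> V1 y"
  and V2: "!!y. y \<in> einterval a b ==> DERIV V1 y :> V2 y"
  and contV2: "continuous_on (einterval a b) V2"
begin

abbreviation "K \<equiv> einterval a b"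
abbreviation "V \<equiv> inv_sq f"
abbreviation "H \<equiv> hint f"
abbreviation "I D u v \<equiv> H D (ereal u) (ereal v)"
abbreviation "rf \<equiv> \<lambda>y. f (- y)"
abbreviation "rV1 \<equiv> \<lambda>y. - V1 (- y)"
abbreviation "rV2 \<equiv> \<lambda>y. V2 (- y)"
abbreviation "m \<equiv> m_inf a b f"
abbreviation "astar \<equiv> a_star a b f"
abbreviation "bstar \<equiv> b_star a b f"
abbreviation "rint \<equiv> R_int a b f"
abbreviation "lint \<equiv> L_int a b f"
abbreviation "close \<equiv> close_right a b f"
abbreviation "relmin \<equiv> rel_min_right a b f"

lemma Vpos: "y \<in> K ==> V y > 0" using fpos[of y] unfolding inv_sq_def by simp

lemma contV: "continuous_on K V" using V1 by (intro DERIV_continuous_on) (auto intro: has_field_derivative_at_within)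

lemma contV1: "continuous_on K V1" using V2 by (intro DERIV_continuous_on) (auto intro: has_field_derivative_at_within)

lemma sub_K: "u \<in> K ==> v \<in> K ==> {u..v} \<subseteq> K"
 by (auto simp: einterval_iff) (meson ereal_less_eq(3) less_le_trans le_less_trans)+

lemma in_K: "u \<in> K ==> v \<in> K ==> u <= x ==> x <= v ==> x \<in> K"
 using sub_K by fastforce

lemma deriv_V: "y \<in> K ==> deriv V y = V1 y" using V1 DERIV_imp_deriv by blast

lemma meas_helem: "(\<lambda>t. ennreal (helem f D t) * indicator A t) \<in> borel_measurable lborel"
 if "A \<subseteq> K" "A \<in> sets borel"
proof -
 have "(\<lambda>t. indicator K t *\<^sub>R V t) \<in> borel_measurable borel"
  by (rule borel_measurable_continuous_on_indicator[OF _ contV]) simp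
 then have [measurable]: "(\<lambda>t. indicator K t * V t) \<in> borel_measurable borel" by simp
 note [measurable] = \<open>A \<in> sets borel\<close>
 have "(\<lambda>t. ennreal (helem f D t) * indicator A t) =
   (\<lambda>t. ennreal ((indicator K t * V t) / sqrt ((indicator K t * V t) - D)) * indicator A t)"
  using that(1) by (intro ext) (auto simp: helem_def indicator_def)
 then show ?thesis by simp
qed

lemma einterval_sub: "a <= u ==> v <= b ==> einterval u v \<subseteq> K"
 by (auto simp: einterval_iff intro: le_less_trans less_le_trans)

lemma hint_add:
 assumes "a <= u" "u <= ereal v" "ereal v <= w" "w <= b"
 shows "H D u w = H D u (ereal v) + H D (ereal v) w"
proof -
 let ?g = "\<lambda>t. ennreal (helem f D t)"
 have s1: "einterval u (ereal v) \<subseteq> K" "einterval (ereal v) w \<subseteq> K" "einterval u w \<subseteq> K"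
  using assms order_trans by (intro einterval_sub; force)+
 have "(\<integral>\<^sup>+ t \<in> einterval u w. ?g t \<partial>lborel) =
   (\<integral>\<^sup>+ t. ?g t * indicator (einterval u (ereal v)) t + ?g t * indicator (einterval (ereal v) w) t \<partial>lborel)"
 proof (rule nn_integral_cong_AE)
  have "AE x in lborel. x \<noteq> v" by (rule AE_lborel_singleton)
  then show "AE t in lborel. ?g t * indicator (einterval u w) t =
    ?g t * indicator (einterval u (ereal v)) t + ?g t * indicator (einterval (ereal v) w) t"
  proof eventually_elim
   case (elim x)
   then consider "x < v" | "x > v" by linarith
   then show ?case
   proof cases
    case 1
    then have "x \<notin> einterval (ereal v) w" "x \<in> einterval u w \<longleftrightarrow> x \<in> einterval u (ereal v)"
     using assms by (auto simp: einterval_iff intro: less_le_trans[of _ "ereal v"])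
    then show ?thesis by (simp add: indicator_def)
   next
    case 2
    then have "x \<notin> einterval u (ereal v)" "x \<in> einterval u w \<longleftrightarrow> x \<in> einterval (ereal v) w"
     using assms by (auto simp: einterval_iff intro: le_less_trans[of _ "ereal v"])
    then show ?thesis by (simp add: indicator_def)
   qed
  qed
 qed
 also have "\<dots> = (\<integral>\<^sup>+ t \<in> einterval u (ereal v). ?g t \<partial>lborel) + (\<integral>\<^sup>+ t \<in> einterval (ereal v) w. ?g t \<partial>lborel)"
  by (rule nn_integral_add) (use s1 meas_helem in auto)
 finally show ?thesis unfolding hint_helem by (simp add: plus_ennreal.rep_eq)
qed

lemma cont_helem:
 assumes "S \<subseteq> K" "!!t. t \<in> S ==> D < V t"
 shows "continuous_on S (helem f D)" unfolding helem_def using assms contV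
 by (intro continuous_intros) (auto intro: continuous_on_subset dest: assms(2))

lemma hint_real:
 assumes "u <= v" "{u..v} \<subseteq> K" "!!t. t \<in> {u..v} ==> D < V t"
 shows "I D u v = ereal (integral {u..v} (helem f D))" and "0 <= integral {u..v} (helem f D)"
proof -
 have "(helem f D has_integral (integral {u..v} (helem f D))) {u..v}"
  using cont_helem[OF assms(2,3)] by (intro integrable_integral integrable_continuous_real)
 then have *: "(helem f D has_integral (integral {u..v} (helem f D))) {u<..<v}" by (simp add: has_integral_Icc_iff_Ioo)
 have nn: "helem f D x \<ge> 0" if "x \<in> {u..v}" for x using assms(3)[OF that] Vpos[of x] assms(2) that unfolding helem_def by force
 have "integral\<^sup>N lborel (\<lambda>x. ennreal (helem f D x) * indicator {u<..<v} x) = ennreal (integral {u..v} (helem f D))"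
  by (rule nn_integral_has_integral_lebesgue'[OF _ *]) (use nn in auto)
 moreover show "0 <= integral {u..v} (helem f D)"
  by (rule integral_nonneg) (use nn cont_helem[OF assms(2,3)] integrable_continuous_real in auto)
 ultimately show "I D u v = ereal (integral {u..v} (helem f D))" unfolding hint_helem by simp
qed

lemma hint_finite:
 assumes "u \<in> K" "v \<in> K" "!!t. t \<in> {u..v} ==> D < V t"
 shows "I D u v < \<infinity>" using hint_real[OF _ sub_K[OF assms(1,2)] assms(3)] hint_empty[of v u] by (cases "u <= v") auto

lemma hint_pos:
 assumes "a <= u" "u < v" "v <= b" "!!t. u < ereal t ==> ereal t < v ==> D < V t"
 shows "0 < H D u v"
proof -
 obtain p where p: "u < ereal p" "ereal p < v" using ereal_dense2[OF assms(2)] by blast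
 obtain q where q: "ereal p < ereal q" "ereal q < v" using ereal_dense2[OF p(2)] by blast
 have pK: "p \<in> K" "q \<in> K" using p q assms by (auto simp: einterval_iff intro: le_less_trans less_le_trans)
 then have sub: "{p..q} \<subseteq> K" by (rule sub_K)
 have gt: "D < V t" if "t \<in> {p..q}" for t
  using that p q by (intro assms(4)) (auto intro: less_le_trans[of u "ereal p"] le_less_trans[of _ "ereal q"])
 have c: "continuous_on {p..q} (helem f D)" by (rule cont_helem[OF sub gt])
 have hp: "helem f D x > 0" if "x \<in> {p..q}" for x using gt[OF that] Vpos sub that unfolding helem_def by auto
 obtain x0 where x0: "x0 \<in> {p..q}" "!!x. x \<in> {p..q} ==> helem f D x0 <= helem f D x"
  using continuous_attains_inf[OF _ _ c] q by auto
 have "integral {p..q} (\<lambda>_. helem f D x0) <= integral {p..q} (helem f D)"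
  by (rule integral_le) (use x0 c integrable_continuous_real in auto)
 moreover have "integral {p..q} (\<lambda>_. helem f D x0) > 0" using hp[OF x0(1)] q by simp
 ultimately have "0 < I D p q" using hint_real(1)[OF _ sub gt] q by simp
 also have "\<dots> <= H D u v" using p q by (intro hint_mono_set) auto
 finally show ?thesis .
qed

text \<open>Below the minimum of \<open>V\<close> on the compact interval the integrand is jointly
  continuous in level and height.\<close>

lemma hint_continuous_D:
 assumes "u \<in> K" "v \<in> K" "!!t. t \<in> {u..v} ==> D < V t"
 shows "((\<lambda>D'. I D' u v) \<longlongrightarrow> I D u v) (at D)"
proof (cases "u <= v")
 case False
 then show ?thesis by (simp add: hint_empty)
next
 case True
 have sub: "{u..v} \<subseteq> K" using assms sub_K by auto
 have cV: "continuous_on {u..v} V" using contV sub continuous_on_subset by blast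
 obtain x0 where x0: "x0 \<in> {u..v}" "!!x. x \<in> {u..v} ==> V x0 <= V x"
  using continuous_attains_inf[OF _ _ cV] True by auto
 define U where "U = {..<V x0}"
 have DU: "D \<in> U" unfolding U_def using assms(3)[OF x0(1)] by simp
 have less: "D' < V t" if "D' \<in> U" "t \<in> {u..v}" for D' t using that x0(2)[of t] unfolding U_def by auto
 have "continuous_on (U \<times> cbox u v) (\<lambda>(D', t). helem f D' t)"
 proof -
  have "continuous_on (U \<times> {u..v}) (\<lambda>z. V (snd z))"
   by (rule continuous_on_compose2[OF cV]) (auto intro!: continuous_intros)
  then show ?thesis unfolding helem_def case_prod_unfold using less by (intro continuous_intros) (auto dest: less)
 qed
 then have "continuous_on U (\<lambda>D'. integral (cbox u v) (helem f D'))" by (rule integral_continuous_on_param)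
 then have "((\<lambda>D'. integral {u..v} (helem f D')) \<longlongrightarrow> integral {u..v} (helem f D)) (at D)"
  using DU continuous_on_eq_continuous_at[of U] by (auto simp: U_def isCont_def)
 then have lim: "((\<lambda>D'. ereal (integral {u..v} (helem f D'))) \<longlongrightarrow> ereal (integral {u..v} (helem f D))) (at D)"
  by (intro tendsto_intros)
 have ev: "eventually (\<lambda>D'. ereal (integral {u..v} (helem f D')) = I D' u v) (at D)"
 proof -
  have "open U" unfolding U_def by simp
  then have "eventually (\<lambda>D'. D' \<in> U) (at D)" using DU by (metis eventually_at_topological)
  then show ?thesis by eventually_elim (use hint_real(1)[OF True sub] less in auto)
 qed
 have "I D u v = ereal (integral {u..v} (helem f D))" by (rule hint_real(1)[OF True sub]) (use less[OF DU] in auto)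
 then show ?thesis using Lim_transform_eventually[OF lim ev] by simp
qed

text \<open>Monotone convergence along compact intervals exhausting \<open>(u, v)\<close>. Infinite
  integrals are covered too, so a strict lower bound for an integral up to an end of
  \<open>K\<close> or up to a turning point, where the integrand is singular, survives on an
  interior interval.\<close>

lemma hint_approx:
 assumes uv: "a <= u" "v <= b" and x: "x < H D u v" "0 <= x"
 obtains p q where "u < ereal p" "p < q" "ereal q < v" "x < I D p q"
proof -
 have "u < v" using x hint_empty[of v u f D] by (metis linorder_not_less)
 then obtain r l :: "nat => real" where A: "einterval u v = (\<Union>i. {l i..r i})" "incseq r" "decseq l"
  "!!i. l i < r i" "!!i. u < ereal (l i)" "!!i. ereal (r i) < v" by (rule einterval_Icc_approximation) (rule that)
 let ?g = "\<lambda>i t. ennreal (helem f D t) * indicator {l i..r i} t"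
 have sub: "{l i..r i} \<subseteq> K" for i using A(1) einterval_sub[OF uv] by auto
 have inc: "{l i..r i} \<subseteq> {l j..r j}" if "i <= j" for i j
  using A(2,3) that by (auto simp: incseq_def decseq_def intro: order_trans)
 have incg: "incseq ?g" by (intro monoI le_funI) (auto simp: indicator_def dest: subsetD[OF inc])
 have "(\<integral>\<^sup>+ t \<in> einterval u v. ennreal (helem f D t) \<partial>lborel) = (\<integral>\<^sup>+ t. (SUP i. ?g i t) \<partial>lborel)"
 proof (rule nn_integral_cong)
  fix t
  show "ennreal (helem f D t) * indicator (einterval u v) t = (SUP i. ?g i t)"
  proof (cases "t \<in> einterval u v")
   case True
   then obtain i where "t \<in> {l i..r i}" using A(1) by auto
   then have "?g i t = ennreal (helem f D t)" by simp
   moreover have "?g j t <= ennreal (helem f D t)" for j by (simp add: indicator_def)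
   ultimately have "(SUP i. ?g i t) = ennreal (helem f D t)" by (metis (no_types, lifting) SUP_eqI UNIV_I)
   then show ?thesis using True by simp
  next
   case False
   then have "t \<notin> {l i..r i}" for i using A(1) by auto
   then show ?thesis using False by simp
  qed
 qed
 also have "\<dots> = (SUP i. integral\<^sup>N lborel (?g i))"
  by (rule nn_integral_monotone_convergence_SUP[OF incg]) (use sub meas_helem in auto)
 finally have eq: "(\<integral>\<^sup>+ t \<in> einterval u v. ennreal (helem f D t) \<partial>lborel) = (SUP i. integral\<^sup>N lborel (?g i))" .
 have "e2ennreal x < (\<integral>\<^sup>+ t \<in> einterval u v. ennreal (helem f D t) \<partial>lborel)"
  using x unfolding hint_helem by (simp add: less_ennreal.rep_eq enn2ereal_e2ennreal)
 then obtain i where i: "e2ennreal x < integral\<^sup>N lborel (?g i)" unfolding eq less_SUP_iff by auto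
 have "integral\<^sup>N lborel (?g i) = (\<integral>\<^sup>+ t \<in> einterval (ereal (l i)) (ereal (r i)). ennreal (helem f D t) \<partial>lborel)"
 proof (rule nn_integral_cong_AE)
  have "AE x in lborel. x \<noteq> l i" "AE x in lborel. x \<noteq> r i" by (rule AE_lborel_singleton)+
  then show "AE t in lborel. ?g i t = ennreal (helem f D t) * indicator (einterval (ereal (l i)) (ereal (r i))) t"
   by eventually_elim (auto simp: indicator_def)
 qed
 then have "x < I D (l i) (r i)" using i x unfolding hint_helem by (simp add: less_ennreal.rep_eq enn2ereal_e2ennreal)
 then show ?thesis using that A by blast
qed

text \<open>Monotone convergence along the levels \<open>D - 1 / Suc i\<close>, on which the
  integrand increases with \<open>i\<close>. This replaces \<open>hint_continuous_D\<close> at a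
  level that \<open>V\<close> touches.\<close>

lemma hint_approx_D:
 assumes uv: "a <= u" "v <= b" and x: "x < H D u v" "0 <= x"
  and V: "!!t. u < ereal t ==> ereal t < v ==> D <= V t"
 obtains D' where "D' < D" "x < H D' u v"
proof -
 let ?g = "\<lambda>i t. ennreal (helem f (D - 1 / Suc i) t) * indicator (einterval u v) t"
 have incg: "incseq ?g"
 proof (intro monoI le_funI)
  fix i j :: nat and t assume ij: "i <= j"
  show "?g i t <= ?g j t"
  proof (cases "t \<in> einterval u v")
   case True
   then have "D <= V t" using V by (auto simp: einterval_iff)
   then have "helem f (D - 1 / Suc i) t <= helem f (D - 1 / Suc j) t"
    using ij by (intro helem_mono) (auto simp: frac_le intro: less_le_trans[of _ D])
   then show ?thesis using True by (simp add: ennreal_leI)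
  qed simp
 qed
 have "(\<integral>\<^sup>+ t \<in> einterval u v. ennreal (helem f D t) \<partial>lborel) <= (\<integral>\<^sup>+ t. (SUP i. ?g i t) \<partial>lborel)"
 proof (rule nn_integral_mono)
  fix t
  show "ennreal (helem f D t) * indicator (einterval u v) t <= (SUP i. ?g i t)"
  proof (cases "t \<in> einterval u v \<and> V t \<noteq> D")
   case True
   then have gt: "D < V t" using V by (auto simp: einterval_iff less_le)
   have "(\<lambda>i. D - 1 / real (Suc i)) \<longlonglongrightarrow> D - 0" by (intro tendsto_intros LIMSEQ_Suc lim_1_over_n)
   then have "(\<lambda>i. helem f (D - 1 / real (Suc i)) t) \<longlonglongrightarrow> helem f D t"
    unfolding helem_def using gt by (intro tendsto_intros) auto
   then have "(\<lambda>i. ennreal (helem f (D - 1 / real (Suc i)) t)) \<longlonglongrightarrow> ennreal (helem f D t)"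
    by (rule tendsto_ennrealI)
   then have "(\<lambda>i. ?g i t) \<longlonglongrightarrow> ennreal (helem f D t)" using True by simp
   moreover have "(\<lambda>i. ?g i t) \<longlonglongrightarrow> (SUP i. ?g i t)"
    by (rule LIMSEQ_SUP) (use incg in \<open>auto simp: incseq_def le_fun_def\<close>)
   ultimately have "(SUP i. ?g i t) = ennreal (helem f D t)" by (metis LIMSEQ_unique)
   then show ?thesis using True by simp
  next
   case False
   \<comment> \<open>At points with \<open>V t = D\<close> division by zero makes the integrand 0,
     so the supremum over the lower levels has nothing to reach there.\<close>
   then have "ennreal (helem f D t) * indicator (einterval u v) t = 0" by (auto simp: helem_def)
   then show ?thesis by (metis zero_le)
  qed
 qed
 also have "\<dots> = (SUP i. integral\<^sup>N lborel (?g i))" by (rule nn_integral_monotone_convergence_SUP[OF incg])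
   (use einterval_sub[OF uv] meas_helem in auto)
 finally have le: "(\<integral>\<^sup>+ t \<in> einterval u v. ennreal (helem f D t) \<partial>lborel) <= (SUP i. integral\<^sup>N lborel (?g i))" .
 have "e2ennreal x < (\<integral>\<^sup>+ t \<in> einterval u v. ennreal (helem f D t) \<partial>lborel)"
  using x unfolding hint_helem by (simp add: less_ennreal.rep_eq enn2ereal_e2ennreal)
 then obtain i where i: "e2ennreal x < integral\<^sup>N lborel (?g i)"
  using le unfolding less_SUP_iff by (metis (no_types, lifting) less_SUP_iff less_le_trans)
 then have "x < H (D - 1 / Suc i) u v" using x unfolding hint_helem by (simp add: less_ennreal.rep_eq enn2ereal_e2ennreal)
 then show ?thesis using that[of "D - 1 / Suc i"] by simp
qed

text \<open>The substitution \<open>y -> - y\<close> exchanges the ends. Interpreting the locale at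
  the reflected data turns a result on the right end into one on the left end, which is how the
  left-hand versions below are obtained.\<close>

lemma warped_reflect: "warped (- b) (- a) rf rV1 rV2"
proof
 have e: "y \<in> einterval (- b) (- a) \<longleftrightarrow> - y \<in> K" for y by (rule einterval_reflect)
 show "- b < - a" using ab by simp
 fix y assume y: "y \<in> einterval (- b) (- a)"
 then have y': "- y \<in> K" using e by simp
 show "0 < f (- y)" using fpos y' by simp
 have m: "DERIV uminus y :> -1" by (auto intro!: derivative_eq_intros)
 have "DERIV (\<lambda>y. inv_sq f (- y)) y :> V1 (- y) * (-1)" by (rule DERIV_chain2[OF V1[OF y'] m])
 then show "DERIV (inv_sq rf) y :> - V1 (- y)" by (simp add: inv_sq_reflect[abs_def])
 have "DERIV (\<lambda>y. V1 (- y)) y :> V2 (- y) * (-1)" by (rule DERIV_chain2[OF V2[OF y'] m])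
 then show "DERIV rV1 y :> V2 (- y)" using DERIV_minus by fastforce
next
 show "continuous_on (einterval (- b) (- a)) rV2"
  by (rule continuous_on_compose2[OF contV2]) (auto simp: einterval_reflect intro!: continuous_intros)
qed

lemma hint_reflect:
 assumes "a <= u" "v <= b"
 shows "hint rf D (- v) (- u) = H D u v"
proof -
 have "(\<integral>\<^sup>+ t \<in> einterval u v. ennreal (helem f D t) \<partial>lborel) =
   ennreal \<bar>-1\<bar> * (\<integral>\<^sup>+ t. (\<lambda>t. ennreal (helem f D t) * indicator (einterval u v) t) (0 + (-1) * t) \<partial>lborel)"
  by (rule nn_integral_real_affine) (use meas_helem[OF einterval_sub[OF assms]] in auto)
 also have "\<dots> = (\<integral>\<^sup>+ t \<in> einterval (- v) (- u). ennreal (helem rf D t) \<partial>lborel)"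
  by (auto simp: indicator_def einterval_reflect helem_def inv_sq_reflect intro!: nn_integral_cong)
 finally show ?thesis unfolding hint_helem by simp
qed

end

section \<open>Lower limits at the ends\<close>

lemma at_left_reflect: "filtermap uminus (at_left b) = at_right (- b)" if "a < (b::ereal)"
proof (rule filter_eqI)
 fix P
 have nb: "- b < - a" using that by simp
 show "eventually P (filtermap uminus (at_left b)) \<longleftrightarrow> eventually P (at_right (- b))"
  unfolding eventually_filtermap eventually_at_left[OF that] eventually_at_right[OF nb]
 proof safe
  fix s assume "s < b" "\<forall>y>s. y < b --> P (- y)"
  then show "\<exists>s>- b. \<forall>y>- b. y < s --> P y"
   by (intro exI[of _ "- s"]) (metis ereal_minus_less_minus ereal_uminus_uminus)
 next
  fix s assume "s > - b" "\<forall>y>- b. y < s --> P y"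
  then show "\<exists>s<b. \<forall>y>s. y < b --> P (- y)"
   by (intro exI[of _ "- s"]) (metis ereal_minus_less_minus ereal_uminus_uminus)
 qed
qed

lemma m_left_reflect: "m_left (- b) (\<lambda>y. f (- y)) = m_right b f" if "a < b"
 unfolding m_left_def m_right_def at_left_reflect[OF that, symmetric]
 by (subst Liminf_filtermap_eq) (auto simp: inv_sq_reflect inj_on_def real_of_ereal_minus')

lemma m_right_lessD:
 assumes "a < b" "m_right b f < ereal x" "s < b"
 obtains t where "s < ereal t" "ereal t < b" "inv_sq f t < x"
proof (rule ccontr)
 assume "\<not> thesis"
 then have *: "x <= inv_sq f t" if "s < ereal t" "ereal t < b" for t
  using that \<open>!!t. _ ==> _ ==> _ ==> thesis\<close> by (meson not_le)
 have "ereal x <= m_right b f" unfolding m_right_def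
 proof (rule Liminf_bounded)
  show "eventually (\<lambda>t. ereal x <= ereal (inv_sq f (real_of_ereal t))) (at_left b)" unfolding eventually_at_left[OF assms(1)]
  proof (intro exI[of _ s] conjI allI impI assms)
   fix y assume "s < y" "y < b"
   then show "ereal x <= ereal (inv_sq f (real_of_ereal y))" using * by (cases y) auto
  qed
 qed
 then show False using assms(2) by simp
qed

lemma m_right_ge:
 assumes "a < b" "s < b" "!!t. s < ereal t ==> ereal t < b ==> x <= inv_sq f t"
 shows "ereal x <= m_right b f"
proof (rule ccontr)
 assume "\<not> ?thesis"
 then obtain t where "s < ereal t" "ereal t < b" "inv_sq f t < x" by (metis m_right_lessD[OF assms(1) _ assms(2)] not_le)
 then show False using assms(3)[of t] by simp
qed

lemma m_right_le:
 assumes "a < b" "!!s. s < b ==> \<exists>t. s < ereal t \<and> ereal t < b \<and> ereal (inv_sq f t) <= x"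
 shows "m_right b f <= x"
proof (rule ccontr)
 assume "\<not> ?thesis"
 then have "x < m_right b f" by simp
 then have "eventually (\<lambda>t. x < ereal (inv_sq f (real_of_ereal t))) (at_left b)" unfolding m_right_def by (rule less_LiminfD)
 then obtain s where s: "s < b" "!!y. s < y ==> y < b ==> x < ereal (inv_sq f (real_of_ereal y))"
  unfolding eventually_at_left[OF assms(1)] by auto
 then obtain t where "s < ereal t" "ereal t < b" "ereal (inv_sq f t) <= x" using assms(2) by blast
 then show False using s(2)[of "ereal t"] by simp
qed

lemma m_right_gtD:
 assumes "a < b" "x < m_right b f"
 obtains s where "s < b" "!!t. s < ereal t ==> ereal t < b ==> x < ereal (inv_sq f t)"
proof -
 have "eventually (\<lambda>t. x < ereal (inv_sq f (real_of_ereal t))) (at_left b)"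
  using assms(2) unfolding m_right_def by (rule less_LiminfD)
 then obtain s where "s < b" "!!y. s < y ==> y < b ==> x < ereal (inv_sq f (real_of_ereal y))"
  unfolding eventually_at_left[OF assms(1)] by auto
 then show ?thesis using that[of s] by fastforce
qed

lemma m_right_nonneg: "a < b ==> 0 <= m_right b f" using m_right_ge[of a b a 0 f] by (auto simp: inv_sq_def zero_ereal_def)

section \<open>Trajectories\<close>

lemma deriv_shift_within:
 assumes "(g has_real_derivative D) (at (s + x) within S)" "!!x'. x' \<in> S' ==> s + x' \<in> S"
 shows "((\<lambda>x. g (s + x)) has_real_derivative D) (at x within S')"
proof -
 have "(g has_real_derivative D) (at (s + x) within ((+) s ` S'))"
  by (rule has_field_derivative_subset[OF assms(1)]) (use assms(2) in auto)
 moreover have "((+) s has_real_derivative 1) (at x within S')" by (auto intro!: derivative_eq_intros)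
 ultimately have "(g \<circ> (+) s has_real_derivative D * 1) (at x within S')" by (rule DERIV_image_chain)
 then show ?thesis by (simp add: o_def)
qed

lemma deriv_rev_within:
 assumes "(g has_real_derivative D) (at (s - x) within S)" "!!x'. x' \<in> S' ==> s - x' \<in> S"
 shows "((\<lambda>x. g (s - x)) has_real_derivative - D) (at x within S')"
proof -
 have "(g has_real_derivative D) (at (s - x) within ((-) s ` S'))"
  by (rule has_field_derivative_subset[OF assms(1)]) (use assms(2) in auto)
 moreover have "((-) s has_real_derivative -1) (at x within S')" by (auto intro!: derivative_eq_intros)
 ultimately have "(g \<circ> (-) s has_real_derivative D * (-1)) (at x within S')" by (rule DERIV_image_chain)
 then show ?thesis by (simp add: o_def)
qed

lemma continuous_Icc_bounded:
 fixes g :: "real => real"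
 assumes "continuous_on {l..r} g"
 obtains B where "0 <= B" "!!x. x \<in> {l..r} ==> \<bar>g x\<bar> <= B"
proof -
 have "bounded (g ` {l..r})" using assms by (intro compact_imp_bounded compact_continuous_image) auto
 then obtain B where B: "\<forall>x\<in>{l..r}. \<bar>g x\<bar> <= B" unfolding bounded_iff by auto
 show ?thesis
 proof (rule that[of "\<bar>B\<bar>"])
  show "\<bar>g x\<bar> <= \<bar>B\<bar>" if "x \<in> {l..r}" for x using B that by force
 qed simp
qed

lemma C1_lipschitz:
 fixes g g' :: "real => real"
 assumes "!!x. x \<in> {l..r} ==> DERIV g x :> g' x" "continuous_on {l..r} g'"
 obtains L where "L \<ge> 0" "!!x y. x \<in> {l..r} ==> y \<in> {l..r} ==> \<bar>g x - g y\<bar> <= L * \<bar>x - y\<bar>"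
proof -
 obtain B where B: "0 <= B" "!!x. x \<in> {l..r} ==> \<bar>g' x\<bar> <= B"
  using continuous_Icc_bounded[OF assms(2)] by blast
 show ?thesis
 proof (rule that[of "\<bar>B\<bar>"])
  fix x y assume "x \<in> {l..r}" "y \<in> {l..r}"
  then have "norm (g x - g y) <= \<bar>B\<bar> * norm (x - y)"
  proof (intro field_differentiable_bound[where S = "{l..r}" and f' = g'])
   show "(g has_real_derivative g' z) (at z within {l..r})" if "z \<in> {l..r}" for z
    using assms(1)[OF that] has_field_derivative_at_within by blast
   show "norm (g' z) <= \<bar>B\<bar>" if "z \<in> {l..r}" for z using B(1) B(2)[OF that] by simp
  qed auto
  then show "\<bar>g x - g y\<bar> <= \<bar>B\<bar> * \<bar>x - y\<bar>" by simp
 qed simp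
qed

abbreviation clampI :: "real => real => real => real" where "clampI l r y \<equiv> max l (min r y)"

lemma clampI_id: "l <= y ==> y <= r ==> clampI l r y = y" by simp

lemma clampI_lip: "\<bar>clampI l r x - clampI l r y\<bar> <= \<bar>x - y\<bar>" by linarith

context warped
begin

text \<open>A timelike geodesic is a graph over \<open>x\<close>; with \<open>p = V (dy/dx)\<close> the geodesic equation becomes
 a regular first order system whose first integral is \<open>D = V - p\<^sup>2\<close>.\<close>

definition sol :: "(real => real) => (real => real) => real => bool" where
 "sol y p T \<longleftrightarrow> (\<forall>x\<in>{0..T}. y x \<in> K
   \<and> (y has_real_derivative p x / V (y x)) (at x within {0..T})
   \<and> (p has_real_derivative V1 (y x) / (2 * V (y x))) (at x within {0..T}))"

text \<open>The system with \<open>V\<close> and \<open>V1\<close> frozen outside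
  \<open>[l, r]\<close>. Its solutions exist for all times and initial values, and they are
  trajectories as long as they stay in \<open>[l, r]\<close>.\<close>

definition csol :: "real => real => (real => real) => (real => real) => real => bool" where
 "csol l r y p T \<longleftrightarrow> (\<forall>x\<in>{0..T}.
    (y has_real_derivative p x / V (clampI l r (y x))) (at x within {0..T})
   \<and> (p has_real_derivative V1 (clampI l r (y x)) / (2 * V (clampI l r (y x)))) (at x within {0..T}))"

lemma sol_csol:
 assumes "sol y p T" "!!x. x \<in> {0..T} ==> l <= y x \<and> y x <= r"
 shows "csol l r y p T" unfolding csol_def
proof
 fix x assume x: "x \<in> {0..T}"
 then have c: "clampI l r (y x) = y x" using assms(2)[OF x] clampI_id by blast
 show "(y has_real_derivative p x / V (clampI l r (y x))) (at x within {0..T})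
   \<and> (p has_real_derivative V1 (clampI l r (y x)) / (2 * V (clampI l r (y x)))) (at x within {0..T})"
  unfolding c using assms(1) x by (simp add: sol_def)
qed

lemma csol_sol:
 assumes "csol l r y p T" "l \<in> K" "r \<in> K" "X <= T" "!!x. x \<in> {0..X} ==> l <= y x \<and> y x <= r"
 shows "sol y p X" unfolding sol_def
proof (intro ballI conjI)
 fix x assume x: "x \<in> {0..X}"
 then have xT: "x \<in> {0..T}" "{0..X} \<subseteq> {0..T}" using assms(4) by auto
 have c: "clampI l r (y x) = y x" using assms(5)[OF x] by simp
 show "y x \<in> K" using in_K[OF assms(2,3)] assms(5)[OF x] by auto
 show "(y has_real_derivative p x / V (y x)) (at x within {0..X})" "(p has_real_derivative V1 (y x) / (2 * V (y x))) (at x within {0..X})"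
  using assms(1) xT c unfolding csol_def by (metis has_field_derivative_subset)+
qed

lemma sol_restrict: "sol y p T ==> X <= T ==> sol y p X" unfolding sol_def
 by (auto intro: has_field_derivative_subset[where s = "{0..T}"])

lemma csol_cont: "csol l r y p T ==> continuous_on {0..T} y" "csol l r y p T ==> continuous_on {0..T} p"
 unfolding csol_def by (auto intro!: DERIV_continuous_on)

lemma sol_cont: "sol y p T ==> continuous_on {0..T} y" "sol y p T ==> continuous_on {0..T} p"
 unfolding sol_def by (auto intro!: DERIV_continuous_on)

lemma sol_in: "sol y p T ==> x \<in> {0..T} ==> y x \<in> K" unfolding sol_def by blast

lemma sol_range:
 assumes "sol y p T" "0 <= T"
 obtains l r where "l \<in> K" "r \<in> K" "!!x. x \<in> {0..T} ==> l <= y x \<and> y x <= r"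
proof -
 have ne: "{0..T} \<noteq> {}" using assms(2) by auto
 obtain xl where "xl \<in> {0..T}" "!!x. x \<in> {0..T} ==> y xl <= y x"
  using continuous_attains_inf[OF compact_Icc ne sol_cont(1)[OF assms(1)]] by auto
 moreover obtain xr where "xr \<in> {0..T}" "!!x. x \<in> {0..T} ==> y x <= y xr"
  using continuous_attains_sup[OF compact_Icc ne sol_cont(1)[OF assms(1)]] by auto
 ultimately show ?thesis using that[of "y xl" "y xr"] sol_in[OF assms(1)] by auto
qed

lemma sol_shift:
 assumes "sol y p T" "0 <= s" "s <= T"
 shows "sol (\<lambda>x. y (s + x)) (\<lambda>x. p (s + x)) (T - s)" unfolding sol_def
proof (intro ballI conjI)
 fix x assume x: "x \<in> {0..T - s}"
 then have xT: "s + x \<in> {0..T}" using assms by auto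
 show "y (s + x) \<in> K" using sol_in[OF assms(1) xT] .
 show "((\<lambda>x. y (s + x)) has_real_derivative p (s + x) / V (y (s + x))) (at x within {0..T - s})"
    "((\<lambda>x. p (s + x)) has_real_derivative V1 (y (s + x)) / (2 * V (y (s + x)))) (at x within {0..T - s})"
  by (rule deriv_shift_within[where S = "{0..T}"]; use assms xT in \<open>auto simp: sol_def\<close>)+
qed

lemma sol_reverse:
 assumes "sol y p T" "0 <= s" "s <= T"
 shows "sol (\<lambda>x. y (s - x)) (\<lambda>x. - p (s - x)) s" unfolding sol_def
proof (intro ballI conjI)
 fix x assume x: "x \<in> {0..s}"
 then have xT: "s - x \<in> {0..T}" using assms by auto
 have s: "sol y p T" by fact
 show "y (s - x) \<in> K" using sol_in[OF assms(1) xT] .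
 have "((\<lambda>x. y (s - x)) has_real_derivative - (p (s - x) / V (y (s - x)))) (at x within {0..s})"
  by (rule deriv_rev_within[where S = "{0..T}"]; use assms xT in \<open>auto simp: sol_def\<close>)
 then show "((\<lambda>x. y (s - x)) has_real_derivative - p (s - x) / V (y (s - x))) (at x within {0..s})" by simp
 have "((\<lambda>x. p (s - x)) has_real_derivative - (V1 (y (s - x)) / (2 * V (y (s - x))))) (at x within {0..s})"
  by (rule deriv_rev_within[where S = "{0..T}"]; use assms xT in \<open>auto simp: sol_def\<close>)
 from DERIV_minus[OF this]
 show "((\<lambda>x. - p (s - x)) has_real_derivative V1 (y (s - x)) / (2 * V (y (s - x)))) (at x within {0..s})" by simp
qed

lemma sol_constant: "c \<in> K ==> V1 c = 0 ==> sol (\<lambda>_. c) (\<lambda>_. 0) T" unfolding sol_def by auto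

subsection \<open>Lipschitz bounds, existence and uniqueness\<close>

text \<open>The momentum is clamped as well: \<open>p / V\<close> is a product, and it is Lipschitz
  in \<open>y\<close> with a uniform constant only for bounded \<open>p\<close>.\<close>

definition field :: "real => real => real => real \<times> real => real \<times> real" where
 "field l r M z = (clampI (-M) M (snd z) / V (clampI l r (fst z)),
          V1 (clampI l r (fst z)) / (2 * V (clampI l r (fst z))))"

text \<open>The first component is estimated as a product whose factor \<open>p\<close> is bounded
  by the clamp \<open>M\<close>. The second component does not involve \<open>M\<close>, so its
  bound \<open>G\<close> can be used to choose \<open>M\<close> afterwards.\<close>

lemma field_lipschitz:
 assumes lr: "l \<in> K" "r \<in> K" "l <= r" and M: "0 <= M"
 obtains L G where "L > 0" "G \<ge> 0" "!!z w. norm (field l r M z - field l r M w) <= L * norm (z - w)"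
  "!!z. \<bar>snd (field l r M z)\<bar> <= G"
proof -
 have sub: "{l..r} \<subseteq> K" using sub_K lr by auto
 have cV: "continuous_on {l..r} V" "continuous_on {l..r} V1" "continuous_on {l..r} V2"
  using contV contV1 contV2 sub continuous_on_subset by blast+
 have Vnz: "V x \<noteq> 0" "V x > 0" if "x \<in> {l..r}" for x using Vpos sub that by force+
 have cl: "clampI l r y \<in> {l..r}" for y using lr by auto
 obtain L1 where L1: "L1 \<ge> 0" "!!x y. x \<in> {l..r} ==> y \<in> {l..r} ==> \<bar>1 / V x - 1 / V y\<bar> <= L1 * \<bar>x - y\<bar>"
 proof (rule C1_lipschitz[of l r "\<lambda>x. 1 / V x" "\<lambda>x. - V1 x / (V x)\<^sup>2"])
  show "DERIV (\<lambda>x. 1 / V x) x :> - V1 x / (V x)\<^sup>2" if "x \<in> {l..r}" for x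
   using Vnz[OF that] V1 sub that by (auto intro!: derivative_eq_intros simp: power2_eq_square)
  show "continuous_on {l..r} (\<lambda>x. - V1 x / (V x)\<^sup>2)" using Vnz cV by (intro continuous_intros) auto
 qed (use that in blast)
 obtain L2 where L2: "L2 \<ge> 0" "!!x y. x \<in> {l..r} ==> y \<in> {l..r} ==> \<bar>V1 x / (2 * V x) - V1 y / (2 * V y)\<bar> <= L2 * \<bar>x - y\<bar>"
 proof (rule C1_lipschitz[of l r "\<lambda>x. V1 x / (2 * V x)" "\<lambda>x. (V2 x * (2 * V x) - V1 x * (2 * V1 x)) / ((2 * V x) * (2 * V x))"])
  show "DERIV (\<lambda>x. V1 x / (2 * V x)) x :> (V2 x * (2 * V x) - V1 x * (2 * V1 x)) / ((2 * V x) * (2 * V x))"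
   if "x \<in> {l..r}" for x using Vnz[OF that] sub that by (intro DERIV_divide V2 DERIV_cmult V1) auto
  show "continuous_on {l..r} (\<lambda>x. (V2 x * (2 * V x) - V1 x * (2 * V1 x)) / ((2 * V x) * (2 * V x)))"
   using Vnz cV by (intro continuous_intros) auto
 qed (use that in blast)
 have c1: "continuous_on {l..r} (\<lambda>x. 1 / V x)" using cV Vnz by (intro continuous_intros) auto
 obtain G1 where G1: "0 <= G1" "!!x. x \<in> {l..r} ==> \<bar>1 / V x\<bar> <= G1"
  by (rule continuous_Icc_bounded[OF c1]) (rule that)
 have c2: "continuous_on {l..r} (\<lambda>x. V1 x / (2 * V x))" using cV Vnz by (intro continuous_intros) auto
 obtain G where G: "0 <= G" "!!x. x \<in> {l..r} ==> \<bar>V1 x / (2 * V x)\<bar> <= G"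
  by (rule continuous_Icc_bounded[OF c2]) (rule that)
 note G10 = G1(1) G(1)
 show ?thesis
 proof (rule that[of "G1 + M * L1 + L2 + 1" G])
  show "G1 + M * L1 + L2 + 1 > 0" using G10 L1 L2 M by (simp add: add_nonneg_pos)
  show "\<bar>snd (field l r M z)\<bar> <= G" for z unfolding field_def using G(2)[OF cl] by simp
  fix z w :: "real \<times> real"
  define A where "A = clampI l r (fst z)"
  define B where "B = clampI l r (fst w)"
  define p where "p = clampI (-M) M (snd z)"
  define q where "q = clampI (-M) M (snd w)"
  define d where "d = norm (z - w)"
  have AB: "A \<in> {l..r}" "B \<in> {l..r}" unfolding A_def B_def by (rule cl)+
  have qM: "\<bar>q\<bar> <= M" unfolding q_def using M by linarith
  have d1: "\<bar>A - B\<bar> <= d" using clampI_lip[of l r "fst z" "fst w"] norm_fst_le[of "fst z - fst w" "snd z - snd w"]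
   unfolding A_def B_def d_def by (cases z; cases w) simp
  have d2: "\<bar>p - q\<bar> <= d" using clampI_lip[of "-M" M "snd z" "snd w"] norm_snd_le[of "snd z - snd w" "fst z - fst w"]
   unfolding p_def q_def d_def by (cases z; cases w) simp
  have "\<bar>p / V A - q / V B\<bar> = \<bar>(p - q) * (1 / V A) + q * (1 / V A - 1 / V B)\<bar>"
   by (simp add: algebra_simps diff_divide_distrib)
  also have "\<dots> <= \<bar>p - q\<bar> * \<bar>1 / V A\<bar> + \<bar>q\<bar> * \<bar>1 / V A - 1 / V B\<bar>"
   unfolding abs_mult[symmetric] by (rule abs_triangle_ineq)
  also have "\<dots> <= d * G1 + M * (L1 * d)"
  proof (intro add_mono mult_mono)
   show "\<bar>1 / V A - 1 / V B\<bar> <= L1 * d" using L1(2)[OF AB] mult_left_mono[OF d1 L1(1)] by linarith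
  qed (use d2 G1(2)[OF AB(1)] M qM in auto)
  finally have e1: "\<bar>p / V A - q / V B\<bar> <= d * G1 + M * (L1 * d)" .
  have e2: "\<bar>V1 A / (2 * V A) - V1 B / (2 * V B)\<bar> <= L2 * d" using L2(2)[OF AB] mult_left_mono[OF d1 L2(1)] by linarith
  have "norm (field l r M z - field l r M w) \<le>
    \<bar>p / V A - q / V B\<bar> + \<bar>V1 A / (2 * V A) - V1 B / (2 * V B)\<bar>"
   unfolding field_def A_def[symmetric] B_def[symmetric] p_def[symmetric] q_def[symmetric]
   using norm_Pair_le[of "p / V A - q / V B" "V1 A / (2 * V A) - V1 B / (2 * V B)"] by (simp only: diff_Pair real_norm_def)
  also have "\<dots> <= (G1 + M * L1 + L2) * d" using e1 e2 by (simp add: algebra_simps)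
  also have "\<dots> <= (G1 + M * L1 + L2 + 1) * d" unfolding d_def by (intro mult_right_mono) auto
  finally show "norm (field l r M z - field l r M w) <= (G1 + M * L1 + L2 + 1) * norm (z - w)" unfolding d_def .
 qed (use G10 in auto)
qed

text \<open>\<open>M\<close> bounds both momenta, so the clamp on the momentum is inactive along
  both curves and they solve one Lipschitz system.\<close>

lemma csol_unique:
 assumes lr: "l \<in> K" "r \<in> K" "l <= r" and s: "csol l r y p T" "csol l r z q T"
  and i: "y 0 = z 0" "p 0 = q 0" and x: "x \<in> {0..T}"
 shows "y x = z x \<and> p x = q x"
proof -
 obtain M1 where M1: "0 <= M1" "!!x. x \<in> {0..T} ==> \<bar>p x\<bar> <= M1"
  by (rule continuous_Icc_bounded[OF csol_cont(2)[OF s(1)]]) (rule that)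
 obtain M2 where M2: "0 <= M2" "!!x. x \<in> {0..T} ==> \<bar>q x\<bar> <= M2"
  by (rule continuous_Icc_bounded[OF csol_cont(2)[OF s(2)]]) (rule that)
 define M where "M = max M1 M2"
 obtain L where L: "!!z w. norm (field l r M z - field l r M w) <= L * norm (z - w)"
  using field_lipschitz[OF lr, of M] M1(1) unfolding M_def by (metis max.coboundedI1)
 have d: "((\<lambda>x. (y x, p x)) has_vector_derivative field l r M (y t, p t)) (at t within {0..T})"
  if "csol l r y p T" "t \<in> {0..T}" "\<bar>p t\<bar> <= M" for y p t
 proof -
  have "clampI (- M) M (p t) = p t" using that(3) by auto
  then show ?thesis unfolding field_def using that(1,2) unfolding csol_def
   by (intro has_vector_derivative_Pair) (auto simp: has_real_derivative_iff_has_vector_derivative[symmetric])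
 qed
 have "norm ((y x, p x) - (z x, q x)) <= exp (L * x) * norm ((y 0, p 0) - (z 0, q 0))"
  by (rule gronwall[OF d[OF s(1)] d[OF s(2)] L x]) (use M1(2) M2(2) in \<open>simp_all add: M_def le_max_iff_disj\<close>)
 then show ?thesis using i by (simp add: zero_prod_def)
qed

lemma sol_unique:
 assumes s: "sol y p T" "sol z q T" and i: "y 0 = z 0" "p 0 = q 0" and x: "x \<in> {0..T}"
 shows "y x = z x" "p x = q x"
proof -
 have T: "0 <= T" using x by auto
 obtain l1 r1 where 1: "l1 \<in> K" "r1 \<in> K" "!!x. x \<in> {0..T} ==> l1 <= y x \<and> y x <= r1"
  using sol_range[OF s(1) T] by metis
 obtain l2 r2 where 2: "l2 \<in> K" "r2 \<in> K" "!!x. x \<in> {0..T} ==> l2 <= z x \<and> z x <= r2"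
  using sol_range[OF s(2) T] by metis
 define l r where "l = min l1 l2" and "r = max r1 r2"
 have lr: "l \<in> K" "r \<in> K" unfolding l_def r_def using 1 2 by (auto simp: min_def max_def)
 have "l <= r" using 1(3)[OF x] unfolding l_def r_def by auto
 have c: "csol l r y p T" "csol l r z q T" by (rule sol_csol[OF s(1)], use 1 in \<open>force simp: l_def r_def\<close>)
    (rule sol_csol[OF s(2)], use 2 in \<open>force simp: l_def r_def\<close>)
 show "y x = z x" "p x = q x" using csol_unique[OF lr \<open>l <= r\<close> c i x] by auto
qed

text \<open>One constant \<open>C\<close> serves all initial momenta up to \<open>M0\<close>; this
  uniform Lipschitz dependence is the continuity that shooting needs. The two-sided time interval
  provides ordinary derivatives at time 0.\<close>

lemma flow_exists:
 assumes lr: "l \<in> K" "r \<in> K" "l <= r" and M0: "0 <= M0" and X: "0 < X"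
 obtains Y P :: "real => real => real" and C where
  "!!p. \<bar>p\<bar> <= M0 ==> Y p 0 = y0 \<and> P p 0 = p"
  "!!p x. \<bar>p\<bar> <= M0 ==> x \<in> {-X<..<X} ==>
    (DERIV (Y p) x :> P p x / V (clampI l r (Y p x)))
   \<and> (DERIV (P p) x :> V1 (clampI l r (Y p x)) / (2 * V (clampI l r (Y p x))))"
  "!!p T. \<bar>p\<bar> <= M0 ==> T < X ==> csol l r (Y p) (P p) T"
  "!!p q x. \<bar>p\<bar> <= M0 ==> \<bar>q\<bar> <= M0 ==> 0 <= x ==> x < X ==>
    \<bar>Y p x - Y q x\<bar> <= C * \<bar>p - q\<bar> \<and> \<bar>P p x - P q x\<bar> <= C * \<bar>p - q\<bar>"
proof -
 obtain L0 G where G: "G \<ge> 0" "!!M z. \<bar>snd (field l r M z)\<bar> <= G"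
  using field_lipschitz[OF lr, of 0] unfolding field_def by (metis order_refl snd_conv)
 \<comment> \<open>The derivative of the momentum is bounded by \<open>G\<close>, so a momentum that
   starts within \<open>M0\<close> stays within \<open>M\<close> for
   \<open>\<bar>x\<bar> < X\<close> and the clamp on it never acts.\<close>
 define M where "M = M0 + G * X"
 have M: "0 <= M" "M0 <= M" unfolding M_def using M0 G X by auto
 obtain L where L: "L > 0" "!!z w. norm (field l r M z - field l r M w) <= L * norm (z - w)"
  using field_lipschitz[OF lr M(1)] by metis
 have "\<exists>z. z 0 = (y0, p) \<and> (\<forall>t\<in>{-X<..<X}. (z has_vector_derivative field l r M (z t)) (at t))" for p
  using ode_two_sided[OF L X, of "(y0, p)"] by metis
 then obtain Z where Z: "!!p. Z p 0 = (y0, p)"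
  "!!p t. t \<in> {-X<..<X} ==> (Z p has_vector_derivative field l r M (Z p t)) (at t)" by metis
 define Y P where "Y p x = fst (Z p x)" and "P p x = snd (Z p x)" for p x
 have ZYP: "Z p x = (Y p x, P p x)" for p x unfolding Y_def P_def by simp
 have dY: "DERIV (Y p) x :> fst (field l r M (Z p x))" if "x \<in> {-X<..<X}" for p x
  unfolding Y_def has_real_derivative_iff_has_vector_derivative
  by (rule bounded_linear.has_vector_derivative[OF bounded_linear_fst Z(2)[OF that]])
 have dP: "DERIV (P p) x :> snd (field l r M (Z p x))" if "x \<in> {-X<..<X}" for p x
  unfolding P_def has_real_derivative_iff_has_vector_derivative
  by (rule bounded_linear.has_vector_derivative[OF bounded_linear_snd Z(2)[OF that]])
 have bP: "\<bar>P p x\<bar> <= M" if "x \<in> {-X<..<X}" "\<bar>p\<bar> <= M0" for p x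
 proof -
  have "norm (P p x - P p 0) <= G * norm (x - 0)"
   by (rule field_differentiable_bound[of "{-X<..<X}" "P p" "\<lambda>x. snd (field l r M (Z p x))"])
    (use dP G X that in \<open>auto intro: has_field_derivative_at_within\<close>)
  also have "\<dots> <= G * X" using that G by (intro mult_left_mono) auto
  finally show ?thesis using that Z(1)[of p] unfolding M_def P_def by auto
 qed
 have clP: "clampI (-M) M (P p x) = P p x" if "x \<in> {-X<..<X}" "\<bar>p\<bar> <= M0" for p x using bP[OF that] by auto
 have der: "(DERIV (Y p) x :> P p x / V (clampI l r (Y p x)))
   \<and> (DERIV (P p) x :> V1 (clampI l r (Y p x)) / (2 * V (clampI l r (Y p x))))"
  if "\<bar>p\<bar> <= M0" "x \<in> {-X<..<X}" for p x
  using dY[OF that(2), of p] dP[OF that(2), of p] clP[OF that(2,1)] unfolding ZYP field_def by simp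
 have cs: "csol l r (Y p) (P p) T" if "\<bar>p\<bar> <= M0" "T < X" for p T unfolding csol_def using der[OF that(1)] that(2) X
  by (auto intro: has_field_derivative_at_within)
 show ?thesis
 proof (rule that[of Y P "exp (L * X)"])
  show "Y p 0 = y0 \<and> P p 0 = p" for p using Z(1) unfolding Y_def P_def by simp
  fix p q x :: real assume h: "\<bar>p\<bar> <= M0" "\<bar>q\<bar> <= M0" "0 <= x" "x < X"
  have "norm (Z p x - Z q x) <= exp (L * x) * norm (Z p 0 - Z q 0)"
  proof (rule gronwall[where T = x and ?f1.0 = "\<lambda>t. field l r M (Z p t)" and ?f2.0 = "\<lambda>t. field l r M (Z q t)"])
   show "(Z p has_vector_derivative field l r M (Z p t)) (at t within {0..x})"
    "(Z q has_vector_derivative field l r M (Z q t)) (at t within {0..x})" if "t \<in> {0..x}" for t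
    by (rule has_vector_derivative_at_within, rule Z(2), use that h in simp)+
  qed (use L h in auto)
  also have "\<dots> <= exp (L * X) * \<bar>p - q\<bar>" using h L unfolding Z(1) by (intro mult_mono) (auto simp: norm_Pair)
  finally show "\<bar>Y p x - Y q x\<bar> <= exp (L * X) * \<bar>p - q\<bar> \<and> \<bar>P p x - P q x\<bar> <= exp (L * X) * \<bar>p - q\<bar>"
   using norm_fst_le[of "Y p x - Y q x" "P p x - P q x"] norm_snd_le[of "P p x - P q x" "Y p x - Y q x"] unfolding ZYP by simp
 qed (use der cs in auto)
qed

lemma sol_energy:
 assumes "sol y p T" "x \<in> {0..T}"
 shows "V (y x) - (p x)\<^sup>2 = V (y 0) - (p 0)\<^sup>2"
proof -
 have "\<exists>c. \<forall>x\<in>{0..T}. V (y x) - (p x)\<^sup>2 = c"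
 proof (rule has_field_derivative_zero_constant)
  fix x assume x: "x \<in> {0..T}"
  have yK: "y x \<in> K" by (rule sol_in[OF assms(1) x])
  have dy: "(y has_real_derivative p x / V (y x)) (at x within {0..T})"
   and dp: "(p has_real_derivative V1 (y x) / (2 * V (y x))) (at x within {0..T})" using assms(1) x unfolding sol_def by auto
  have "((\<lambda>x. V (y x)) has_real_derivative V1 (y x) * (p x / V (y x))) (at x within {0..T})"
   by (rule DERIV_chain2[OF V1[OF yK] dy])
  moreover have "((\<lambda>x. (p x)\<^sup>2) has_real_derivative 2 * p x * (V1 (y x) / (2 * V (y x)))) (at x within {0..T})"
   by (rule derivative_eq_intros dp refl | simp)+
  ultimately have "((\<lambda>x. V (y x) - (p x)\<^sup>2) has_real_derivative
    V1 (y x) * (p x / V (y x)) - 2 * p x * (V1 (y x) / (2 * V (y x)))) (at x within {0..T})" by (rule DERIV_diff)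
  then show "((\<lambda>x. V (y x) - (p x)\<^sup>2) has_real_derivative 0) (at x within {0..T})" by simp
 qed simp
 then show ?thesis using assms(2) by force
qed

text \<open>Where \<open>p = 0\<close> the time-reversed trajectory has the same initial data as the
  trajectory itself, so by uniqueness the motion after a turning point mirrors the motion before
  it.\<close>

lemma sol_bounce:
 assumes s: "sol y p T" and R: "0 <= R" "p R = 0" and r: "0 <= t" "t <= R" "R + t <= T"
 shows "y (R + t) = y (R - t)" "p (R + t) = - p (R - t)"
proof -
 have 1: "sol (\<lambda>x. y (R + x)) (\<lambda>x. p (R + x)) t" by (rule sol_restrict[OF sol_shift[OF s]]) (use R r in auto)
 have 2: "sol (\<lambda>x. y (R - x)) (\<lambda>x. - p (R - x)) t" by (rule sol_restrict[OF sol_reverse[OF s]]) (use R r in auto)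
 show "y (R + t) = y (R - t)" "p (R + t) = - p (R - t)" using sol_unique[OF 1 2, of t] R r by auto
qed

lemma sol_equilibrium:
 assumes s: "sol y p T" and x: "x \<in> {0..T}" "p x = 0" "V1 (y x) = 0" and x': "x' \<in> {0..T}"
 shows "y x' = y x" "p x' = 0"
proof -
 have K: "y x \<in> K" using sol_in[OF s x(1)] .
 have "y x' = y x \<and> p x' = 0"
 proof (cases "x <= x'")
  case True
  have "sol (\<lambda>t. y (x + t)) (\<lambda>t. p (x + t)) (T - x)" by (rule sol_shift[OF s]) (use x in auto)
  from sol_unique[OF this sol_constant[OF K x(3)], of "x' - x"] show ?thesis using x x' True by auto
 next
  case False
  have "sol (\<lambda>t. y (x - t)) (\<lambda>t. - p (x - t)) x" by (rule sol_reverse[OF s]) (use x in auto)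
  from sol_unique[OF this sol_constant[OF K x(3)], of "x - x'"] show ?thesis using x x' False by auto
 qed
 then show "y x' = y x" "p x' = 0" by auto
qed


section \<open>Travel times\<close>

text \<open>\<open>h\<close> is a primitive of \<open>helem f D'\<close>, and the factor
  \<open>V\<close> cancels against \<open>y' = p / V\<close>. Elapsed time is thus compared with the
  integral by comparing \<open>p\<close> with \<open>sqrt (V - D')\<close>: on the trajectory's own
  level they agree up to sign, on lower levels \<open>\<bar>p\<bar>\<close> is smaller.\<close>

lemma travel_prim:
 assumes s: "sol y p T" and x12: "0 <= x1" "x1 <= x2" "x2 <= T" and gt: "!!x. x \<in> {x1..x2} ==> D' < V (y x)"
 obtains h where
  "!!x. x \<in> {x1..x2} ==> ((\<lambda>x. h (y x)) has_real_derivative p x / sqrt (V (y x) - D')) (at x within {x1..x2})"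
  "!!x x'. x \<in> {x1..x2} ==> x' \<in> {x1..x2} ==> y x <= y x' ==>
    I D' (y x) (y x') = ereal (h (y x') - h (y x))"
proof -
 have sub: "{x1..x2} \<subseteq> {0..T}" using x12 by auto
 have c: "continuous_on {x1..x2} y" using sol_cont(1)[OF s] sub continuous_on_subset by blast
 obtain l r where lr: "y ` {x1..x2} = {l..r}" "l <= r" using continuous_image_closed_interval[OF x12(2) c] by metis
 have inK: "w \<in> K" "D' < V w" if "w \<in> {l..r}" for w
  using that lr(1) gt sol_in[OF s] sub by (metis (no_types, lifting) imageE subsetD)+
 have subK: "{l..r} \<subseteq> K" using inK by blast
 have ch: "continuous_on {l..r} (helem f D')" by (rule cont_helem[OF subK inK(2)])
 define h where "h w = integral {l..w} (helem f D')" for w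
 show ?thesis
 proof (rule that[of h])
  fix x assume x: "x \<in> {x1..x2}"
  then have yx: "y x \<in> {l..r}" using lr by blast
  have "(h has_real_derivative helem f D' (y x)) (at (y x) within y ` {x1..x2})"
   unfolding h_def lr(1) by (rule integral_has_real_derivative[OF ch yx])
  moreover have "(y has_real_derivative p x / V (y x)) (at x within {x1..x2})"
   using s x sub unfolding sol_def by (metis has_field_derivative_subset subsetD)
  ultimately have "(h \<circ> y has_real_derivative helem f D' (y x) * (p x / V (y x))) (at x within {x1..x2})"
   by (rule DERIV_image_chain)
  moreover have "helem f D' (y x) * (p x / V (y x)) = p x / sqrt (V (y x) - D')" using Vpos[OF inK(1)[OF yx]] unfolding helem_def by simp
  ultimately show "((\<lambda>x. h (y x)) has_real_derivative p x / sqrt (V (y x) - D')) (at x within {x1..x2})" by (simp add: o_def)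
 next
  fix x x' assume x: "x \<in> {x1..x2}" "x' \<in> {x1..x2}" and le: "y x <= y x'"
  have yx: "y x \<in> {l..r}" "y x' \<in> {l..r}" using x lr by blast+
  have "integral {l..y x} (helem f D') + integral {y x..y x'} (helem f D') = integral {l..y x'} (helem f D')"
  proof (rule Henstock_Kurzweil_Integration.integral_combine)
   show "helem f D' integrable_on {l..y x'}" by (rule integrable_continuous_real[OF continuous_on_subset[OF ch]]) (use yx in auto)
  qed (use yx le in auto)
  moreover have "I D' (y x) (y x') = ereal (integral {y x..y x'} (helem f D'))" by (rule hint_real(1)[OF le]) (use subK inK yx in auto)
  ultimately show "I D' (y x) (y x') = ereal (h (y x') - h (y x))" unfolding h_def by simp
 qed
qed

text \<open>On a lower level \<open>D'\<close> the primitive along the trajectory is 1-Lipschitz, so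
  no passage is faster than the integral, whatever detours it makes. The trajectory's own level is
  reached by approximation from below, because there \<open>V - D\<close> vanishes at turning
  points.\<close>

lemma travel_le:
 assumes s: "sol y p T" and x: "x1 \<in> {0..T}" "x2 \<in> {0..T}" and D: "D' <= V (y 0) - (p 0)\<^sup>2"
 shows "I D' (y x1) (y x2) <= ereal \<bar>x2 - x1\<bar>"
proof -
 define D where "D = V (y 0) - (p 0)\<^sup>2"
 have en: "V (y x) = D + (p x)\<^sup>2" if "x \<in> {0..T}" for x using sol_energy[OF s that] unfolding D_def by simp
 have less: "I D'' (y x1) (y x2) <= ereal \<bar>x2 - x1\<bar>" if D'': "D'' < D" for D''
 proof (cases "y x1 <= y x2")
  case True
  have gt: "D'' < V (y x)" if "x \<in> {0..T}" for x using en[OF that] D'' zero_le_power2[of "p x"] by linarith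
  obtain h where h: "!!x. x \<in> {0..T} ==> ((\<lambda>x. h (y x)) has_real_derivative p x / sqrt (V (y x) - D'')) (at x within {0..T})"
   "!!x x'. x \<in> {0..T} ==> x' \<in> {0..T} ==> y x <= y x' ==>
    I D'' (y x) (y x') = ereal (h (y x') - h (y x))" using travel_prim[OF s _ _ _ gt, of 0 T] x by auto
  have "norm (h (y x2) - h (y x1)) <= 1 * norm (x2 - x1)"
  proof (rule field_differentiable_bound[OF _ h(1)])
   fix z assume z: "z \<in> {0..T}"
   have "\<bar>p z\<bar> <= sqrt (V (y z) - D'')" by (rule real_le_rsqrt) (use en[OF z] D'' in simp)
   then show "norm (p z / sqrt (V (y z) - D'')) <= 1" using gt[OF z] by (simp add: divide_le_eq)
  qed (use x in auto)
  then show ?thesis using h(2)[OF x True] by simp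
 qed (simp add: hint_empty)
 show ?thesis
 proof (cases "D' = D")
  case False
  then show ?thesis using less D unfolding D_def by simp
 next
  case True
  show ?thesis
  proof (rule ccontr)
   assume "\<not> ?thesis"
   then have gt: "ereal \<bar>x2 - x1\<bar> < I D (y x1) (y x2)" using True by simp
   have yK: "y x1 \<in> K" "y x2 \<in> K" using sol_in[OF s] x by auto
   have ge: "D <= V w" if t: "ereal (y x1) < ereal w" "ereal w < ereal (y x2)" for w
   proof -
    have "\<exists>z\<in>{0..T}. y z = w"
    proof (cases "x1 <= x2")
     case True
     have "continuous_on {x1..x2} y" using sol_cont(1)[OF s] x by (auto intro: continuous_on_subset)
     then show ?thesis using IVT'[of y x1 w x2] t True x by force
    next
     case False
     have "continuous_on {x2..x1} y" using sol_cont(1)[OF s] x by (auto intro: continuous_on_subset)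
     then show ?thesis using IVT2'[of y x1 w x2] t False x by force
    qed
    then show ?thesis using en by force
   qed
   obtain D'' where "D'' < D" "ereal \<bar>x2 - x1\<bar> < I D'' (y x1) (y x2)"
    by (rule hint_approx_D[OF _ _ gt _ ge]) (use yK in \<open>auto simp: einterval_iff\<close>)
   then show False using less[of D''] by simp
  qed
 qed
qed

text \<open>While \<open>p > 0\<close> the primitive advances at rate exactly 1. Positivity is asked
  inside the time interval only, since a leg may begin or end at a turning point; hence the detour
  over shrunken intervals.\<close>

lemma travel_ge:
 assumes s: "sol y p T" and x: "0 <= x1" "x1 <= x2" "x2 <= T"
  and pos: "!!x. x1 < x ==> x < x2 ==> p x > 0" and D: "D = V (y 0) - (p 0)\<^sup>2"
 shows "ereal (x2 - x1) <= I D (y x1) (y x2)"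
proof -
 have en: "V (y x) = D + (p x)\<^sup>2" if "x \<in> {0..T}" for x using sol_energy[OF s that] unfolding D by simp
 have mono: "y s1 <= y s2" if "x1 <= s1" "s1 <= s2" "s2 <= x2" for s1 s2
 proof (rule DERIV_nonneg_imp_increasing_open[of s1 s2 y])
  show "continuous_on {s1..s2} y" using sol_cont(1)[OF s] x that by (auto intro: continuous_on_subset)
  fix z assume z: "s1 < z" "z < s2"
  then have zT: "z \<in> {0..T}" "z \<in> interior {0..T}" using x that by auto
  then have "DERIV y z :> p z / V (y z)" using s at_within_interior unfolding sol_def by metis
  moreover have "p z / V (y z) \<ge> 0" using pos[of z] z that Vpos[OF sol_in[OF s zT(1)]] by auto
  ultimately show "\<exists>d. DERIV y z :> d \<and> 0 <= d" by blast
 qed (use that in auto)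
 have inner: "ereal (s2 - s1) <= I D (y x1) (y x2)" if t: "x1 < s1" "s1 <= s2" "s2 < x2" for s1 s2
 proof -
  have gt: "D < V (y z)" if "z \<in> {s1..s2}" for z using en[of z] pos[of z] that t x by force
  obtain h where h: "!!x. x \<in> {s1..s2} ==> ((\<lambda>x. h (y x)) has_real_derivative p x / sqrt (V (y x) - D)) (at x within {s1..s2})"
   "!!x x'. x \<in> {s1..s2} ==> x' \<in> {s1..s2} ==> y x <= y x' ==>
    I D (y x) (y x') = ereal (h (y x') - h (y x))" by (rule travel_prim[OF s _ t(2) _ gt]) (use x t in auto)
  have "\<exists>c. \<forall>z\<in>{s1..s2}. h (y z) - z = c"
  proof (rule has_field_derivative_zero_constant)
   fix z assume z: "z \<in> {s1..s2}"
   have "sqrt (V (y z) - D) = p z" "p z > 0" using en[of z] pos[of z] z t x by (auto simp: real_sqrt_unique)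
   then have "((\<lambda>x. h (y x)) has_real_derivative 1) (at z within {s1..s2})" using h(1)[OF z] by simp
   from DERIV_diff[OF this DERIV_ident]
   show "((\<lambda>z. h (y z) - z) has_real_derivative 0) (at z within {s1..s2})" by simp
  qed simp
  then obtain c where "\<forall>z\<in>{s1..s2}. h (y z) - z = c" by blast
  then have "h (y s1) - s1 = c" "h (y s2) - s2 = c" using t by auto
  then have "h (y s2) - h (y s1) = s2 - s1" by simp
  then have "ereal (s2 - s1) = I D (y s1) (y s2)" using h(2)[of s1 s2] mono[of s1 s2] t by auto
  also have "\<dots> <= I D (y x1) (y x2)" using mono t by (intro hint_mono_set) auto
  finally show ?thesis .
 qed
 show ?thesis
 proof (rule ccontr)
  assume "\<not> ?thesis"
  then have lt: "I D (y x1) (y x2) < ereal (x2 - x1)" by simp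
  then obtain w where w: "I D (y x1) (y x2) = ereal w" "0 <= w" using hint_nonneg[of f D "ereal (y x1)" "ereal (y x2)"]
   by (cases "I D (y x1) (y x2)") auto
  \<comment> \<open>Cutting \<open>e\<close> off at both ends leaves a leg of duration
    \<open>w + e\<close>, which is longer than the integral \<open>w\<close> allows.\<close>
  define e where "e = (x2 - x1 - w) / 3"
  have e: "e > 0" unfolding e_def using lt w by simp
  have e3: "3 * e = x2 - x1 - w" unfolding e_def by simp
  have "ereal (x2 - e - (x1 + e)) <= ereal w" unfolding w(1)[symmetric] using e e3 w(2) by (intro inner) linarith+
  then show False using e e3 by simp
 qed
qed

subsection \<open>Monotone runs\<close>

text \<open>A trajectory that sets out to the right keeps \<open>p > 0\<close> until
  \<open>u\<close>: at a first zero of \<open>p\<close> the energy would give \<open>V = D\<close>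
  at a point where \<open>V > D\<close>. So the elapsed time is the integral up to the current
  height, until \<open>u\<close> is hit or time is over.\<close>

lemma run_right:
 assumes lr: "l \<in> K" "r \<in> K" and s: "csol l r y p X" and y0: "l <= y 0" "y 0 < u" "u <= r"
  and V: "!!w. y 0 < w ==> w < u ==> D < V w" and D: "D = V (y 0) - (p 0)\<^sup>2"
  and start: "p 0 > 0 \<or> (p 0 = 0 \<and> V1 (y 0) > 0)"
 obtains (hits) x where "x \<in> {0<..X}" "y x = u" "\<forall>x'\<in>{0..x}. y 0 <= y x' \<and> y x' <= u" "\<forall>x'\<in>{0<..<x}. p x' > 0"
   "ereal x = I D (y 0) u"
 | (stays) "\<forall>x\<in>{0..X}. y 0 <= y x \<and> y x < u \<and> (x \<noteq> 0 --> y 0 < y x \<and> p x > 0) \<and> ereal x = I D (y 0) (y x)"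
proof (cases "0 <= X")
 case False
 then show ?thesis using stays by auto
next
 case X0: True
 note cont = csol_cont[OF s]
 have uK: "y 0 \<in> K" "u \<in> K" using in_K[OF lr] y0 by auto
 \<comment> \<open>If the start is a turning point, the initial push comes from
   \<open>p' = V1 / (2 * V) > 0\<close>.\<close>
 obtain e where e: "e > 0" "!!x. 0 < x ==> x < e ==> x <= X ==> p x > 0"
 proof (cases "p 0 > 0")
  case True
  have "continuous (at 0 within {0..X}) p" using cont(2) X0 by (simp add: continuous_on_eq_continuous_within)
  then obtain d where "d > 0" and d: "!!x. x \<in> {0..X} ==> dist x 0 < d ==> dist (p x) (p 0) < p 0"
   using True unfolding continuous_within_eps_delta by metis
  then have "p x > 0" if "0 < x" "x < d" "x <= X" for x
  proof -
   have "dist (p x) (p 0) < p 0" using d[of x] that by simp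
   then show ?thesis by (simp add: dist_real_def abs_if split: if_splits)
  qed
  then show ?thesis using that[of d] \<open>d > 0\<close> by blast
 next
  case False
  then have p0: "p 0 = 0" "V1 (y 0) > 0" using start by auto
  have c: "clampI l r (y 0) = y 0" using y0 by simp
  have "(p has_real_derivative V1 (y 0) / (2 * V (y 0))) (at 0 within {0..X})"
   using s X0 c unfolding csol_def by (metis atLeastAtMost_iff order_refl)
  moreover have "V1 (y 0) / (2 * V (y 0)) > 0" using p0 Vpos[OF uK(1)] by simp
  ultimately obtain d where "d > 0" "!!h. h > 0 ==> 0 + h \<in> {0..X} ==> h < d ==> p 0 < p (0 + h)"
   using has_real_derivative_pos_inc_right by metis
  then show ?thesis using p0 by (intro that[of d]) auto
 qed
 have solW: "sol y p x" if "x \<in> {0..X}" "\<forall>x'\<in>{0..x}. y 0 <= y x' \<and> y x' <= u" for x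
  by (rule csol_sol[OF s lr]) (use that y0 in force)+
 have incr: "y 0 < y x" "\<forall>x'\<in>{0..x}. y 0 <= y x'"
  if x: "0 < x" "x <= X" and pp: "!!x'. 0 < x' ==> x' < x ==> p x' > 0" for x
 proof -
  have lt: "y s1 < y s2" if "0 <= s1" "s1 < s2" "s2 <= x" for s1 s2
  proof (rule DERIV_pos_imp_increasing_open[of s1 s2 y])
   show "continuous_on {s1..s2} y" using cont(1) x that by (auto intro: continuous_on_subset)
   fix z assume z: "s1 < z" "z < s2"
   then have zT: "z \<in> {0..X}" "z \<in> interior {0..X}" using x that by auto
   then have "DERIV y z :> p z / V (clampI l r (y z))" using s at_within_interior unfolding csol_def by metis
   moreover have "V (clampI l r (y z)) > 0" by (rule Vpos, rule in_K[OF lr]) (use y0 in auto)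
   moreover have "p z > 0" using pp z that by auto
   ultimately show "\<exists>d. DERIV y z :> d \<and> 0 < d" by (metis divide_pos_pos)
  qed fact
  show "y 0 < y x" using lt[of 0 x] x by simp
  show "\<forall>x'\<in>{0..x}. y 0 <= y x'" using lt[of 0] by (force simp: less_eq_real_def)
 qed
 have claim: "p x > 0" if x: "0 < x" "x <= X" and below: "\<forall>x'\<in>{0..x}. y x' < u" for x
 proof (rule ccontr)
  assume np: "\<not> p x > 0"
  define e' where "e' = min e x / 2"
  have e': "0 < e'" "e' < e" "e' < x" unfolding e'_def using e x by auto
  have c: "continuous_on {e'..X} p" using cont(2) e' by (auto intro: continuous_on_subset)
  obtain t where t: "e' <= t" "t <= x" "p t \<in> {..0}" "!!x'. e' <= x' ==> x' < t ==> p x' \<notin> {..0}"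
   by (rule first_time[OF c, of "{..0}" x]) (use np x e' in auto)
  have pe: "p e' > 0" using e(2)[of e'] e' x by simp
  have te: "e' < t" using t(1,3) pe by (cases "t = e'") auto
  have before: "p x' > 0" if "0 < x'" "x' < t" for x'
  proof (cases "x' < e")
   case True
   then show ?thesis using e(2)[of x'] that t x by simp
  next
   case False
   then show ?thesis using t(4)[of x'] that e' by auto
  qed
  have "p t = 0"
  proof (rule ccontr)
   assume "p t \<noteq> 0"
   then have neg: "p t < 0" using t(3) by auto
   have "continuous_on {e'..t} p" using c t x by (auto intro: continuous_on_subset)
   then obtain z where "e' <= z" "z <= t" "p z = 0" using IVT2'[of p t 0 e'] neg pe te by auto
   then show False using before[of z] e' neg by (cases "z = t") auto
  qed
  moreover have i: "y 0 < y t" "\<forall>x'\<in>{0..t}. y 0 <= y x'" using incr[of t] before te e' t x by auto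
  have "sol y p t" using solW[of t] i(2) below t x te e' by (force intro: less_imp_le)
  ultimately have "V (y t) = D" using sol_energy[of y p t t] D te e' by simp
  moreover have "D < V (y t)" using V[of "y t"] i(1) below t x te e' by auto
  ultimately show False by simp
 qed
 show ?thesis
 proof (cases "\<exists>x\<in>{0..X}. y x \<in> {u..}")
  case True
  then obtain x0 where x0: "x0 \<in> {0..X}" "y x0 \<in> {u..}" by auto
  obtain x where x: "0 <= x" "x <= x0" "y x \<in> {u..}" "!!x'. 0 <= x' ==> x' < x ==> y x' \<notin> {u..}"
   using first_time[OF cont(1) _ x0] by (metis closed_atLeast)
  have xX: "0 < x" "x <= X" using x x0 y0 by (cases "x = 0"; auto)+
  have "y x = u"
  proof (rule ccontr)
   assume "y x \<noteq> u"
   then have "u < y x" using x(3) by auto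
   moreover have "continuous_on {0..x} y" using cont(1) xX by (auto intro: continuous_on_subset)
   ultimately obtain z where "0 <= z" "z <= x" "y z = u" using IVT'[of y 0 u x] y0 xX by auto
   then show False using x(4)[of z] \<open>y x \<noteq> u\<close> by (cases "z = x") auto
  qed
  have pp: "p x' > 0" if "0 < x'" "x' < x" for x' by (rule claim) (use that x(4) xX in force)+
  have rng: "\<forall>x'\<in>{0..x}. y 0 <= y x' \<and> y x' <= u"
   using incr(2)[OF xX pp] x(4) \<open>y x = u\<close> by (force simp: le_less)
  then have sx: "sol y p x" using solW[of x] xX by auto
  have "ereal x = I D (y 0) u"
  proof (rule antisym)
   show "ereal x <= I D (y 0) u" using travel_ge[OF sx, of 0 x D] D pp xX \<open>y x = u\<close> by simp
   show "I D (y 0) u <= ereal x" using travel_le[OF sx, of 0 x D] D xX \<open>y x = u\<close> by simp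
  qed
  then show ?thesis by (intro hits[of x]) (use xX \<open>y x = u\<close> rng pp in auto)
 next
  case False
  then have below: "y x < u" if "x \<in> {0..X}" for x using that by force
  have "y 0 <= y x \<and> y x < u \<and> (x \<noteq> 0 --> y 0 < y x \<and> p x > 0) \<and> ereal x = I D (y 0) (y x)"
   if x: "x \<in> {0..X}" for x
  proof (cases "x = 0")
   case True
   then show ?thesis using y0 by (simp add: hint_empty zero_ereal_def)
  next
   case False
   then have x': "0 < x" "x <= X" using x by auto
   have pp: "p x' > 0" if "0 < x'" "x' <= x" for x' by (rule claim) (use that below x' in auto)
   have i: "y 0 < y x" "\<forall>x'\<in>{0..x}. y 0 <= y x'" using incr[OF x'] pp by auto
   have sx: "sol y p x" by (rule solW) (use x i below in force)+
   have "ereal x = I D (y 0) (y x)"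
   proof (rule antisym)
    show "ereal x <= I D (y 0) (y x)" using travel_ge[OF sx, of 0 x D] D pp x' by simp
    show "I D (y 0) (y x) <= ereal x" using travel_le[OF sx, of 0 x D] D x' by simp
   qed
   then show ?thesis using i below[OF x] pp[of x] x' by simp
  qed
  then show ?thesis using stays by blast
 qed
qed

subsection \<open>Reflection\<close>

lemma csol_reflect:
 assumes "csol l r y p X" "l <= r"
 shows "warped.csol rf rV1 (- r) (- l) (\<lambda>x. - y x) (\<lambda>x. - p x) X"
proof -
 interpret R: warped "- b" "- a" rf rV1 rV2 by (rule warped_reflect)
 show ?thesis unfolding R.csol_def
 proof
  fix x assume x: "x \<in> {0..X}"
  have c: "clampI (- r) (- l) (- y x) = - clampI l r (y x)" using assms(2) by (auto simp: max_def min_def)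
  have dy: "(y has_real_derivative p x / V (clampI l r (y x))) (at x within {0..X})"
   and dp: "(p has_real_derivative V1 (clampI l r (y x)) / (2 * V (clampI l r (y x)))) (at x within {0..X})"
   using assms(1) x unfolding csol_def by auto
  show "((\<lambda>x. - y x) has_real_derivative - p x / inv_sq rf (clampI (- r) (- l) (- y x))) (at x within {0..X}) \<and>
     ((\<lambda>x. - p x) has_real_derivative
      - V1 (- clampI (- r) (- l) (- y x)) / (2 * inv_sq rf (clampI (- r) (- l) (- y x)))) (at x within {0..X})"
   unfolding c inv_sq_reflect using DERIV_minus[OF dy] DERIV_minus[OF dp] by simp
 qed
qed

lemma sol_reflect1:
 assumes "sol y p X"
 shows "warped.sol (- b) (- a) rf rV1 (\<lambda>x. - y x) (\<lambda>x. - p x) X"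
proof -
 interpret R: warped "- b" "- a" rf rV1 rV2 by (rule warped_reflect)
 show ?thesis unfolding R.sol_def
 proof
  fix x assume x: "x \<in> {0..X}"
  have yK: "y x \<in> K" and dy: "(y has_real_derivative p x / V (y x)) (at x within {0..X})"
   and dp: "(p has_real_derivative V1 (y x) / (2 * V (y x))) (at x within {0..X})" using assms(1) x unfolding sol_def by auto
  show "- y x \<in> R.K \<and> ((\<lambda>x. - y x) has_real_derivative - p x / inv_sq rf (- y x)) (at x within {0..X}) \<and>
     ((\<lambda>x. - p x) has_real_derivative
      - V1 (- (- y x)) / (2 * inv_sq rf (- y x))) (at x within {0..X})"
   unfolding inv_sq_reflect einterval_reflect using DERIV_minus[OF dy] DERIV_minus[OF dp] yK by simp
 qed
qed

lemma sol_reflect: "warped.sol (- b) (- a) rf rV1 (\<lambda>x. - y x) (\<lambda>x. - p x) X \<longleftrightarrow> sol y p X"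
proof
 assume *: "warped.sol (- b) (- a) rf rV1 (\<lambda>x. - y x) (\<lambda>x. - p x) X"
 interpret R: warped "- b" "- a" rf rV1 rV2 by (rule warped_reflect)
 show "sol y p X" using R.sol_reflect1[OF *] by simp
qed (rule sol_reflect1)

lemma run_left:
 assumes lr: "l \<in> K" "r \<in> K" and s: "csol l r y p X" and y0: "y 0 <= r" "u < y 0" "l <= u"
  and V: "!!t. u < t ==> t < y 0 ==> D < V t" and D: "D = V (y 0) - (p 0)\<^sup>2"
  and start: "p 0 < 0 \<or> (p 0 = 0 \<and> V1 (y 0) < 0)"
 obtains (hits) x where "x \<in> {0<..X}" "y x = u" "\<forall>x'\<in>{0..x}. u <= y x' \<and> y x' <= y 0" "\<forall>x'\<in>{0<..<x}. p x' < 0"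
   "ereal x = I D u (y 0)"
 | (stays) "\<forall>x\<in>{0..X}. u < y x \<and> y x <= y 0 \<and> (x \<noteq> 0 --> y x < y 0 \<and> p x < 0) \<and> ereal x = I D (y x) (y 0)"
proof -
 interpret R: warped "- b" "- a" rf rV1 rV2 by (rule warped_reflect)
 have lr': "- r \<in> R.K" "- l \<in> R.K" using lr by (simp_all add: einterval_reflect)
 have "u \<in> K" "y 0 \<in> K" using in_K[OF lr] y0 by auto
 then have inb: "a <= ereal u" "ereal (y 0) <= b" by (auto simp: einterval_iff)
 have h: "hint rf D (ereal (- y 0)) (ereal (- v)) = I D v (y 0)" if "u <= v" for v
  using hint_reflect[of "ereal v" "ereal (y 0)" D] inb that by (metis ereal_less_eq(3) order_trans uminus_ereal.simps(1))
 have cs: "R.csol (- r) (- l) (\<lambda>x. - y x) (\<lambda>x. - p x) X" by (rule csol_reflect[OF s]) (use y0 in simp)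
 show ?thesis
 proof (rule R.run_right[OF lr' cs])
  fix x assume x: "x \<in> {0<..X}" "- y x = - u" "\<forall>x'\<in>{0..x}. - y 0 <= - y x' \<and> - y x' <= - u"
   "\<forall>x'\<in>{0<..<x}. - p x' > 0" "ereal x = R.I D (- y 0) (- u)"
  have "ereal x = I D u (y 0)" using x(5) h[of u] by simp
  then show ?thesis by (intro hits[of x]) (use x in auto)
 next
  assume *: "\<forall>x\<in>{0..X}. - y 0 <= - y x \<and> - y x < - u \<and> (x \<noteq> 0 --> - y 0 < - y x \<and> - p x > 0)
      \<and> ereal x = R.I D (- y 0) (- y x)"
  have "u < y x \<and> y x <= y 0 \<and> (x \<noteq> 0 --> y x < y 0 \<and> p x < 0) \<and> ereal x = I D (y x) (y 0)"
   if "x \<in> {0..X}" for x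
  proof -
   from *[rule_format, OF that] have r: "- y 0 <= - y x" "- y x < - u" "x \<noteq> 0 --> - y 0 < - y x \<and> - p x > 0"
    "ereal x = R.I D (- y 0) (- y x)" by auto
   then show ?thesis using h[of "y x"] by auto
  qed
  then show ?thesis using stays by blast
 qed (use y0 V start D in \<open>auto simp: inv_sq_reflect\<close>)
qed


section \<open>Connecting trajectories\<close>

lemma csol_exists:
 assumes "l \<in> K" "r \<in> K" "l <= r"
 obtains y p where "csol l r y p T" "y 0 = y0" "p 0 = p0"
proof -
 obtain Y P C where "!!p. \<bar>p\<bar> <= \<bar>p0\<bar> ==> Y p 0 = y0 \<and> P p 0 = p"
  "!!p T'. \<bar>p\<bar> <= \<bar>p0\<bar> ==> T' < \<bar>T\<bar> + 1 ==> csol l r (Y p) (P p) T'"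
  by (rule flow_exists[OF assms, of "\<bar>p0\<bar>" "\<bar>T\<bar> + 1" y0]) (auto intro: that)
 then show ?thesis using that[of "Y p0" "P p0"] by auto
qed

lemma sol_interior_max:
 assumes s: "sol y p X" and T: "0 < T" "T < X" and m: "!!x. x \<in> {0..X} ==> y x <= y T"
 shows "p T = 0"
proof -
 have TX: "T \<in> {0..X}" "T \<in> interior {0..X}" using T by auto
 then have "DERIV y T :> p T / V (y T)" using s at_within_interior unfolding sol_def by metis
 then have "p T / V (y T) = 0"
  by (rule DERIV_local_max[where d = "min T (X - T)"]) (use T m in \<open>auto simp: abs_if split: if_splits\<close>)
 then show ?thesis using Vpos[OF sol_in[OF s TX(1)]] by simp
qed

lemma sol_interior_min:
 assumes s: "sol y p X" and T: "0 < T" "T < X" and m: "!!x. x \<in> {0..X} ==> y T <= y x"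
 shows "p T = 0"
proof -
 have TX: "T \<in> {0..X}" "T \<in> interior {0..X}" using T by auto
 then have "DERIV y T :> p T / V (y T)" using s at_within_interior unfolding sol_def by metis
 then have "p T / V (y T) = 0"
  by (rule DERIV_local_min[where d = "min T (X - T)"]) (use T m in \<open>auto simp: abs_if split: if_splits\<close>)
 then show ?thesis using Vpos[OF sol_in[OF s TX(1)]] by simp
qed

lemma sol_leaves_right:
 assumes s: "sol y p X" and T: "0 <= T" "T < X" "p T = 0" "V1 (y T) > 0"
 shows "\<exists>x\<in>{T<..X}. y T < y x"
proof -
 have TX: "T \<in> {0..X}" using T by auto
 have "V1 (y T) / (2 * V (y T)) > 0" using T Vpos[OF sol_in[OF s TX]] by simp
 moreover have "(p has_real_derivative V1 (y T) / (2 * V (y T))) (at T within {0..X})" using s TX unfolding sol_def by blast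
 ultimately obtain d where d: "d > 0" "!!h. h > 0 ==> T + h \<in> {0..X} ==> h < d ==> p T < p (T + h)"
  using has_real_derivative_pos_inc_right by metis
 define e where "e = min d (X - T) / 2"
 have e: "0 < e" "e < d" "T + e <= X" unfolding e_def using d T by (auto simp: min_def field_simps)
 have "y T < y (T + e)"
 proof (rule DERIV_pos_imp_increasing_open[of T "T + e" y])
  show "continuous_on {T..T + e} y" using sol_cont(1)[OF s] T e by (auto intro: continuous_on_subset)
  fix z assume z: "T < z" "z < T + e"
  then have zX: "z \<in> {0..X}" "z \<in> interior {0..X}" using T e by auto
  then have "DERIV y z :> p z / V (y z)" using s at_within_interior unfolding sol_def by metis
  moreover have "p z > 0" using d(2)[of "z - T"] z e zX T by auto
  ultimately show "\<exists>d. DERIV y z :> d \<and> 0 < d" using Vpos[OF sol_in[OF s zX(1)]] by (metis divide_pos_pos)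
 qed (use e in simp)
 then show ?thesis using e by (intro bexI[of _ "T + e"]) auto
qed

lemma sol_leaves_left:
 assumes s: "sol y p X" and T: "0 <= T" "T < X" "p T = 0" "V1 (y T) < 0"
 shows "\<exists>x\<in>{T<..X}. y x < y T"
proof -
 interpret R: warped "- b" "- a" rf rV1 rV2 by (rule warped_reflect)
 show ?thesis using R.sol_leaves_right[OF sol_reflect1[OF s] T(1,2)] T by auto
qed

text \<open>At a barrier the energy would give \<open>V >= D\<close>, but \<open>V\<close> is below
  \<open>D\<close> at both \<open>l\<close> and \<open>r\<close>. Such a pair is a trap, in which
  the clamped solution is a genuine trajectory for all of \<open>[0, X]\<close>.\<close>

lemma csol_confined:
 assumes lr: "l \<in> K" "r \<in> K" and s: "csol l r y p X" and y0: "l < y 0" "y 0 < r"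
  and D: "V l < V (y 0) - (p 0)\<^sup>2" "V r < V (y 0) - (p 0)\<^sup>2"
 shows "\<forall>x\<in>{0..X}. l < y x \<and> y x < r" "sol y p X"
proof -
 show *: "\<forall>x\<in>{0..X}. l < y x \<and> y x < r"
 proof (rule ccontr)
  assume "\<not> ?thesis"
  then obtain x0 where x0: "x0 \<in> {0..X}" "y x0 \<in> {..l} \<union> {r..}" by force
  obtain x where x: "0 <= x" "x <= x0" "y x \<in> {..l} \<union> {r..}" "!!x'. 0 <= x' ==> x' < x ==> y x' \<notin> {..l} \<union> {r..}"
   using first_time[OF csol_cont(1)[OF s] _ x0] by (metis closed_Un closed_atLeast closed_atMost)
  have xp: "0 < x" using x y0 by (cases "x = 0") auto
  have c: "continuous_on {0..x} y" using csol_cont(1)[OF s] x x0 by (auto intro: continuous_on_subset)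
  have "l <= y x \<and> y x <= r"
  proof (rule ccontr)
   assume "\<not> ?thesis"
   then consider "y x < l" | "r < y x" by linarith
   then show False
   proof cases
    case 1
    then obtain z where "0 <= z" "z <= x" "y z = l" using IVT2'[OF _ _ _ c, of l] y0 xp by auto
    then show False using x(4)[of z] 1 by (cases "z = x") auto
   next
    case 2
    then obtain z where "0 <= z" "z <= x" "y z = r" using IVT'[OF _ _ _ c, of r] y0 xp by auto
    then show False using x(4)[of z] 2 by (cases "z = x") auto
   qed
  qed
  then have "\<forall>x'\<in>{0..x}. l <= y x' \<and> y x' <= r" and e: "y x = l \<or> y x = r"
   using x(3,4) by (force simp: le_less)+
  then have "sol y p x" using csol_sol[OF s lr] x x0 by auto
  then have "V (y x) - (p x)\<^sup>2 = V (y 0) - (p 0)\<^sup>2" by (rule sol_energy) (use x in simp)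
  then have "V (y 0) - (p 0)\<^sup>2 <= V (y x)" using zero_le_power2[of "p x"] by linarith
  then show False using e D by auto
 qed
 show "sol y p X" by (rule csol_sol[OF s lr]) (use * in \<open>auto intro: less_imp_le\<close>)
qed

text \<open>At a critical point of \<open>V\<close> the travel time is infinite: otherwise a trajectory would reach
 an equilibrium in finite time.\<close>

lemma hint_critical_left:
 assumes c: "c \<in> K" "V1 c = 0" and e: "e \<in> K" "c < e" and gt: "!!t. c < t ==> t <= e ==> V c < V t"
 shows "I (V c) c e = \<infinity>"
proof (rule ccontr)
 assume "\<not> ?thesis"
 then obtain w where w: "I (V c) c e = ereal w" using hint_nonneg[of f "V c" "ereal c" "ereal e"] by (cases "I (V c) c e") auto
 define p0 where "p0 = - sqrt (V e - V c)"
 have p0: "p0 < 0" "p0\<^sup>2 = V e - V c" unfolding p0_def using gt[of e] e by auto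
 have ce: "c <= e" using e by simp
 define X where "X = \<bar>w\<bar> + 1"
 obtain y p where s: "csol c e y p X" "y 0 = e" "p 0 = p0" by (rule csol_exists[OF c(1) e(1) ce])
 show False
 proof (rule run_left[OF c(1) e(1) s(1)])
  fix x assume x: "x \<in> {0<..X}" "y x = c" "\<forall>x'\<in>{0..x}. c <= y x' \<and> y x' <= y 0"
  have "sol y p x" by (rule csol_sol[OF s(1) c(1) e(1)]) (use x s in auto)
  moreover from sol_energy[OF this, of x] have "p x = 0" using x s p0 by simp
  ultimately have "y 0 = y x" using sol_equilibrium(1)[of y p x x 0] x c by simp
  then show False using x s e by simp
 next
  assume "\<forall>x\<in>{0..X}. c < y x \<and> y x <= y 0 \<and> (x \<noteq> 0 --> y x < y 0 \<and> p x < 0) \<and> ereal x = I (V c) (y x) (y 0)"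
  then have "c < y X" "ereal X = I (V c) (y X) e" using s unfolding X_def by auto
  then have "ereal X <= ereal w" unfolding w[symmetric] by (metis ereal_less_eq(3) hint_mono_set less_imp_le order_refl)
  then show False unfolding X_def by simp
 qed (use s e gt p0 in auto)
qed

lemma hint_critical_right:
 assumes c: "c \<in> K" "V1 c = 0" and e: "e \<in> K" "e < c" and gt: "!!t. e <= t ==> t < c ==> V c < V t"
 shows "I (V c) e c = \<infinity>"
proof -
 interpret R: warped "- b" "- a" rf rV1 rV2 by (rule warped_reflect)
 have "R.I (inv_sq rf (- c)) (- c) (- e) = \<infinity>"
  by (rule R.hint_critical_left) (use c e gt in \<open>auto simp: einterval_reflect inv_sq_reflect\<close>)
 moreover have "a <= ereal e" "ereal c <= b" using c e by (auto simp: einterval_iff)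
 ultimately show ?thesis using hint_reflect[of "ereal e" "ereal c" "V c"] by (simp add: inv_sq_reflect)
qed

text \<open>By translation and reflection in \<open>x\<close>, a timelike geodesic between two
  points amounts to a trajectory between their heights whose time is their distance in
  \<open>x\<close>.\<close>

definition connects :: "real => real => real => bool" where
 "connects y0 y1 X \<longleftrightarrow> (\<exists>y p. sol y p X \<and> y 0 = y0 \<and> y X = y1)"

text \<open>\<open>shooting\<close> with the parameter \<open>p 0\<close>. The hypotheses on
  touching a barrier concern genuine trajectories, since a clamped solution inside
  \<open>[l, r]\<close> is one; the two extreme starts may leave \<open>[l, r]\<close> and are
  therefore described by clamped solutions.\<close>

lemma connects_shoot:
 assumes lr: "l \<in> K" "r \<in> K" and y0: "l < y0" "y0 < r" and y1: "l < y1" "y1 < r" and X: "0 < X"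
  and pmp: "pm \<in> {i..j}" "pp \<in> {i..j}"
  and nor: "!!y p T x1. sol y p x1 ==> y 0 = y0 ==> i <= p 0 ==> p 0 <= j ==> 0 <= T ==> T <= x1 ==> x1 <= X ==>
    (\<forall>x\<in>{0..x1}. l <= y x \<and> y x <= r) ==> y T = r ==> y x1 = y1 ==> False"
  and nol: "!!y p T x1. sol y p x1 ==> y 0 = y0 ==> i <= p 0 ==> p 0 <= j ==> 0 <= T ==> T <= x1 ==> x1 <= X ==>
    (\<forall>x\<in>{0..x1}. l <= y x \<and> y x <= r) ==> y T = l ==> y x1 = y1 ==> False"
  and ah: "!!y p. csol l r y p X ==> y 0 = y0 ==> p 0 = pp ==> ahead l r y1 X y"
  and bh: "!!y p. csol l r y p X ==> y 0 = y0 ==> p 0 = pm ==> ahead (- r) (- l) (- y1) X (\<lambda>x. - y x)"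
 shows "connects y0 y1 X"
proof -
 have lr': "l <= r" using y0 by simp
 define M0 where "M0 = max \<bar>i\<bar> \<bar>j\<bar>"
 have M: "\<bar>p\<bar> <= M0" if "p \<in> {i..j}" for p using that unfolding M0_def by auto
 have M0: "0 <= M0" unfolding M0_def by simp
 have D1: "0 < X + 1" using X by simp
 obtain Y P C where ini: "!!p. \<bar>p\<bar> <= M0 ==> Y p 0 = y0 \<and> P p 0 = p"
  and s: "!!p T. \<bar>p\<bar> <= M0 ==> T < X + 1 ==> csol l r (Y p) (P p) T"
  and dep: "!!p q x. \<bar>p\<bar> <= M0 ==> \<bar>q\<bar> <= M0 ==> 0 <= x ==> x < X + 1 ==>
    \<bar>Y p x - Y q x\<bar> <= C * \<bar>p - q\<bar> \<and> \<bar>P p x - P q x\<bar> <= C * \<bar>p - q\<bar>"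
  by (rule flow_exists[OF lr lr' M0 D1, of y0]) (rule that)
 have s': "csol l r (Y p) (P p) X" if "p \<in> {i..j}" for p using s[OF M[OF that]] by simp
 have so: "sol (Y p) (P p) x1" if "p \<in> {i..j}" "x1 <= X" "\<forall>x\<in>{0..x1}. l <= Y p x \<and> Y p x <= r" for p x1
  using csol_sol[OF s'[OF that(1)] lr that(2)] that(3) by auto
 have "\<exists>p\<in>{i..j}. Y p X = y1 \<and> (\<forall>x\<in>{0..X}. l < Y p x \<and> Y p x < r)"
 proof (rule shooting[where C = C and pp = pp and pm = pm])
  show "continuous_on {0..X} (Y p)" if "p \<in> {i..j}" for p by (rule csol_cont(1)[OF s'[OF that]])
  show "\<bar>Y p x - Y q x\<bar> <= C * \<bar>p - q\<bar>" if "p \<in> {i..j}" "q \<in> {i..j}" "x \<in> {0..X}" for p q x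
   using dep[OF M[OF that(1)] M[OF that(2)], of x] that by simp
  show "l < Y p 0 \<and> Y p 0 < r" if "p \<in> {i..j}" for p using ini[OF M[OF that]] y0 by simp
  show "ahead l r y1 X (Y pp)" using ah[OF s'[of pp]] ini[OF M[of pp]] pmp by simp
  show "ahead (- r) (- l) (- y1) X (\<lambda>x. - Y pm x)" using bh[OF s'[of pm]] ini[OF M[of pm]] pmp by simp
 next
  fix p T x1 assume h: "p \<in> {i..j}" "0 <= T" "T <= x1" "x1 <= X" "\<forall>x\<in>{0..x1}. l <= Y p x \<and> Y p x <= r" "Y p x1 = y1"
  show False if "Y p T = r" by (rule nor[OF so[OF h(1,4,5)], of T]) (use h that ini[OF M[OF h(1)]] in auto)
  show False if "Y p T = l" by (rule nol[OF so[OF h(1,4,5)], of T]) (use h that ini[OF M[OF h(1)]] in auto)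
 qed (use X y1 pmp in auto)
 then obtain p where p: "p \<in> {i..j}" "Y p X = y1" "\<forall>x\<in>{0..X}. l < Y p x \<and> Y p x < r" by blast
 then have "sol (Y p) (P p) X" using so[OF p(1)] by (auto intro: less_imp_le)
 then show ?thesis unfolding connects_def using p ini[OF M[OF p(1)]] by blast
qed

lemma connects_reflect: "warped.connects (- b) (- a) rf rV1 (- y0) (- y1) X \<longleftrightarrow> connects y0 y1 X"
proof -
 interpret R: warped "- b" "- a" rf rV1 rV2 by (rule warped_reflect)
 show ?thesis
 proof
  assume "R.connects (- y0) (- y1) X"
  then obtain y p where "R.sol y p X" "y 0 = - y0" "y X = - y1" unfolding R.connects_def by blast
  then show "connects y0 y1 X" unfolding connects_def using sol_reflect[of "\<lambda>x. - y x" "\<lambda>x. - p x" X]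
   by (intro exI[of _ "\<lambda>x. - y x"] exI[of _ "\<lambda>x. - p x"]) auto
 next
  assume "connects y0 y1 X"
  then obtain y p where "sol y p X" "y 0 = y0" "y X = y1" unfolding connects_def by blast
  then show "R.connects (- y0) (- y1) X" unfolding R.connects_def using sol_reflect1
   by (intro exI[of _ "\<lambda>x. - y x"] exI[of _ "\<lambda>x. - p x"]) auto
 qed
qed

text \<open>A trajectory below \<open>r\<close> that touches \<open>r\<close> has
  \<open>p = 0\<close> there. If \<open>V1 r = 0\<close> it is the equilibrium and never was below
  \<open>r\<close>; if \<open>V1 r > 0\<close> it is pushed beyond \<open>r\<close>. Points with
  \<open>V1 >= 0\<close> are thus safe barriers on the right, regardless of travel times.\<close>

lemma no_touch_increasing:
 assumes s: "sol y p x1" and r: "V1 r \<ge> 0" and T: "0 <= T" "T <= x1" and le: "!!x. x \<in> {0..x1} ==> y x <= r"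
  and h: "y T = r" "y 0 < r" "y x1 < r"
 shows False
proof -
 have TT: "0 < T" "T < x1" using T h by (cases "T = 0"; cases "T = x1"; auto)+
 have p: "p T = 0" by (rule sol_interior_max[OF s TT]) (use le h in auto)
 show False
 proof (cases "V1 r = 0")
  case True
  then show False using sol_equilibrium(1)[OF s, of T 0] p h TT by auto
 next
  case False
  then obtain x where "x \<in> {T<..x1}" "y T < y x" using sol_leaves_right[OF s T(1) TT(2) p] h r by auto
  then show False using le[of x] h T by auto
 qed
qed

text \<open>\<open>p 0 = sqrt (V (y 0))\<close> is the level \<open>D = 0\<close>, the lightlike
  limit: since \<open>V > 0\<close> there is no turning point, and the target is passed at time
  \<open>I 0 (y 0) y1 < X\<close> unless \<open>r\<close> is reached before
  \<open>X\<close>.\<close>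

lemma ahead_lightlike:
 assumes lr: "l \<in> K" "r \<in> K" and s: "csol l r y p X" and y0: "l < y 0" "y 0 < r" and p: "p 0 = sqrt (V (y 0))"
  and y1: "y1 < r" and X: "0 < X" "I 0 (y 0) y1 < ereal X"
 shows "ahead l r y1 X y"
proof -
 have VK: "V t > 0" if "l <= t" "t <= r" for t using Vpos in_K[OF lr that] by blast
 show ?thesis
 proof (rule run_right[OF lr s])
  fix x assume "x \<in> {0<..X}" "y x = r" "\<forall>x'\<in>{0..x}. y 0 <= y x' \<and> y x' <= r"
  then show ?thesis unfolding ahead_def using y0 by (intro bexI[of _ x]) force+
 next
  assume *: "\<forall>x\<in>{0..X}. y 0 <= y x \<and> y x < r \<and> (x \<noteq> 0 --> y 0 < y x \<and> p x > 0) \<and> ereal x = I 0 (y 0) (y x)"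
  then have eq: "ereal X = I 0 (y 0) (y X)" using X by auto
  have "y1 < y X"
  proof (rule ccontr)
   assume "\<not> ?thesis"
   then have "I 0 (y 0) (y X) <= I 0 (y 0) y1" by (intro hint_mono_set) auto
   then show False using eq X by simp
  qed
  then show ?thesis unfolding ahead_def using * X y0 by (intro bexI[of _ X]) force+
 qed (use VK y0 p in \<open>auto simp: less_imp_le\<close>)
qed

lemma behind_lightlike:
 assumes lr: "l \<in> K" "r \<in> K" and s: "csol l r y p X" and y0: "l < y 0" "y 0 < r" and p: "p 0 = - sqrt (V (y 0))"
  and y1: "l < y1" and X: "0 < X" "I 0 y1 (y 0) < ereal X"
 shows "ahead (- r) (- l) (- y1) X (\<lambda>x. - y x)"
proof -
 interpret R: warped "- b" "- a" rf rV1 rV2 by (rule warped_reflect)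
 have h: "R.I 0 (- y 0) (- y1) = I 0 y1 (y 0)"
 proof (cases "y1 <= y 0")
  case True
  have "y1 \<in> K" "y 0 \<in> K" using in_K[OF lr] y0 y1 True by auto
  then show ?thesis using hint_reflect[of "ereal y1" "ereal (y 0)" 0] by (auto simp: einterval_iff)
 qed (simp add: hint_empty)
 show ?thesis by (rule R.ahead_lightlike[OF _ _ csol_reflect[OF s]])
   (use lr y0 p y1 X h in \<open>auto simp: einterval_reflect inv_sq_reflect\<close>)
qed


section \<open>Points of the open interval\<close>

lemma K_up: "s \<in> K ==> s <= t ==> ereal t < b ==> t \<in> K"
 using less_le_trans[of a "ereal s" "ereal t"] by (simp add: einterval_iff)

lemma K_down: "s \<in> K ==> t <= s ==> a < ereal t ==> t \<in> K"
 using le_less_trans[of "ereal t" "ereal s" b] by (simp add: einterval_iff)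

lemma K_bounds: "s \<in> K ==> a < ereal s" "s \<in> K ==> ereal s < b" "s \<in> K ==> a <= ereal s" "s \<in> K ==> ereal s <= b"
 by (auto simp: einterval_iff)

section \<open>Turning points\<close>

text \<open>For \<open>D < V c\<close> the base point does not solve \<open>V = D\<close>, so both
  branches of \<open>b_star\<close> agree: the value is the first zero of \<open>V - D\<close> to
  the right of \<open>c\<close>, or \<open>b\<close>.\<close>

lemma b_star_cases:
 assumes c: "c \<in> K" "D < V c"
 obtains (none) "bstar c D = b" "!!t. c <= t ==> ereal t < b ==> D < V t"
 | (turn) r where "bstar c D = ereal r" "r \<in> K" "c < r" "V r = D"
   "!!t. c <= t ==> t < r ==> D < V t"
proof -
 have nc: "A_plus a b f c D - {ereal c} = A_plus a b f c D" unfolding A_plus_def using c by (auto simp: einterval_iff)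
 then have bs: "bstar c D = Inf (A_plus a b f c D)" unfolding b_star_def by simp
 have inK: "t \<in> K" if "c <= t" "ereal t < b" for t using that c by (auto simp: einterval_iff intro: less_le_trans[of a "ereal c"])
 show ?thesis
 proof (cases "\<exists>s0\<in>K. c <= s0 \<and> V s0 <= D")
  case False
  then have gt: "D < V t" if "c <= t" "ereal t < b" for t using inK[OF that] that by force
  have "{t \<in> K. t \<ge> c \<and> V t = D} = {}" using False by force
  then have "A_plus a b f c D = {b}" unfolding A_plus_def by (metis image_empty sup_bot_left)
  then have "bstar c D = b" unfolding bs by simp
  then show ?thesis using none gt by blast
 next
  case True
  then obtain s0 where s0: "s0 \<in> K" "c <= s0" "V s0 <= D" by blast
  have cV: "continuous_on {c..s0} V" using contV sub_K[OF c(1) s0(1)] continuous_on_subset by blast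
  obtain r where r: "c <= r" "r <= s0" "V r \<in> {..D}" "!!t. c <= t ==> t < r ==> V t \<notin> {..D}"
   by (rule first_time[OF cV, of "{..D}" s0]) (use s0 in auto)
  have gt: "D < V t" if "c <= t" "t < r" for t using r(4)[OF that] by simp
  have bK: "r \<in> K" using in_K[OF c(1) s0(1)] r by blast
  have eq: "V r = D"
  proof (rule ccontr)
   assume "V r \<noteq> D"
   then have "V r < D" using r(3) by auto
   moreover have "continuous_on {c..r} V" using cV r by (auto intro: continuous_on_subset)
   ultimately obtain z where "c <= z" "z <= r" "V z = D" using IVT2'[of V r D c] c r by auto
   then show False using gt[of z] \<open>V r \<noteq> D\<close> by (cases "z = r") auto
  qed
  have "Inf (A_plus a b f c D) = ereal r"
  proof (rule Inf_eqI)
   show "ereal r <= i" if "i \<in> A_plus a b f c D" for i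
    using that gt bK unfolding A_plus_def by (force simp: einterval_iff not_le[symmetric])
   show "z <= ereal r" if "!!i. i \<in> A_plus a b f c D ==> z <= i" for z
    by (rule that) (use bK eq r in \<open>auto simp: A_plus_def\<close>)
  qed
  moreover have "c < r" using c eq r(1) by (cases "c = r") auto
  ultimately show ?thesis by (intro turn[of r]) (use bs bK eq gt in auto)
 qed
qed

lemma deriv_reflect: "c \<in> K ==> deriv (inv_sq rf) (- c) = - deriv V c"
proof -
 interpret R: warped "- b" "- a" rf rV1 rV2 by (rule warped_reflect)
 assume "c \<in> K"
 then show ?thesis using R.deriv_V[of "- c"] deriv_V by (simp add: einterval_reflect)
qed

lemma A_plus_reflect: "A_plus (- b) (- a) rf (- c) D = uminus ` A_minus a b f c D"
proof -
 have 1: "{t \<in> einterval (- b) (- a). - c <= t \<and> inv_sq rf t = D} = uminus ` {t \<in> K. t <= c \<and> V t = D}"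
 proof (rule set_eqI)
  fix x
  have "x \<in> uminus ` S \<longleftrightarrow> - x \<in> S" for S :: "real set" by (force simp: image_iff)
  then show "x \<in> {t \<in> einterval (- b) (- a). - c <= t \<and> inv_sq rf t = D} \<longleftrightarrow> x \<in> uminus ` {t \<in> K. t <= c \<and> V t = D}"
   by (auto simp: einterval_reflect inv_sq_reflect)
 qed
 have 2: "ereal ` uminus ` S = uminus ` ereal ` S" for S by (simp add: image_image)
 show ?thesis unfolding A_plus_def A_minus_def 1 2 by (simp add: image_Un)
qed

lemma b_star_reflect: "c \<in> K ==> b_star (- b) (- a) rf (- c) D = - astar c D"
proof -
 assume c: "c \<in> K"
 have "A_plus (- b) (- a) rf (- c) D - {ereal (- c)} = uminus ` (A_minus a b f c D - {ereal c})"
 proof -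
  have "inj_on uminus (A_minus a b f c D)" by (rule inj_onI) simp
  then have "uminus ` (A_minus a b f c D - {ereal c}) = uminus ` A_minus a b f c D - uminus ` {ereal c}"
   by (metis (no_types, lifting) ereal_uminus_eq_iff image_set_diff inj_def)
  then show ?thesis unfolding A_plus_reflect by simp
 qed
 then show ?thesis unfolding b_star_def a_star_def deriv_reflect[OF c] A_plus_reflect by (simp add: ereal_Inf_uminus_image_eq)
qed

lemma a_star_reflect: "c \<in> K ==> a_star (- b) (- a) rf (- c) D = - bstar c D"
proof -
 interpret R: warped "- b" "- a" rf rV1 rV2 by (rule warped_reflect)
 assume c: "c \<in> K"
 show ?thesis using R.b_star_reflect[of "- c" D] c by (simp add: einterval_reflect)
qed

lemma a_star_cases:
 assumes c: "c \<in> K" "D < V c"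
 obtains (none) "astar c D = a" "!!t. t <= c ==> a < ereal t ==> D < V t"
 | (turn) l where "astar c D = ereal l" "l \<in> K" "l < c" "V l = D"
   "!!t. l < t ==> t <= c ==> D < V t"
proof -
 interpret R: warped "- b" "- a" rf rV1 rV2 by (rule warped_reflect)
 have c': "- c \<in> R.K" "D < inv_sq rf (- c)" using c by (auto simp: einterval_reflect inv_sq_reflect)
 have bs: "b_star (- b) (- a) rf (- c) D = - astar c D" by (rule b_star_reflect[OF c(1)])
 show ?thesis
 proof (rule R.b_star_cases[OF c'])
  assume h: "b_star (- b) (- a) rf (- c) D = - a" "!!t. - c <= t ==> ereal t < - a ==> D < inv_sq rf t"
  show ?thesis
  proof (rule none)
   show "astar c D = a" using h(1) bs by simp
   show "D < V t" if "t <= c" "a < ereal t" for t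
    using h(2)[of "- t"] that by (simp add: inv_sq_reflect) (metis ereal_minus_less_minus uminus_ereal.simps(1))
  qed
 next
  fix r assume h: "b_star (- b) (- a) rf (- c) D = ereal r" "r \<in> R.K" "- c < r"
   "inv_sq rf r = D" "!!t. - c <= t ==> t < r ==> D < inv_sq rf t"
  show ?thesis
  proof (rule turn[of "- r"])
   show "astar c D = ereal (- r)" using h(1) bs by (metis ereal_uminus_uminus uminus_ereal.simps(1))
   show "D < V t" if "- r < t" "t <= c" for t using h(5)[of "- t"] that by (simp add: inv_sq_reflect)
  qed (use h in \<open>auto simp: einterval_reflect inv_sq_reflect\<close>)
 qed
qed

section \<open>The right end\<close>

abbreviation "mr \<equiv> real_of_ereal (m_right b f)"

lemma m_right_real:
 assumes "relmin"
 shows "m_right b f = ereal mr" "0 <= mr"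
proof -
 obtain s where s: "a <= ereal s" "ereal s < b" "!!t. s < t ==> ereal t < b ==> m_right b f < ereal (V t)"
  using assms unfolding rel_min_right_def above_right_def by auto
 obtain t where "ereal s < ereal t" "ereal t < b" using ereal_dense2[OF s(2)] by blast
 then have "m_right b f < \<infinity>" using s(3)[of t] by (metis ereal_less_PInfty less_ereal.simps(1) less_trans)
 moreover have "0 <= m_right b f" by (rule m_right_nonneg[OF ab])
 ultimately show "m_right b f = ereal mr" "0 <= mr" by (cases "m_right b f"; simp)+
qed

lemma close_right_ex: "relmin ==> \<exists>c. close c"
proof -
 assume "relmin"
 then obtain s where s: "above_right a b f s" unfolding rel_min_right_def by blast
 then obtain c where "ereal s < ereal c" "ereal c < b" using ereal_dense2 unfolding above_right_def by blast
 then show ?thesis using s unfolding close_right_def by auto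
qed

lemma close_rightD:
 assumes "close c"
 shows "relmin" "c \<in> K" "!!t. c <= t ==> ereal t < b ==> mr < V t"
proof -
 obtain s where s: "a <= ereal s" "ereal s < b" "!!t. s < t ==> ereal t < b ==> m_right b f < ereal (V t)"
  "s < c" "ereal c < b" "above_right a b f s" using assms unfolding close_right_def above_right_def by auto
 show r: "relmin" using s(6) unfolding rel_min_right_def by blast
 show "c \<in> K" using s by (auto simp: einterval_iff intro: le_less_trans[of a "ereal s"])
 show "mr < V t" if "c <= t" "ereal t < b" for t
  using s(3)[of t] s(4) that m_right_real[OF r] by (metis less_ereal.simps(1) order_less_le_trans)
qed

lemma near_right:
 assumes "relmin" "mr < x" "s \<in> K"
 obtains t where "s < t" "t \<in> K" "V t < x"
proof -
 have "m_right b f < ereal x" using m_right_real[OF assms(1)] assms(2) by (metis less_ereal.simps(1))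
 moreover have "ereal s < b" using assms(3) by (simp add: einterval_iff)
 ultimately obtain t where "ereal s < ereal t" "ereal t < b" "V t < x" by (rule m_right_lessD[OF ab])
 then show ?thesis using that[of t] K_up[OF assms(3), of t] by simp
qed

lemma K_gt:
 assumes "s \<in> K"
 obtains r where "r \<in> K" "s < r"
proof -
 obtain r where "ereal s < ereal r" "ereal r < b" using ereal_dense2[of "ereal s" b] assms by (auto simp: einterval_iff)
 then show ?thesis using that[of r] K_up[OF assms, of r] by simp
qed

lemma K_lt:
 assumes "s \<in> K"
 obtains r where "r \<in> K" "r < s"
proof -
 obtain r where "a < ereal r" "ereal r < ereal s" using ereal_dense2[of a "ereal s"] assms by (auto simp: einterval_iff)
 then show ?thesis using that[of r] K_down[OF assms, of r] by simp
qed

text \<open>If \<open>V1 < 0\<close> on all of \<open>(s, b)\<close>, then \<open>V\<close>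
  decreases strictly and stays above its lower limit at \<open>b\<close>, which is a relative
  minimum. Otherwise points with \<open>V1 >= 0\<close> accumulate at \<open>b\<close>, and these
  are barriers by \<open>no_touch_increasing\<close>.\<close>

lemma not_rel_min_right:
 assumes "\<not> relmin" "s \<in> K"
 obtains r where "s < r" "r \<in> K" "V1 r \<ge> 0"
proof (rule ccontr)
 assume "\<not> thesis"
 then have neg: "V1 r < 0" if "s < r" "r \<in> K" for r using that \<open>!!r. _ ==> _ ==> _ ==> thesis\<close> by force
 have dec: "V v < V u" if "s < u" "u < v" "v \<in> K" for u v
 proof (rule DERIV_neg_imp_decreasing[of u v V])
  fix x assume "u <= x" "x <= v"
  then have "x \<in> K" "s < x" using in_K[OF assms(2) that(3)] that by auto
  then show "\<exists>d. DERIV V x :> d \<and> d < 0" using V1 neg by blast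
 qed fact
 have "above_right a b f s" unfolding above_right_def
 proof (intro conjI allI impI)
  show "a <= ereal s" "ereal s < b" using assms(2) by (auto simp: einterval_iff)
  fix z assume t: "s < z \<and> ereal z < b"
  then have tK: "z \<in> K" using assms(2) by (auto simp: einterval_iff intro: less_trans[of a "ereal s"])
  obtain v where v: "v \<in> K" "z < v" by (rule K_gt[OF tK])
  have "m_right b f <= ereal (V v)"
  proof (rule m_right_le[OF ab])
   fix w assume "w < b"
   then obtain w' where "max w (ereal v) < ereal w'" "ereal w' < b"
    using ereal_dense2[of "max w (ereal v)" b] v by (auto simp: einterval_iff)
   then show "\<exists>z. w < ereal z \<and> ereal z < b \<and> ereal (V z) <= ereal (V v)"
    using dec[of v w'] t v K_up[OF v(1), of w'] by (intro exI[of _ w']) auto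
  qed
  also have "ereal (V v) < ereal (V z)" using dec[of z v] t v by simp
  finally show "m_right b f < ereal (V z)" .
 qed
 then show False using assms(1) unfolding rel_min_right_def by blast
qed

text \<open>A barrier that no trajectory from \<open>y0\<close> grazes from below and leaves for
  \<open>y1\<close> within time \<open>X\<close>. \<open>right_ok\<close> asks for such barriers
  arbitrarily close to \<open>b\<close>, so that one lies beyond any given heights.\<close>

definition good_right :: "real => real => real => real => bool" where
 "good_right y0 y1 X r \<longleftrightarrow> r \<in> K \<and> (\<forall>y p T x1. sol y p x1 --> y 0 = y0 --> 0 <= T --> T <= x1 --> x1 <= X -->
   (\<forall>x\<in>{0..x1}. y x <= r) --> y T = r --> y x1 = y1 --> False)"

definition right_ok :: "real => real => real => bool" where
 "right_ok y0 y1 X \<longleftrightarrow> (\<forall>s\<in>K. \<exists>r>s. good_right y0 y1 X r)"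

text \<open>Touching from below is an interior maximum, so \<open>p\<close> vanishes there: the
  barrier determines the level of the trajectory.\<close>

lemma touch_energy:
 assumes s: "sol y p x1" and T: "0 <= T" "T <= x1" "\<forall>x\<in>{0..x1}. y x <= r" "y T = r" "y 0 < r" "y x1 < r"
 shows "0 < T" "T < x1" "p T = 0" "V (y 0) - (p 0)\<^sup>2 = V r"
proof -
 show TT: "0 < T" "T < x1" using T by (cases "T = 0"; cases "T = x1"; auto)+
 show p: "p T = 0" by (rule sol_interior_max[OF s TT]) (use T in auto)
 show "V (y 0) - (p 0)\<^sup>2 = V r" using sol_energy[OF s, of T] p T by simp
qed

text \<open>A grazing trajectory runs on level \<open>V r\<close>, and by \<open>travel_le\<close>
  its way up to \<open>r\<close> and its way back to \<open>y1\<close> each cost at least the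
  integral on any level \<open>D' <= V r\<close>.\<close>

lemma good_right_time:
 assumes r: "r \<in> K" "y0 < r" "y1 < r" "D' <= V r" and t: "ereal X < I D' y0 r + I D' y1 r"
 shows "good_right y0 y1 X r" unfolding good_right_def
proof (intro conjI allI impI r(1))
 fix y p T x1
 assume s: "sol y p x1" and h: "y 0 = y0" "0 <= T" "T <= x1" "x1 <= X" "\<forall>x\<in>{0..x1}. y x <= r" "y T = r" "y x1 = y1"
 have e: "V (y 0) - (p 0)\<^sup>2 = V r" using touch_energy(4)[OF s h(2,3,5,6)] h r by simp
 have "I D' y0 r <= ereal \<bar>T - 0\<bar>" using travel_le[OF s, of 0 T D'] h e r by simp
 moreover have "I D' y1 r <= ereal \<bar>T - x1\<bar>" using travel_le[OF s, of x1 T D'] h e r by simp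
 ultimately have "I D' y0 r + I D' y1 r <= ereal \<bar>T - 0\<bar> + ereal \<bar>T - x1\<bar>" by (rule add_mono)
 also have "\<dots> <= ereal X" using h by simp
 finally show False using t by simp
qed

lemma right_ok_not_rel_min:
 assumes "\<not> relmin" "y0 \<in> K" "y1 \<in> K"
 shows "right_ok y0 y1 X" unfolding right_ok_def
proof
 fix s assume "s \<in> K"
 then have "max s (max y0 y1) \<in> K" using assms by (auto simp: max_def)
 then obtain r where r: "max s (max y0 y1) < r" "r \<in> K" "V1 r \<ge> 0" by (rule not_rel_min_right[OF assms(1)])
 have "good_right y0 y1 X r" unfolding good_right_def using r no_touch_increasing by (metis max_less_iff_conj)
 then show "\<exists>r>s. good_right y0 y1 X r" using r by auto
qed

text \<open>Close to \<open>b\<close> all barriers have \<open>V r > mr\<close>, so a grazing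
  trajectory has a level above \<open>V q\<close> and cannot cross \<open>q\<close> on its way from
  \<open>y0\<close> to \<open>r\<close>.\<close>

lemma right_ok_barrier:
 assumes rm: "relmin" and y: "y0 \<in> K" "y1 \<in> K" and q: "q \<in> K" "y0 <= q" "V q <= mr"
 shows "right_ok y0 y1 X" unfolding right_ok_def
proof
 fix s assume s: "s \<in> K"
 obtain c where c: "close c" using close_right_ex[OF rm] by blast
 note cD = close_rightD[OF c]
 have "max (max s c) (max q y1) \<in> K" using cD(2) y q s by (auto simp: max_def)
 then obtain r where r: "r \<in> K" "max (max s c) (max q y1) < r" by (rule K_gt)
 have Vr: "mr < V r" by (rule cD(3)) (use r in \<open>auto simp: einterval_iff\<close>)
 have "good_right y0 y1 X r" unfolding good_right_def
 proof (intro conjI allI impI r(1))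
  fix y p T x1
  assume s: "sol y p x1" and h: "y 0 = y0" "0 <= T" "T <= x1" "x1 <= X" "\<forall>x\<in>{0..x1}. y x <= r" "y T = r" "y x1 = y1"
  have e: "V (y 0) - (p 0)\<^sup>2 = V r" using touch_energy(4)[OF s h(2,3,5,6)] h r q by simp
  have "continuous_on {0..T} y" using sol_cont(1)[OF s] h by (auto intro: continuous_on_subset)
  then obtain z where z: "0 <= z" "z <= T" "y z = q" using IVT'[of y 0 q T] h q r by auto
  have "V q - (p z)\<^sup>2 = V r" using sol_energy[OF s, of z] z h e by simp
  then show False using q Vr zero_le_power2[of "p z"] by linarith
 qed
 then show "\<exists>r>s. good_right y0 y1 X r" using r by auto
qed

text \<open>On level \<open>mr\<close> the way to a barrier close enough to \<open>b\<close> takes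
  longer than any given \<open>X\<close>, and a grazing trajectory, on the higher level
  \<open>V r\<close>, is slower still.\<close>

lemma right_ok_infinite:
 assumes c: "close c" "H mr (ereal c) b = \<infinity>" and y: "y0 \<in> K" "y1 \<in> K"
 shows "right_ok y0 y1 X"
proof (cases "\<exists>q\<in>K. y0 <= q \<and> V q <= mr")
 case True
 then show ?thesis using right_ok_barrier close_rightD(1)[OF c(1)] y by blast
next
 case False
 note cD = close_rightD[OF c(1)]
 have inf: "H mr (ereal y0) b = \<infinity>"
 proof (cases "y0 <= c")
  case True
  then have "H mr (ereal c) b <= H mr (ereal y0) b" by (intro hint_mono_set) auto
  then show ?thesis using c by simp
 next
  case nle: False
  have "H mr (ereal c) b = I mr c y0 + H mr (ereal y0) b" by (rule hint_add) (use nle cD(2) y in \<open>auto simp: einterval_iff\<close>)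
  moreover have "I mr c y0 < \<infinity>" by (rule hint_finite[OF cD(2) y(1)]) (use in_K[OF cD(2) y(1)] cD(3) K_bounds in auto)
  ultimately show ?thesis using c(2) by auto
 qed
 show ?thesis unfolding right_ok_def
 proof
  fix s assume s: "s \<in> K"
  have ab': "a <= ereal y0" "b <= b" using y by (auto simp: einterval_iff)
  have "ereal \<bar>X\<bar> < H mr (ereal y0) b" using inf by simp
  then obtain p q where pq: "ereal y0 < ereal p" "p < q" "ereal q < b" "ereal \<bar>X\<bar> < I mr p q" by (rule hint_approx[OF ab']) auto
  have qK: "q \<in> K" using pq y by (auto simp: einterval_iff intro: less_trans[of a "ereal y0"])
  have "max (max s q) (max c y1) \<in> K" using qK cD(2) y s by (auto simp: max_def)
  then obtain r where r: "r \<in> K" "max (max s q) (max c y1) < r" by (rule K_gt)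
  have "ereal X <= ereal \<bar>X\<bar>" by simp
  also have "\<dots> < I mr p q" by (rule pq)
  also have "\<dots> <= I mr y0 r" using pq r by (intro hint_mono_set) auto
  also have "\<dots> <= I mr y0 r + I mr y1 r" using hint_nonneg by (simp add: add_increasing2)
  finally have "good_right y0 y1 X r"
   using pq r cD(3)[of r] by (intro good_right_time[of r _ _ mr]) (auto simp: einterval_iff less_imp_le)
  then show "\<exists>r>s. good_right y0 y1 X r" using r by auto
 qed
qed


text \<open>\<open>d_at\<close> and \<open>i_at\<close> are \<open>d_right\<close> and
  \<open>i_right\<close> with the base point as an argument. Results for every close base point
  apply to the one chosen by \<open>SOME\<close>, so independence of the choice does not have to be
  proved separately.\<close>

definition d_at :: "real => ereal" where "d_at c = Limsup (at mr) (\<lambda>D. H D (ereal c) (bstar c D)) - H mr (ereal c) b"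

definition i_at :: "real => ereal" where "i_at c = (INF D\<in>{m <.. mr}. H D (astar c D) b)"

lemma V_min:
 assumes "u \<in> K" "v \<in> K" "u <= v"
 obtains w where "w \<in> {u..v}" "!!t. t \<in> {u..v} ==> V w <= V t"
proof -
 have "continuous_on {u..v} V" using contV sub_K[OF assms(1,2)] continuous_on_subset by blast
 then have "\<exists>w\<in>{u..v}. \<forall>t\<in>{u..v}. V w <= V t" using assms(3) by (intro continuous_attains_inf) auto
 then obtain w where w: "w \<in> {u..v}" "\<forall>t\<in>{u..v}. V w <= V t" by blast
 show ?thesis by (rule that[of w]) (use w in auto)
qed

lemma eventually_below_V:
 assumes "u \<in> K" "v \<in> K" "!!t. t \<in> {u..v} ==> D0 < V t"
 shows "eventually (\<lambda>D. \<forall>t\<in>{u..v}. D < V t) (at D0)"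
proof (cases "u <= v")
 case True
 obtain w where w: "w \<in> {u..v}" "!!t. t \<in> {u..v} ==> V w <= V t" by (rule V_min[OF assms(1,2) True]) (rule that)
 have "eventually (\<lambda>D. D < V w) (at D0)" by (rule order_tendstoD(2)[OF tendsto_ident_at assms(3)[OF w(1)]])
 then show ?thesis by eventually_elim (use w in force)
qed simp

text \<open>The limit superior in \<open>d_at\<close> is approached by levels \<open>D > mr\<close> only, and for these the
 turning point lies close to \<open>b\<close>.\<close>

lemma d_at_frequently:
 assumes c: "close c" and fin: "H mr (ereal c) b < \<infinity>"
  and B: "H mr (ereal c) b <= ereal B" "ereal B < Limsup (at mr) (\<lambda>D. H D (ereal c) (bstar c D))"
  and Z: "Z \<in> K" "c <= Z" and P: "eventually P (at mr)"
 obtains D r where "mr < D" "P D" "r \<in> K" "Z < r" "V r = D" "!!t. c <= t ==> t < r ==> D < V t"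
  "bstar c D = ereal r" "ereal B < I D c r"
proof -
 note cD = close_rightD[OF c]
 have ev: "eventually (\<lambda>D. P D \<and> (\<forall>t\<in>{c..Z}. D < V t) \<and> D \<noteq> mr) (at mr)"
 proof (intro eventually_conj P)
  show "eventually (\<lambda>D. \<forall>t\<in>{c..Z}. D < V t) (at mr)"
   by (rule eventually_below_V[OF cD(2) Z(1)]) (use cD(3) in_K[OF cD(2) Z(1)] K_bounds(2) in auto)
  show "eventually (\<lambda>D. D \<noteq> mr) (at mr)" by (simp add: eventually_at_filter)
 qed
 have "\<exists>D. (P D \<and> (\<forall>t\<in>{c..Z}. D < V t) \<and> D \<noteq> mr) \<and> ereal B < H D (ereal c) (bstar c D)"
 proof (rule ccontr)
  assume "\<not> ?thesis"
  then have "eventually (\<lambda>D. H D (ereal c) (bstar c D) <= ereal B) (at mr)" by (intro eventually_mono[OF ev]) (meson not_le)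
  then have "Limsup (at mr) (\<lambda>D. H D (ereal c) (bstar c D)) <= ereal B" by (rule Limsup_bounded)
  then show False using B by simp
 qed
 then obtain D where D: "P D" "!!t. t \<in> {c..Z} ==> D < V t" "D \<noteq> mr" "ereal B < H D (ereal c) (bstar c D)"
  by blast
 have gt: "mr < D"
 proof (rule ccontr)
  assume "\<not> ?thesis"
  then have lt: "D < mr" using D by simp
  have "H D (ereal c) (bstar c D) <= H D (ereal c) b"
  proof (rule hint_mono_set)
   show "bstar c D <= b" using D(2)[of c] Z cD(2) by (rule_tac b_star_cases[of c D]) (auto simp: einterval_iff)
  qed simp
  also have "\<dots> <= H mr (ereal c) b" by (rule hint_mono_D) (use lt cD(3) in auto)
  finally show False using D(4) B(1) by simp
 qed
 have Dc: "D < V c" using D(2)[of c] Z by simp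
 show ?thesis
 proof (rule b_star_cases[OF cD(2) Dc])
  assume h: "!!t. c <= t ==> ereal t < b ==> D < V t"
  obtain t where "c < t" "t \<in> K" "V t < D" by (rule near_right[OF cD(1) gt cD(2)])
  then show ?thesis using h[of t] K_bounds by auto
 next
  fix r assume h: "bstar c D = ereal r" "r \<in> K" "c < r" "V r = D" "!!t. c <= t ==> t < r ==> D < V t"
  have "Z < r" using D(2)[of r] h by force
  then show ?thesis using that[of D r] gt D h by simp
 qed
qed

lemma d_at_nonneg_real:
 assumes "H mr (ereal c) b < \<infinity>"
 obtains T where "H mr (ereal c) b = ereal T" "0 <= T" using assms hint_nonneg[of f mr "ereal c" b] by (cases "H mr (ereal c) b") auto

text \<open>The barriers are turning points \<open>v\<close> of suitable levels slightly above
  \<open>mr\<close>. Beyond a height \<open>Z\<close> close to \<open>b\<close>, the leg to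
  \<open>v\<close> takes about \<open>k + d\<close>, with \<open>k\<close> the remaining time on
  level \<open>mr\<close> and \<open>d\<close> the jump measured by \<open>d_at\<close>. A grazing
  trajectory makes this leg twice and needs about \<open>H mr (ereal y0) b + k + 2 * d\<close>; the
  surplus \<open>k > 0\<close> absorbs the approximations.\<close>

lemma right_ok_time:
 assumes c: "close c" and fin: "H mr (ereal c) b < \<infinity>" and y: "y0 \<in> K" "y1 \<in> K"
  and Vy: "!!t. y0 <= t ==> ereal t < b ==> mr < V t"
  and X: "ereal X <= H mr (ereal y0) b + 2 * d_at c"
 shows "right_ok y0 y1 X" unfolding right_ok_def
proof
 fix s assume s: "s \<in> K"
 note cD = close_rightD[OF c]
 define Z where "Z = max (max y0 y1) (max c s)"
 have Z: "Z \<in> K" "y0 <= Z" "y1 <= Z" "c <= Z" "s <= Z" unfolding Z_def using y cD(2) s by (auto simp: max_def)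
 have VZ: "mr < V t" if "Z <= t" "ereal t < b" for t using cD(3)[of t] that Z by simp
 have split_c: "H D (ereal c) w = I D c Z + H D (ereal Z) w" if "ereal Z <= w" "w <= b" for D w
  by (rule hint_add) (use that Z cD(2) K_bounds in auto)
 have split_y: "H D (ereal y0) w = I D y0 Z + H D (ereal Z) w" if "ereal Z <= w" "w <= b" for D w
  by (rule hint_add) (use that Z y K_bounds in auto)
 have finA: "I mr c Z < \<infinity>" by (rule hint_finite) (use cD Z in_K[OF cD(2) Z(1)] K_bounds in auto)
 have fin0: "I mr y0 Z < \<infinity>" by (rule hint_finite) (use y Vy Z in_K[OF y(1) Z(1)] K_bounds in auto)
 obtain A where A: "I mr c Z = ereal A" "0 <= A" using finA hint_nonneg[of f mr "ereal c" "ereal Z"] by (cases "I mr c Z") auto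
 obtain T0 where T0: "I mr y0 Z = ereal T0" "0 <= T0" using fin0 hint_nonneg[of f mr "ereal y0" "ereal Z"] by (cases "I mr y0 Z") auto
 have sc: "H mr (ereal c) b = ereal A + H mr (ereal Z) b" using split_c[of b mr] A K_bounds[OF Z(1)] by simp
 obtain k where k: "H mr (ereal Z) b = ereal k" using fin sc hint_nonneg[of f mr "ereal Z" b] by (cases "H mr (ereal Z) b") auto
 have "0 < H mr (ereal Z) b" by (rule hint_pos) (use Z VZ K_bounds in auto)
 then have k0: "0 < k" using k by simp
 have T: "H mr (ereal y0) b = ereal (T0 + k)" using split_y[of b mr] T0 k K_bounds[OF Z(1)] by simp
 have tot: "H mr (ereal c) b = ereal (A + k)" using sc k by simp
 show "\<exists>r>s. good_right y0 y1 X r"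
 proof (cases "X < T0 + 2 * k")
  case True
  \<comment> \<open>Here level \<open>mr\<close> alone is slow enough: with a barrier so far right
    that each leg beyond \<open>Z\<close> takes more than \<open>x\<close>, the two legs exceed
    \<open>X - T0\<close>.\<close>
  define x where "x = max 0 ((X - T0) / 2)"
  have x: "0 <= x" "x < k" unfolding x_def using True k0 by auto
  then have "ereal x < H mr (ereal Z) b" "0 <= ereal x" using k by auto
  then obtain p q where pq: "ereal Z < ereal p" "p < q" "ereal q < b" "ereal x < I mr p q"
   by (rule hint_approx[OF K_bounds(3)[OF Z(1)] order_refl])
  have qK: "q \<in> K" using K_up[OF Z(1)] pq by auto
  have le: "I mr p q <= I mr Z q" using pq by (intro hint_mono_set) auto
  have "I mr y0 q = ereal T0 + I mr Z q" using split_y[of "ereal q" mr] T0 pq K_bounds[OF qK] by simp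
  moreover have "I mr Z q <= I mr y1 q" using Z by (intro hint_mono_set) auto
  moreover have "ereal X < ereal T0 + ereal x' + ereal x'" if "x < x'" for x'
   using that unfolding x_def by (auto simp: max_def split: if_splits)
  ultimately have "ereal X < I mr y0 q + I mr y1 q"
  proof (cases "I mr Z q")
   case (real x')
   then have "x < x'" using pq(4) le by (metis less_ereal.simps(1) order_less_le_trans)
   then have "ereal X < ereal T0 + ereal x' + ereal x'" using \<open>!!x'. x < x' ==> _\<close> by blast
   also have "\<dots> <= I mr y0 q + I mr y1 q" using \<open>H mr (ereal Z) (ereal q) <= I mr y1 q\<close> real
     \<open>H mr (ereal y0) (ereal q) = ereal T0 + I mr Z q\<close> by (intro add_mono) auto
   finally show ?thesis .
  next
   case PInf
   then show ?thesis using \<open>H mr (ereal y0) (ereal q) = ereal T0 + I mr Z q\<close>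
     hint_nonneg[of f mr "ereal y1" "ereal q"] by auto
  qed (use hint_nonneg[of f mr "ereal Z" "ereal q"] in auto)
  then have "good_right y0 y1 X q" using pq Z VZ[of q] by (intro good_right_time[of q _ _ mr]) (use qK in auto)
  then show ?thesis using pq Z by (intro exI[of _ q]) auto
 next
  case False
  define g where "g D = H D (ereal c) (bstar c D)" for D
  have d: "d_at c = Limsup (at mr) g - ereal (A + k)" unfolding d_at_def g_def tot ..
  \<comment> \<open>Chosen so that \<open>T0 + 2 * (B - A - k / 4) = X\<close>. The
    \<open>k / 4\<close> inside \<open>B\<close> keeps it strictly below the limit superior; the
    other \<open>k / 4\<close> allows \<open>I D c Z\<close> to exceed its limit
    \<open>A\<close>.\<close>
  define B where "B = A + k + (X - T0 - k) / 2 - k / 4"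
  have B: "A + k <= B" unfolding B_def using False k0 by (simp add: field_simps)
  have BL: "ereal B < Limsup (at mr) g"
  proof (cases "Limsup (at mr) g")
   case (real L)
   then have "d_at c = ereal (L - (A + k))" using d by simp
   then have "X <= T0 + k + 2 * (L - (A + k))" using X T by simp
   then show ?thesis using real k0 unfolding B_def by (simp add: field_simps)
  next
   case MInf
   then have "d_at c = - \<infinity>" using d by simp
   then show ?thesis using X T by simp
  qed simp
  have lim: "((\<lambda>D. I D c Z) \<longlongrightarrow> ereal A) (at mr)"
   using hint_continuous_D[OF cD(2) Z(1), of mr] A cD in_K[OF cD(2) Z(1)] K_bounds by auto
  have "eventually (\<lambda>D. I D c Z < ereal (A + k / 4)) (at mr)" by (rule order_tendstoD(2)[OF lim]) (use k0 in simp)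
  moreover have "eventually (\<lambda>D. \<forall>t\<in>{y0..Z}. D < V t) (at mr)"
   by (rule eventually_below_V) (use y Z Vy in_K[OF y(1) Z(1)] K_bounds in auto)
  ultimately have ev: "eventually (\<lambda>D. I D c Z < ereal (A + k / 4) \<and> (\<forall>t\<in>{y0..Z}. D < V t)) (at mr)"
   by (rule eventually_conj)
  have B': "H mr (ereal c) b <= ereal B" using B tot by simp
  obtain D v where D: "mr < D" "I D c Z < ereal (A + k / 4)" "\<forall>t\<in>{y0..Z}. D < V t"
   "v \<in> K" "Z < v" "V v = D" "!!t. c <= t ==> t < v ==> D < V t" "ereal B < I D c v"
   by (rule d_at_frequently[OF c fin B' BL[unfolded g_def] Z(1,4) ev]) auto
  have "I D c v = I D c Z + I D Z v" using D K_bounds[OF D(4)] by (intro split_c) auto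
  then have big: "ereal (B - A - k / 4) < I D Z v"
   using D(2,8) hint_nonneg[of f D "ereal c" "ereal Z"] hint_nonneg[of f D "ereal Z" "ereal v"]
   by (cases "I D c Z"; cases "I D Z v") auto
  have "ereal X = ereal T0 + ereal (B - A - k / 4) + ereal (B - A - k / 4)" unfolding B_def by (simp add: field_simps)
  also have "\<dots> < (I D y0 Z + I D Z v) + I D y1 v"
  proof -
   have 1: "ereal T0 <= I D y0 Z" unfolding T0(1)[symmetric] by (rule hint_mono_D) (use D in auto)
   have 2: "I D Z v <= I D y1 v" using Z by (intro hint_mono_set) auto
   have "ereal T0 + ereal (B - A - k / 4) <= I D y0 Z + I D Z v" using 1 big by (intro add_mono) auto
   moreover have "ereal (B - A - k / 4) < I D y1 v" using big 2 by (rule less_le_trans)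
   ultimately show ?thesis using ereal_add_strict_mono[of "ereal T0 + ereal (B - A - k / 4)"] hint_nonneg B k0 T0
    by (cases "I D y0 Z + I D Z v"; cases "I D y1 v") auto
  qed
  also have "I D y0 Z + I D Z v = I D y0 v" using D K_bounds[OF D(4)] by (intro split_y[symmetric]) auto
  finally have "good_right y0 y1 X v" using D Z by (intro good_right_time[of v _ _ D]) auto
  then show ?thesis using D Z by (intro exI[of _ v]) auto
 qed
qed

text \<open>Level \<open>V l\<close> turns at \<open>l\<close> and nowhere to the right of it. A
  trajectory on it that starts to the left comes back from \<open>l\<close> and escapes towards
  \<open>b\<close>, all in time less than \<open>X\<close>: an overshooting start with negative
  momentum.\<close>

definition right_return :: "real => real => bool" where
 "right_return y0 X \<longleftrightarrow> (\<exists>l\<in>K. l < y0 \<and> V1 l > 0 \<and> (\<forall>t. l < t --> ereal t < b --> V l < V t)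
   \<and> 2 * H (V l) (ereal l) b < ereal X)"

lemma m_inf_le: "y \<in> K ==> m <= V y"
 unfolding m_inf_def by (intro cINF_lower bdd_belowI2[where m = 0]) (auto simp: inv_sq_def)

lemma m_inf_less:
 assumes "m < D"
 obtains y where "y \<in> K" "V y < D"
proof -
 have "K \<noteq> {}" using einterval_nonempty[OF ab] by auto
 moreover have "bdd_below (V ` K)" by (intro bdd_belowI2[where m = 0]) (auto simp: inv_sq_def)
 ultimately show ?thesis using assms that unfolding m_inf_def by (subst (asm) cINF_less_iff) auto
qed

lemma V1_nonneg_right:
 assumes "l \<in> K" "!!t. l < t ==> t \<in> K ==> V l < V t"
 shows "V1 l \<ge> 0"
proof (rule ccontr)
 assume "\<not> ?thesis"
 then have "V1 l < 0" by simp
 from DERIV_neg_dec_right[OF V1[OF assms(1)] this]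
 obtain d where d: "d > 0" "!!h. 0 < h ==> h < d ==> V (l + h) < V l" by auto
 obtain r where r: "r \<in> K" "l < r" by (rule K_gt[OF assms(1)])
 define h where "h = min (d / 2) (r - l)"
 have h: "0 < h" "h < d" "l + h <= r" unfolding h_def using d r by auto
 then have "l + h \<in> K" using in_K[OF assms(1) r(1)] by auto
 then show False using assms(2)[of "l + h"] d(2)[OF h(1,2)] h by auto
qed

text \<open>A level that nearly realizes the infimum in \<open>i_at\<close> serves. Being above
  \<open>m\<close> and at most \<open>mr\<close>, it has a turning point \<open>l\<close> to the
  left of \<open>c\<close> and none between \<open>l\<close> and \<open>b\<close>;
  \<open>V1 l > 0\<close> because at a critical point the integral would be infinite.\<close>

lemma right_return_i:
 assumes c: "close c" and y: "y0 \<in> K" and Vy: "!!t. y0 <= t ==> ereal t < b ==> mr < V t"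
  and X: "2 * i_at c < ereal X"
 shows "right_return y0 X"
proof -
 note cD = close_rightD[OF c]
 have "i_at c < ereal (X / 2)" using X by (cases "i_at c") auto
 then obtain D where D: "m < D" "D <= mr" "H D (astar c D) b < ereal (X / 2)" unfolding i_at_def INF_less_iff by auto
 have Dc: "D < V c" using D cD(3)[of c] K_bounds[OF cD(2)] by simp
 obtain w where w: "w \<in> K" "V w < D" by (rule m_inf_less[OF D(1)])
 show ?thesis
 proof (rule a_star_cases[OF cD(2) Dc])
  assume h: "!!t. t <= c ==> a < ereal t ==> D < V t"
  show ?thesis using h[of w] cD(3)[of w] D w K_bounds[OF w(1)] by (cases "w <= c") auto
 next
  fix l assume h: "astar c D = ereal l" "l \<in> K" "l < c" "V l = D" "!!t. l < t ==> t <= c ==> D < V t"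
  have gt: "V l < V t" if "l < t" "ereal t < b" for t using h(4,5) that cD(3)[of t] D by (cases "t <= c") auto
  have "l < y0" using Vy[of l] K_bounds[OF h(2)] h D by force
  moreover have "V1 l \<ge> 0" by (rule V1_nonneg_right[OF h(2)]) (use gt K_bounds in auto)
  moreover have "V1 l \<noteq> 0"
  proof
   assume "V1 l = 0"
   then have "I (V l) l c = \<infinity>" by (rule hint_critical_left[OF h(2) _ cD(2) h(3)]) (use gt h in auto)
   moreover have "I (V l) l c <= H D (astar c D) b" unfolding h(1,4) using K_bounds[OF cD(2)] by (intro hint_mono_set) auto
   ultimately show False using D(3) by simp
  qed
  moreover have "2 * H (V l) (ereal l) b < ereal X" using D(3) h hint_nonneg[of f D "ereal l" b] by (cases "H D (ereal l) b") auto
  ultimately show ?thesis unfolding right_return_def using h gt by force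
 qed
qed

lemma csol_shift:
 assumes "csol l r y p T" "0 <= s" "s <= T"
 shows "csol l r (\<lambda>x. y (s + x)) (\<lambda>x. p (s + x)) (T - s)" unfolding csol_def
proof (intro ballI conjI)
 fix x assume x: "x \<in> {0..T - s}"
 then have xT: "s + x \<in> {0..T}" using assms by auto
 show "((\<lambda>x. y (s + x)) has_real_derivative p (s + x) / V (clampI l r (y (s + x)))) (at x within {0..T - s})"
    "((\<lambda>x. p (s + x)) has_real_derivative V1 (clampI l r (y (s + x))) / (2 * V (clampI l r (y (s + x))))) (at x within {0..T - s})"
  by (rule deriv_shift_within[where S = "{0..T}"]; use assms xT in \<open>auto simp: csol_def\<close>)+
qed

text \<open>Both legs, down to \<open>w\<close> and up to the barrier \<open>r\<close>, are parts of
  the way from \<open>w\<close> to \<open>b\<close> and take at most \<open>h\<close> each, where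
  \<open>2 * h < X\<close>.\<close>

lemma ahead_return:
 assumes lr: "l \<in> K" "r \<in> K" and s: "csol l r y p X" and y0: "y 0 = y0" "y0 < r"
  and w: "w \<in> K" "l < w" "w < y0" "V1 w > 0" "!!z. w < z ==> ereal z < b ==> V w < V z"
  and t: "2 * H (V w) (ereal w) b < ereal X" and p: "p 0 = - sqrt (V y0 - V w)"
 shows "ahead l r y1 X y"
proof -
 let ?D = "V w"
 have rb: "ereal r < b" using K_bounds[OF lr(2)] by simp
 have y0K: "y0 \<in> K" using in_K[OF w(1) lr(2)] w y0 by auto
 have gt0: "?D < V y0" using w(5)[of y0] w(3) K_bounds[OF y0K] by simp
 have p2: "p 0 < 0" "(p 0)\<^sup>2 = V y0 - ?D" using p gt0 by auto
 obtain h where h: "H ?D (ereal w) b = ereal h" "2 * h < X" "0 <= h"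
  using t hint_nonneg[of f ?D "ereal w" b] by (cases "H ?D (ereal w) b") auto
 have sub: "I ?D u v <= ereal h" if "w <= u" "v <= r" for u v
  unfolding h(1)[symmetric] using that rb by (intro hint_mono_set) (auto intro: order_trans[of _ "ereal r"])
 have X: "0 < X" using h by simp
 obtain t1 where t1: "t1 \<in> {0<..X}" "y t1 = w" "\<forall>x'\<in>{0..t1}. w <= y x' \<and> y x' <= y 0" "t1 <= h"
 proof (rule run_left[OF lr s])
  show "?D < V z" if "w < z" "z < y 0" for z using w(5)[of z] that y0 rb by (meson ereal_less_eq(3) less_ereal.simps(1) less_trans)
 next
  fix x assume x: "x \<in> {0<..X}" "y x = w" "\<forall>x'\<in>{0..x}. w <= y x' \<and> y x' <= y 0" "ereal x = I ?D w (y 0)"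
  have "I ?D w (y 0) <= ereal h" by (rule sub) (use y0 in auto)
  then have "x <= h" using x(4) by (metis ereal_less_eq(3))
  then show thesis using that x by simp
 next
  assume *: "\<forall>x\<in>{0..X}. w < y x \<and> y x <= y 0 \<and> (x \<noteq> 0 --> y x < y 0 \<and> p x < 0) \<and> ereal x = I ?D (y x) (y 0)"
  then have "w < y X" "ereal X = I ?D (y X) (y 0)" using X by auto
  then have "ereal X <= ereal h" using sub[of "y X" "y 0"] y0 by simp
  then show thesis using h by simp
 qed (use y0 w p2 in auto)
 have st1: "sol y p t1" by (rule csol_sol[OF s lr]) (use t1 y0 w in force)+
 from sol_energy[OF this, of t1] have pt1: "p t1 = 0" using t1 y0 p2 by simp
 have s2: "csol l r (\<lambda>x. y (t1 + x)) (\<lambda>x. p (t1 + x)) (X - t1)" by (rule csol_shift[OF s]) (use t1 in auto)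
 show ?thesis
 proof (rule run_right[OF lr s2])
  show "?D < V z" if "y (t1 + 0) < z" "z < r" for z using w(5)[of z] that t1 rb by (simp, meson less_ereal.simps(1) less_trans)
 next
  fix x assume x: "x \<in> {0<..X - t1}" "y (t1 + x) = r" "\<forall>x'\<in>{0..x}. y (t1 + 0) <= y (t1 + x') \<and> y (t1 + x') <= r"
  have "l < y x'" if "x' \<in> {0..t1 + x}" for x'
  proof (cases "x' <= t1")
   case True
   then show ?thesis using t1(3) that w(2) by force
  next
   case False
   then have "y (t1 + 0) <= y (t1 + (x' - t1))" using x(3)[rule_format, of "x' - t1"] that by simp
   then show ?thesis using t1 w by simp
  qed
  then show ?thesis unfolding ahead_def using x t1 by (intro bexI[of _ "t1 + x"]) auto
 next
  assume *: "\<forall>x\<in>{0..X - t1}. y (t1 + 0) <= y (t1 + x) \<and> y (t1 + x) < r \<and> (x \<noteq> 0 --> y (t1 + 0) < y (t1 + x) \<and> p (t1 + x) > 0)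
      \<and> ereal x = I ?D (y (t1 + 0)) (y (t1 + x))"
  from *[rule_format, of "X - t1"]
  have "y X < r" "ereal (X - t1) = I ?D w (y X)" using t1 by auto
  then have "ereal (X - t1) <= ereal h" using sub[of w "y X"] by simp
  then show ?thesis using h t1 by simp
 qed (use t1 pt1 w y0 in auto)
qed


section \<open>Condition (C)\<close>

definition right_C :: "ereal => bool" where "right_C L \<longleftrightarrow> \<not> relmin
   \<or> (\<exists>c. close c \<and> H mr (ereal c) b = \<infinity>)
   \<or> (\<exists>c. close c \<and> H mr (ereal c) b < \<infinity> \<and> L <= 2 * d_at c)
   \<or> (\<exists>c. close c \<and> H mr (ereal c) b < \<infinity> \<and> m < mr \<and> i_at c <= d_at c)"

text \<open>If \<open>i <= d\<close>, the size of \<open>X\<close> decides: up to the bound of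
  \<open>right_ok_time\<close> there are barriers, and beyond it \<open>X > 2 * d >= 2 * i\<close>
  provides a return trajectory. A point to the right of \<open>y0\<close> with
  \<open>V <= mr\<close> is an obstacle that gives barriers by itself.\<close>

lemma right_C_cases:
 assumes "right_C L" and y: "y0 \<in> K" "y1 \<in> K" and X: "0 < X" "ereal X < L"
 shows "right_ok y0 y1 X \<or> (right_return y0 X \<and> m < mr \<and> (\<forall>t. y0 <= t --> ereal t < b --> mr < V t))"
proof (cases "relmin \<and> (\<forall>t. y0 <= t --> ereal t < b --> mr < V t)")
 case False
 then consider "\<not> relmin" | t where "relmin" "y0 <= t" "ereal t < b" "V t <= mr" by force
 then show ?thesis
 proof cases
  case 1
  then show ?thesis using right_ok_not_rel_min y by blast
 next
  case (2 t)
  then show ?thesis using right_ok_barrier[OF 2(1) y K_up[OF y(1) 2(2,3)]] by blast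
 qed
next
 case True
 then have rm: "relmin" and Vy: "!!t. y0 <= t ==> ereal t < b ==> mr < V t" by auto
 have nn: "0 <= H mr (ereal y0) b" by (rule hint_nonneg)
 from assms(1) rm consider
   c where "close c" "H mr (ereal c) b = \<infinity>"
  | c where "close c" "H mr (ereal c) b < \<infinity>" "L <= 2 * d_at c"
  | c where "close c" "H mr (ereal c) b < \<infinity>" "m < mr" "i_at c <= d_at c" unfolding right_C_def by blast
 then show ?thesis
 proof cases
  case (1 c)
  then show ?thesis using right_ok_infinite y by blast
 next
  case (2 c)
  have "ereal X <= 2 * d_at c" using X 2(3) by simp
  then have "ereal X <= H mr (ereal y0) b + 2 * d_at c" using nn by (simp add: add_increasing)
  then show ?thesis using right_ok_time[OF 2(1,2) y Vy] by blast
 next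
  case (3 c)
  show ?thesis
  proof (cases "ereal X <= H mr (ereal y0) b + 2 * d_at c")
   case True
   then show ?thesis using right_ok_time[OF 3(1,2) y Vy] by blast
  next
   case False
   then have lt: "H mr (ereal y0) b + 2 * d_at c < ereal X" by simp
   have "2 * i_at c <= 2 * d_at c" using 3(4) by (intro ereal_mult_left_mono) auto
   also have "\<dots> <= H mr (ereal y0) b + 2 * d_at c" using nn by (simp add: add_increasing)
   finally have "2 * i_at c < ereal X" using lt by simp
   then show ?thesis using right_return_i[OF 3(1) y(1) Vy] 3(3) Vy by blast
  qed
 qed
qed

lemma good_right_reflect:
 assumes "warped.good_right (- b) (- a) rf rV1 (- y0) (- y1) X (- l)"
 shows "l \<in> K"
  and "!!y p T x1. sol y p x1 ==> y 0 = y0 ==> 0 <= T ==> T <= x1 ==> x1 <= X ==>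
    (\<forall>x\<in>{0..x1}. l <= y x) ==> y T = l ==> y x1 = y1 ==> False"
proof -
 interpret R: warped "- b" "- a" rf rV1 rV2 by (rule warped_reflect)
 show "l \<in> K" using assms unfolding R.good_right_def by (simp add: einterval_reflect)
 fix y p T x1 assume h: "sol y p x1" "y 0 = y0" "0 <= T" "T <= x1" "x1 <= X" "\<forall>x\<in>{0..x1}. l <= y x" "y T = l" "y x1 = y1"
 have *: "R.sol (\<lambda>x. - y x) (\<lambda>x. - p x) x1" by (rule sol_reflect1[OF h(1)])
 show False using assms * h unfolding R.good_right_def by (metis neg_le_iff_le)
qed

text \<open>With barriers at both ends the momenta run from one lightlike value to the other. With
  \<open>right_return\<close> they run up to \<open>- sqrt (V y0 - V w)\<close> only: their levels
  are at most \<open>V w < V r\<close>, so none of these trajectories grazes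
  \<open>r\<close>.\<close>

lemma connects_if_ends_ok:
 assumes y: "y0 \<in> K" "y1 \<in> K" and X: "0 < X" "I 0 y0 y1 < ereal X" "I 0 y1 y0 < ereal X"
  and right: "right_ok y0 y1 X \<or> right_return y0 X" and left: "warped.right_ok (- b) (- a) rf rV1 (- y0) (- y1) X"
 shows "connects y0 y1 X"
proof -
 interpret R: warped "- b" "- a" rf rV1 rV2 by (rule warped_reflect)
 have left': "\<exists>l<s. R.good_right (- y0) (- y1) X (- l)" if "s \<in> K" for s
 proof -
  have "- s \<in> R.K" using that by (simp add: einterval_reflect)
  then obtain r where "r > - s" "R.good_right (- y0) (- y1) X r" using left unfolding R.right_ok_def by blast
  then show ?thesis by (intro exI[of _ "- r"]) auto
 qed
 define y where "y = min y0 y1"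
 define z where "z = max y0 y1"
 have yz: "y \<in> K" "z \<in> K" "y <= y0" "y <= y1" "y0 <= z" "y1 <= z" unfolding y_def z_def using y by (auto simp: min_def max_def)
 have V0: "V y0 > 0" by (rule Vpos[OF y(1)])
 have pm: "- sqrt (V y0) <= - sqrt (V y0 - v)" if "0 <= v" for v using that by (simp add: real_sqrt_le_mono)
 from right show ?thesis
 proof
  assume r: "right_ok y0 y1 X"
  obtain r where r: "z < r" "good_right y0 y1 X r" using r yz unfolding right_ok_def by blast
  obtain l where l: "l < y" "R.good_right (- y0) (- y1) X (- l)" using left'[OF yz(1)] by blast
  note gl = good_right_reflect[OF l(2)]
  have rK: "r \<in> K" using r unfolding good_right_def by blast
  show ?thesis
  proof (rule connects_shoot[OF gl(1) rK])
   show "l < y0" "y0 < r" "l < y1" "y1 < r" using l r yz by auto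
   show "- sqrt (V y0) \<in> {- sqrt (V y0)..sqrt (V y0)}" "sqrt (V y0) \<in> {- sqrt (V y0)..sqrt (V y0)}" using V0 by simp_all
   show False if "sol y p x1" "y 0 = y0" "0 <= T" "T <= x1" "x1 <= X"
    "\<forall>x\<in>{0..x1}. l <= y x \<and> y x <= r" "y T = r" "y x1 = y1" for y p T x1
    using r(2) that unfolding good_right_def by blast
   show False if "sol y p x1" "y 0 = y0" "0 <= T" "T <= x1" "x1 <= X"
    "\<forall>x\<in>{0..x1}. l <= y x \<and> y x <= r" "y T = l" "y x1 = y1" for y p T x1 using gl(2)[OF that(1-5)] that by blast
   show "ahead l r y1 X y" if "csol l r y p X" "y 0 = y0" "p 0 = sqrt (V y0)" for y p
    by (rule ahead_lightlike[OF gl(1) rK that(1)]) (use that l r yz X in auto)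
   show "ahead (- r) (- l) (- y1) X (\<lambda>x. - y x)" if "csol l r y p X" "y 0 = y0" "p 0 = - sqrt (V y0)" for y p
    by (rule behind_lightlike[OF gl(1) rK that(1)]) (use that l r yz X in auto)
  qed (rule X(1))
 next
  assume "right_return y0 X"
  then obtain w where w: "w \<in> K" "w < y0" "V1 w > 0" "!!t. w < t ==> ereal t < b ==> V w < V t"
   "2 * H (V w) (ereal w) b < ereal X" unfolding right_return_def by blast
  obtain r where r: "r \<in> K" "z < r" by (rule K_gt[OF yz(2)])
  have "min y w \<in> K" using yz w by (auto simp: min_def)
  then obtain l where l: "l < min y w" "R.good_right (- y0) (- y1) X (- l)" using left' by blast
  note gl = good_right_reflect[OF l(2)]
  have Va: "V w > 0" by (rule Vpos[OF w(1)])
  have gt0: "V w < V y0" using w(4)[of y0] w(2) K_bounds[OF y(1)] by simp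
  show ?thesis
  proof (rule connects_shoot[OF gl(1) r(1)])
   show "l < y0" "y0 < r" "l < y1" "y1 < r" using l r yz by auto
   show "- sqrt (V y0) \<in> {- sqrt (V y0)..- sqrt (V y0 - V w)}"
    "- sqrt (V y0 - V w) \<in> {- sqrt (V y0)..- sqrt (V y0 - V w)}" using pm Va by simp_all
   show False if s: "sol y p x1" "y 0 = y0" "p 0 <= - sqrt (V y0 - V w)" "0 <= T" "T <= x1" "x1 <= X"
    "\<forall>x\<in>{0..x1}. l <= y x \<and> y x <= r" "y T = r" "y x1 = y1" for y p T x1
   proof -
    have "V (y 0) - (p 0)\<^sup>2 = V r" by (rule touch_energy(4)[OF s(1,4,5)]) (use s r yz in auto)
    moreover have "(sqrt (V y0 - V w))\<^sup>2 <= (- p 0)\<^sup>2" using s(3) gt0 by (intro power_mono) auto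
    ultimately have "V r <= V w" using s gt0 by simp
    then show False using w(4)[of r] w(2) r yz K_bounds[OF r(1)] by force
   qed
   show False if "sol y p x1" "y 0 = y0" "0 <= T" "T <= x1" "x1 <= X"
    "\<forall>x\<in>{0..x1}. l <= y x \<and> y x <= r" "y T = l" "y x1 = y1" for y p T x1 using gl(2)[OF that(1-5)] that by blast
   show "ahead l r y1 X y" if "csol l r y p X" "y 0 = y0" "p 0 = - sqrt (V y0 - V w)" for y p
    by (rule ahead_return[OF gl(1) r(1) that(1,2) _ w(1) _ w(2,3,4,5)]) (use that l r yz in auto)
   show "ahead (- r) (- l) (- y1) X (\<lambda>x. - y x)" if "csol l r y p X" "y 0 = y0" "p 0 = - sqrt (V y0)" for y p
    by (rule behind_lightlike[OF gl(1) r(1) that(1)]) (use that l r yz X in auto)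
  qed (rule X(1))
 qed
qed

lemma hint_reflect_real: "y \<in> K ==> z \<in> K ==> hint rf D (ereal (- z)) (ereal (- y)) = I D y z"
 using hint_reflect[of "ereal y" "ereal z" D] K_bounds by simp

lemma m_inf_reflect: "m_inf (- b) (- a) rf = m"
proof -
 have "einterval (- b) (- a) = uminus ` K"
 proof (rule set_eqI)
  fix x show "x \<in> einterval (- b) (- a) \<longleftrightarrow> x \<in> uminus ` K" by (metis einterval_reflect image_iff minus_minus)
 qed
 then show ?thesis unfolding m_inf_def by (simp add: image_image inv_sq_reflect)
qed

text \<open>At least one end has barriers: the return alternative at both ends would put
  \<open>V\<close> above \<open>mr\<close> to the right of \<open>y0\<close> and above
  \<open>R.mr\<close> to the left, though both numbers exceed the infimum of
  \<open>V\<close>.\<close>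

lemma right_C_imp_connects:
 assumes r: "right_C L" and l: "warped.right_C (- b) (- a) rf L" and y: "y0 \<in> K" "y1 \<in> K" and X: "0 < X" "ereal X < L"
   "I 0 y0 y1 < ereal X" "I 0 y1 y0 < ereal X"
 shows "connects y0 y1 X"
proof -
 interpret R: warped "- b" "- a" rf rV1 rV2 by (rule warped_reflect)
 have y': "- y0 \<in> R.K" "- y1 \<in> R.K" using y by (auto simp: einterval_reflect)
 note R = right_C_cases[OF r y X(1,2)] and Lc = R.right_C_cases[OF l y' X(1,2)]
 show ?thesis
 proof (cases "R.right_ok (- y0) (- y1) X")
  case True
  then show ?thesis using connects_if_ends_ok[OF y X(1,3,4)] R by blast
 next
  case False
  then have L1: "R.right_return (- y0) X" "m < R.mr"
   "!!t. - y0 <= t ==> ereal t < - a ==> R.mr < inv_sq rf t" using Lc m_inf_reflect by auto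
  show ?thesis
  proof (cases "right_ok y0 y1 X")
   case True
   have *: "warped.right_ok (- (- a)) (- (- b)) (\<lambda>y. f (- (- y))) (\<lambda>y. - (- V1 (- (- y)))) (- (- y0)) (- (- y1)) X"
    using True by simp
   have "R.connects (- y0) (- y1) X" by (rule R.connects_if_ends_ok[OF y' X(1) _ _ _ *]) (use X L1 hint_reflect_real y in auto)
   then show ?thesis using connects_reflect by blast
  next
   case F: False
   then have R1: "m < mr" "!!t. y0 <= t ==> ereal t < b ==> mr < V t" using R by auto
   have "m < min mr R.mr" using R1 L1 by simp
   then obtain z where z: "z \<in> K" "V z < min mr R.mr" by (rule m_inf_less)
   show ?thesis
   proof (cases "y0 <= z")
    case True
    then show ?thesis using R1(2)[of z] z K_bounds by auto
   next
    case False
    have "ereal (- z) < - a" using K_bounds(1)[OF z(1)] by (metis ereal_minus_less_minus uminus_ereal.simps(1))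
    then show ?thesis using L1(3)[of "- z"] z False by (auto simp: inv_sq_reflect)
   qed
  qed
 qed
qed

subsection \<open>Necessity\<close>

lemma sol_decreases:
 assumes s: "sol y p X" and T: "0 <= T" "T < X" "p T < 0"
 shows "\<exists>x\<in>{T<..X}. y x < y T"
proof -
 have TX: "T \<in> {0..X}" using T by auto
 have "p T / V (y T) < 0" using T Vpos[OF sol_in[OF s TX]] by (simp add: divide_neg_pos)
 moreover have "(y has_real_derivative p T / V (y T)) (at T within {0..X})" using s TX unfolding sol_def by blast
 ultimately obtain d where d: "d > 0" "!!h. h > 0 ==> T + h \<in> {0..X} ==> h < d ==> y (T + h) < y T"
  using has_real_derivative_neg_dec_right by metis
 define e where "e = min d (X - T) / 2"
 have e: "0 < e" "e < d" "T + e <= X" unfolding e_def using d T by (auto simp: min_def field_simps)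
 then show ?thesis using d(2)[of e] T by (intro bexI[of _ "T + e"]) auto
qed

text \<open>For levels just below \<open>mr\<close> there is no turning point to the right of
  \<open>c\<close>, so \<open>bstar c D = b\<close>, and these integrals come arbitrarily close to
  the one on level \<open>mr\<close>.\<close>

lemma d_at_nonneg:
 assumes c: "close c" and fin: "H mr (ereal c) b < \<infinity>"
 shows "0 <= d_at c"
proof -
 note cD = close_rightD[OF c]
 let ?g = "\<lambda>D. H D (ereal c) (bstar c D)"
 have "H mr (ereal c) b <= Limsup (at mr) ?g"
 proof (rule ccontr)
  assume "\<not> ?thesis"
  then have lt: "Limsup (at mr) ?g < H mr (ereal c) b" by simp
  have L0: "0 <= Limsup (at mr) ?g"
   by (rule order_trans[OF _ Liminf_le_Limsup]) (auto intro!: Liminf_bounded always_eventually hint_nonneg)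
  obtain D' where D': "D' < mr" "Limsup (at mr) ?g < H D' (ereal c) b"
   by (rule hint_approx_D[OF K_bounds(3)[OF cD(2)] order_refl lt L0]) (use cD(3) in \<open>auto intro: less_imp_le\<close>)
  have "eventually (\<lambda>D. ?g D < H D' (ereal c) b) (at mr)" using D'(2) by (rule Limsup_lessD)
  then have "eventually (\<lambda>D. ?g D < H D' (ereal c) b) (at_left mr)" using at_within_le_at by (rule filter_leD[rotated])
  then obtain w where w: "w < mr" "!!D. w < D ==> D < mr ==> ?g D < H D' (ereal c) b"
   using eventually_at_left[of D' mr] D'(1) by auto
  define D where "D = (max w D' + mr) / 2"
  have D: "w < D" "D' < D" "D < mr" unfolding D_def using w D' by auto
  have "bstar c D = b"
  proof (rule b_star_cases[OF cD(2)])
   show "D < V c" using cD(3)[of c] D K_bounds[OF cD(2)] by simp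
   fix r assume "r \<in> K" "c < r" "V r = D"
   then show ?thesis using cD(3)[of r] D K_bounds[of r] by simp
  qed
  then have "?g D = H D (ereal c) b" by simp
  moreover have "H D' (ereal c) b <= H D (ereal c) b" by (rule hint_mono_D) (use D cD(3) in \<open>auto intro: less_trans\<close>)
  ultimately show False using w(2)[of D] D by simp
 qed
 then show ?thesis unfolding d_at_def
  using fin hint_nonneg[of f mr "ereal c" b] by (cases "H mr (ereal c) b"; cases "Limsup (at mr) ?g") auto
qed


lemma V1_at_minimum:
 assumes "p \<in> K" "!!t. t \<in> K ==> V p <= V t"
 shows "V1 p = 0"
proof -
 obtain l where l: "l \<in> K" "l < p" by (rule K_lt[OF assms(1)])
 obtain r where r: "r \<in> K" "p < r" by (rule K_gt[OF assms(1)])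
 show ?thesis
 proof (rule DERIV_local_min[OF V1[OF assms(1)], of "min (p - l) (r - p)"])
  show "\<forall>y. \<bar>p - y\<bar> < min (p - l) (r - p) --> V p <= V y"
   using assms(2) in_K[OF l(1) r(1)] by (auto simp: abs_if split: if_splits)
 qed (use l r in auto)
qed

lemma V1_nonpos_left:
 assumes "r \<in> K" "!!t. t < r ==> t \<in> K ==> c <= t ==> V r < V t" "c < r" "c \<in> K"
 shows "V1 r <= 0"
proof (rule ccontr)
 assume "\<not> ?thesis"
 then have "V1 r > 0" by simp
 from DERIV_pos_inc_left[OF V1[OF assms(1)] this]
 obtain d where d: "d > 0" "!!h. 0 < h ==> h < d ==> V (r - h) < V r" by auto
 define h where "h = min (d / 2) (r - c)"
 have h: "0 < h" "h < d" "c <= r - h" unfolding h_def using d assms by auto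
 then have "r - h \<in> K" using in_K[OF assms(4,1)] by auto
 then show False using assms(2)[of "r - h"] d(2)[OF h(1,2)] h by auto
qed

text \<open>The levels at which a trajectory may turn on the left of a point close to \<open>b\<close>: either the
 excursion takes longer than half the prescribed time, or there are none.\<close>

lemma left_excursions_long:
 assumes c: "close c"
  and alt: "(\<exists>l\<in>K. V l = mr \<and> (\<forall>t. l < t --> ereal t < b --> mr < V t) \<and> ereal (X / 2) < H mr (ereal l) b)
    \<or> (\<exists>s\<in>K. \<exists>x>mr. \<forall>t\<in>K. t < s --> x < V t) \<and> (\<forall>t\<in>K. mr < V t)"
  and X: "0 < X"
 obtains D2 Z2 where "mr < D2" "Z2 \<in> K" "c <= Z2"
  "!!y0 D0 l. y0 \<in> K ==> Z2 <= y0 ==> D0 < D2 ==> \<forall>t. c <= t --> t < y0 --> D0 < V t ==>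
    l \<in> K ==> l < y0 ==> V l <= D0 ==> ereal (X / 2) < I mr l y0" using alt
proof (elim disjE bexE conjE)
 note cD = close_rightD[OF c]
 fix ab' assume ab: "ab' \<in> K" "V ab' = mr" "\<forall>t. ab' < t --> ereal t < b --> mr < V t" "ereal (X / 2) < H mr (ereal ab') b"
 have h0: "0 <= ereal (X / 2)" using X by simp
 obtain p q where pq: "ereal ab' < ereal p" "p < q" "ereal q < b" "ereal (X / 2) < I mr p q"
  by (rule hint_approx[OF K_bounds(3)[OF ab(1)] order_refl ab(4) h0])
 have K: "q \<in> K" using K_up[OF ab(1), of q] pq by auto
 have K: "p \<in> K" "q \<in> K" using in_K[OF ab(1) K, of p] K pq by auto
 define Z where "Z = max c q"
 have Z: "Z \<in> K" "c <= Z" "q <= Z" unfolding Z_def using cD(2) K by (auto simp: max_def)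
 have pZ: "p <= Z" using pq Z by simp
 obtain w where w: "w \<in> {p..Z}" "!!t. t \<in> {p..Z} ==> V w <= V t" by (rule V_min[OF K(1) Z(1) pZ]) (rule that)
 have "w \<in> K" using w in_K[OF K(1) Z(1)] by auto
 then have gt: "mr < V w" using ab(3) w pq K_bounds by auto
 show thesis
 proof (rule that[OF gt Z(1,2)])
  fix y0 D0 l assume h: "y0 \<in> K" "Z <= y0" "D0 < V w" "\<forall>t. c <= t --> t < y0 --> D0 < V t"
   "l \<in> K" "l < y0" "V l <= D0"
  have "l < p"
  proof (rule ccontr)
   assume np: "\<not> l < p"
   show False
   proof (cases "l <= Z")
    case True
    then show False using w(2)[of l] np h by auto
   next
    case False
    then have "c <= l" using Z by simp
    then show False using h(4)[rule_format, of l] h(6,7) by simp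
   qed
  qed
  then have "I mr p q <= I mr l y0" using Z h by (intro hint_mono_set) auto
  then show "ereal (X / 2) < I mr l y0" using pq(4) by simp
 qed
next
 note cD = close_rightD[OF c]
 fix s assume s: "s \<in> K" "\<forall>t\<in>K. mr < V t" and "\<exists>x>mr. \<forall>t\<in>K. t < s --> x < V t"
 then obtain x where x: "mr < x" "!!t. t \<in> K ==> t < s ==> x < V t" by blast
 define s' where "s' = min s c"
 have s': "s' \<in> K" "s' <= s" "s' <= c" unfolding s'_def using s cD(2) by (auto simp: min_def)
 obtain w where w: "w \<in> {s'..c}" "!!t. t \<in> {s'..c} ==> V w <= V t" by (rule V_min[OF s'(1) cD(2) s'(3)]) (rule that)
 have "w \<in> K" using w in_K[OF s'(1) cD(2)] by auto
 then have gt: "mr < min x (V w)" using x s by auto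
 show thesis
 proof (rule that[OF gt cD(2) order_refl])
  fix y0 D0 l assume h: "y0 \<in> K" "c <= y0" "D0 < min x (V w)" "\<forall>t. c <= t --> t < y0 --> D0 < V t"
   "l \<in> K" "l < y0" "V l <= D0"
  have False
  proof -
   consider "l < s'" | "l \<in> {s'..c}" | "c < l" by fastforce
   then show False
   proof cases
    case 1
    then show False using x(2)[of l] h s' by auto
   next
    case 2
    then show False using w(2)[OF 2] h by auto
   next
    case 3
    then show False using h(4)[rule_format, of l] h(6,7) by simp
   qed
  qed
  then show "ereal (X / 2) < I mr l y0" ..
 qed
qed

text \<open>\<open>X\<close> is taken between \<open>2 * d\<close> and \<open>L\<close>, and below
  \<open>2 * i\<close> if \<open>m < mr\<close>. From a height \<open>y0\<close> close enough to
  \<open>b\<close>, a round trip to the right takes less than \<open>X\<close>, whereas a dip below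
  \<open>y0\<close> takes more than \<open>X / 2\<close> each way. A trajectory that returns to
  \<open>y0\<close> at time \<open>X\<close> can therefore never go below \<open>y0\<close>, but
  after its first round trip to the right it does.\<close>

lemma not_connected_near_right:
 assumes conn: "!!y0 X. y0 \<in> K ==> 0 < X ==> ereal X < L ==> connects y0 y0 X"
  and c: "close c" and fin: "H mr (ereal c) b < \<infinity>"
  and dL: "2 * d_at c < L" and L0: "0 < L" and di: "m < mr ==> d_at c < i_at c"
  and nR: "\<not> ((\<forall>t\<in>K. m < V t) \<and> m_left a f = ereal (m) \<and> m_right b f = ereal (m))"
 shows False
proof -
 note cD = close_rightD[OF c]
 let ?m = "m"
 have m_le: "?m <= mr"
 proof (rule ccontr)
  assume "\<not> ?thesis"
  then have "mr < ?m" by simp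
  then obtain t where "c < t" "t \<in> K" "V t < ?m" by (rule near_right[OF cD(1) _ cD(2)])
  then show False using m_inf_le[of t] by simp
 qed
 have d0: "0 <= d_at c" by (rule d_at_nonneg[OF c fin])
 obtain d where d: "d_at c = ereal d" "0 <= d" using dL d0 by (cases "d_at c") auto
 \<comment> \<open>\<open>i_at c\<close> is an infimum over the levels in \<open>{m <.. mr}\<close>,
   which exist only if \<open>m < mr\<close>.\<close>
 define U where "U = (if ?m < mr then min L (2 * i_at c) else L)"
 have "ereal (2 * d) < U"
 proof -
  have "ereal (2 * d) < L" using dL d by simp
  moreover have "ereal (2 * d) < 2 * i_at c" if "?m < mr" using di[OF that] d by (cases "i_at c") auto
  ultimately show ?thesis unfolding U_def by simp
 qed
 then obtain X where E: "ereal (2 * d) < ereal X" "ereal X < U" using ereal_dense2 by blast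
 have X: "2 * d < X" "0 < X" "ereal X < L" using E d unfolding U_def by (auto split: if_splits)
 have Di: "ereal (X / 2) < i_at c" if "?m < mr" using E(2) that unfolding U_def by (cases "i_at c") auto
 obtain T where T: "H mr (ereal c) b = ereal T" "0 <= T" by (rule d_at_nonneg_real[OF fin])
 let ?g = "\<lambda>D. H D (ereal c) (bstar c D)"
 have Lim: "Limsup (at mr) ?g = ereal (T + d)" using d(1) T unfolding d_at_def by (cases "Limsup (at mr) ?g") auto
 \<comment> \<open>The midpoint of \<open>T + d\<close> and \<open>T + X / 2\<close>: levels
   slightly above \<open>mr\<close> have times below \<open>B\<close>, and the gap up to
   \<open>T + X / 2\<close> is left for the position of \<open>y0\<close>.\<close>
 define B where "B = T + d / 2 + X / 4"
 have B: "T + d < B" "B < T + X / 2" unfolding B_def using X by auto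
 have "eventually (\<lambda>D. ?g D < ereal B) (at mr)" by (rule Limsup_lessD) (use Lim B in simp)
 then have "eventually (\<lambda>D. ?g D < ereal B) (at_right mr)" using at_within_le_at by (rule filter_leD[rotated])
 then obtain D1 where D1: "mr < D1" "!!D. mr < D ==> D < D1 ==> ?g D < ereal B"
  unfolding eventually_at_right[OF less_add_one[of mr]] by auto
 \<comment> \<open>how close to \<open>b\<close> the base point has to be\<close>
 define k where "k = (if ?m < mr \<and> i_at c \<noteq> \<infinity> then min (T + X / 2 - B) (real_of_ereal (i_at c) - X / 2) else T + X / 2 - B)"
 have k0: "0 < k" using B Di unfolding k_def by (cases "i_at c") auto
 have k1: "k <= T + X / 2 - B" unfolding k_def by auto
 have k2: "ereal (X / 2) + ereal k <= i_at c" if "?m < mr"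
 proof (cases "i_at c")
  case (real r)
  then have "k <= r - X / 2" using that unfolding k_def by simp
  then show ?thesis using real by simp
 qed (use Di[OF that] in auto)
 obtain Z where Z: "Z \<in> K" "c <= Z" "H mr (ereal Z) b < ereal k"
 proof (cases "T < k")
  case True
  then show ?thesis using that[of c] cD(2) T by simp
 next
  case False
  then have "ereal (T - k) < H mr (ereal c) b" "0 <= ereal (T - k)" using T k0 by auto
  then obtain p q where pq: "ereal c < ereal p" "p < q" "ereal q < b" "ereal (T - k) < I mr p q"
   by (rule hint_approx[OF K_bounds(3)[OF cD(2)] order_refl])
  have qK: "q \<in> K" using K_up[OF cD(2)] pq by auto
  have "I mr p q <= I mr c q" using pq by (intro hint_mono_set) auto
  then have "ereal (T - k) < I mr c q" using pq(4) by simp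
  moreover have "H mr (ereal c) b = I mr c q + H mr (ereal q) b" by (rule hint_add) (use pq K_bounds[OF cD(2)] in auto)
  ultimately have "H mr (ereal q) b < ereal k" using T hint_nonneg[of f mr "ereal q" b]
   by (cases "I mr c q"; cases "H mr (ereal q) b") auto
  then show ?thesis using that[of q] qK pq by simp
 qed
 \<comment> \<open>If \<open>V\<close> comes down to \<open>mr\<close> somewhere, the last such
   point \<open>l\<close> is far away in time: by \<open>X < 2 * i\<close> if \<open>m < mr\<close>,
   and because it is critical if \<open>m = mr\<close>. Otherwise \<open>V > mr = m\<close>
   throughout, and \<open>nR\<close> keeps \<open>V\<close> away from \<open>m\<close> near
   \<open>a\<close>.\<close>
 have alt: "(\<exists>l\<in>K. V l = mr \<and> (\<forall>t. l < t --> ereal t < b --> mr < V t) \<and> ereal (X / 2) < H mr (ereal l) b)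
    \<or> (\<exists>s\<in>K. \<exists>x>mr. \<forall>t\<in>K. t < s --> x < V t) \<and> (\<forall>t\<in>K. mr < V t)"
 proof (cases "\<exists>t\<in>K. V t <= mr")
  case True
  then obtain t0 where t0: "t0 \<in> K" "V t0 <= mr" by blast
  have Dc: "mr < V c" using cD(3)[of c] K_bounds[OF cD(2)] by simp
  show ?thesis
  proof (rule a_star_cases[OF cD(2) Dc])
   assume h: "!!t. t <= c ==> a < ereal t ==> mr < V t"
   show ?thesis using h[of t0] cD(3)[of t0] t0 K_bounds[OF t0(1)] by (cases "t0 <= c") auto
  next
   fix l assume h: "astar c mr = ereal l" "l \<in> K" "l < c" "V l = mr" "!!t. l < t ==> t <= c ==> mr < V t"
   have gt: "mr < V t" if "l < t" "ereal t < b" for t using h(5) that cD(3)[of t] by (cases "t <= c") auto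
   have "ereal (X / 2) < H mr (ereal l) b"
   proof (cases "?m < mr")
    case True
    then have "i_at c <= H mr (astar c mr) b" unfolding i_at_def by (intro INF_lower) auto
    then show ?thesis using Di[OF True] h(1) by simp
   next
    case False
    then have "V1 l = 0" using m_inf_le m_le h by (intro V1_at_minimum) auto
    then have "I (V l) l c = \<infinity>" by (rule hint_critical_left[OF h(2) _ cD(2) h(3)]) (use h in auto)
    moreover have "I mr l c <= H mr (ereal l) b" using K_bounds[OF cD(2)] by (intro hint_mono_set) auto
    ultimately show ?thesis using h(4) by simp
   qed
   then show ?thesis using h gt by blast
  qed
 next
  case False
  then have all: "\<forall>t\<in>K. mr < V t" by force
  have "\<not> ?m < mr" using m_inf_less[of mr] all by (metis less_asym)
  then have meq: "?m = mr" using m_le by simp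
  have "m_right b f = ereal mr" by (rule m_right_real[OF cD(1)])
  then have "m_left a f \<noteq> ereal mr" using nR meq all by simp
  interpret R: warped "- b" "- a" rf rV1 rV2 by (rule warped_reflect)
  have ml: "m_left a f = m_right (- a) rf" using m_left_reflect[OF R.ab, of rf] by simp
  have "ereal mr <= m_right (- a) rf"
  proof (rule m_right_ge[OF R.ab R.ab])
   fix t assume "- b < ereal t" "ereal t < - a"
   then have "- t \<in> K" unfolding einterval_reflect[symmetric] by (simp add: einterval_iff)
   then show "mr <= inv_sq rf t" using all by (auto simp: inv_sq_reflect less_imp_le)
  qed
  then have "ereal mr < m_left a f" using ml \<open>m_left a f \<noteq> ereal mr\<close> by simp
  then obtain x where x: "ereal mr < ereal x" "ereal x < m_left a f" using ereal_dense2 by blast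
  obtain s where s: "s < - a" "!!t. s < ereal t ==> ereal t < - a ==> ereal x < ereal (inv_sq rf t)"
   by (rule m_right_gtD[OF R.ab x(2)[unfolded ml]]) (rule that)
  have mx: "max s (- b) < - a" using s(1) R.ab by simp
  obtain s1 where s1: "max s (- b) < ereal s1" "ereal s1 < - a" using ereal_dense2[OF mx] by blast
  then have s1K: "- s1 \<in> K" unfolding einterval_reflect[symmetric] by (simp add: einterval_iff)
  have "x < V t" if "t \<in> K" "t < - s1" for t
  proof -
   have "- t \<in> R.K" using that by (simp add: einterval_reflect)
   then have "ereal (- t) < - a" by (simp add: einterval_iff)
   moreover have "s < ereal (- t)"
   proof -
    have "s < ereal s1" using s1(1) by simp
    also have "ereal s1 < ereal (- t)" using that by simp
    finally show ?thesis .
   qed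
   ultimately show ?thesis using s(2)[of "- t"] by (simp add: inv_sq_reflect)
  qed
  then have "\<exists>s\<in>K. \<exists>x>mr. \<forall>t\<in>K. t < s --> x < V t"
   using s1K x(1) by (intro bexI[of _ "- s1"] exI[of _ x]) auto
  then show ?thesis using all by blast
 qed
 obtain D2 Z2 where Z2: "mr < D2" "Z2 \<in> K" "c <= Z2" and
  long: "!!y0 D0 l. y0 \<in> K ==> Z2 <= y0 ==> D0 < D2 ==> \<forall>t. c <= t --> t < y0 --> D0 < V t ==>
    l \<in> K ==> l < y0 ==> V l <= D0 ==> ereal (X / 2) < I mr l y0"
  by (rule left_excursions_long[OF c alt X(2)]) (rule that)
 define Z3 where "Z3 = max Z Z2"
 have Z3: "Z3 \<in> K" "Z <= Z3" "Z2 <= Z3" "c <= Z3" unfolding Z3_def using Z Z2 by (auto simp: max_def)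
 obtain w where w: "w \<in> {c..Z3}" "!!t. t \<in> {c..Z3} ==> V w <= V t" by (rule V_min[OF cD(2) Z3(1,4)]) (rule that)
 have "w \<in> K" using w in_K[OF cD(2) Z3(1)] by auto
 then have "mr < V w" using cD(3)[of w] w K_bounds by auto
 then have "mr < min (min D1 D2) (V w)" using D1 Z2 by simp
 then obtain D0 where D0: "mr < D0" "D0 < min (min D1 D2) (V w)" using dense by blast
 have D0c: "D0 < V c" using w(2)[of c] D0 Z3 by auto
 \<comment> \<open>The starting height is itself a turning point, so \<open>V > D0\<close> between
   \<open>c\<close> and \<open>y0\<close>. A critical point there would make the time on level
   \<open>D0\<close> infinite, hence \<open>V1 y0 < 0\<close>.\<close>
 obtain y0 where y0: "bstar c D0 = ereal y0" "y0 \<in> K" "c < y0" "V y0 = D0" "!!t. c <= t ==> t < y0 ==> D0 < V t"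
 proof (rule b_star_cases[OF cD(2) D0c])
  assume h: "!!t. c <= t ==> ereal t < b ==> D0 < V t"
  obtain t where "c < t" "t \<in> K" "V t < D0" by (rule near_right[OF cD(1) D0(1) cD(2)])
  then show thesis using h[of t] K_bounds by auto
 next
  fix v assume "bstar c D0 = ereal v" "v \<in> K" "c < v" "V v = D0" "!!t. c <= t ==> t < v ==> D0 < V t"
  then show thesis by (rule that)
 qed
 have y0Z: "Z3 < y0" using w(2)[of y0] D0 y0 by (force simp: not_less[symmetric])
 have V1y0: "V1 y0 < 0"
 proof -
  have "V1 y0 <= 0" by (rule V1_nonpos_left[OF y0(2) _ y0(3) cD(2)]) (use y0 in auto)
  moreover have "V1 y0 \<noteq> 0"
  proof
   assume "V1 y0 = 0"
   then have "I (V y0) c y0 = \<infinity>" by (rule hint_critical_right[OF y0(2) _ cD(2) y0(3)]) (use y0 in auto)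
   then show False using D1(2)[OF D0(1)] D0(2) y0 by simp
  qed
  ultimately show ?thesis by simp
 qed
 obtain y p where s: "sol y p X" and i: "y 0 = y0" "y X = y0" using conn[OF y0(2) X(2,3)] unfolding connects_def by blast
 define D where "D = V (y 0) - (p 0)\<^sup>2"
 have en: "V (y x) = D + (p x)\<^sup>2" if "x \<in> {0..X}" for x using sol_energy[OF s that] unfolding D_def by simp
 have DD0: "D <= D0" unfolding D_def using i y0 by simp
 have y0b: "H mr (ereal y0) b < ereal k"
 proof -
  have "H mr (ereal y0) b <= H mr (ereal Z) b" using y0Z Z3 by (intro hint_mono_set) auto
  then show ?thesis using Z(3) by simp
 qed
 have above: "y0 <= y x" if x: "x \<in> {0..X}" for x
 proof (rule ccontr)
  assume lt: "\<not> y0 <= y x"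
  obtain xm where xm: "xm \<in> {0..X}" "!!x. x \<in> {0..X} ==> y xm <= y x"
  proof -
   have "\<exists>xm\<in>{0..X}. \<forall>x\<in>{0..X}. y xm <= y x" using sol_cont(1)[OF s] X by (intro continuous_attains_inf) auto
   then show thesis using that by blast
  qed
  define l where "l = y xm"
  have l: "l \<in> K" "l < y0" using sol_in[OF s xm(1)] xm(2)[OF x] lt unfolding l_def by auto
  have xm': "0 < xm" "xm < X" using xm(1) l i unfolding l_def by (auto simp: less_le)
  have pm: "p xm = 0" by (rule sol_interior_min[OF s xm'(1,2) xm(2)])
  have VD: "V l = D" using en[OF xm(1)] pm unfolding l_def by simp
  have time: "\<not> ereal (X / 2) < I D' l y0" if "D' <= D" for D'
  proof
   assume lt: "ereal (X / 2) < I D' l y0"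
   have "I D' l y0 <= ereal \<bar>0 - xm\<bar>" "I D' l y0 <= ereal \<bar>X - xm\<bar>"
    using travel_le[OF s xm(1), of 0 D'] travel_le[OF s xm(1), of X D'] that i X unfolding D_def l_def by auto
   then have "ereal (X / 2) < ereal xm" "ereal (X / 2) < ereal (X - xm)" using lt xm' by (auto dest: less_le_trans)
   then show False by simp
  qed
  show False
  proof (cases "mr <= D")
   case True
   have "ereal (X / 2) < I mr l y0" by (rule long[OF y0(2) _ _ _ l]) (use y0(5) y0Z Z3 D0 VD DD0 in auto)
   then show False using time[OF True] by simp
  next
   case False
   \<comment> \<open>On such a level nothing turns close to \<open>b\<close>, and
     \<open>i_at c\<close> bounds from below the time from the turning point \<open>l'\<close> to
     \<open>b\<close>, of which less than \<open>k\<close> is spent beyond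
     \<open>y0\<close>.\<close>
   then have Dlt: "D < mr" by simp
   have mD: "?m <= D" using m_inf_le[OF l(1)] VD by simp
   show False
   proof (cases "?m = D")
    case True
    then have "V1 l = 0" using m_inf_le VD l by (intro V1_at_minimum) auto
    then have "y 0 = y xm" using sol_equilibrium(1)[OF s xm(1) pm, of 0] X unfolding l_def by simp
    then show False using l i unfolding l_def by simp
   next
    case False
    then have mD': "?m < D" using mD by simp
    then have mm: "?m < mr" using Dlt by simp
    have Dc: "D < V c" using Dlt cD(3)[of c] K_bounds[OF cD(2)] by simp
    have ac: "l < c" using cD(3)[of l] VD Dlt K_bounds[OF l(1)] by force
    obtain l' where l': "astar c D = ereal l'" "l' \<in> K" "l' < c" "V l' = D" "!!t. l' < t ==> t <= c ==> D < V t"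
    proof (rule a_star_cases[OF cD(2) Dc])
     assume "!!t. t <= c ==> a < ereal t ==> D < V t"
     from this[of l] show thesis using ac VD K_bounds[OF l(1)] by simp
    next
     fix v assume "astar c D = ereal v" "v \<in> K" "v < c" "V v = D" "!!t. v < t ==> t <= c ==> D < V t"
     then show thesis by (rule that)
    qed
    have "l <= l'" using l'(5)[of l] VD ac by force
    have "i_at c <= H D (astar c D) b" unfolding i_at_def using mD' Dlt by (intro INF_lower) auto
    also have "\<dots> = I D l' y0 + H D (ereal y0) b" unfolding l'(1) by (rule hint_add) (use l' y0 K_bounds in auto)
    also have "\<dots> <= I D l y0 + H mr (ereal y0) b"
    proof (rule add_mono)
     show "I D l' y0 <= I D l y0" using \<open>l <= l'\<close> by (intro hint_mono_set) auto
     show "H D (ereal y0) b <= H mr (ereal y0) b" by (rule hint_mono_D) (use Dlt cD(3) y0 in auto)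
    qed
    also have "\<dots> < ereal (X / 2) + ereal k"
    proof -
     have "I D l y0 <= ereal (X / 2)" using time[OF order_refl] by simp
     then show ?thesis using y0b hint_nonneg[of f D "ereal l" "ereal y0"] hint_nonneg[of f mr "ereal y0" b]
      by (cases "I D l y0"; cases "H mr (ereal y0) b") auto
    qed
    finally show False using k2[OF mm] by simp
   qed
  qed
 qed
 have T0: "0 \<in> {0..X}" using X by simp
 have p0: "p 0 > 0"
 proof (rule ccontr)
  assume "\<not> p 0 > 0"
  then consider "p 0 < 0" | "p 0 = 0" by linarith
  then have "\<exists>x\<in>{0<..X}. y x < y 0"
  proof cases
   case 1
   then show ?thesis using sol_decreases[OF s _ X(2)] by simp
  next
   case 2
   then show ?thesis using sol_leaves_left[OF s _ X(2)] V1y0 i by simp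
  qed
  then obtain x where "x \<in> {0<..X}" "y x < y 0" by blast
  then show False using above[of x] i by simp
 qed
 have DltD0: "D < D0" unfolding D_def using i y0 p0 by simp
 obtain xm where xm: "xm \<in> {0..X}" "!!x. x \<in> {0..X} ==> y x <= y xm"
 proof -
  have "\<exists>xm\<in>{0..X}. \<forall>x\<in>{0..X}. y x <= y xm" using sol_cont(1)[OF s] X by (intro continuous_attains_sup) auto
  then show thesis using that by blast
 qed
 have xm': "0 < xm" "xm < X"
 proof -
  have "\<exists>x\<in>{0<..X}. - y x < - y 0"
  proof -
   interpret R: warped "- b" "- a" rf rV1 rV2 by (rule warped_reflect)
   show ?thesis using R.sol_decreases[OF sol_reflect1[OF s] _ X(2)] p0 by simp
  qed
  then obtain x where "x \<in> {0<..X}" "y 0 < y x" by auto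
  then have "y0 < y xm" using xm(2)[of x] i by auto
  then have "xm \<noteq> 0" "xm \<noteq> X" using i by auto
  then show "0 < xm" "xm < X" using xm(1) by auto
 qed
 have pm: "p xm = 0" by (rule sol_interior_max[OF s xm'(1,2) xm(2)])
 define r' where "r' = y xm"
 have r': "r' \<in> K" "V r' = D" "y0 <= r'" using sol_in[OF s xm(1)] en[OF xm(1)] pm above[OF xm(1)] unfolding r'_def by auto
 have Dmr: "mr < D" using cD(3)[of r'] r' y0 K_bounds by auto
 have Dc: "D < V c" using DltD0 D0c by simp
 obtain v where v: "bstar c D = ereal v" "v \<in> K" "c < v" "V v = D" "!!t. c <= t ==> t < v ==> D < V t"
 proof (rule b_star_cases[OF cD(2) Dc])
  assume h: "!!t. c <= t ==> ereal t < b ==> D < V t"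
  show thesis using h[of r'] r' y0 K_bounds by auto
 next
  fix v assume "bstar c D = ereal v" "v \<in> K" "c < v" "V v = D" "!!t. c <= t ==> t < v ==> D < V t"
  then show thesis by (rule that)
 qed
 have by': "y0 < v"
 proof (rule ccontr)
  assume "\<not> ?thesis"
  then show False using y0(4) y0(5)[of v] v DltD0 by (cases "v = y0") auto
 qed
 have bb: "v <= r'" using v(5)[of r'] r' y0 by force
 have gB: "I D c v < ereal B" using D1(2)[OF Dmr] DltD0 D0 v(1) by simp
 have cs: "csol y0 r' y p X" by (rule sol_csol[OF s]) (use above xm(2) in \<open>auto simp: r'_def\<close>)
 obtain t1 where t1: "t1 \<in> {0<..X}" "y t1 = v" "ereal t1 = I D y0 v"
 proof (rule run_right[OF y0(2) r'(1) cs])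
  assume "\<forall>x\<in>{0..X}. y 0 <= y x \<and> y x < v \<and> (x \<noteq> 0 --> y 0 < y x \<and> p x > 0) \<and> ereal x = I D (y 0) (y x)"
  then show thesis using xm(1) bb unfolding r'_def by (meson not_less)
 qed (use i by' bb v(5) y0 p0 D_def that in auto)
 have pt1: "p t1 = 0" using en[of t1] t1 v by auto
 \<comment> \<open>On level \<open>D\<close> the leg from \<open>c\<close> to \<open>v\<close> takes
   less than \<open>B\<close> and its part up to \<open>y0\<close> more than \<open>T - k\<close>,
   so \<open>t1 < B - T + k <= X / 2\<close>.\<close>
 have "2 * t1 < X"
 proof -
  have 1: "I D c v = I D c y0 + I D y0 v" by (rule hint_add) (use y0 v by' cD(2) K_bounds in auto)
  have 2: "H mr (ereal c) b = I mr c y0 + H mr (ereal y0) b" by (rule hint_add) (use y0 cD(2) K_bounds in auto)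
  have 3: "I mr c y0 <= I D c y0" by (rule hint_mono_D) (use Dmr v by' in auto)
  have "ereal (T - k) < I mr c y0" using 2 T y0b hint_nonneg[of f mr "ereal c" "ereal y0"] hint_nonneg[of f mr "ereal y0" b]
   by (cases "I mr c y0"; cases "H mr (ereal y0) b") auto
  then have "ereal (T - k) < I D c y0" using 3 by simp
  then have "ereal (T - k + t1) < ereal B" using 1 gB t1(3)[symmetric] by (cases "I D c y0") auto
  then show ?thesis using k1 by simp
 qed
 then have t2: "t1 + t1 <= X" "2 * t1 < X" "0 < t1" using t1 by auto
 have e: "t1 + t1 = 2 * t1" "t1 - t1 = 0" by simp_all
 have y2: "y (2 * t1) = y0" using sol_bounce(1)[OF s less_imp_le[OF t2(3)] pt1 less_imp_le[OF t2(3)] order_refl t2(1)] unfolding e i(1) .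
 have "p (2 * t1) = - p 0" using sol_bounce(2)[OF s less_imp_le[OF t2(3)] pt1 less_imp_le[OF t2(3)] order_refl t2(1)] unfolding e .
 then have p2: "p (2 * t1) < 0" using p0 by linarith
 have "\<exists>x\<in>{2 * t1<..X}. y x < y (2 * t1)" by (rule sol_decreases[OF s _ t2(2) p2]) (use t2(3) in simp)
 then obtain x where "x \<in> {2 * t1<..X}" "y x < y0" using y2 by auto
 then show False using above[of x] t2 by auto
qed


section \<open>Oscillating trajectories\<close>

lemma first_leg:
 assumes s: "sol y p X" and X: "0 <= X" and p0: "p 0 > 0" and D: "D = V (y 0) - (p 0)\<^sup>2"
  and q: "q \<in> K" "y 0 < q" "V q = D" "!!t. y 0 <= t ==> t < q ==> D < V t"
 shows "(ereal X < I D (y 0) q \<and>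
      (\<forall>x\<in>{0..X}. y 0 <= y x \<and> y x < q \<and> p x > 0 \<and> ereal x = I D (y 0) (y x)))
    \<or> (\<exists>R\<in>{0<..X}. ereal R = I D (y 0) q \<and> y R = q \<and> p R = 0 \<and>
      (\<forall>x\<in>{0..R}. y 0 <= y x \<and> y x <= q \<and> ereal x = I D (y 0) (y x)) \<and> (\<forall>x\<in>{0..<R}. p x > 0))"
proof -
 obtain l0 r0 where lr0: "l0 \<in> K" "r0 \<in> K" "!!x. x \<in> {0..X} ==> l0 <= y x \<and> y x <= r0"
  using sol_range[OF s X] by metis
 define r where "r = max r0 q"
 have r: "r \<in> K" "q <= r" unfolding r_def using lr0 q by (auto simp: max_def)
 have cs: "csol l0 r y p X" by (rule sol_csol[OF s]) (use lr0 in \<open>force simp: r_def\<close>)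
 have X0: "0 \<in> {0..X}" using X by simp
 have yK: "y 0 \<in> K" using sol_in[OF s X0] .
 show ?thesis
 proof (rule run_right[OF lr0(1) r(1) cs])
  fix R assume R: "R \<in> {0<..X}" "y R = q" "\<forall>x'\<in>{0..R}. y 0 <= y x' \<and> y x' <= q" "\<forall>x'\<in>{0<..<R}. p x' > 0"
   "ereal R = I D (y 0) q"
  have "p R = 0" using sol_energy[OF s, of R] R q D by simp
  moreover have "ereal x = I D (y 0) (y x)" if x: "x \<in> {0..R}" for x
  proof (rule antisym)
   show "ereal x <= I D (y 0) (y x)" using travel_ge[OF s, of 0 x D] R x D by auto
   show "I D (y 0) (y x) <= ereal x" using travel_le[OF s, of 0 x D] R x D X0 by auto
  qed
  moreover have "p x > 0" if "x \<in> {0..<R}" for x using R(4) p0 that by (cases "x = 0") auto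
  ultimately show ?thesis using R by (intro disjI2 bexI[of _ R]) auto
 next
  assume *: "\<forall>x\<in>{0..X}. y 0 <= y x \<and> y x < q \<and> (x \<noteq> 0 --> y 0 < y x \<and> p x > 0) \<and> ereal x = I D (y 0) (y x)"
  then have **: "y 0 <= y X" "y X < q" "ereal X = I D (y 0) (y X)" using X by auto
  have yX: "y X \<in> K" by (rule sol_in[OF s]) (use X in simp)
  have "I D (y 0) q = ereal X + I D (y X) q" unfolding **(3) by (rule hint_add) (use ** yK q(1) K_bounds in auto)
  moreover have "0 < I D (y X) q" by (rule hint_pos) (use ** yX q K_bounds in auto)
  ultimately have "ereal X < I D (y 0) q" by (cases "I D (y X) q") auto
  moreover have "\<forall>x\<in>{0..X}. y 0 <= y x \<and> y x < q \<and> p x > 0 \<and> ereal x = I D (y 0) (y x)"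
  proof
   fix x assume "x \<in> {0..X}"
   with * p0 show "y 0 <= y x \<and> y x < q \<and> p x > 0 \<and> ereal x = I D (y 0) (y x)" by (cases "x = 0") auto
  qed
  ultimately show ?thesis by blast
 qed (use lr0 X0 q r D p0 in auto)
qed

text \<open>On the outward leg time is a strictly increasing function of height, and
  \<open>sol_bounce\<close> makes the way back its mirror image; so within one round trip the height
  is at least \<open>s1\<close> exactly between the two passages of \<open>s1\<close>. An infinite
  \<open>R\<close> means an outward leg that never ends, and the extended inequalities cover
  this.\<close>

lemma excursion_right:
 assumes s: "sol y p X" and X: "0 <= X" and p0: "p 0 > 0" and D: "D = V (y 0) - (p 0)\<^sup>2"
  and q: "q \<in> K" "y 0 < q" "V q = D" "!!z. y 0 <= z ==> z < q ==> D < V z" and R: "R = I D (y 0) q"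
 shows "ereal X <= 2 * R ==> y 0 <= y X"
  and "ereal X <= 2 * R ==> y 0 < s1 ==> s1 <= q ==>
    s1 <= y X \<longleftrightarrow> I D (y 0) s1 <= ereal X \<and> ereal X <= R + I D s1 q"
  and "2 * R <= ereal X ==> \<exists>r>0. R = ereal r \<and> 2 * r <= X \<and> y (2 * r) = y 0 \<and> p (2 * r) = - p 0"
proof -
 have X0: "0 \<in> {0..X}" "X \<in> {0..X}" using X by auto
 have yK: "y 0 \<in> K" using sol_in[OF s X0(1)] .
 have R0: "0 < R" unfolding R by (rule hint_pos) (use yK q K_bounds in auto)
 have split: "R = I D (y 0) u + I D u q" if "y 0 <= u" "u <= q" for u unfolding R by (rule hint_add) (use that yK q K_bounds in auto)
 have pos: "0 < I D u v" if "y 0 <= u" "u < v" "v <= q" for u v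
 proof (rule hint_pos)
  show "a <= ereal u" "ereal v <= b" using K_bounds in_K[OF yK q(1)] that by auto
 qed (use that q in auto)
 have iff: "s1 <= y x \<longleftrightarrow> I D (y 0) s1 <= ereal x"
  if x: "y 0 <= y x" "y x <= q" "ereal x = I D (y 0) (y x)" and s1: "y 0 < s1" "s1 <= q" for x s1
 proof
  assume "s1 <= y x"
  then show "I D (y 0) s1 <= ereal x" unfolding x(3) by (intro hint_mono_set) auto
 next
  assume le: "I D (y 0) s1 <= ereal x"
  show "s1 <= y x"
  proof (rule ccontr)
   assume lt: "\<not> s1 <= y x"
   have yx: "y x \<in> K" using in_K[OF yK q(1)] x by simp
   have s1K: "s1 \<in> K" using in_K[OF yK q(1)] s1 by simp
   have "I D (y 0) s1 = ereal x + I D (y x) s1" unfolding x(3) by (rule hint_add) (use x lt yK s1K K_bounds in auto)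
   moreover have "0 < I D (y x) s1" by (rule pos) (use x lt s1 in auto)
   ultimately show False using le by (cases "I D (y x) s1") auto
  qed
 qed
 have cases: "(ereal X < R \<and>
      (\<forall>x\<in>{0..X}. y 0 <= y x \<and> y x < q \<and> p x > 0 \<and> ereal x = I D (y 0) (y x)))
    \<or> (\<exists>r\<in>{0<..X}. ereal r = R \<and> y r = q \<and> p r = 0 \<and>
      (\<forall>x\<in>{0..r}. y 0 <= y x \<and> y x <= q \<and> ereal x = I D (y 0) (y x)) \<and> (\<forall>x\<in>{0..<r}. p x > 0))"
  unfolding R by (rule first_leg[OF s X p0 D q])
 have both: "y 0 <= y X \<and> (y 0 < s1 --> s1 <= q -->
    (s1 <= y X \<longleftrightarrow> I D (y 0) s1 <= ereal X \<and> ereal X <= R + I D s1 q))"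
  if le: "ereal X <= 2 * R" for s1 using cases
 proof (elim disjE bexE conjE)
  assume XR: "ereal X < R" and *: "\<forall>x\<in>{0..X}. y 0 <= y x \<and> y x < q \<and> p x > 0 \<and> ereal x = I D (y 0) (y x)"
  have i: "y 0 <= y X" "y X <= q" "ereal X = I D (y 0) (y X)" using *[rule_format, OF X0(2)] by (simp_all add: less_imp_le)
  have "ereal X <= R + I D s1 q" using XR hint_nonneg[of f D "ereal s1" "ereal q"] by (simp add: add_increasing2 less_imp_le)
  then show ?thesis using iff[OF i] i by simp
 next
  fix r assume r: "r \<in> {0<..X}" "ereal r = R" "y r = q" "p r = 0"
   and *: "\<forall>x\<in>{0..r}. y 0 <= y x \<and> y x <= q \<and> ereal x = I D (y 0) (y x)"
  have X2: "X <= 2 * r" using le r(2)[symmetric] by simp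
  define t where "t = X - r"
  have t: "0 <= t" "t <= r" "r + t <= X" unfolding t_def using X2 r by auto
  have yX: "y X = y (r - t)" using sol_bounce(1)[OF s _ r(4) t] r unfolding t_def by simp
  have i: "y 0 <= y (r - t)" "y (r - t) <= q" "ereal (r - t) = I D (y 0) (y (r - t))" using *[rule_format, of "r - t"] t by auto
  show ?thesis
  proof (intro conjI impI)
   show "y 0 <= y X" using i yX by simp
   assume s1: "y 0 < s1" "s1 <= q"
   have sp: "ereal r = I D (y 0) s1 + I D s1 q" using split[of s1] s1 r(2) by simp
   have "s1 <= y X \<longleftrightarrow> I D (y 0) s1 <= ereal (r - t)" unfolding yX by (rule iff[OF i s1])
   also have "\<dots> \<longleftrightarrow> I D (y 0) s1 <= ereal X \<and> ereal X <= R + I D s1 q"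
    using sp hint_nonneg[of f D "ereal (y 0)" "ereal s1"] hint_nonneg[of f D "ereal s1" "ereal q"] r(1) t
    unfolding r(2)[symmetric] t_def by (cases "I D (y 0) s1"; cases "I D s1 q") auto
   finally show "s1 <= y X \<longleftrightarrow> I D (y 0) s1 <= ereal X \<and> ereal X <= R + I D s1 q" .
  qed
 qed
 show "ereal X <= 2 * R ==> y 0 <= y X" using both by blast
 show "ereal X <= 2 * R ==> y 0 < s1 ==> s1 <= q ==>
    s1 <= y X \<longleftrightarrow> I D (y 0) s1 <= ereal X \<and> ereal X <= R + I D s1 q" using both by blast
 assume ge: "2 * R <= ereal X"
 show "\<exists>r>0. R = ereal r \<and> 2 * r <= X \<and> y (2 * r) = y 0 \<and> p (2 * r) = - p 0" using cases
 proof (elim disjE bexE conjE)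
  assume "ereal X < R"
  then show ?thesis using ge R0 by (cases R) auto
 next
  fix r assume r: "r \<in> {0<..X}" "ereal r = R" "p r = 0"
  have X2: "r + r <= X" "0 <= r" using ge r(1) r(2)[symmetric] by auto
  have e: "r + r = 2 * r" "r - r = 0" by simp_all
  have "y (2 * r) = y 0" "p (2 * r) = - p 0" using sol_bounce[OF s X2(2) r(3) X2(2) order_refl X2(1)] unfolding e by simp_all
  then show ?thesis using r X2 by (intro exI[of _ r]) auto
 qed
qed

lemma excursion_left:
 assumes s: "sol y p X" and X: "0 <= X" and p0: "p 0 < 0" and D: "D = V (y 0) - (p 0)\<^sup>2"
  and l: "l \<in> K" "l < y 0" "V l = D" "!!t. l < t ==> t <= y 0 ==> D < V t" and L: "L = I D l (y 0)"
 shows "ereal X <= 2 * L ==> y X <= y 0"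
  and "2 * L <= ereal X ==> \<exists>r>0. L = ereal r \<and> 2 * r <= X \<and> y (2 * r) = y 0 \<and> p (2 * r) = - p 0"
proof -
 interpret R: warped "- b" "- a" rf rV1 rV2 by (rule warped_reflect)
 have yK: "y 0 \<in> K" by (rule sol_in[OF s]) (use X in simp)
 have L': "L = R.I D (- y 0) (- l)" using hint_reflect_real[OF l(1) yK] L by simp
 have w: "- l \<in> R.K" "- y 0 < - l" "inv_sq rf (- l) = D"
  "!!t. - y 0 <= t ==> t < - l ==> D < inv_sq rf t"
  using l by (auto simp: einterval_reflect inv_sq_reflect)
 have D': "D = inv_sq rf (- y 0) - (- p 0)\<^sup>2" "0 < - p 0" using D p0 by (auto simp: inv_sq_reflect)
 note E = R.excursion_right[OF sol_reflect1[OF s] X D'(2,1) w L']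
 show "ereal X <= 2 * L ==> y X <= y 0" using E(1) by simp
 show "2 * L <= ereal X ==> \<exists>r>0. L = ereal r \<and> 2 * r <= X \<and> y (2 * r) = y 0 \<and> p (2 * r) = - p 0"
  using E(3) by force
qed

text \<open>\<open>shift_time L R n\<close> is the time at which a trajectory returns to its base point before its
 \<open>n\<close>-th visit to the right end; it starts to the right iff \<open>n\<close> is even.\<close>

definition shift_time :: "ereal => ereal => nat => ereal" where
 "shift_time L R n = (if even n then ereal (real n) * (L + R) else 2 * L + ereal (real (n - 1)) * (L + R))"

lemma shift_time_0: "shift_time L R 0 = 0" unfolding shift_time_def by (simp add: zero_ereal_def[symmetric])

lemma shift_time_even: "even n ==> shift_time L R (Suc n) = 2 * L + shift_time L R n" unfolding shift_time_def by simp

lemma shift_time_odd: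
 assumes "odd n" "0 <= L" "0 <= R"
 shows "shift_time L R (Suc n) = 2 * R + shift_time L R n"
proof -
 obtain k where k: "n = Suc k" using assms(1) by (cases n) auto
 have "ereal (real (Suc n)) * (L + R) = ereal (2 + real k) * (L + R)" using k by (simp add: algebra_simps)
 also have "\<dots> = (2 + ereal (real k)) * (L + R)" by simp
 also have "\<dots> = 2 * (L + R) + ereal (real k) * (L + R)" by (rule ereal_left_distrib) auto
 also have "2 * (L + R) = 2 * L + 2 * R" using assms by (intro ereal_right_distrib) auto
 finally show ?thesis using assms k unfolding shift_time_def by (simp add: ac_simps)
qed

lemma shift_time_nonneg: "0 <= L ==> 0 <= R ==> 0 <= shift_time L R n" unfolding shift_time_def by auto

text \<open>Induction peels off the initial excursion, which takes \<open>2 * L\<close> or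
  \<open>2 * R\<close>, returns to \<open>y0\<close> and reverses the momentum; this flips the
  parity of \<open>n\<close>.\<close>

lemma visit_if_time:
 assumes y0: "y0 \<in> K" and l: "l \<in> K" "l < y0" "V l = D" "!!t. l < t ==> t <= y0 ==> D < V t"
  and q: "q \<in> K" "y0 < q" "V q = D" "!!t. y0 <= t ==> t < q ==> D < V t"
  and L: "L = I D l y0" and R: "R = I D y0 q" and s1: "y0 < s1" "s1 <= q"
 shows "sol y p X ==> 0 <= X ==> y 0 = y0 ==> D = V y0 - (p 0)\<^sup>2 ==> (even n \<longleftrightarrow> p 0 > 0) ==> p 0 \<noteq> 0 ==>
   shift_time L R n + I D y0 s1 <= ereal X ==>
   ereal X <= shift_time L R n + (R + I D s1 q) ==> s1 <= y X"
proof (induction n arbitrary: y p X)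
 case 0
 have p0: "p 0 > 0" using 0 by simp
 have le: "ereal X <= 2 * R"
 proof -
  have "I D s1 q <= R" unfolding R using s1 by (intro hint_mono_set) auto
  then have "R + I D s1 q <= R + R" by (intro add_mono) auto
  also have "\<dots> = 2 * R" by (cases R) auto
  finally show ?thesis using 0 by (simp add: shift_time_0)
 qed
 show ?case using excursion_right(2)[OF 0(1,2) p0, of D q R s1] 0 q R s1 le by (simp add: shift_time_0)
next
 case (Suc n)
 have nn: "0 <= L" "0 <= R" unfolding L R by (rule hint_nonneg)+
 have hn: "0 <= I D y0 s1" by (rule hint_nonneg)
 define d where "d = (if even n then L else R)"
 have sh: "shift_time L R (Suc n) = 2 * d + shift_time L R n" unfolding d_def using shift_time_even shift_time_odd nn by auto
 have "2 * d <= 2 * d + (shift_time L R n + I D y0 s1)" using shift_time_nonneg[OF nn, of n] hn by (simp add: add_increasing2)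
 also have "\<dots> <= ereal X" using Suc.prems(7) unfolding sh by (simp add: add.assoc)
 finally have ge: "2 * d <= ereal X" .
 have "\<exists>r>0. d = ereal r \<and> 2 * r <= X \<and> y (2 * r) = y 0 \<and> p (2 * r) = - p 0"
 proof (cases "even n")
  case True
  then have "p 0 < 0" using Suc.prems by simp
  then show ?thesis using excursion_left(2)[OF Suc.prems(1,2), of D l L] Suc.prems l L ge True unfolding d_def by simp
 next
  case False
  then have "p 0 > 0" using Suc.prems by simp
  then show ?thesis using excursion_right(3)[OF Suc.prems(1,2), of D q R] Suc.prems q R ge False unfolding d_def by simp
 qed
 then obtain r where r: "r > 0" "d = ereal r" "2 * r <= X" "y (2 * r) = y0" "p (2 * r) = - p 0" using Suc.prems(3) by auto
 have s': "sol (\<lambda>x. y (2 * r + x)) (\<lambda>x. p (2 * r + x)) (X - 2 * r)" by (rule sol_shift[OF Suc.prems(1)]) (use r in auto)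
 have "s1 <= y (2 * r + (X - 2 * r))"
 proof (rule Suc.IH[OF s'])
  show "shift_time L R n + I D y0 s1 <= ereal (X - 2 * r)" using Suc.prems(7) unfolding sh r(2)
   by (cases "shift_time L R n"; cases "I D y0 s1") auto
  show "ereal (X - 2 * r) <= shift_time L R n + (R + I D s1 q)" using Suc.prems(8) unfolding sh r(2)
   by (cases "shift_time L R n"; cases "R + I D s1 q") auto
 qed (use r Suc.prems in auto)
 then show ?case by simp
qed

text \<open>The same peeling in the converse direction, by induction on a bound \<open>k * w\<close>
  for the remaining time: every excursion takes longer than \<open>w\<close>, a positive number
  below both \<open>L\<close> and \<open>R\<close>, which may be infinite.\<close>

lemma time_if_visit:
 assumes y0: "y0 \<in> K" and l: "l \<in> K" "l < y0" "V l = D" "!!t. l < t ==> t <= y0 ==> D < V t"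
  and q: "q \<in> K" "y0 < q" "V q = D" "!!t. y0 <= t ==> t < q ==> D < V t"
  and L: "L = I D l y0" and R: "R = I D y0 q" and s1: "y0 < s1" "s1 <= q"
  and s: "sol y p X" "0 <= X" "y 0 = y0" "D = V y0 - (p 0)\<^sup>2" "p 0 \<noteq> 0" "s1 <= y X"
 shows "\<exists>n. (even n \<longleftrightarrow> p 0 > 0) \<and> shift_time L R n + I D y0 s1 <= ereal X \<and>
   ereal X <= shift_time L R n + (R + I D s1 q)"
proof -
 have pos: "0 < L" "0 < R" unfolding L R using y0 l q K_bounds by (auto intro!: hint_pos)
 obtain w where w: "0 < w" "ereal w < L" "ereal w < R"
 proof -
  have "0 < min L R" using pos by simp
  then obtain w where "0 < ereal w" "ereal w < min L R" using ereal_dense2 by (metis zero_ereal_def)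
  then show thesis using that[of w] by auto
 qed
 have main: "\<exists>n. (even n \<longleftrightarrow> p 0 > 0) \<and> shift_time L R n + I D y0 s1 <= ereal X \<and>
   ereal X <= shift_time L R n + (R + I D s1 q)"
  if "X < real k * w" "sol y p X" "0 <= X" "y 0 = y0" "D = V y0 - (p 0)\<^sup>2" "p 0 \<noteq> 0" "s1 <= y X" for k y p X using that
 proof (induction k arbitrary: y p X)
  case 0
  then show ?case by simp
 next
  case (Suc k)
  define d where "d = (if p 0 > 0 then R else L)"
  show ?case
  proof (cases "p 0 > 0 \<and> ereal X <= 2 * R")
   case True
   then have "I D y0 s1 <= ereal X \<and> ereal X <= R + I D s1 q"
    using excursion_right(2)[OF Suc.prems(2,3), of D q R s1] Suc.prems q R s1 by simp
   then show ?thesis using True by (intro exI[of _ 0]) (simp add: shift_time_0)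
  next
   case False
   have ge: "2 * d <= ereal X"
   proof (cases "p 0 > 0")
    case True
    then show ?thesis using False unfolding d_def by simp
   next
    case neg: False
    then have n: "p 0 < 0" using Suc.prems by simp
    have "\<not> ereal X <= 2 * L"
    proof
     assume "ereal X <= 2 * L"
     then have "y X <= y 0" using excursion_left(1)[OF Suc.prems(2,3) n, of D l L] Suc.prems l L by simp
     then show False using Suc.prems s1 by simp
    qed
    then show ?thesis using neg unfolding d_def by simp
   qed
   have "\<exists>r>0. d = ereal r \<and> 2 * r <= X \<and> y (2 * r) = y 0 \<and> p (2 * r) = - p 0"
   proof (cases "p 0 > 0")
    case True
    then show ?thesis using excursion_right(3)[OF Suc.prems(2,3), of D q R] Suc.prems q R ge unfolding d_def by simp
   next
    case False
    then have "p 0 < 0" using Suc.prems by simp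
    then show ?thesis using excursion_left(2)[OF Suc.prems(2,3), of D l L] Suc.prems l L ge unfolding d_def by simp
   qed
   then obtain r where r: "r > 0" "d = ereal r" "2 * r <= X" "y (2 * r) = y0" "p (2 * r) = - p 0" using Suc.prems(4) by auto
   have s': "sol (\<lambda>x. y (2 * r + x)) (\<lambda>x. p (2 * r + x)) (X - 2 * r)"
    by (rule sol_shift[OF Suc.prems(2)]) (use r in auto)
   have "w < r" using w r(2) unfolding d_def by (auto split: if_splits)
   then have lt: "X - 2 * r < real k * w" using Suc.prems(1) w by (simp add: algebra_simps)
   have "\<exists>n. (even n \<longleftrightarrow> p (2 * r + 0) > 0) \<and> shift_time L R n + I D y0 s1 <= ereal (X - 2 * r) \<and>
     ereal (X - 2 * r) <= shift_time L R n + (R + I D s1 q)" by (rule Suc.IH[OF lt s']) (use r Suc.prems in auto)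
   then obtain n where n: "even n \<longleftrightarrow> - p 0 > 0" "shift_time L R n + I D y0 s1 <= ereal (X - 2 * r)"
    "ereal (X - 2 * r) <= shift_time L R n + (R + I D s1 q)" using r by auto
   have sh: "shift_time L R (Suc n) = ereal (2 * r) + shift_time L R n"
    using shift_time_even[of n L R] shift_time_odd[of n L R] pos n(1) r(2) Suc.prems(6) unfolding d_def by (auto split: if_splits)
   show ?thesis
   proof (intro exI[of _ "Suc n"] conjI)
    show "even (Suc n) \<longleftrightarrow> p 0 > 0" using n(1) Suc.prems(6) by auto
    show "shift_time L R (Suc n) + I D y0 s1 <= ereal X"
     using n(2) unfolding sh by (cases "shift_time L R n"; cases "I D y0 s1") auto
    show "ereal X <= shift_time L R (Suc n) + (R + I D s1 q)"
     using n(3) unfolding sh by (cases "shift_time L R n"; cases "R + I D s1 q") auto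
   qed
  qed
 qed
 obtain k where "X < real k * w" using ex_less_of_nat_mult[OF w(1)] by blast
 then show ?thesis using main s by blast
qed


section \<open>Condition (R): the arrival and departure times\<close>


definition both_ends_min :: bool where
 "both_ends_min \<longleftrightarrow> (\<forall>t\<in>K. m < V t) \<and> m_left a f = ereal m \<and> m_right b f = ereal m"

lemma m_nonneg: "0 <= m"
proof -
 have "K \<noteq> {}" using einterval_nonempty[OF ab] by auto
 then show ?thesis unfolding m_inf_def by (rule cINF_greatest) (simp add: inv_sq_def)
qed

lemma m_right_reflect: "m_right (- a) rf = m_left a f"
proof -
 have "- b < - a" using ab by simp
 from m_left_reflect[OF this, of rf] show ?thesis by simp
qed

lemma both_ends_min_reflect: "warped.both_ends_min (- b) (- a) rf \<longleftrightarrow> both_ends_min"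
proof -
 interpret R: warped "- b" "- a" rf rV1 rV2 by (rule warped_reflect)
 have "(\<forall>t\<in>R.K. m < inv_sq rf t) \<longleftrightarrow> (\<forall>t\<in>K. m < V t)"
  unfolding inv_sq_reflect by (metis einterval_reflect minus_minus)
 then show ?thesis unfolding R.both_ends_min_def both_ends_min_def m_inf_reflect m_right_reflect m_left_reflect[OF ab] by auto
qed

lemma near_right_end:
 assumes R: "both_ends_min" and x: "m < x" "s \<in> K"
 obtains t where "s < t" "t \<in> K" "V t < x"
proof -
 have "m_right b f < ereal x" "ereal s < b" using R x K_bounds unfolding both_ends_min_def by auto
 then obtain t where "ereal s < ereal t" "ereal t < b" "V t < x" by (rule m_right_lessD[OF ab])
 then show ?thesis using that[of t] K_up[OF x(2), of t] by simp
qed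

lemma near_left_end:
 assumes R: "both_ends_min" and x: "m < x" "s \<in> K"
 obtains t where "t < s" "t \<in> K" "V t < x"
proof -
 interpret R: warped "- b" "- a" rf rV1 rV2 by (rule warped_reflect)
 have "R.both_ends_min" "R.m < x" "- s \<in> R.K" using R x both_ends_min_reflect m_inf_reflect by (auto simp: einterval_reflect)
 then obtain t where "- s < t" "t \<in> R.K" "inv_sq rf t < x" by (rule R.near_right_end)
 then show ?thesis using that[of "- t"] by (auto simp: einterval_reflect inv_sq_reflect)
qed

lemma turn_right:
 assumes R: "both_ends_min" and y0: "y0 \<in> K" and D: "m < D" "D < V y0"
 obtains r where "bstar y0 D = ereal r" "r \<in> K" "y0 < r" "V r = D"
  "!!t. y0 <= t ==> t < r ==> D < V t"
proof (rule b_star_cases[OF y0 D(2)])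
 assume h: "!!t. y0 <= t ==> ereal t < b ==> D < V t"
 obtain t where "y0 < t" "t \<in> K" "V t < D" by (rule near_right_end[OF R D(1) y0])
 then show thesis using h[of t] K_bounds by auto
next
 fix r assume "bstar y0 D = ereal r" "r \<in> K" "y0 < r" "V r = D" "!!t. y0 <= t ==> t < r ==> D < V t"
 then show thesis by (rule that)
qed

lemma turn_left:
 assumes R: "both_ends_min" and y0: "y0 \<in> K" and D: "m < D" "D < V y0"
 obtains l where "astar y0 D = ereal l" "l \<in> K" "l < y0" "V l = D"
  "!!t. l < t ==> t <= y0 ==> D < V t"
proof (rule a_star_cases[OF y0 D(2)])
 assume h: "!!t. t <= y0 ==> a < ereal t ==> D < V t"
 obtain t where "t < y0" "t \<in> K" "V t < D" by (rule near_left_end[OF R D(1) y0])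
 then show thesis using h[of t] K_bounds by auto
next
 fix r assume "astar y0 D = ereal r" "r \<in> K" "r < y0" "V r = D" "!!t. r < t ==> t <= y0 ==> D < V t"
 then show thesis by (rule that)
qed

text \<open>A level above \<open>m\<close> finds points with smaller \<open>V\<close> on both sides
  of \<open>y0\<close>, so its trajectories are trapped and last for any given time.\<close>

lemma confined_sol:
 assumes R: "both_ends_min" and y0: "y0 \<in> K" and p0: "m < V y0 - p0\<^sup>2"
 obtains y p where "sol y p T" "y 0 = y0" "p 0 = p0"
proof -
 obtain l where l: "l < y0" "l \<in> K" "V l < V y0 - p0\<^sup>2" by (rule near_left_end[OF R p0 y0])
 obtain r where r: "y0 < r" "r \<in> K" "V r < V y0 - p0\<^sup>2" by (rule near_right_end[OF R p0 y0])
 have lr: "l <= r" using l r by simp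
 obtain y p where s: "csol l r y p T" "y 0 = y0" "p 0 = p0" by (rule csol_exists[OF l(2) r(2) lr])
 have "sol y p T" by (rule csol_confined(2)[OF l(2) r(2) s(1)]) (use s l r in auto)
 then show ?thesis using that s by blast
qed

text \<open>The time to the turning point depends continuously on the level, also where it is infinite:
 it is the first zero of \<open>p\<close>, at which \<open>p\<close> changes sign.\<close>

lemma R_int_tendsto:
 assumes R: "both_ends_min" and y0: "y0 \<in> K" and D1: "m < D1" "D1 < V y0"
 shows "((\<lambda>D. rint y0 D) \<longlongrightarrow> rint y0 D1) (at D1)"
proof -
 obtain v where v: "bstar y0 D1 = ereal v" "v \<in> K" "y0 < v" "V v = D1"
  "!!s. y0 <= s ==> s < v ==> D1 < V s" by (rule turn_right[OF R y0 D1]) (rule that)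
 have R1: "rint y0 D1 = I D1 y0 v" unfolding R_int_def v(1) ..
 show ?thesis
 proof (rule order_tendstoI)
  fix x assume x: "x < rint y0 D1"
  show "eventually (\<lambda>D. x < rint y0 D) (at D1)"
  proof (cases "x < 0")
   case True
   have "x < rint y0 D" for D using hint_nonneg[of f D "ereal y0" "bstar y0 D"] True unfolding R_int_def by (rule less_le_trans[rotated])
   then show ?thesis by simp
  next
   case False
   then have x0: "0 <= x" by simp
   have x': "x < I D1 y0 v" using x R1 by simp
   obtain p q where pq: "ereal y0 < ereal p" "p < q" "ereal q < ereal v" "x < I D1 p q"
    by (rule hint_approx[OF K_bounds(3)[OF y0] K_bounds(4)[OF v(2)] x' x0])
   have qK: "q \<in> K" using in_K[OF y0 v(2)] pq by auto
   have "I D1 p q <= I D1 y0 q" using pq by (intro hint_mono_set) auto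
   then have xq: "x < I D1 y0 q" using pq(4) by simp
   have gt: "D1 < V s" if "s \<in> {y0..q}" for s using v(5) that pq by auto
   have "((\<lambda>D. I D y0 q) \<longlongrightarrow> I D1 y0 q) (at D1)" by (rule hint_continuous_D[OF y0 qK gt])
   then have "eventually (\<lambda>D. x < I D y0 q) (at D1)" using xq by (rule order_tendstoD(1))
   moreover have "eventually (\<lambda>D. \<forall>s\<in>{y0..q}. D < V s) (at D1)" by (rule eventually_below_V[OF y0 qK gt])
   ultimately show ?thesis
   proof eventually_elim
    case (elim D)
    have "ereal q <= bstar y0 D"
    proof (rule b_star_cases[OF y0])
     show "D < V y0" using elim pq by auto
     assume "bstar y0 D = b"
     then show ?thesis using K_bounds[OF qK] by simp
    next
     fix w assume "bstar y0 D = ereal w" "V w = D" "y0 < w"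
     then show ?thesis using elim(2) by (force simp: not_le[symmetric])
    qed
    then have "I D y0 q <= rint y0 D" unfolding R_int_def by (intro hint_mono_set) auto
    then show ?case using elim(1) by simp
   qed
  qed
 next
  fix x assume x: "rint y0 D1 < x"
  then obtain t where t: "rint y0 D1 < ereal t" "ereal t < x" using ereal_dense2 by blast
  obtain j where j: "rint y0 D1 = ereal j" using t hint_nonneg[of f D1 "ereal y0" "ereal v"] unfolding R1 by (cases "I D1 y0 v") auto
  have "0 < rint y0 D1" unfolding R1 by (rule hint_pos) (use y0 v K_bounds in auto)
  then have r0: "0 < j" "j < t" using j t by auto
  define e where "e = min j (t - j) / 2"
  have e: "0 < e" "e < j" "j + e < t" unfolding e_def using r0 by (auto simp: min_def field_simps)
  define t' where "t' = j + e"
  define D' where "D' = (m + D1) / 2"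
  have D': "m < D'" "D' < D1" unfolding D'_def using D1 by auto
  \<comment> \<open>Barriers with \<open>V\<close> below \<open>D'\<close> trap the trajectories of
    all levels between \<open>D'\<close> and \<open>V y0\<close> at once, so a single flow
    represents them.\<close>
  obtain l where l: "l < y0" "l \<in> K" "V l < D'" by (rule near_left_end[OF R D'(1) y0])
  obtain r where r: "y0 < r" "r \<in> K" "V r < D'" by (rule near_right_end[OF R D'(1) y0])
  have lr: "l <= r" using l r by simp
  define M0 where "M0 = sqrt (V y0)"
  have M0: "0 <= M0" "0 < t' + 1" unfolding M0_def t'_def using r0 e Vpos[OF y0] by auto
  obtain Y P C where ini: "!!p. \<bar>p\<bar> <= M0 ==> Y p 0 = y0 \<and> P p 0 = p"
   and cs: "!!p T. \<bar>p\<bar> <= M0 ==> T < t' + 1 ==> csol l r (Y p) (P p) T"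
   and dep: "!!p q x. \<bar>p\<bar> <= M0 ==> \<bar>q\<bar> <= M0 ==> 0 <= x ==> x < t' + 1 ==>
     \<bar>Y p x - Y q x\<bar> <= C * \<bar>p - q\<bar> \<and> \<bar>P p x - P q x\<bar> <= C * \<bar>p - q\<bar>"
   by (rule flow_exists[OF l(2) r(2) lr M0, of y0]) (rule that)
  define ps where "ps D = sqrt (V y0 - D)" for D
  have ps: "\<bar>ps D\<bar> <= M0" "V y0 - (ps D)\<^sup>2 = D" "0 < ps D" "sol (Y (ps D)) (P (ps D)) t'" if "D' < D" "D < V y0" for D
  proof -
   show 1: "\<bar>ps D\<bar> <= M0" unfolding ps_def M0_def using that D' m_nonneg by (simp add: real_sqrt_le_mono)
   show 2: "V y0 - (ps D)\<^sup>2 = D" "0 < ps D" unfolding ps_def using that by auto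
   show "sol (Y (ps D)) (P (ps D)) t'" by (rule csol_confined(2)[OF l(2) r(2) cs[OF 1]]) (use ini[OF 1] 2 l r that in auto)
  qed
  note p1 = ps[OF D'(2) D1(2)]
  have t'0: "0 <= t'" unfolding t'_def using r0 e by simp
  have neg: "P (ps D1) t' < 0"
  proof -
   have "(ereal t' < I D1 (Y (ps D1) 0) v \<and>
      (\<forall>x\<in>{0..t'}. Y (ps D1) 0 <= Y (ps D1) x \<and> Y (ps D1) x < v \<and> P (ps D1) x > 0 \<and> ereal x = I D1 (Y (ps D1) 0) (Y (ps D1) x)))
    \<or> (\<exists>R\<in>{0<..t'}. ereal R = I D1 (Y (ps D1) 0) v \<and> Y (ps D1) R = v \<and> P (ps D1) R = 0 \<and>
      (\<forall>x\<in>{0..R}. Y (ps D1) 0 <= Y (ps D1) x \<and> Y (ps D1) x <= v \<and> ereal x = I D1 (Y (ps D1) 0) (Y (ps D1) x)) \<and> (\<forall>x\<in>{0..<R}. P (ps D1) x > 0))"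
    by (rule first_leg[OF p1(4) t'0]) (use ini[OF p1(1)] p1 v in auto)
   moreover have "\<not> ereal t' < I D1 (Y (ps D1) 0) v" using ini[OF p1(1)] j R1 e unfolding t'_def by simp
   ultimately obtain i where "ereal i = I D1 (Y (ps D1) 0) v" "P (ps D1) i = 0" "\<forall>x\<in>{0..<i}. P (ps D1) x > 0" by blast
   then have b: "P (ps D1) j = 0" "\<forall>x\<in>{0..<j}. P (ps D1) x > 0" using ini[OF p1(1)] j R1 by auto
   have "P (ps D1) (j + e) = - P (ps D1) (j - e)" by (rule sol_bounce(2)[OF p1(4) _ b(1)]) (use r0 e in \<open>auto simp: t'_def\<close>)
   then show ?thesis using b(2)[rule_format, of "j - e"] e unfolding t'_def by simp
  qed
  have "(ps \<longlongrightarrow> ps D1) (at D1)" unfolding ps_def by (intro tendsto_intros)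
  then have "((\<lambda>D. C * \<bar>ps D - ps D1\<bar>) \<longlongrightarrow> C * \<bar>ps D1 - ps D1\<bar>) (at D1)" by (intro tendsto_intros)
  then have "eventually (\<lambda>D. C * \<bar>ps D - ps D1\<bar> < - P (ps D1) t') (at D1)" by (rule order_tendstoD(2)) (use neg in simp)
  moreover have "eventually (\<lambda>D. D' < D) (at D1)" "eventually (\<lambda>D. D < V y0) (at D1)"
   using order_tendstoD[OF tendsto_ident_at] D' D1 by blast+
  ultimately show "eventually (\<lambda>D. rint y0 D < x) (at D1)"
  proof eventually_elim
   case (elim D)
   note pD = ps[OF elim(2,3)]
   have "\<bar>P (ps D) t' - P (ps D1) t'\<bar> <= C * \<bar>ps D - ps D1\<bar>" using dep[OF pD(1) p1(1) t'0] by simp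
   then have neg': "P (ps D) t' < 0" using elim(1) by linarith
   have mD: "m < D" using elim D' by simp
   obtain w where w: "bstar y0 D = ereal w" "w \<in> K" "y0 < w" "V w = D"
    "!!s. y0 <= s ==> s < w ==> D < V s" by (rule turn_right[OF R y0 mD elim(3)]) (rule that)
   have "(ereal t' < I D (Y (ps D) 0) w \<and>
      (\<forall>x\<in>{0..t'}. Y (ps D) 0 <= Y (ps D) x \<and> Y (ps D) x < w \<and> P (ps D) x > 0 \<and> ereal x = I D (Y (ps D) 0) (Y (ps D) x)))
    \<or> (\<exists>R\<in>{0<..t'}. ereal R = I D (Y (ps D) 0) w \<and> Y (ps D) R = w \<and> P (ps D) R = 0 \<and>
      (\<forall>x\<in>{0..R}. Y (ps D) 0 <= Y (ps D) x \<and> Y (ps D) x <= w \<and> ereal x = I D (Y (ps D) 0) (Y (ps D) x)) \<and> (\<forall>x\<in>{0..<R}. P (ps D) x > 0))"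
    by (rule first_leg[OF pD(4) t'0]) (use ini[OF pD(1)] pD w in auto)
   moreover have "\<not> (\<forall>x\<in>{0..t'}. P (ps D) x > 0)" using neg' t'0 by (auto intro!: bexI[of _ t'])
   ultimately obtain i where "i \<in> {0<..t'}" "ereal i = I D (Y (ps D) 0) w" by blast
   then have "rint y0 D <= ereal t'" unfolding R_int_def w(1) using ini[OF pD(1)] by simp (metis ereal_less_eq(3))
   also have "ereal t' < ereal t" unfolding t'_def using e by simp
   also have "\<dots> < x" by (rule t)
   finally show ?case .
  qed
 qed
qed

lemma L_int_reflect:
 assumes "y0 \<in> K" "D < V y0"
 shows "R_int (- b) (- a) rf (- y0) D = lint y0 D"
proof -
 have "a <= astar y0 D" by (rule a_star_cases[OF assms]) (use K_bounds in auto)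
 then have "hint rf D (- ereal y0) (- astar y0 D) = H D (astar y0 D) (ereal y0)" using K_bounds[OF assms(1)] by (intro hint_reflect) auto
 then show ?thesis unfolding R_int_def L_int_def b_star_reflect[OF assms(1)] by simp
qed

lemma L_int_tendsto:
 assumes R: "both_ends_min" and y0: "y0 \<in> K" and D1: "m < D1" "D1 < V y0"
 shows "((\<lambda>D. lint y0 D) \<longlongrightarrow> lint y0 D1) (at D1)"
proof -
 interpret R: warped "- b" "- a" rf rV1 rV2 by (rule warped_reflect)
 have "((\<lambda>D. R_int (- b) (- a) rf (- y0) D) \<longlongrightarrow> R_int (- b) (- a) rf (- y0) D1) (at D1)"
  by (rule R.R_int_tendsto) (use R y0 D1 both_ends_min_reflect m_inf_reflect in \<open>auto simp: einterval_reflect inv_sq_reflect\<close>)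
 moreover have "eventually (\<lambda>D. R_int (- b) (- a) rf (- y0) D = lint y0 D) (at D1)"
  by (rule eventually_mono[OF order_tendstoD(2)[OF tendsto_ident_at D1(2)]]) (rule L_int_reflect[OF y0])
 ultimately show ?thesis unfolding L_int_reflect[OF y0 D1(2)] by (rule Lim_transform_eventually)
qed

text \<open>On level \<open>D\<close> the \<open>n\<close>-th visit to the right, counted from 0,
  begins after \<open>shift_time\<close>. \<open>arrival\<close> is the moment it reaches height
  \<open>s\<close>, \<open>departure\<close> the moment it drops back to \<open>s\<close> after the
  turn at \<open>bstar y0 D\<close>.\<close>

definition arrival :: "real => nat => ereal => real => ereal" where
 "arrival y0 n s D = shift_time (lint y0 D) (rint y0 D) n + H D (ereal y0) s"

definition departure :: "real => nat => ereal => real => ereal" where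
 "departure y0 n s D = shift_time (lint y0 D) (rint y0 D) n
   + (rint y0 D + H D s (bstar y0 D))"

lemma L_R_int_nonneg: "0 <= lint y0 D" "0 <= rint y0 D" unfolding L_int_def R_int_def by (rule hint_nonneg)+

lemma shift_time_tendsto:
 assumes "(g1 \<longlongrightarrow> x) F" "(g2 \<longlongrightarrow> y) F" "!!D. 0 <= g1 D" "!!D. 0 <= g2 D" "0 <= x" "0 <= (y::ereal)"
 shows "((\<lambda>D. shift_time (g1 D) (g2 D) n) \<longlongrightarrow> shift_time x y n) F"
proof -
 have W: "((\<lambda>D. g1 D + g2 D) \<longlongrightarrow> x + y) F"
  using assms by (intro tendsto_add_ereal_nonneg) (auto intro: always_eventually)
 have W': "((\<lambda>D. ereal c * (g1 D + g2 D)) \<longlongrightarrow> ereal c * (x + y)) F" for c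
  by (rule tendsto_cmult_ereal[OF _ W]) simp
 have 2: "((\<lambda>D. 2 * g1 D) \<longlongrightarrow> 2 * x) F" by (rule tendsto_cmult_ereal[OF _ assms(1)]) simp
 show ?thesis
 proof (cases "even n")
  case True
  then show ?thesis unfolding shift_time_def using W' by simp
 next
  case False
  have "((\<lambda>D. 2 * g1 D + ereal (real (n - 1)) * (g1 D + g2 D)) \<longlongrightarrow> 2 * x + ereal (real (n - 1)) * (x + y)) F"
   using assms 2 W' by (intro tendsto_add_ereal_nonneg) (auto intro: always_eventually)
  then show ?thesis unfolding shift_time_def using False by simp
 qed
qed

lemma b_star_base:
 assumes R: "both_ends_min" and y: "y0 \<in> K" "s \<in> K" "y0 <= s" and D: "m < D" "!!t. t \<in> {y0..s} ==> D < V t"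
 shows "bstar y0 D = bstar s D"
proof -
 have D0: "D < V y0" "D < V s" using D(2) y by auto
 obtain r where r: "bstar y0 D = ereal r" "r \<in> K" "y0 < r" "V r = D"
  "!!t. y0 <= t ==> t < r ==> D < V t" by (rule turn_right[OF R y(1) D(1) D0(1)]) (rule that)
 obtain c where c: "bstar s D = ereal c" "c \<in> K" "s < c" "V c = D"
  "!!t. s <= t ==> t < c ==> D < V t" by (rule turn_right[OF R y(2) D(1) D0(2)]) (rule that)
 have "s < r" using D(2)[of r] r by force
 have "\<not> r < c" using c(5)[of r] \<open>s < r\<close> r(4) by auto
 moreover have "\<not> c < r" using r(5)[of c] c y by auto
 ultimately show ?thesis using r(1) c(1) by simp
qed

text \<open>Limits inferior and superior provide one level that arrives early enough and another
  that departs late enough; a single level with both is wanted. The levels departing before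
  \<open>X\<close> and those arriving after \<open>X\<close> are disjoint open subsets of
  \<open>(m, m')\<close>, and \<open>D1\<close>, \<open>D2\<close> show that neither is everything,
  so by connectedness they leave a level out.\<close>

lemma level_between:
 assumes R: "both_ends_min" and y: "y0 \<in> K" "s \<in> K" "y0 < s" and m': "m' <= V y0" "!!D t. D < m' ==> t \<in> {y0..s} ==> D < V t"
  and D1: "m < D1" "D1 < m'" "arrival y0 n (ereal s) D1 < ereal X" and D2: "m < D2" "D2 < m'" "ereal X < departure y0 n (ereal s) D2"
 obtains D where "m < D" "D < m'" "arrival y0 n (ereal s) D <= ereal X" "ereal X <= departure y0 n (ereal s) D"
proof (rule ccontr)
 assume no: "\<not> thesis"
 let ?I = "{m<..<m'}"
 define A where "A = {D \<in> ?I. departure y0 n (ereal s) D < ereal X}"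
 define B where "B = {D \<in> ?I. ereal X < arrival y0 n (ereal s) D}"
 have I: "m < D" "D < V y0" "!!t. t \<in> {y0..s} ==> D < V t" "D < V s" if "D \<in> ?I" for D
  using that m'(1) m'(2)[of D] y by auto
 have eqd: "departure y0 n (ereal s) D = shift_time (lint y0 D) (rint y0 D) n + (rint y0 D + rint s D)" if "D \<in> ?I" for D
  unfolding departure_def R_int_def[of a b f s] using b_star_base[OF R y(1,2) less_imp_le[OF y(3)] I(1,3)[OF that]] by simp
 have nm: "x \<noteq> - \<infinity>" if "0 <= x" for x :: ereal using that by auto
 have ts: "((\<lambda>D. shift_time (lint y0 D) (rint y0 D) n) \<longlongrightarrow> shift_time (lint y0 D0) (rint y0 D0) n) (at D0)"
  if "D0 \<in> ?I" for D0
  by (rule shift_time_tendsto[OF L_int_tendsto[OF R y(1) I(1,2)[OF that]] R_int_tendsto[OF R y(1) I(1,2)[OF that]]])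
   (rule L_R_int_nonneg)+
 have ta: "((\<lambda>D. arrival y0 n (ereal s) D) \<longlongrightarrow> arrival y0 n (ereal s) D0) (at D0)" if "D0 \<in> ?I" for D0
  unfolding arrival_def by (rule tendsto_add_ereal_nonneg[OF nm nm ts[OF that] hint_continuous_D[OF y(1,2) I(3)[OF that]]])
   (intro L_R_int_nonneg shift_time_nonneg hint_nonneg)+
 have td: "((\<lambda>D. departure y0 n (ereal s) D) \<longlongrightarrow> departure y0 n (ereal s) D0) (at D0)" if "D0 \<in> ?I" for D0
 proof -
  have "((\<lambda>D. shift_time (lint y0 D) (rint y0 D) n + (rint y0 D + rint s D)) \<longlongrightarrow>
    shift_time (lint y0 D0) (rint y0 D0) n + (rint y0 D0 + rint s D0)) (at D0)"
   by (intro tendsto_add_ereal_nonneg ts[OF that] R_int_tendsto[OF R y(1) I(1,2)[OF that]] R_int_tendsto[OF R y(2) I(1,4)[OF that]])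
    (intro nm L_R_int_nonneg shift_time_nonneg add_nonneg_nonneg)+
  moreover have "eventually (\<lambda>D. shift_time (lint y0 D) (rint y0 D) n + (rint y0 D + rint s D) = departure y0 n (ereal s) D) (at D0)"
   unfolding eventually_at_topological using that eqd by (intro exI[of _ ?I]) auto
  ultimately show ?thesis unfolding eqd[OF that] by (rule Lim_transform_eventually)
 qed
 have op: "open {D \<in> ?I. P D}" if evP: "!!D0. D0 \<in> ?I ==> P D0 ==> eventually P (at D0)" for P
 proof (subst open_subopen)
  show "\<forall>x\<in>{D \<in> ?I. P D}. \<exists>T. open T \<and> x \<in> T \<and> T \<subseteq> {D \<in> ?I. P D}"
  proof
   fix D0 assume D0: "D0 \<in> {D \<in> ?I. P D}"
   then obtain S where "open S" "D0 \<in> S" "\<forall>x\<in>S. x \<noteq> D0 --> P x"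
    using evP[of D0] unfolding eventually_at_topological by auto
   then show "\<exists>T. open T \<and> D0 \<in> T \<and> T \<subseteq> {D \<in> ?I. P D}"
    using D0 by (intro exI[of _ "S \<inter> ?I"]) (auto intro: open_Int)
  qed
 qed
 have oA: "open A" unfolding A_def by (rule op) (use td in \<open>auto dest: order_tendstoD(2)\<close>)
 have oB: "open B" unfolding B_def by (rule op) (use ta in \<open>auto dest: order_tendstoD(1)\<close>)
 have le: "arrival y0 n (ereal s) D <= departure y0 n (ereal s) D" if "D \<in> ?I" for D
 proof -
  note I' = I[OF that]
  obtain r where r: "bstar y0 D = ereal r" "r \<in> K" "y0 < r" "V r = D"
   "!!t. y0 <= t ==> t < r ==> D < V t" by (rule turn_right[OF R y(1) I'(1,2)]) (rule that)
  have "s < r" using I'(3)[of r] r by force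
  then have "I D y0 s <= rint y0 D" unfolding R_int_def r(1) by (intro hint_mono_set) auto
  also have "\<dots> <= rint y0 D + H D (ereal s) (bstar y0 D)" using hint_nonneg by (simp add: add_increasing2)
  finally show ?thesis unfolding arrival_def departure_def by (intro add_mono) auto
 qed
 have "A \<inter> B \<inter> ?I = {}" unfolding A_def B_def using le by force
 moreover have "?I \<subseteq> A \<union> B"
 proof
  fix D assume D: "D \<in> ?I"
  show "D \<in> A \<union> B"
  proof (rule ccontr)
   assume "D \<notin> A \<union> B"
   then have "arrival y0 n (ereal s) D <= ereal X" "ereal X <= departure y0 n (ereal s) D" using D unfolding A_def B_def by auto
   then show False using no that[of D] D by auto
  qed
 qed
 moreover have "D1 \<in> A \<inter> ?I"
 proof -
  have "D1 \<notin> B" using D1 unfolding B_def by auto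
  then show ?thesis using \<open>?I \<subseteq> A \<union> B\<close> D1 by auto
 qed
 moreover have "D2 \<in> B \<inter> ?I"
 proof -
  have "D2 \<notin> A" using D2 unfolding A_def by auto
  then show ?thesis using \<open>?I \<subseteq> A \<union> B\<close> D2 by auto
 qed
 ultimately show False using connectedD[of ?I A B] oA oB connected_Ioo[of m m'] by blast
qed

end

section \<open>Limits of monotone functions at an extended real end\<close>

lemma at_left_ereal_not_bot: "at_left b \<noteq> bot" if zb: "z < (b::ereal)"
proof
 assume "at_left b = bot"
 then have "eventually (\<lambda>_. False) (at_left b)" by simp
 then obtain w where w: "w < b" "!!y. w < y ==> y < b ==> False"
  unfolding eventually_at_left[OF zb] by blast
 then show False using dense[OF w(1)] by blast
qed

lemma Lim_at_left_increasing:
 fixes g :: "ereal => ereal"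
 assumes "z < b" "!!s s'. z < s ==> s <= s' ==> s' < b ==> g s <= g s'"
 shows "Lim (at_left b) g = (SUP s\<in>{z<..<b}. g s)"
proof (rule tendsto_Lim)
 show "at_left b \<noteq> bot" by (rule at_left_ereal_not_bot[OF assms(1)])
 show "(g \<longlongrightarrow> (SUP s\<in>{z<..<b}. g s)) (at_left b)"
 proof (rule order_tendstoI)
  fix x assume "x < (SUP s\<in>{z<..<b}. g s)"
  then obtain s where "z < s" "s < b" "x < g s" unfolding less_SUP_iff by auto
  then show "eventually (\<lambda>s. x < g s) (at_left b)" unfolding eventually_at_left[OF assms(1)] using assms(2)
   by (intro exI[of _ s]) (auto intro: less_le_trans less_imp_le)
 next
  fix x assume x: "(SUP s\<in>{z<..<b}. g s) < x"
  have "g s < x" if "z < s" "s < b" for s by (rule le_less_trans[OF SUP_upper x]) (use that in auto)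
  then show "eventually (\<lambda>s. g s < x) (at_left b)" unfolding eventually_at_left[OF assms(1)] using assms(1) by auto
 qed
qed

lemma Lim_at_left_decreasing:
 fixes g :: "ereal => ereal"
 assumes "z < b" "!!s s'. z < s ==> s <= s' ==> s' < b ==> g s' <= g s"
 shows "Lim (at_left b) g = (INF s\<in>{z<..<b}. g s)"
proof (rule tendsto_Lim)
 show "at_left b \<noteq> bot" by (rule at_left_ereal_not_bot[OF assms(1)])
 show "(g \<longlongrightarrow> (INF s\<in>{z<..<b}. g s)) (at_left b)"
 proof (rule order_tendstoI)
  fix x assume "(INF s\<in>{z<..<b}. g s) < x"
  then obtain s where "z < s" "s < b" "g s < x" unfolding INF_less_iff by auto
  then show "eventually (\<lambda>s. g s < x) (at_left b)" unfolding eventually_at_left[OF assms(1)] using assms(2)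
   by (intro exI[of _ s]) (auto intro: le_less_trans less_imp_le)
 next
  fix x assume x: "x < (INF s\<in>{z<..<b}. g s)"
  have "x < g s" if "z < s" "s < b" for s by (rule less_le_trans[OF x INF_lower]) (use that in auto)
  then show "eventually (\<lambda>s. x < g s) (at_left b)" unfolding eventually_at_left[OF assms(1)] using assms(1) by auto
 qed
qed

lemma Liminf_cong:
 assumes "eventually (\<lambda>x. f x = g x) F"
 shows "Liminf F f = Liminf F g" "Limsup F f = Limsup F g" using assms by (auto intro: Liminf_eq Limsup_eq)

context warped
begin

section \<open>The limits of Condition (R) in terms of arrival and departure times\<close>

lemma interval_right: "y0 \<in> K ==> {ereal y0<..<b} = ereal ` {s \<in> K. y0 < s}"
proof (rule set_eqI)
 fix x assume y0: "y0 \<in> K"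
 show "x \<in> {ereal y0<..<b} \<longleftrightarrow> x \<in> ereal ` {s \<in> K. y0 < s}"
  using K_up[OF y0] K_bounds by (cases x) (auto simp: image_iff less_imp_le)
qed

lemma eventually_levels:
 assumes "m < V y0"
 shows "eventually (\<lambda>D. m < D \<and> D < V y0) (at_right m)"
 unfolding eventually_at_right[OF assms] using assms by (intro exI[of _ "V y0"]) auto

text \<open>From the left turning point to \<open>s\<close> it takes
  \<open>lint y0 D + I D y0 s\<close>. For even \<open>n\<close> this \<open>lint\<close> and
  \<open>E_int\<close> complete one more \<open>W_int\<close>, for odd \<open>n\<close> they add up
  to twice \<open>lint\<close>; both give \<open>shift_time\<close>.\<close>

lemma arrival_form:
 assumes R: both_ends_min and y0: "y0 \<in> K" and D: "m < D" "D < V y0" and s: "s \<in> K" "y0 < s" and n: "n \<noteq> 0"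
 shows "E_int a b f y0 n D + ereal (real (n - 1)) * W_int a b f y0 D + H D (astar y0 D) (ereal s)
   = arrival y0 n (ereal s) D"
proof -
 obtain l where l: "astar y0 D = ereal l" "l \<in> K" "l < y0" by (rule turn_left[OF R y0 D]) (rule that)
 let ?L = "lint y0 D" and ?R = "rint y0 D"
 have nn: "0 <= ?L" "0 <= ?R" by (rule L_R_int_nonneg)+
 have h: "H D (astar y0 D) (ereal s) = ?L + I D y0 s" unfolding L_int_def l(1) by (rule hint_add) (use l s y0 K_bounds in auto)
 obtain k where k: "n = Suc k" using n by (cases n) auto
 show ?thesis
 proof (cases "even n")
  case True
  have "ereal (real n) * (?L + ?R) = (1 + ereal (real k)) * (?L + ?R)" using k by (simp add: one_ereal_def)
  also have "\<dots> = (?L + ?R) + ereal (real k) * (?L + ?R)" by (subst ereal_left_distrib) auto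
  finally show ?thesis unfolding arrival_def shift_time_def E_int_def W_int_def h using True k by (simp add: ac_simps)
 next
  case False
  have "2 * ?L = ?L + ?L" by (cases ?L) auto
  then show ?thesis unfolding arrival_def shift_time_def E_int_def W_int_def h using False k by (simp add: ac_simps)
 qed
qed

lemma departure_form: "E_int a b f y0 n D + ereal (real n) * W_int a b f y0 D + H D s (bstar y0 D) = departure y0 n s D"
proof -
 let ?L = "lint y0 D" and ?R = "rint y0 D"
 have nn: "0 <= ?L" "0 <= ?R" by (rule L_R_int_nonneg)+
 show ?thesis
 proof (cases "even n")
  case True
  then show ?thesis unfolding departure_def shift_time_def E_int_def W_int_def by (simp add: ac_simps)
 next
  case False
  then obtain k where k: "n = Suc k" by (cases n) auto
  have "ereal (real n) * (?L + ?R) = (1 + ereal (real k)) * (?L + ?R)" using k by (simp add: one_ereal_def)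
  also have "\<dots> = (?L + ?R) + ereal (real k) * (?L + ?R)" by (subst ereal_left_distrib) auto
  finally have "ereal (real n) * (?L + ?R) = (?L + ?R) + ereal (real k) * (?L + ?R)" .
  moreover have "2 * ?L = ?L + ?L" by (cases ?L) auto
  ultimately have "?L + ereal (real n) * (?L + ?R) = 2 * ?L + ereal (real k) * (?L + ?R) + ?R" by (simp add: ac_simps)
  then show ?thesis unfolding departure_def shift_time_def E_int_def W_int_def using False k by (simp add: ac_simps)
 qed
qed

lemma r_i_eq:
 assumes R: both_ends_min and y0: "y0 \<in> K"
 shows "r_i a b f y0 n = (SUP s\<in>{s \<in> K. y0 < s}. Liminf (at_right m) (\<lambda>D. arrival y0 n (ereal s) D))"
proof -
 have V0: "m < V y0" using R y0 unfolding both_ends_min_def by blast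
 have y0b: "ereal y0 < b" using K_bounds[OF y0] by simp
 define F where "F s D = (if n = 0 then H D (ereal y0) s else
   E_int a b f y0 n D + ereal (real (n - 1)) * W_int a b f y0 D + H D (astar y0 D) s)" for s D
 have ri: "r_i a b f y0 n = Lim (at_left b) (\<lambda>s. Liminf (at_right m) (\<lambda>D. F s D))" unfolding r_i_def F_def by simp
 have mono: "F s D <= F s' D" if "s <= s'" for s s' D unfolding F_def using that by (auto intro!: add_mono hint_mono_set)
 have "Lim (at_left b) (\<lambda>s. Liminf (at_right m) (\<lambda>D. F s D)) = (SUP s\<in>{ereal y0<..<b}. Liminf (at_right m) (\<lambda>D. F s D))"
  by (rule Lim_at_left_increasing[OF y0b]) (intro Liminf_mono always_eventually allI mono)
 also have "\<dots> = (SUP s\<in>{s \<in> K. y0 < s}. Liminf (at_right m) (\<lambda>D. F (ereal s) D))"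
  unfolding interval_right[OF y0] by (simp add: image_image)
 also have "\<dots> = (SUP s\<in>{s \<in> K. y0 < s}. Liminf (at_right m) (\<lambda>D. arrival y0 n (ereal s) D))"
 proof (rule SUP_cong[OF refl], rule Liminf_cong)
  fix s assume s: "s \<in> {s \<in> K. y0 < s}"
  show "eventually (\<lambda>D. F (ereal s) D = arrival y0 n (ereal s) D) (at_right m)" using eventually_levels[OF V0]
  proof eventually_elim
   case (elim D)
   show ?case
   proof (cases "n = 0")
    case True
    then show ?thesis unfolding F_def arrival_def by (simp add: shift_time_0)
   next
    case False
    then show ?thesis using arrival_form[OF R y0, of D s n] elim s unfolding F_def by simp
   qed
  qed
 qed
 finally show ?thesis unfolding ri .
qed

lemma r_s_eq:
 assumes y0: "y0 \<in> K"
 shows "r_s a b f y0 n = (INF s\<in>{s \<in> K. y0 < s}. Limsup (at_right m) (\<lambda>D. departure y0 n (ereal s) D))"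
proof -
 have y0b: "ereal y0 < b" using K_bounds[OF y0] by simp
 have rs: "r_s a b f y0 n = Lim (at_left b) (\<lambda>s. Limsup (at_right m) (\<lambda>D. departure y0 n s D))"
  unfolding r_s_def departure_form ..
 have mono: "departure y0 n s' D <= departure y0 n s D" if "s <= s'" for s s' D
  unfolding departure_def using that by (auto intro!: add_mono hint_mono_set)
 have "Lim (at_left b) (\<lambda>s. Limsup (at_right m) (\<lambda>D. departure y0 n s D)) = (INF s\<in>{ereal y0<..<b}. Limsup (at_right m) (\<lambda>D. departure y0 n s D))"
  by (rule Lim_at_left_decreasing[OF y0b]) (intro Limsup_mono always_eventually allI mono)
 then show ?thesis unfolding rs interval_right[OF y0] by (simp add: image_image)
qed

lemma below_min:
 assumes "both_ends_min" "y0 \<in> K" "s \<in> K" "y0 <= s"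
 obtains m' where "m < m'" "m' <= V y0" "!!D t. D < m' ==> t \<in> {y0..s} ==> D < V t"
proof -
 obtain w where w: "w \<in> {y0..s}" "!!t. t \<in> {y0..s} ==> V w <= V t" by (rule V_min[OF assms(2-4)]) (rule that)
 have "w \<in> K" using in_K[OF assms(2,3)] w(1) by auto
 then have "m < V w" using assms(1) unfolding both_ends_min_def by blast
 then show ?thesis using that[of "V w"] w assms(4) by force
qed

text \<open>Moving \<open>s\<close> to a later \<open>s'\<close> costs at least
  \<open>c > 0\<close>, uniformly in the level. This reserve turns weak inequalities between limits
  into strict ones on individual levels.\<close>

lemma later_point:
 assumes R: both_ends_min and y0: "y0 \<in> K" and s: "s \<in> K" "y0 < s"
 obtains s' c m' where "s' \<in> K" "s < s'" "0 < c" "!!D. m < D ==> D < m' ==> ereal c <= I D s s'"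
  "m < m'" "m' <= V y0" "!!D t. D < m' ==> t \<in> {y0..s'} ==> D < V t"
proof -
 obtain s' where s': "s' \<in> K" "s < s'" by (rule K_gt[OF s(1)])
 have le0: "y0 <= s'" using s s' by simp
 obtain m' where m': "m < m'" "m' <= V y0" "!!D t. D < m' ==> t \<in> {y0..s'} ==> D < V t"
  by (rule below_min[OF R y0 s'(1) le0]) (rule that)
 have "0 < I m s s'" by (rule hint_pos) (use s s' K_bounds m' in \<open>auto intro!: m'(3)\<close>)
 then obtain c where c: "0 < ereal c" "ereal c < I m s s'" using ereal_dense2[of 0] by (metis zero_ereal_def)
 have "ereal c <= I D s s'" if D: "m < D" "D < m'" for D
 proof -
  have "I m s s' <= I D s s'" by (rule hint_mono_D) (use D s in \<open>auto intro!: m'(3)\<close>)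
  then show ?thesis using c(2) by simp
 qed
 then show ?thesis using that[of s' c m'] s' c(1) m' by simp
qed

lemma r_i_leD:
 assumes R: both_ends_min and y0: "y0 \<in> K" and le: "r_i a b f y0 n <= ereal X" and s: "s \<in> K" "y0 < s" and d: "m < d"
 obtains D where "m < D" "D < d" "arrival y0 n (ereal s) D < ereal X"
proof (rule ccontr)
 assume "\<not> thesis"
 then have ge: "ereal X <= arrival y0 n (ereal s) D" if "m < D" "D < d" for D
  using that \<open>!!D. _ ==> _ ==> _ ==> thesis\<close> by force
 obtain s' c m' where s': "s' \<in> K" "s < s'" and c: "0 < c" "!!D. m < D ==> D < m' ==> ereal c <= I D s s'"
  and m': "m < m'" "m' <= V y0" "!!D t. D < m' ==> t \<in> {y0..s'} ==> D < V t"
  by (rule later_point[OF R y0 s]) (rule that)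
 have big: "ereal (X + c) <= arrival y0 n (ereal s') D" if D: "m < D" "D < min d m'" for D
 proof -
  have "I D y0 s' = I D y0 s + I D s s'" by (rule hint_add) (use s s' y0 K_bounds in auto)
  then have "arrival y0 n (ereal s') D = arrival y0 n (ereal s) D + I D s s'" unfolding arrival_def by (simp add: add.assoc)
  moreover have "ereal c <= I D s s'" by (rule c(2)) (use D in auto)
  moreover have "ereal X <= arrival y0 n (ereal s) D" using ge D by simp
  ultimately show ?thesis using add_mono by fastforce
 qed
 have "ereal (X + c) <= Liminf (at_right m) (\<lambda>D. arrival y0 n (ereal s') D)"
 proof (rule Liminf_bounded)
  have "m < min d m'" using d m' by simp
  then show "eventually (\<lambda>D. ereal (X + c) <= arrival y0 n (ereal s') D) (at_right m)"
   unfolding eventually_at_right[OF \<open>m < min d m'\<close>] using big by blast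
 qed
 also have "\<dots> <= r_i a b f y0 n" unfolding r_i_eq[OF R y0] by (rule SUP_upper) (use s s' in auto)
 also have "\<dots> <= ereal X" by (rule le)
 finally show False using c(1) by simp
qed

lemma r_s_geD:
 assumes R: both_ends_min and y0: "y0 \<in> K" and le: "ereal X <= r_s a b f y0 n" and s: "s \<in> K" "y0 < s" and w: "m < w"
 obtains D where "m < D" "D < w" "ereal X < departure y0 n (ereal s) D"
proof (rule ccontr)
 assume "\<not> thesis"
 then have ge: "departure y0 n (ereal s) D <= ereal X" if "m < D" "D < w" for D
  using that \<open>!!D. _ ==> _ ==> _ ==> thesis\<close> by force
 obtain s' c m' where s': "s' \<in> K" "s < s'" and c: "0 < c" "!!D. m < D ==> D < m' ==> ereal c <= I D s s'"
  and m': "m < m'" "m' <= V y0" "!!D t. D < m' ==> t \<in> {y0..s'} ==> D < V t"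
  by (rule later_point[OF R y0 s]) (rule that)
 have small: "departure y0 n (ereal s') D <= ereal (X - c)" if D: "m < D" "D < min w m'" for D
 proof -
  have D0: "D < V y0" using D m' by simp
  obtain q where q: "bstar y0 D = ereal q" "q \<in> K" "y0 < q" "V q = D" by (rule turn_right[OF R y0 D(1) D0]) (rule that)
  have sb: "s' < q" using m'(3)[of D q] D q by force
  have "I D s q = I D s s' + I D s' q" by (rule hint_add) (use s s' sb q K_bounds in auto)
  then have e: "departure y0 n (ereal s) D = departure y0 n (ereal s') D + I D s s'" unfolding departure_def q(1) by (simp add: ac_simps)
  have c': "ereal c <= I D s s'" by (rule c(2)) (use D in auto)
  have d: "departure y0 n (ereal s') D + I D s s' <= ereal X" unfolding e[symmetric] by (rule ge) (use D in auto)
  have "0 <= departure y0 n (ereal s') D" unfolding departure_def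
   by (intro add_nonneg_nonneg shift_time_nonneg L_R_int_nonneg hint_nonneg)
  then show ?thesis using c' d by (cases "departure y0 n (ereal s') D"; cases "I D s s'") auto
 qed
 have "ereal X <= r_s a b f y0 n" by (rule le)
 also have "\<dots> <= Limsup (at_right m) (\<lambda>D. departure y0 n (ereal s') D)"
  unfolding r_s_eq[OF y0] by (rule INF_lower) (use s s' in auto)
 also have "\<dots> <= ereal (X - c)"
 proof (rule Limsup_bounded)
  have "m < min w m'" using w m' by simp
  then show "eventually (\<lambda>D. departure y0 n (ereal s') D <= ereal (X - c)) (at_right m)"
   unfolding eventually_at_right[OF \<open>m < min w m'\<close>] using small by blast
 qed
 finally show False using c(1) by simp
qed

text \<open>The initial rise to \<open>s\<close> involves no turning point, so its time is
  continuous at \<open>D = m\<close> and the limit inferior is the value there.\<close>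

lemma r_i_0_eq:
 assumes R: both_ends_min and y0: "y0 \<in> K"
 shows "r_i a b f y0 0 = (SUP s\<in>{s \<in> K. y0 < s}. I m y0 s)" unfolding r_i_eq[OF R y0]
proof (rule SUP_cong[OF refl])
 fix s assume s: "s \<in> {s \<in> K. y0 < s}"
 then have sK: "s \<in> K" by blast
 have gt: "m < V t" if "t \<in> {y0..s}" for t using R in_K[OF y0 sK] that unfolding both_ends_min_def by auto
 have "((\<lambda>D. I D y0 s) \<longlongrightarrow> I m y0 s) (at_right m)"
  by (rule tendsto_within_subset[OF hint_continuous_D[OF y0 sK gt]]) simp_all
 then have "Liminf (at_right m) (\<lambda>D. I D y0 s) = I m y0 s" by (intro lim_imp_Liminf) simp_all
 then show "Liminf (at_right m) (arrival y0 0 (ereal s)) = I m y0 s" unfolding arrival_def shift_time_0 by simp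
qed


section \<open>From the covering by times of presence to connecting trajectories\<close>

definition right_cover :: "real => ereal => bool" where
 "right_cover y0 L \<longleftrightarrow> real_Icc (r_i a b f y0 0) L \<subseteq> (\<Union>n. real_Icc (r_i a b f y0 n) (r_s a b f y0 n))"

lemma r_i_leI:
 assumes R: both_ends_min and y0: "y0 \<in> K"
  and h: "!!s d. s \<in> K ==> y0 < s ==> m < d ==> \<exists>D. m < D \<and> D < d \<and> arrival y0 n (ereal s) D <= ereal X"
 shows "r_i a b f y0 n <= ereal X" unfolding r_i_eq[OF R y0]
proof (rule SUP_least, rule ccontr)
 fix s assume s: "s \<in> {s \<in> K. y0 < s}" and "\<not> Liminf (at_right m) (arrival y0 n (ereal s)) <= ereal X"
 then have "ereal X < Liminf (at_right m) (arrival y0 n (ereal s))" by simp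
 then have "eventually (\<lambda>D. ereal X < arrival y0 n (ereal s) D) (at_right m)" by (rule less_LiminfD)
 then obtain d where d: "m < d" "!!D. m < D ==> D < d ==> ereal X < arrival y0 n (ereal s) D"
  unfolding eventually_at_right[OF less_add_one[of m]] by auto
 obtain D where "m < D" "D < d" "arrival y0 n (ereal s) D <= ereal X" using h[of s d] s d by auto
 then show False using d(2)[of D] by simp
qed

lemma r_s_geI:
 assumes y0: "y0 \<in> K"
  and h: "!!s d x. s \<in> K ==> y0 < s ==> m < d ==> x < X ==> \<exists>D. m < D \<and> D < d \<and> ereal x <= departure y0 n (ereal s) D"
 shows "ereal X <= r_s a b f y0 n" unfolding r_s_eq[OF y0]
proof (rule INF_greatest, rule ccontr)
 fix s assume s: "s \<in> {s \<in> K. y0 < s}" and "\<not> ereal X <= Limsup (at_right m) (departure y0 n (ereal s))"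
 then have "Limsup (at_right m) (departure y0 n (ereal s)) < ereal X" by simp
 then obtain x where x: "Limsup (at_right m) (departure y0 n (ereal s)) < ereal x" "ereal x < ereal X" using ereal_dense2 by blast
 from x(1) have "eventually (\<lambda>D. departure y0 n (ereal s) D < ereal x) (at_right m)" by (rule Limsup_lessD)
 then obtain d where d: "m < d" "!!D. m < D ==> D < d ==> departure y0 n (ereal s) D < ereal x"
  unfolding eventually_at_right[OF less_add_one[of m]] by auto
 obtain D where D: "m < D" "D < d" "ereal x <= departure y0 n (ereal s) D" using h[of s d x] s d x by auto
 then show False using d(2)[of D] by simp
qed

text \<open>The level comes from \<open>level_between\<close>, the sign of the initial momentum from
  the parity of \<open>n\<close>: excursions alternate between the sides, so an even number of them
  before the visit means a start to the right.\<close>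

lemma visit_exists:
 assumes R: both_ends_min and y0: "y0 \<in> K" and X: "0 < X" "r_i a b f y0 n <= ereal X" "ereal X <= r_s a b f y0 n"
  and s: "s \<in> K" "y0 < s"
 obtains y p where "sol y p X" "y 0 = y0" "m < V y0 - (p 0)\<^sup>2" "s <= y X"
proof -
 obtain m' where m': "m < m'" "m' <= V y0" "!!D t. D < m' ==> t \<in> {y0..s} ==> D < V t"
  by (rule below_min[OF R y0 s(1) less_imp_le[OF s(2)]]) (rule that)
 obtain D1 where D1: "m < D1" "D1 < m'" "arrival y0 n (ereal s) D1 < ereal X" by (rule r_i_leD[OF R y0 X(2) s m'(1)]) (rule that)
 obtain D2 where D2: "m < D2" "D2 < m'" "ereal X < departure y0 n (ereal s) D2" by (rule r_s_geD[OF R y0 X(3) s m'(1)]) (rule that)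
 obtain D where D: "m < D" "D < m'" "arrival y0 n (ereal s) D <= ereal X" "ereal X <= departure y0 n (ereal s) D"
 proof (rule level_between[OF R y0 s m'(2) _ D1 D2])
  fix D t assume "D < m'" "t \<in> {y0..s}"
  then show "D < V t" by (rule m'(3))
 qed (rule that)
 have DV: "D < V y0" using D m' by simp
 obtain l where l: "astar y0 D = ereal l" "l \<in> K" "l < y0" "V l = D"
  "!!t. l < t ==> t <= y0 ==> D < V t" by (rule turn_left[OF R y0 D(1) DV]) (rule that)
 obtain q where q: "bstar y0 D = ereal q" "q \<in> K" "y0 < q" "V q = D"
  "!!t. y0 <= t ==> t < q ==> D < V t" by (rule turn_right[OF R y0 D(1) DV]) (rule that)
 have sb: "s <= q" using m'(3)[OF D(2), of q] q by force
 define p0 where "p0 = (if even n then 1 else -1) * sqrt (V y0 - D)"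
 have p0: "V y0 - p0\<^sup>2 = D" "even n \<longleftrightarrow> p0 > 0" "p0 \<noteq> 0" unfolding p0_def using DV by auto
 have mp: "m < V y0 - p0\<^sup>2" using p0 D by simp
 obtain y p where yp: "sol y p X" "y 0 = y0" "p 0 = p0" by (rule confined_sol[OF R y0 mp])
 have "s <= y X"
 proof (rule visit_if_time[OF y0 l(2-5) q(2-5) refl refl s(2) sb yp(1)])
  show "shift_time (I D l y0) (I D y0 q) n + I D y0 s <= ereal X" using D(3) unfolding arrival_def L_int_def R_int_def l(1) q(1) .
  show "ereal X <= shift_time (I D l y0) (I D y0 q) n + (I D y0 q + I D s q)"
   using D(4) unfolding departure_def L_int_def R_int_def l(1) q(1) .
 qed (use X yp p0 in auto)
 then show ?thesis using that yp mp by blast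
qed

text \<open>Either \<open>X\<close> is so short that even on level \<open>m\<close>, faster than any
  level that can turn near \<open>b\<close>, some \<open>q\<close> is not reached in time; or the
  covering supplies a trapped trajectory ending above \<open>y1\<close>, which replaces the
  lightlike start of the shooting.\<close>

lemma right_data:
 assumes R: both_ends_min and y: "y0 \<in> K" "y1 \<in> K" and X: "0 < X" "ereal X < L" and cov: "right_cover y0 L"
 shows "(\<exists>q\<in>K. y0 < q \<and> ereal X < I m y0 q)
   \<or> (\<exists>y p. sol y p X \<and> y 0 = y0 \<and> m < V y0 - (p 0)\<^sup>2 \<and> y1 < y X)"
proof (cases "ereal X < r_i a b f y0 0")
 case True
 then show ?thesis unfolding r_i_0_eq[OF R y(1)] less_SUP_iff by auto
next
 case False
 then have "X \<in> real_Icc (r_i a b f y0 0) L" using X unfolding real_Icc_def by auto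
 then obtain n where n: "r_i a b f y0 n <= ereal X" "ereal X <= r_s a b f y0 n"
  using cov unfolding right_cover_def real_Icc_def by auto
 have "max y0 y1 \<in> K" using y by (simp add: max_def)
 then obtain s where s: "s \<in> K" "max y0 y1 < s" by (rule K_gt)
 obtain y p where "sol y p X" "y 0 = y0" "m < V y0 - (p 0)\<^sup>2" "s <= y X"
  by (rule visit_exists[OF R y(1) X(1) n s(1)]) (use s in \<open>auto intro: that\<close>)
 then show ?thesis using s by (intro disjI2 exI[of _ y] exI[of _ p]) auto
qed

text \<open>\<open>pm\<close> and \<open>pp\<close> are the initial values from which the shooting starts; each is either lightlike or
 such that the trajectory keeps away from both ends.\<close>

definition untouched :: "real => real => real => real => real => bool" where
 "untouched r pp pm X y0 \<longleftrightarrow> (\<exists>q. q <= r \<and> ereal X < I m y0 q)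
   \<or> V r < V y0 - pp\<^sup>2 \<and> (V r < V y0 - pm\<^sup>2 \<or> (\<exists>q. pm <= pp \<and> q <= y0 \<and> ereal X < I m q y0 \<and> (\<forall>t\<in>{q..y0}. V r < V t)))"

text \<open>A grazing trajectory runs on level \<open>V r\<close>, which each alternative of
  \<open>untouched\<close> excludes: the way up to \<open>q\<close> takes too long; or both extreme
  momenta have levels above \<open>V r\<close>, hence all momenta between them have; or only
  strongly negative momenta are left, and their dip below \<open>q\<close> alone takes longer than
  \<open>X\<close>.\<close>

lemma no_touch:
 assumes s: "sol y p x1" and y0: "y 0 = y0" "y0 < r" and T: "0 <= T" "T <= x1" "x1 <= X" "\<forall>x\<in>{0..x1}. y x <= r"
  "y T = r" "y x1 < r" and p: "min pm pp <= p 0" "p 0 <= max pm pp" and r: "m <= V r" and right: "untouched r pp pm X y0"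
 shows False
proof -
 have y0': "y 0 < r" using y0 by simp
 note te = touch_energy[OF s T(1,2,4,5) y0' T(6)]
 have en: "V y0 - (p 0)\<^sup>2 = V r" using te(4) y0 by simp
 from right show False unfolding untouched_def
 proof (elim disjE exE conjE)
  fix q assume q: "q <= r" "ereal X < I m y0 q"
  have "I m (y 0) (y T) <= ereal \<bar>T - 0\<bar>" by (rule travel_le[OF s]) (use T te r in auto)
  moreover have "I m y0 q <= I m (y 0) (y T)" using q y0 T by (intro hint_mono_set) auto
  ultimately have "I m y0 q <= ereal \<bar>T - 0\<bar>" by (rule order_trans[rotated])
  then have "ereal X < ereal \<bar>T - 0\<bar>" by (rule less_le_trans[OF q(2)])
  then show False using T by simp
 next
  assume "V r < V y0 - pp\<^sup>2" "V r < V y0 - pm\<^sup>2"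
  then have "pp\<^sup>2 < (p 0)\<^sup>2" "pm\<^sup>2 < (p 0)\<^sup>2" using en by auto
  then have "\<bar>pp\<bar> < \<bar>p 0\<bar>" "\<bar>pm\<bar> < \<bar>p 0\<bar>" by (simp_all add: abs_le_square_iff[symmetric] not_le[symmetric])
  then show False using p by (auto simp: min_def max_def abs_if split: if_splits)
 next
  fix q assume q: "V r < V y0 - pp\<^sup>2" "pm <= pp" "q <= y0" "ereal X < I m q y0" "\<forall>t\<in>{q..y0}. V r < V t"
  have "pp\<^sup>2 < (p 0)\<^sup>2" using en q by auto
  then have "\<bar>pp\<bar> < \<bar>p 0\<bar>" by (simp add: abs_le_square_iff[symmetric] not_le[symmetric])
  then have p0: "p 0 < 0" using p q(2) by (auto simp: abs_if split: if_splits)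
  have x1: "0 < x1" using te by simp
  obtain xd where xd: "xd \<in> {0<..x1}" "y xd < y 0" using sol_decreases[OF s _ x1 p0] by auto
  obtain xm where xm: "xm \<in> {0..T}" "!!x. x \<in> {0..T} ==> y xm <= y x"
  proof -
   have "continuous_on {0..T} y" using sol_cont(1)[OF s] T by (auto intro: continuous_on_subset)
   then have "\<exists>xm\<in>{0..T}. \<forall>x\<in>{0..T}. y xm <= y x" using T(1) by (intro continuous_attains_inf) auto
   then show thesis using that by blast
  qed
  have sT: "sol y p T" by (rule sol_restrict[OF s T(2)])
  obtain xe where xe: "xe \<in> {0<..T}" "y xe < y 0" using sol_decreases[OF sT _ te(1) p0] by auto
  have lt: "y xm < y 0" using xm(2)[of xe] xe by auto
  have xm': "0 < xm" "xm < T" using xm(1) lt y0 T by (auto simp: less_le)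
  have pm0: "p xm = 0" by (rule sol_interior_min[OF sT xm'(1,2) xm(2)])
  have Vm: "V (y xm) = V r" using sol_energy[OF sT xm(1)] pm0 en y0 by simp
  have "y xm < q" using q(5) Vm lt y0 by (metis atLeastAtMost_iff less_irrefl not_le less_imp_le)
  then have "I m q y0 <= I m (y xm) (y 0)" using y0 by (intro hint_mono_set) auto
  also have "\<dots> <= ereal \<bar>0 - xm\<bar>" by (rule travel_le[OF s]) (use xm T te r in auto)
  finally have "ereal X < ereal \<bar>0 - xm\<bar>" by (rule less_le_trans[OF q(4)])
  then have "X < xm" using xm' by simp
  then show False using xm' T by simp
 qed
qed

text \<open>Each extreme momentum is either lightlike, with an integral on level \<open>m\<close>
  that exceeds \<open>X\<close>, or trapped on a level above \<open>m\<close>. The barriers are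
  placed where \<open>V\<close> is below the levels of the trapped starts, so that these never reach
  them.\<close>

lemma R_imp_connects:
 assumes R: both_ends_min and y: "y0 \<in> K" "y1 \<in> K" and X: "0 < X" "ereal X < L" "I 0 y0 y1 < ereal X" "I 0 y1 y0 < ereal X"
  and cov: "right_cover y0 L" "warped.right_cover (- b) (- a) rf (- y0) L"
 shows "connects y0 y1 X"
proof -
 interpret R: warped "- b" "- a" rf rV1 rV2 by (rule warped_reflect)
 have RR: "R.both_ends_min" using R both_ends_min_reflect by simp
 have y': "- y0 \<in> R.K" "- y1 \<in> R.K" using y by (auto simp: einterval_reflect)
 have Vm: "m < V t" if "t \<in> K" for t using R that unfolding both_ends_min_def by blast
 have V0: "m < V y0" by (rule Vm[OF y(1)])
 have right: "(\<exists>q\<in>K. y0 < q \<and> ereal X < I m y0 q)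
   \<or> (\<exists>y p. sol y p X \<and> y 0 = y0 \<and> m < V y0 - (p 0)\<^sup>2 \<and> y1 < y X)"
  by (rule right_data[OF R y X(1,2) cov(1)])
 have left: "(\<exists>q\<in>K. q < y0 \<and> ereal X < I m q y0)
   \<or> (\<exists>y p. sol y p X \<and> y 0 = y0 \<and> m < V y0 - (p 0)\<^sup>2 \<and> y X < y1)"
  using R.right_data[OF RR y' X(1,2) cov(2)]
 proof (elim disjE bexE exE conjE)
  fix q assume q: "q \<in> R.K" "- y0 < q" "ereal X < R.I R.m (- y0) q"
  have qK: "- q \<in> K" using q by (simp add: einterval_reflect)
  have "R.I R.m (- y0) q = I m (- q) y0" using hint_reflect_real[OF qK y(1), of m] by (simp add: m_inf_reflect)
  then show ?thesis using q qK by (intro disjI1 bexI[of _ "- q"]) auto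
 next
  fix z p assume "R.sol z p X" "z 0 = - y0" "R.m < inv_sq rf (- y0) - (p 0)\<^sup>2" "- y1 < z X"
  then show ?thesis using sol_reflect[of "\<lambda>x. - z x" "\<lambda>x. - p x" X]
   by (intro disjI2 exI[of _ "\<lambda>x. - z x"] exI[of _ "\<lambda>x. - p x"]) (auto simp: m_inf_reflect inv_sq_reflect)
 qed
 define yl where "yl = min y0 y1"
 define yr where "yr = max y0 y1"
 have yK: "yl \<in> K" "yr \<in> K" "yl <= y0" "yl <= y1" "y0 <= yr" "y1 <= yr"
  unfolding yl_def yr_def using y by (auto simp: min_def max_def)
 \<comment> \<open>a starting value, its level if it is confined, and how far the outer comparison integral reaches\<close>
 obtain pp er qr where pp: "qr \<in> K" "y0 <= qr" "m < er" "er <= V y0" "pp\<^sup>2 <= V y0"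
  "(pp = sqrt (V y0) \<and> ereal X < I m y0 qr) \<or>
   (V y0 - pp\<^sup>2 = er \<and> (\<exists>y p. sol y p X \<and> y 0 = y0 \<and> p 0 = pp \<and> y1 < y X))" using right
 proof (elim disjE bexE exE conjE)
  fix q assume q: "q \<in> K" "y0 < q" "ereal X < I m y0 q"
  show thesis by (rule that[of q "V y0" "sqrt (V y0)"]) (use q V0 Vpos[OF y(1)] in auto)
 next
  fix z p assume "sol z p X" "z 0 = y0" "m < V y0 - (p 0)\<^sup>2" "y1 < z X"
  then show thesis using m_nonneg y by (intro that[of y0 "V y0 - (p 0)\<^sup>2" "p 0"]) auto
 qed
 obtain pm el ql where pm: "ql \<in> K" "ql <= y0" "m < el" "el <= V y0" "pm\<^sup>2 <= V y0"
  "(pm = - sqrt (V y0) \<and> ereal X < I m ql y0) \<or>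
   (V y0 - pm\<^sup>2 = el \<and> (\<exists>y p. sol y p X \<and> y 0 = y0 \<and> p 0 = pm \<and> y X < y1))" using left
 proof (elim disjE bexE exE conjE)
  fix q assume q: "q \<in> K" "q < y0" "ereal X < I m q y0"
  show thesis by (rule that[of q "V y0" "- sqrt (V y0)"]) (use q V0 Vpos[OF y(1)] in auto)
 next
  fix z p assume "sol z p X" "z 0 = y0" "m < V y0 - (p 0)\<^sup>2" "z X < y1"
  then show thesis using m_nonneg y by (intro that[of y0 "V y0 - (p 0)\<^sup>2" "p 0"]) auto
 qed
 have ppb: "\<bar>pp\<bar> <= sqrt (V y0)" "\<bar>pm\<bar> <= sqrt (V y0)" using pp(5) pm(5) by (auto intro: real_le_rsqrt)
 have qlr: "ql <= qr" using pp pm by simp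
 obtain w where w: "w \<in> {ql..qr}" "!!t. t \<in> {ql..qr} ==> V w <= V t" by (rule V_min[OF pm(1) pp(1) qlr]) (rule that)
 \<comment> \<open>Below the trapped levels and below \<open>V\<close> on \<open>[ql, qr]\<close>;
   the latter forces a detour on the level of a barrier to go beyond \<open>ql\<close> or
   \<open>qr\<close>, which takes too long.\<close>
 define e where "e = min (V w) (min er el)"
 have "w \<in> K" using in_K[OF pm(1) pp(1)] w by auto
 then have e: "m < e" "e <= er" "e <= el" unfolding e_def using Vm pp(3) pm(3) by auto
 have e4: "e <= V t" if "t \<in> {ql..qr}" for t using w(2)[OF that] unfolding e_def by simp
 have "max yr qr \<in> K" using yK pp by (auto simp: max_def)
 then obtain r where r: "max yr qr < r" "r \<in> K" "V r < e" by (rule near_right_end[OF R e(1)])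
 have "min yl ql \<in> K" using yK pm by (auto simp: min_def)
 then obtain l where l: "l < min yl ql" "l \<in> K" "V l < e" by (rule near_left_end[OF R e(1)])
 have mr_: "m <= V r" "m <= V l" using Vm r l by (auto intro: less_imp_le)
 have same: "z' x = z x \<and> l < z x \<and> z x < r" if z: "sol z p X" "z 0 = y0" "e <= V y0 - (p 0)\<^sup>2" and z': "csol l r z' p' X" "z' 0 = y0" "p' 0 = p 0"
   and x: "x \<in> {0..X}" for z p z' p' x
 proof -
  have c: "\<forall>x\<in>{0..X}. l < z' x \<and> z' x < r" "sol z' p' X"
   by (rule csol_confined[OF l(2) r(2) z'(1)]; use z z' l r yK in auto)+
  then have "z' x = z x" using sol_unique(1)[OF c(2) z(1) _ _ x] z z' by simp
  then show ?thesis using bspec[OF c(1) x] by simp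
 qed
 show ?thesis
 proof (rule connects_shoot[OF l(2) r(2), where i = "min pm pp" and j = "max pm pp" and pp = pp and pm = pm])
  show "l < y0" "y0 < r" "l < y1" "y1 < r" using l r yK by auto
  show "pm \<in> {min pm pp..max pm pp}" "pp \<in> {min pm pp..max pm pp}" by auto
 next
  fix z p T x1
  assume s: "sol z p x1" "z 0 = y0" "min pm pp <= p 0" "p 0 <= max pm pp" "0 <= T" "T <= x1" "x1 <= X"
   "\<forall>x\<in>{0..x1}. l <= z x \<and> z x <= r" "z T = r" "z x1 = y1"
  show False
  proof (rule no_touch[OF s(1,2) _ s(5,6,7) _ s(9) _ s(3,4) mr_(1)])
   show "y0 < r" "\<forall>x\<in>{0..x1}. z x <= r" "z x1 < r" using r yK s by auto
   show "untouched r pp pm X y0" using pp(6)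
   proof (elim disjE conjE)
    assume "ereal X < I m y0 qr"
    then show ?thesis unfolding untouched_def using r by (intro disjI1 exI[of _ qr]) auto
   next
    assume p1: "V y0 - pp\<^sup>2 = er"
    have "V r < V y0 - pm\<^sup>2 \<or> (\<exists>q. pm <= pp \<and> q <= y0 \<and> ereal X < I m q y0 \<and> (\<forall>t\<in>{q..y0}. V r < V t))"
     using pm(6)
    proof (elim disjE conjE)
     assume "pm = - sqrt (V y0)" "ereal X < I m ql y0"
     then show ?thesis using e4 r ppb pp(2) pm(2) by (intro disjI2 exI[of _ ql]) force
    next
     assume "V y0 - pm\<^sup>2 = el"
     then show ?thesis using e r by simp
    qed
    then show ?thesis unfolding untouched_def using p1 e r by simp
   qed
  qed
 next
  fix z p T x1
  assume s: "sol z p x1" "z 0 = y0" "min pm pp <= p 0" "p 0 <= max pm pp" "0 <= T" "T <= x1" "x1 <= X"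
   "\<forall>x\<in>{0..x1}. l <= z x \<and> z x <= r" "z T = l" "z x1 = y1"
  have hr: "R.I D (- y0) (- q) = I D q y0" "R.I D (- q) (- y0) = I D y0 q" if "q \<in> K" for q D using hint_reflect_real that y by auto
  show False
  proof (rule R.no_touch[OF sol_reflect1[OF s(1)], of "- y0" "- l" T X "- pp" "- pm"])
   show "- z 0 = - y0" "- y0 < - l" "\<forall>x\<in>{0..x1}. - z x <= - l" "- z T = - l" "- z x1 < - l" using l yK s by auto
   show "min (- pp) (- pm) <= - p 0" "- p 0 <= max (- pp) (- pm)" using s(3,4) by (auto simp: min_def max_def split: if_splits)
   show "R.m <= inv_sq rf (- l)" using mr_ by (simp add: m_inf_reflect inv_sq_reflect)
   show "R.untouched (- l) (- pm) (- pp) X (- y0)" using pm(6)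
   proof (elim disjE conjE)
    assume "ereal X < I m ql y0"
    then show ?thesis unfolding R.untouched_def using l hr(1)[OF pm(1)] by (intro disjI1 exI[of _ "- ql"]) (auto simp: m_inf_reflect)
   next
    assume p1: "V y0 - pm\<^sup>2 = el"
    have "V l < V y0 - pp\<^sup>2 \<or>
     (\<exists>q. - pp <= - pm \<and> q <= - y0 \<and> ereal X < R.I R.m q (- y0) \<and>
      (\<forall>t\<in>{q..- y0}. V l < V (- t)))" using pp(6)
    proof (elim disjE conjE)
     assume "pp = sqrt (V y0)" "ereal X < I m y0 qr"
     moreover have "V l < V (- t)" if "t \<in> {- qr..- y0}" for t using e4[of "- t"] that l pm(2) by simp
     ultimately show ?thesis using ppb pp(2) hr(2)[OF pp(1), of m] by (intro disjI2 exI[of _ "- qr"]) (auto simp: m_inf_reflect)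
    next
     assume "V y0 - pp\<^sup>2 = er"
     then show ?thesis using e l by simp
    qed
    then show ?thesis unfolding R.untouched_def using p1 e l by (simp add: inv_sq_reflect)
   qed
  qed (use s in auto)
 next
  fix z p assume z: "csol l r z p X" "z 0 = y0" "p 0 = pp"
  show "ahead l r y1 X z" using pp(6)
  proof (elim disjE exE conjE)
   assume "pp = sqrt (V y0)"
   then show ?thesis using z l r yK X by (intro ahead_lightlike[OF l(2) r(2) z(1)]) auto
  next
   fix z0 p0 assume z0: "V y0 - pp\<^sup>2 = er" "sol z0 p0 X" "z0 0 = y0" "p0 0 = pp" "y1 < z0 X"
   have "z x = z0 x \<and> l < z0 x \<and> z0 x < r" if "x \<in> {0..X}" for x
    by (rule same[OF z0(2,3) _ z(1,2) _ that]) (use z0 z e in auto)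
   then show ?thesis unfolding ahead_def using z0(5) X by (intro bexI[of _ X]) auto
  qed
 next
  fix z p assume z: "csol l r z p X" "z 0 = y0" "p 0 = pm"
  show "ahead (- r) (- l) (- y1) X (\<lambda>x. - z x)" using pm(6)
  proof (elim disjE exE conjE)
   assume "pm = - sqrt (V y0)"
   then show ?thesis using z l r yK X by (intro behind_lightlike[OF l(2) r(2) z(1)]) auto
  next
   fix z0 p0 assume z0: "V y0 - pm\<^sup>2 = el" "sol z0 p0 X" "z0 0 = y0" "p0 0 = pm" "z0 X < y1"
   have "z x = z0 x \<and> l < z0 x \<and> z0 x < r" if "x \<in> {0..X}" for x
    by (rule same[OF z0(2,3) _ z(1,2) _ that]) (use z0 z e in auto)
   then show ?thesis unfolding ahead_def using z0(5) X by (intro bexI[of _ X]) auto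
  qed
 qed (rule X(1))
qed


section \<open>From connecting trajectories to the covering\<close>

lemma arrival_mono: "s <= s' ==> arrival y0 n s D <= arrival y0 n s' D"
 unfolding arrival_def by (intro add_left_mono hint_mono_set) auto

lemma departure_antimono: "s <= s' ==> departure y0 n s' D <= departure y0 n s D"
 unfolding departure_def by (intro add_left_mono hint_mono_set) auto

lemma shift_time_ge:
 assumes "0 <= L" "0 <= R"
 shows "ereal (real (n - 1)) * R <= shift_time L R n"
proof (cases "even n")
 case True
 have "ereal (real (n - 1)) * R <= ereal (real n) * (L + R)" using assms by (intro ereal_mult_mono) (auto intro: add_increasing)
 then show ?thesis unfolding shift_time_def using True by simp
next
 case False
 have "ereal (real (n - 1)) * R <= ereal (real (n - 1)) * (L + R)" using assms by (intro ereal_mult_mono) (auto intro: add_increasing)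
 also have "\<dots> <= 2 * L + ereal (real (n - 1)) * (L + R)" using assms by (intro add_increasing) auto
 finally show ?thesis unfolding shift_time_def using False by simp
qed

text \<open>The trajectory that connects \<open>y0\<close> with the turning point \<open>s\<close>
  of a level \<open>D0\<close> close to \<open>m\<close> has a level \<open>D <= D0\<close>. If
  \<open>D <= m\<close> it would never turn and would arrive too early. So it oscillates, and
  \<open>time_if_visit\<close> tells during which visit it is at \<open>s\<close>; the bound on
  \<open>n\<close> does not depend on the level.\<close>

lemma crossing:
 assumes R: both_ends_min and y0: "y0 \<in> K"
  and conn: "!!y1 X. y1 \<in> K ==> 0 < X ==> ereal X < L ==> I 0 y0 y1 < ereal X ==>
   I 0 y1 y0 < ereal X ==> connects y0 y1 X"
  and x: "r_i a b f y0 0 < ereal x" "ereal x < L" and s0: "s0 \<in> K" "y0 < s0" and d: "m < d"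
 obtains D n where "m < D" "D < d" "arrival y0 n (ereal s0) D <= ereal x" "ereal x <= departure y0 n (ereal s0) D"
  "ereal (real (n - 1)) * I m y0 s0 <= ereal x"
proof -
 have Vm: "m < V t" if "t \<in> K" for t using R that unfolding both_ends_min_def by blast
 obtain m' where m': "m < m'" "m' <= V y0" "!!D t. D < m' ==> t \<in> {y0..s0} ==> D < V t"
  by (rule below_min[OF R y0 s0(1) less_imp_le[OF s0(2)]]) (rule that)
 define D0 where "D0 = (m + min m' d) / 2"
 have D0: "m < D0" "D0 < m'" "D0 < d" unfolding D0_def using m'(1) d by (auto simp: min_def)
 have D0V: "D0 < V y0" using D0 m' by simp
 obtain s where s: "bstar y0 D0 = ereal s" "s \<in> K" "y0 < s" "V s = D0"
  "!!t. y0 <= t ==> t < s ==> D0 < V t" by (rule turn_right[OF R y0 D0(1) D0V]) (rule that)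
 have ss: "s0 <= s" using m'(3)[OF D0(2), of s] s by force
 have inK: "t \<in> K" if "y0 <= t" "t <= s" for t using in_K[OF y0 s(2)] that by auto
 have Hs: "I m y0 s <= r_i a b f y0 0" unfolding r_i_0_eq[OF R y0] by (rule SUP_upper) (use s in auto)
 have Hm: "I D y0 s <= I m y0 s" if "D <= m" for D using that Vm inK by (intro hint_mono_D) auto
 have Hx: "I m y0 s < ereal x" using Hs x by simp
 have x0: "0 < x" using le_less_trans[OF hint_nonneg Hx] by simp
 have H0: "I 0 y0 s < ereal x" using Hm[of 0] m_nonneg Hx by (auto intro: le_less_trans)
 have "I 0 s y0 < ereal x" using s x0 by (simp add: hint_empty)
 from conn[OF s(2) x0 x(2) H0 this] obtain y p where yp: "sol y p x" "y 0 = y0" "y x = s" unfolding connects_def by blast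
 define D where "D = V y0 - (p 0)\<^sup>2"
 have en: "V (y z) = D + (p z)\<^sup>2" if "z \<in> {0..x}" for z using sol_energy[OF yp(1) that] yp unfolding D_def by simp
 have yK: "y z \<in> K" if "z \<in> {0..x}" for z using yp(1) that unfolding sol_def by blast
 have DD0: "D <= D0" using en[of x] x0 yp s by auto
 have Dm: "m < D"
 proof (rule ccontr)
  assume "\<not> m < D"
  then have nD: "D <= m" by simp
  have pn: "p z \<noteq> 0" if "z \<in> {0..x}" for z using en[OF that] Vm[OF yK[OF that]] nD by auto
  have pc: "continuous_on {0..x} p" by (rule sol_cont(2)[OF yp(1)])
  have conn: "connected (p ` {0..x})" by (rule connected_continuous_image[OF pc]) simp
  have sgn: "(\<forall>z\<in>{0..x}. p z > 0) \<or> (\<forall>z\<in>{0..x}. p z < 0)"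
  proof (rule ccontr)
   assume "\<not> ?thesis"
   then obtain z1 z2 where z: "z1 \<in> {0..x}" "z2 \<in> {0..x}" "p z1 <= 0" "0 <= p z2" by (auto simp: not_less)
   then have "0 \<in> p ` {0..x}" using connectedD_interval[OF conn, of "p z1" "p z2" 0] by auto
   then show False using pn by auto
  qed
  then show False
  proof
   assume pos: "\<forall>z\<in>{0..x}. p z > 0"
   have "ereal (x - 0) <= I D (y 0) (y x)" by (rule travel_ge[OF yp(1)]) (use pos x0 yp D_def in auto)
   then show False using Hm[OF nD] Hx yp by (auto dest: le_less_trans)
  next
   assume neg: "\<forall>z\<in>{0..x}. p z < 0"
   interpret R: warped "- b" "- a" rf rV1 rV2 by (rule warped_reflect)
   have "ereal (x - 0) <= R.I D (- y 0) (- y x)"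
    by (rule R.travel_ge[OF sol_reflect1[OF yp(1)]]) (use neg x0 yp D_def in \<open>auto simp: inv_sq_reflect\<close>)
   then show False using yp s x0 by (simp add: hint_empty)
  qed
 qed
 have DV: "D < V y0" using DD0 D0V by simp
 obtain l where l: "astar y0 D = ereal l" "l \<in> K" "l < y0" "V l = D"
  "!!t. l < t ==> t <= y0 ==> D < V t" by (rule turn_left[OF R y0 Dm DV]) (rule that)
 obtain q where q: "bstar y0 D = ereal q" "q \<in> K" "y0 < q" "V q = D"
  "!!t. y0 <= t ==> t < q ==> D < V t" by (rule turn_right[OF R y0 Dm DV]) (rule that)
 have sb: "s <= q" using s(5)[of q] q DD0 by force
 have p0: "p 0 \<noteq> 0" using DV unfolding D_def by auto
 obtain n where n: "shift_time (lint y0 D) (rint y0 D) n + I D y0 s <= ereal x"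
   "ereal x <= shift_time (lint y0 D) (rint y0 D) n + (rint y0 D + I D s q)"
  using time_if_visit[OF y0 l(2-5) q(2-5) refl refl s(3) sb yp(1) less_imp_le[OF x0] yp(2) D_def p0] yp(3)
  unfolding L_int_def R_int_def l(1) q(1) by blast
 show thesis
 proof (rule that[OF Dm])
  show "D < d" using DD0 D0 by simp
  have "arrival y0 n (ereal s0) D <= arrival y0 n (ereal s) D" using ss by (intro arrival_mono) simp
  then show ar: "arrival y0 n (ereal s0) D <= ereal x" using n(1) unfolding arrival_def by simp
  have "departure y0 n (ereal s) D <= departure y0 n (ereal s0) D" using ss by (intro departure_antimono) simp
  then show "ereal x <= departure y0 n (ereal s0) D" using n(2) unfolding departure_def q(1) by simp
  have "I m y0 s0 <= I D y0 s0" using Dm m'(3)[of D] DD0 D0 by (intro hint_mono_D) auto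
  also have "\<dots> <= rint y0 D" unfolding R_int_def q(1) using ss sb by (intro hint_mono_set) auto
  finally have "ereal (real (n - 1)) * I m y0 s0 <= ereal (real (n - 1)) * rint y0 D" by (intro ereal_mult_left_mono) auto
  also have "\<dots> <= shift_time (lint y0 D) (rint y0 D) n" by (intro shift_time_ge L_R_int_nonneg)
  also have "\<dots> <= arrival y0 n (ereal s0) D" unfolding arrival_def by (intro add_increasing2) (simp_all add: hint_nonneg)
  finally show "ereal (real (n - 1)) * I m y0 s0 <= ereal x" using ar by simp
 qed
qed

text \<open>The left end of the interval to be covered is out of reach of \<open>crossing\<close>,
  which asks for a strictly larger time. Here the outward leg alone makes the departure of visit 0
  late enough.\<close>

lemma cover_first:
 assumes R: both_ends_min and y0: "y0 \<in> K" and x: "r_i a b f y0 0 = ereal x"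
 shows "ereal x <= r_s a b f y0 0"
proof (rule r_s_geI[OF y0])
 fix s d x' assume h: "s \<in> K" "y0 < s" "m < d" "x' < x"
 have "ereal x' < (SUP s\<in>{s \<in> K. y0 < s}. I m y0 s)" using h x unfolding r_i_0_eq[OF R y0] by simp
 then obtain s' where s': "s' \<in> K" "y0 < s'" "ereal x' < I m y0 s'" unfolding less_SUP_iff by blast
 obtain m' where m': "m < m'" "m' <= V y0" "!!D t. D < m' ==> t \<in> {y0..s'} ==> D < V t"
  by (rule below_min[OF R y0 s'(1) less_imp_le[OF s'(2)]]) (rule that)
 define D where "D = (m + min m' d) / 2"
 have D: "m < D" "D < m'" "D < d" unfolding D_def using m'(1) h by (auto simp: min_def)
 have DV: "D < V y0" using D m' by simp
 obtain q where q: "bstar y0 D = ereal q" "q \<in> K" "y0 < q" "V q = D" by (rule turn_right[OF R y0 D(1) DV]) (rule that)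
 have "s' <= q" using m'(3)[OF D(2), of q] q by force
 have "I m y0 s' <= I D y0 s'" using D(1) m'(3)[OF D(2)] by (intro hint_mono_D) auto
 also have "\<dots> <= rint y0 D" unfolding R_int_def q(1) using \<open>s' <= q\<close> by (intro hint_mono_set) auto
 also have "\<dots> <= departure y0 0 (ereal s) D" unfolding departure_def shift_time_0 by (simp add: hint_nonneg add_increasing2)
 finally have "ereal x' <= departure y0 0 (ereal s) D" using s'(3) by simp
 then show "\<exists>D>m. D < d \<and> ereal x' <= departure y0 0 (ereal s) D" using D by blast
qed

text \<open>A time \<open>x\<close> poses infinitely many requirements, one for each height
  \<open>s\<close>, level bound \<open>d\<close> and time \<open>x' < x\<close>, and
  \<open>crossing\<close> may answer them with different \<open>n\<close>. Since \<open>n\<close>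
  stays bounded by \<open>N\<close>, some \<open>n\<close> answers all of them: otherwise one
  failing requirement for each \<open>n\<close> could be merged into a single one that
  \<open>crossing\<close> contradicts.\<close>

lemma cover_if_connected:
 assumes R: both_ends_min and y0: "y0 \<in> K"
  and conn: "!!y1 X. y1 \<in> K ==> 0 < X ==> ereal X < L ==> I 0 y0 y1 < ereal X ==>
   I 0 y1 y0 < ereal X ==> connects y0 y1 X"
 shows "right_cover y0 L" unfolding right_cover_def
proof
 fix x assume "x \<in> real_Icc (r_i a b f y0 0) L"
 then have x: "r_i a b f y0 0 <= ereal x" "ereal x <= L" unfolding real_Icc_def by auto
 show "x \<in> (\<Union>n. real_Icc (r_i a b f y0 n) (r_s a b f y0 n))"
 proof (cases "r_i a b f y0 0 = ereal x")
  case True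
  have "x \<in> real_Icc (r_i a b f y0 0) (r_s a b f y0 0)" unfolding real_Icc_def using x(1) cover_first[OF R y0 True] by auto
  then show ?thesis by blast
 next
  case False
  then have "r_i a b f y0 0 < ereal x" using x(1) by simp
  then obtain x0 where x0: "r_i a b f y0 0 < ereal x0" "ereal x0 < ereal x" using ereal_dense2 by blast
  have Vm: "m < V t" if "t \<in> K" for t using R that unfolding both_ends_min_def by blast
  obtain s1 where s1: "s1 \<in> K" "y0 < s1" by (rule K_gt[OF y0])
  define w where "w = real_of_ereal (I m y0 s1)"
  have Hle: "I m y0 s1 <= r_i a b f y0 0" unfolding r_i_0_eq[OF R y0] by (rule SUP_upper) (use s1 in auto)
  have pos: "0 < I m y0 s1" using y0 s1 Vm K_bounds in_K[OF y0 s1(1)] by (intro hint_pos) auto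
  have w: "I m y0 s1 = ereal w" "0 < w" using pos le_less_trans[OF Hle x0(1)] unfolding w_def by (cases "I m y0 s1"; auto)+
  \<comment> \<open>From \<open>(n - 1) * w <= x\<close>, the bound of \<open>crossing\<close> on
    the number of the visit.\<close>
  define N where "N = nat \<lceil>x / w\<rceil> + 1"
  define good where "good n q \<longleftrightarrow> (case q of (s, d, x') => s \<in> K --> y0 < s --> m < d --> x' < x -->
   (\<exists>D. m < D \<and> D < d \<and> arrival y0 n (ereal s) D <= ereal x \<and> ereal x' <= departure y0 n (ereal s) D))" for n q
  have "\<exists>n\<le>N. \<forall>q. good n q"
  proof (rule ccontr)
   assume "\<not> ?thesis"
   then have "\<forall>n\<in>{..N}. \<exists>q. \<not> good n q" by blast
   from bchoice[OF this] obtain q where "\<forall>n\<in>{..N}. \<not> good n (q n)" by blast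
   then have q: "!!n. n <= N ==> fst (q n) \<in> K" "!!n. n <= N ==> m < fst (snd (q n))" "!!n. n <= N ==> snd (snd (q n)) < x"
    "!!n D. n <= N ==> m < D ==> D < fst (snd (q n)) ==> arrival y0 n (ereal (fst (q n))) D <= ereal x ==> \<not> ereal (snd (snd (q n))) <= departure y0 n (ereal (fst (q n))) D"
    unfolding good_def by (auto simp: case_prod_beta)
   define s where "s = Max (insert s1 ((\<lambda>n. fst (q n)) ` {..N}))"
   define d where "d = Min ((\<lambda>n. fst (snd (q n))) ` {..N})"
   \<comment> \<open>The merged time stays strictly below \<open>x\<close>, which may equal
     \<open>L\<close>, whereas \<open>crossing\<close> needs a time less than \<open>L\<close>;
     inserting \<open>x0\<close> keeps it above the initial rise.\<close>
   define x' where "x' = Max (insert x0 ((\<lambda>n. snd (snd (q n))) ` {..N}))"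
   have "s \<in> insert s1 ((\<lambda>n. fst (q n)) ` {..N})" unfolding s_def by (rule Max_in) auto
   then have sK: "s \<in> K" using s1 q(1) by auto
   have sge: "s1 <= s" "!!n. n <= N ==> fst (q n) <= s" unfolding s_def by (rule Max_ge; simp)+
   have d: "m < d" "!!n. n <= N ==> d <= fst (snd (q n))" unfolding d_def using q(2) by (simp, intro Min_le) auto
   have "x' \<in> insert x0 ((\<lambda>n. snd (snd (q n))) ` {..N})" unfolding x'_def by (rule Max_in) auto
   then have x'x: "x' < x" using x0(2) q(3) by auto
   have x'ge: "x0 <= x'" "!!n. n <= N ==> snd (snd (q n)) <= x'" unfolding x'_def by (rule Max_ge; simp)+
   have x'1: "r_i a b f y0 0 < ereal x'" using x0(1) x'ge(1) by (auto intro: less_le_trans)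
   have x'2: "ereal x' < L" by (rule less_le_trans[OF _ x(2)]) (use x'x in simp)
   have sy: "y0 < s" using s1 sge by simp
   obtain D n where D: "m < D" "D < d" "arrival y0 n (ereal s) D <= ereal x'" "ereal x' <= departure y0 n (ereal s) D"
    "ereal (real (n - 1)) * I m y0 s <= ereal x'" by (rule crossing[OF R y0 conn x'1 x'2 sK sy d(1)])
   have "ereal w <= I m y0 s" unfolding w(1)[symmetric] using sge by (intro hint_mono_set) auto
   then have "ereal (real (n - 1)) * ereal w <= ereal (real (n - 1)) * I m y0 s" by (intro ereal_mult_left_mono) auto
   also have "\<dots> <= ereal x" using D(5) x'x by (auto intro: order_trans)
   finally have "real (n - 1) * w <= x" by simp
   then have "real (n - 1) <= x / w" using w(2) by (simp add: field_simps)
   then have nN: "n <= N" unfolding N_def by linarith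
   have "arrival y0 n (ereal (fst (q n))) D <= arrival y0 n (ereal s) D" using sge(2)[OF nN] by (intro arrival_mono) simp
   also have "\<dots> <= ereal x" using D(3) x'x by (auto intro: order_trans)
   finally have ar: "arrival y0 n (ereal (fst (q n))) D <= ereal x" .
   have "ereal (snd (snd (q n))) <= ereal x'" using x'ge(2)[OF nN] by simp
   also have "\<dots> <= departure y0 n (ereal s) D" by (rule D(4))
   also have "\<dots> <= departure y0 n (ereal (fst (q n))) D" using sge(2)[OF nN] by (intro departure_antimono) simp
   finally show False using q(4)[OF nN D(1) less_le_trans[OF D(2) d(2)[OF nN]] ar] by simp
  qed
  then obtain n where n: "!!s d x'. good n (s, d, x')" by blast
  have "r_i a b f y0 n <= ereal x"
  proof (rule r_i_leI[OF R y0])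
   fix s d assume "s \<in> K" "y0 < s" "m < d"
   then show "\<exists>D>m. D < d \<and> arrival y0 n (ereal s) D <= ereal x" using n[of s d "x - 1"] unfolding good_def by auto
  qed
  moreover have "ereal x <= r_s a b f y0 n"
  proof (rule r_s_geI[OF y0])
   fix s d x' assume "s \<in> K" "y0 < s" "m < d" "x' < x"
   then show "\<exists>D>m. D < d \<and> ereal x' <= departure y0 n (ereal s) D" using n[of s d x'] unfolding good_def by auto
  qed
  ultimately show ?thesis unfolding real_Icc_def by auto
 qed
qed

end

section \<open>Conditions (C) and (R) expressed by the right ends of the data and of their
  reflection\<close>

lemma Lim_reflect:
 fixes g h :: "ereal => 'a::t2_space"
 assumes z: "a < (z::ereal)" and eq: "!!s. a < s ==> s < z ==> g (- s) = h s"
 shows "Lim (at_left (- a)) g = Lim (at_right a) h"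
proof -
 have za: "- z < - a" using z by simp
 have F: "filtermap uminus (at_left (- a)) = at_right a" using at_left_reflect[OF za] by simp
 have "eventually (\<lambda>x. g x = h (- x)) (at_left (- a))" unfolding eventually_at_left[OF za]
 proof (intro exI[of _ "- z"] conjI allI impI za)
  fix y assume y: "- z < y" "y < - a"
  have "a < - y" "- y < z" using y by (simp_all add: ereal_less_uminus_reorder ereal_uminus_less_reorder)
  then show "g y = h (- y)" using eq[of "- y"] by simp
 qed
 then have "(g \<longlongrightarrow> l) (at_left (- a)) \<longleftrightarrow> (h \<longlongrightarrow> l) (at_right a)" for l
  unfolding F[symmetric] filterlim_filtermap by (rule filterlim_cong[OF refl refl])
 then show ?thesis unfolding t2_space_class.Lim_def by presburger
qed

context warped
begin

lemma ereal_uminus_less: "ereal (- s) < - u \<longleftrightarrow> u < ereal s" "- u < ereal (- s) \<longleftrightarrow> ereal s < u"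
 "- u <= ereal (- s) \<longleftrightarrow> ereal s <= u" by (cases u; simp)+

lemma above_left_reflect: "above_right (- b) (- a) rf (- s) \<longleftrightarrow> above_left a b f s"
proof -
 have "(\<forall>t. - s < t \<and> ereal t < - a --> m_left a f < ereal (inv_sq f (- t)))
   \<longleftrightarrow> (\<forall>t. a < ereal t \<and> t < s --> m_left a f < ereal (inv_sq f t))" (is "?A \<longleftrightarrow> ?B")
 proof
  assume h: ?A
  show ?B
  proof (intro allI impI)
   fix t assume "a < ereal t \<and> t < s"
   then show "m_left a f < ereal (inv_sq f t)" using h[rule_format, of "- t"] by (simp add: ereal_uminus_less)
  qed
 next
  assume h: ?B
  show ?A
  proof (intro allI impI)
   fix t assume "- s < t \<and> ereal t < - a"
   then show "m_left a f < ereal (inv_sq f (- t))" using h[rule_format, of "- t"] ereal_uminus_less(1)[of "- t" a] by auto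
  qed
 qed
 then show ?thesis unfolding above_right_def above_left_def m_right_reflect inv_sq_reflect ereal_uminus_less by auto
qed

lemma rel_min_left_reflect: "rel_min_right (- b) (- a) rf \<longleftrightarrow> rel_min_left a b f"
 unfolding rel_min_right_def rel_min_left_def by (metis above_left_reflect minus_minus)

lemma close_left_reflect: "close_right (- b) (- a) rf (- c) \<longleftrightarrow> close_left a b f c"
 unfolding close_right_def close_left_def ereal_uminus_less by (metis above_left_reflect minus_minus neg_less_iff_less)

lemma a_star_ge: "c \<in> K ==> a <= astar c D"
 unfolding a_star_def A_minus_def using K_bounds[of c] by (auto intro!: Sup_upper)

lemma b_star_le: "c \<in> K ==> bstar c D <= b"
 unfolding b_star_def A_plus_def using K_bounds[of c] by (auto intro!: Inf_lower)

lemma hint_a_star_reflect: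
 assumes "c \<in> K" "ereal s <= b"
 shows "hint rf D (ereal (- s)) (b_star (- b) (- a) rf (- c) D) = H D (astar c D) (ereal s)"
 using hint_reflect[OF a_star_ge[OF assms(1)] assms(2), of D D] unfolding b_star_reflect[OF assms(1)] by simp

lemma hint_b_star_reflect:
 assumes "c \<in> K" "a <= u"
 shows "hint rf D (a_star (- b) (- a) rf (- c) D) (- u) = H D u (bstar c D)"
 using hint_reflect[OF assms(2) b_star_le[OF assms(1)], of D D] unfolding a_star_reflect[OF assms(1)] by simp

text \<open>The disjunction of Condition (C) at \<open>b\<close> as it is written, side conditions
  included, with the base point as an argument; \<open>right_C\<close> is its weaker form in which
  each alternative carries its own close base point.\<close>

definition right_alternative :: "real => ereal => bool" where
 "right_alternative c L \<longleftrightarrow> \<not> relmin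
   \<or> (\<exists>c. close c \<and> H mr (ereal c) b = \<infinity>)
   \<or> (relmin \<and> (\<exists>c. close c \<and> H mr (ereal c) b < \<infinity>) \<and> L <= 2 * d_at c)
   \<or> (relmin \<and> (\<exists>c. close c \<and> H mr (ereal c) b < \<infinity>) \<and> 2 * d_at c < L
     \<and> ereal m < m_right b f \<and> i_at c <= d_at c)"

lemma right_alternative_imp: 
 assumes c: "relmin ==> close c" and r: "right_alternative c L"
 shows "right_C L"
proof (cases "relmin \<and> H mr (ereal c) b < \<infinity>")
 case True
 have "m < mr" if "ereal m < m_right b f" using that m_right_real(1) True by (metis less_ereal.simps(1))
 then show ?thesis using r c True unfolding right_alternative_def right_C_def by blast
next
 case False
 then show ?thesis using c unfolding right_C_def by (auto simp: less_top[symmetric] top_ereal_def)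
qed

lemma not_right_alternative:
 assumes c: "relmin ==> close c" and r: "\<not> right_alternative c L"
 shows "close c" "H mr (ereal c) b < \<infinity>" "2 * d_at c < L" "m < mr ==> d_at c < i_at c"
proof -
 have rel: "relmin" using r unfolding right_alternative_def by blast
 show cl: "close c" by (rule c[OF rel])
 show fin: "H mr (ereal c) b < \<infinity>" using r cl unfolding right_alternative_def by (auto simp: less_top[symmetric] top_ereal_def)
 show d: "2 * d_at c < L" using r rel cl fin unfolding right_alternative_def by (auto simp: not_le[symmetric])
 assume "m < mr"
 then have "ereal m < m_right b f" using m_right_real(1)[OF rel] by (metis less_ereal.simps(1))
 then show "d_at c < i_at c" using r rel cl fin d unfolding right_alternative_def by (auto simp: not_le[symmetric])
qed

lemma condition_C_iff: "condition_C a b f L \<longleftrightarrow> right_alternative (SOME c. close c) L \<and>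
   warped.right_alternative (- b) (- a) rf (- (SOME c. close_left a b f c)) L"
proof -
 interpret R: warped "- b" "- a" rf rV1 rV2 by (rule warped_reflect)
 define c where "c = (SOME c. close_left a b f c)"
 have right: "d_right a b f = d_at (SOME c. close c)" "i_right a b f = i_at (SOME c. close c)"
  unfolding d_right_def d_at_def i_right_def i_at_def Let_def by simp_all
 have ex: "(\<exists>c. close_right (- b) (- a) rf c \<and> P (R.H (real_of_ereal (m_left a f)) (ereal c) (- a))) \<longleftrightarrow>
   (\<exists>c. close_left a b f c \<and> P (H (real_of_ereal (m_left a f)) a (ereal c)))" for P
 proof -
  have "R.H (real_of_ereal (m_left a f)) (ereal (- c)) (- a) = H (real_of_ereal (m_left a f)) a (ereal c)" if "close_left a b f c" for c
  proof -
   have "ereal c <= b" using that unfolding close_left_def above_left_def by (meson ereal_less_eq(3) less_imp_le order_trans)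
   then show ?thesis using hint_reflect[of a "ereal c"] by (simp add: m_right_reflect)
  qed
  then show ?thesis by (metis close_left_reflect minus_minus)
 qed
 have left: "d_left a b f = R.d_at (- c)" "i_left a b f = R.i_at (- c)" if rel: "rel_min_left a b f"
 proof -
  obtain c' where "close_right (- b) (- a) rf c'" using R.close_right_ex rel rel_min_left_reflect by blast
  then have "close_left a b f (- c')" using close_left_reflect[of "- c'"] by simp
  then have "close_left a b f c" unfolding c_def by (rule someI)
  then have "close_right (- b) (- a) rf (- c)" by (simp add: close_left_reflect)
  from R.close_rightD(2)[OF this] have cK: "c \<in> K" by (simp add: einterval_reflect)
  have cb: "ereal c <= b" using K_bounds[OF cK] by simp
  have ha: "R.H D (ereal (- c)) (- a) = H D a (ereal c)" for D using hint_reflect[OF order_refl cb, of D] by simp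
  show "d_left a b f = R.d_at (- c)"
   unfolding d_left_def R.d_at_def Let_def c_def[symmetric] hint_a_star_reflect[OF cK cb] m_right_reflect ha ..
  show "i_left a b f = R.i_at (- c)"
   unfolding i_left_def R.i_at_def Let_def c_def[symmetric] hint_b_star_reflect[OF cK order_refl] m_right_reflect m_inf_reflect ..
 qed
 have "R.right_alternative (- c) L \<longleftrightarrow> \<not> rel_min_left a b f
   \<or> (\<exists>c. close_left a b f c \<and> hint f (real_of_ereal (m_left a f)) a (ereal c) = \<infinity>)
   \<or> (d_left_defined a b f \<and> 2 * d_left a b f \<ge> L)
   \<or> (i_left_defined a b f L \<and> d_left a b f \<ge> i_left a b f)"
  unfolding R.right_alternative_def rel_min_left_reflect ex[of "\<lambda>x. x = \<infinity>"] ex[of "\<lambda>x. x < \<infinity>"]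
   m_right_reflect m_inf_reflect d_left_defined_def i_left_defined_def using left by auto
 moreover have "right_alternative (SOME c. close c) L \<longleftrightarrow> \<not> relmin
   \<or> (\<exists>c. close c \<and> hint f mr (ereal c) b = \<infinity>)
   \<or> (d_right_defined a b f \<and> 2 * d_right a b f \<ge> L)
   \<or> (i_right_defined a b f L \<and> d_right a b f \<ge> i_right a b f)"
  unfolding right_alternative_def d_right_defined_def i_right_defined_def right by auto
 ultimately show ?thesis unfolding condition_C_def c_def by simp
qed

lemma R_int_reflect:
 assumes "y0 \<in> K" "D < V y0"
 shows "L_int (- b) (- a) rf (- y0) D = rint y0 D"
proof -
 interpret R: warped "- b" "- a" rf rV1 rV2 by (rule warped_reflect)
 show ?thesis using R.L_int_reflect[of "- y0" D] assms by (simp add: einterval_reflect inv_sq_reflect)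
qed

lemma r_i_reflect:
 assumes y0: "y0 \<in> K" "m < V y0"
 shows "r_i (- b) (- a) rf (- y0) n = l_i a b f y0 n"
proof -
 have y0b: "a < ereal y0" "ereal y0 <= b" using K_bounds[OF y0(1)] by auto
 have ev: "eventually (\<lambda>D. m < D \<and> D < V y0) (at_right m)" by (rule eventually_levels[OF y0(2)])
 show ?thesis
 proof (cases "n = 0")
  case True
  show ?thesis unfolding r_i_def l_i_def m_inf_reflect using True
  proof (simp, intro Lim_reflect[OF y0b(1)])
   fix s assume "a < s" "s < ereal y0"
   then have "hint rf D (ereal (- y0)) (- s) = H D s (ereal y0)" for D using hint_reflect[of s "ereal y0" D] y0b by simp
   then show "Liminf (at_right m) (\<lambda>D. hint rf D (ereal (- y0)) (- s)) = Liminf (at_right m) (\<lambda>D. H D s (ereal y0))"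
    by simp
  qed
 next
  case False
  show ?thesis unfolding r_i_def l_i_def m_inf_reflect if_not_P[OF False]
  proof (intro Lim_reflect[OF y0b(1)] Liminf_cong(1) eventually_mono[OF ev])
   fix s D assume "a < s" "s < ereal y0" and D: "m < D \<and> D < V y0"
   then have as: "a <= s" by simp
   have D': "D < V y0" using D by simp
   show "E_int (- b) (- a) rf (- y0) n D + ereal (real (n - 1)) * W_int (- b) (- a) rf (- y0) D +
     hint rf D (a_star (- b) (- a) rf (- y0) D) (- s)
     = G_int a b f y0 n D + ereal (real (n - 1)) * W_int a b f y0 D + H D s (bstar y0 D)"
    unfolding hint_b_star_reflect[OF y0(1) as] E_int_def G_int_def W_int_def R_int_reflect[OF y0(1) D'] L_int_reflect[OF y0(1) D']
    by (simp add: add.commute)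
  qed
 qed
qed

lemma r_s_reflect:
 assumes y0: "y0 \<in> K" "m < V y0"
 shows "r_s (- b) (- a) rf (- y0) n = l_s a b f y0 n"
proof -
 have y0b: "a < ereal y0" "ereal y0 <= b" using K_bounds[OF y0(1)] by auto
 have ev: "eventually (\<lambda>D. m < D \<and> D < V y0) (at_right m)" by (rule eventually_levels[OF y0(2)])
 show ?thesis unfolding r_s_def l_s_def m_inf_reflect
 proof (intro Lim_reflect[OF y0b(1)] Liminf_cong(2) eventually_mono[OF ev])
  fix s D assume s: "a < s" "s < ereal y0" and D: "m < D \<and> D < V y0"
  have sb: "s <= b" using s y0b by auto
  have D': "D < V y0" using D by simp
  have "hint rf D (- s) (b_star (- b) (- a) rf (- y0) D) = H D (astar y0 D) s"
   using hint_reflect[OF a_star_ge[OF y0(1)] sb, of D D] unfolding b_star_reflect[OF y0(1)] by simp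
  then show "E_int (- b) (- a) rf (- y0) n D + ereal (real n) * W_int (- b) (- a) rf (- y0) D +
    hint rf D (- s) (b_star (- b) (- a) rf (- y0) D)
    = G_int a b f y0 n D + ereal (real n) * W_int a b f y0 D + H D (astar y0 D) s"
   unfolding E_int_def G_int_def W_int_def R_int_reflect[OF y0(1) D'] L_int_reflect[OF y0(1) D'] by (simp add: add.commute)
 qed
qed

lemma condition_R_iff: "condition_R a b f L \<longleftrightarrow> both_ends_min \<and>
   (\<forall>y0\<in>K. right_cover y0 L \<and> warped.right_cover (- b) (- a) rf (- y0) L)"
proof (cases both_ends_min)
 case True
 interpret R: warped "- b" "- a" rf rV1 rV2 by (rule warped_reflect)
 have "R.right_cover (- y0) L \<longleftrightarrow> real_Icc (l_i a b f y0 0) L \<subseteq> (\<Union>n. real_Icc (l_i a b f y0 n) (l_s a b f y0 n))"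
  if "y0 \<in> K" for y0
 proof -
  have "m < V y0" using True that unfolding both_ends_min_def by blast
  show ?thesis unfolding R.right_cover_def r_i_reflect[OF that \<open>m < V y0\<close>] r_s_reflect[OF that \<open>m < V y0\<close>] by (rule refl)
 qed
 then show ?thesis using True unfolding condition_R_def both_ends_min_def right_cover_def by auto
next
 case False
 then show ?thesis unfolding condition_R_def both_ends_min_def by auto
qed

text \<open>The converse splits on \<open>both_ends_min\<close>: if it holds, (R) is derived from
  trajectories to targets near the ends; otherwise (C) is derived at each end from trajectories that
  return to their starting height.\<close>

theorem all_connected_iff:
 assumes L0: "0 < L"
 shows "(\<forall>y0\<in>K. \<forall>y1\<in>K. \<forall>X. 0 < X --> ereal X < L --> I 0 y0 y1 < ereal X -->
   I 0 y1 y0 < ereal X --> connects y0 y1 X)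
  \<longleftrightarrow> condition_C a b f L \<or> condition_R a b f L" (is "?conn \<longleftrightarrow> _")
proof -
 interpret R: warped "- b" "- a" rf rV1 rV2 by (rule warped_reflect)
 have cr: "close (SOME c. close c)" if "relmin" using close_right_ex[OF that] by (rule someI_ex)
 have cl: "close_right (- b) (- a) rf (- (SOME c. close_left a b f c))" if rel: "rel_min_right (- b) (- a) rf"
 proof -
  obtain c' where "close_right (- b) (- a) rf c'" using R.close_right_ex[OF rel] by blast
  then have "close_left a b f (- c')" using close_left_reflect[of "- c'"] by simp
  then have "close_left a b f (SOME c. close_left a b f c)" by (rule someI)
  then show ?thesis by (simp add: close_left_reflect)
 qed
 show ?thesis
 proof
  assume "condition_C a b f L \<or> condition_R a b f L"
  then show ?conn
  proof
   assume "condition_C a b f L"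
   then have "right_C L" "R.right_C L" unfolding condition_C_iff
    using right_alternative_imp[OF cr] R.right_alternative_imp[OF cl] by blast+
   then show ?conn using right_C_imp_connects by blast
  next
   assume "condition_R a b f L"
   then show ?conn unfolding condition_R_iff using R_imp_connects by blast
  qed
 next
  assume conn: ?conn
  have Rconn: "R.connects y0 y1 X" if h: "y0 \<in> R.K" "y1 \<in> R.K" "0 < X" "ereal X < L"
   "R.I 0 y0 y1 < ereal X" "R.I 0 y1 y0 < ereal X" for y0 y1 X
  proof -
   have K: "- y0 \<in> K" "- y1 \<in> K" using h by (auto simp: einterval_reflect)
   have "I 0 (- y1) (- y0) < ereal X" "I 0 (- y0) (- y1) < ereal X"
    using h(5,6) hint_reflect_real[OF K(2,1), of 0] hint_reflect_real[OF K, of 0] by simp_all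
   then have "connects (- y0) (- y1) X" using conn K h by blast
   then show ?thesis using connects_reflect[of "- y0" "- y1" X] by simp
  qed
  have same: "connects y0 y0 X" if "y0 \<in> K" "0 < X" "ereal X < L" for y0 X using conn that by (simp add: hint_empty)
  have Rsame: "R.connects y0 y0 X" if "y0 \<in> R.K" "0 < X" "ereal X < L" for y0 X
   by (rule Rconn[OF that(1,1,2,3)]) (use that in \<open>simp_all add: hint_empty\<close>)
  show "condition_C a b f L \<or> condition_R a b f L"
  proof (cases both_ends_min)
   case True
   then have RT: "R.both_ends_min" using both_ends_min_reflect by simp
   have "right_cover y0 L \<and> R.right_cover (- y0) L" if "y0 \<in> K" for y0
   proof
    show "right_cover y0 L" by (rule cover_if_connected[OF True that]) (use conn that in blast)
    have y0': "- y0 \<in> R.K" using that by (simp add: einterval_reflect)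
    show "R.right_cover (- y0) L" by (rule R.cover_if_connected[OF RT y0' Rconn[OF y0']])
   qed
   then show ?thesis unfolding condition_R_iff using True by blast
  next
   case False
   have "right_alternative (SOME c. close c) L"
   proof (rule ccontr)
    assume n: "\<not> ?thesis"
    note c = not_right_alternative[OF cr n]
    show False by (rule not_connected_near_right[OF same c(1,2,3) L0 c(4)]) (use False both_ends_min_def in auto)
   qed
   moreover have "R.right_alternative (- (SOME c. close_left a b f c)) L"
   proof (rule ccontr)
    assume n: "\<not> ?thesis"
    note c = R.not_right_alternative[OF cl n]
    have RF: "\<not> R.both_ends_min" using False both_ends_min_reflect by simp
    show False by (rule R.not_connected_near_right[OF Rsame c(1,2,3) L0 c(4)]) (use RF R.both_ends_min_def in auto)
   qed
   ultimately show ?thesis unfolding condition_C_iff by blast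
  qed
 qed
qed

end

section \<open>Smooth functions\<close>

abbreviation "vderiv F \<equiv> (\<lambda>t. vector_derivative F (at t))"

lemma vderiv_cong:
 assumes "open U" "t \<in> U" "!!s. s \<in> U ==> F s = G s"
 shows "vector_derivative F (at t) = vector_derivative G (at t)"
  and "F differentiable (at t) \<longleftrightarrow> G differentiable (at t)"
  and "(F has_vector_derivative D) (at t) \<longleftrightarrow> (G has_vector_derivative D) (at t)"
proof -
 have ev: "eventually (\<lambda>s. F s = G s) (nhds t)" using assms by (auto simp: eventually_nhds)
 have *: "(F has_vector_derivative D) (at t) \<longleftrightarrow> (G has_vector_derivative D) (at t)" for D
  by (rule has_vector_derivative_cong_ev) (use ev assms(3)[OF assms(2)] in auto)
 then show "(F has_vector_derivative D) (at t) \<longleftrightarrow> (G has_vector_derivative D) (at t)" by blast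
 show "vector_derivative F (at t) = vector_derivative G (at t)" unfolding vector_derivative_def * by simp
 show "F differentiable (at t) \<longleftrightarrow> G differentiable (at t)"
  using * vector_derivative_works differentiableI_vector by blast
qed

lemma smooth_on_differentiable: "smooth_on U F ==> t \<in> U ==> F differentiable (at t)"
 unfolding smooth_on_def by (metis funpow_0)

lemma smooth_on_has_vderiv: "smooth_on U F ==> t \<in> U ==> (F has_vector_derivative vderiv F t) (at t)"
 using smooth_on_differentiable vector_derivative_works by blast

lemma smooth_on_has_deriv:
 fixes F :: "real => real"
 shows "smooth_on U F ==> t \<in> U ==> DERIV F t :> vderiv F t"
 using smooth_on_has_vderiv by (auto simp: has_real_derivative_iff_has_vector_derivative)

lemma smooth_on_vderiv: "smooth_on U F ==> smooth_on U (vderiv F)" unfolding smooth_on_def by (metis funpow_Suc_right o_apply)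

lemma smooth_on_subset: "smooth_on U F ==> U' \<subseteq> U ==> smooth_on U' F" unfolding smooth_on_def by blast

text \<open>Coinduction: if every member of a class has a derivative in the class, its members are
  smooth. Derivatives are compared on the open set \<open>U\<close> only, where
  \<open>vector_derivative\<close> is determined by nearby values.\<close>

lemma smooth_on_coinduct:
 assumes U: "open U" and F: "S F"
  and step: "!!G. S G ==> \<exists>G'. S G' \<and> (\<forall>t\<in>U. (G has_vector_derivative G' t) (at t))"
 shows "smooth_on U F" unfolding smooth_on_def
proof (intro allI ballI)
 fix n t assume t: "t \<in> U"
 have "\<exists>G. S G \<and> (\<forall>t\<in>U. ((\<lambda>G t. vector_derivative G (at t)) ^^ n) F t = G t)"
 proof (induction n)
  case 0
  show ?case using F by auto
 next
  case (Suc n)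
  then obtain G where G: "S G" "!!t. t \<in> U ==> ((\<lambda>G t. vector_derivative G (at t)) ^^ n) F t = G t" by blast
  obtain G' where G': "S G'" "!!t. t \<in> U ==> (G has_vector_derivative G' t) (at t)" using step[OF G(1)] by blast
  have "((\<lambda>G t. vector_derivative G (at t)) ^^ Suc n) F t = G' t" if "t \<in> U" for t
   using vderiv_cong(1)[OF U that G(2)] vector_derivative_at[OF G'(2)[OF that]] by simp
  then show ?case using G'(1) by blast
 qed
 then obtain G where G: "S G" "!!t. t \<in> U ==> ((\<lambda>G t. vector_derivative G (at t)) ^^ n) F t = G t" by blast
 obtain G' where G': "!!t. t \<in> U ==> (G has_vector_derivative G' t) (at t)" using step[OF G(1)] by blast
 show "((\<lambda>G t. vector_derivative G (at t)) ^^ n) F differentiable (at t)"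
  using vderiv_cong(2)[OF U t G(2)] differentiableI_vector[OF G'[OF t]] by simp
qed

lemma smooth_on_cong:
 assumes U: "open U" and F: "smooth_on U F" and eq: "!!t. t \<in> U ==> F t = G t"
 shows "smooth_on U G"
proof (rule smooth_on_coinduct[OF U, where S = "\<lambda>G. \<exists>F. smooth_on U F \<and> (\<forall>t\<in>U. F t = G t)"])
 fix G assume "\<exists>F. smooth_on U F \<and> (\<forall>t\<in>U. F t = G t)"
 then obtain F where F: "smooth_on U F" "!!t. t \<in> U ==> F t = G t" by blast
 have "(G has_vector_derivative vderiv F t) (at t)" if "t \<in> U" for t
  using smooth_on_has_vderiv[OF F(1) that] vderiv_cong(3)[OF U that F(2)] by simp
 then show "\<exists>G'. (\<exists>F. smooth_on U F \<and> (\<forall>t\<in>U. F t = G' t)) \<and> (\<forall>t\<in>U. (G has_vector_derivative G' t) (at t))"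
  using smooth_on_vderiv[OF F(1)] by (intro exI[of _ "vderiv F"]) auto
qed (use F eq in blast)

lemma smooth_on_antideriv:
 assumes U: "open U" and d: "!!t. t \<in> U ==> (F has_vector_derivative F' t) (at t)" and s: "smooth_on U F'"
 shows "smooth_on U F"
proof (rule smooth_on_coinduct[OF U, where S = "\<lambda>G. G = F \<or> smooth_on U G"])
 fix G assume "G = F \<or> smooth_on U G"
 then show "\<exists>G'. (G' = F \<or> smooth_on U G') \<and> (\<forall>t\<in>U. (G has_vector_derivative G' t) (at t))"
  using d s smooth_on_has_vderiv smooth_on_vderiv by metis
qed simp

text \<open>The functions obtained from \<open>v\<close> and the \<open>G \<circ> y\<close> by ring operations are closed under
 differentiation if \<open>v\<close> is the derivative of \<open>y\<close> and the derivative of \<open>v\<close> is such a function.\<close>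

inductive_set generated :: "real set => real set => (real => real) => (real => real) => (real => real) set"
 for U W y v where
 base: "smooth_on U F ==> F \<in> generated U W y v"
| velo: "v \<in> generated U W y v"
| comp: "smooth_on W G ==> (\<lambda>t. G (y t)) \<in> generated U W y v"
| add: "F \<in> generated U W y v ==> G \<in> generated U W y v ==> (\<lambda>t. F t + G t) \<in> generated U W y v"
| mult: "F \<in> generated U W y v ==> G \<in> generated U W y v ==> (\<lambda>t. F t * G t) \<in> generated U W y v"

lemma smooth_on_generated:
 assumes U: "open U" and y: "!!t. t \<in> U ==> y t \<in> W \<and> (DERIV y t :> v t)"
  and v: "!!t. t \<in> U ==> DERIV v t :> w t" and w: "w \<in> generated U W y v"
  and F: "F \<in> generated U W y v"
 shows "smooth_on U F"
proof (rule smooth_on_coinduct[OF U, where S = "\<lambda>F. F \<in> generated U W y v"])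
 fix F assume "F \<in> generated U W y v"
 then show "\<exists>G'. G' \<in> generated U W y v \<and> (\<forall>t\<in>U. (F has_vector_derivative G' t) (at t))"
  unfolding has_real_derivative_iff_has_vector_derivative[symmetric]
 proof induction
  case (base F)
  then show ?case using smooth_on_has_deriv smooth_on_vderiv generated.base by blast
 next
  case velo
  then show ?case using v w by blast
 next
  case (comp G)
  have "(\<lambda>t. vderiv G (y t) * v t) \<in> generated U W y v"
   by (intro generated.mult generated.velo generated.comp smooth_on_vderiv comp)
  moreover have "DERIV (\<lambda>t. G (y t)) t :> vderiv G (y t) * v t" if "t \<in> U" for t
   by (rule DERIV_chain2) (use y[OF that] smooth_on_has_deriv[OF comp] in auto)
  ultimately show ?case by blast
 next
  case (add F G)
  then obtain F' G' where h: "F' \<in> generated U W y v" "!!t. t \<in> U ==> DERIV F t :> F' t"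
   "G' \<in> generated U W y v" "!!t. t \<in> U ==> DERIV G t :> G' t" by blast
  show ?case by (intro exI[of _ "\<lambda>t. F' t + G' t"] conjI ballI generated.add h DERIV_add)
 next
  case (mult F G)
  then obtain F' G' where h: "F' \<in> generated U W y v" "!!t. t \<in> U ==> DERIV F t :> F' t"
   "G' \<in> generated U W y v" "!!t. t \<in> U ==> DERIV G t :> G' t" by blast
  show ?case by (intro exI[of _ "\<lambda>t. F' t * G t + G' t * F t"] conjI ballI generated.add generated.mult h mult DERIV_mult)
 qed
qed (rule F)

lemma smooth_on_const: "smooth_on U (\<lambda>_. c)" for c :: "'a::real_normed_vector"
proof -
 have "smooth_on UNIV (\<lambda>_. c)"
  by (rule smooth_on_coinduct[where S = "\<lambda>F. \<exists>c. F = (\<lambda>_. c)"]) (auto intro!: exI[of _ "\<lambda>_. 0"])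
 then show ?thesis by (rule smooth_on_subset) simp
qed

lemma smooth_on_compose:
 assumes U: "open U" and F: "smooth_on U F" "!!t. t \<in> U ==> F t \<in> W" and G: "smooth_on W G"
 shows "smooth_on U (\<lambda>t::real. G (F t) :: real)"
proof (rule smooth_on_generated[OF U, where W = W and y = F and v = "vderiv F" and w = "vderiv (vderiv F)"])
 show "F t \<in> W \<and> (DERIV F t :> vderiv F t)" if "t \<in> U" for t
  using smooth_on_has_deriv[OF F(1) that] F(2)[OF that] by simp
 show "DERIV (vderiv F) t :> vderiv (vderiv F) t" if "t \<in> U" for t
  by (rule smooth_on_has_deriv[OF smooth_on_vderiv[OF F(1)] that])
 show "vderiv (vderiv F) \<in> generated U W F (vderiv F)" by (intro generated.base smooth_on_vderiv F)
qed (intro generated.comp G)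

text \<open>Sums and products arise from base functions alone, so the closure result applies with
  the curve and its velocity equal to 0.\<close>

lemma smooth_on_add_mult:
 fixes F G :: "real => real"
 assumes U: "open U" and F: "smooth_on U F" and G: "smooth_on U G"
 shows smooth_on_add: "smooth_on U (\<lambda>t. F t + G t)" and smooth_on_mult: "smooth_on U (\<lambda>t. F t * G t)"
proof -
 have *: "smooth_on U H" if "H \<in> generated U UNIV (\<lambda>_. 0) (\<lambda>_. 0)" for H
  by (rule smooth_on_generated[OF U _ _ _ that, where w = "\<lambda>_. 0"]) (auto intro: generated.velo)
 show "smooth_on U (\<lambda>t. F t + G t)" "smooth_on U (\<lambda>t. F t * G t)"
  by (rule *, rule generated.intros; rule generated.base; fact)+
qed

text \<open>The multiples of real powers are closed under differentiation; the exponent -1 yields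
  reciprocals.\<close>

lemma smooth_on_powr: "smooth_on {0<..} (\<lambda>x. x powr r)" for r :: real
proof (rule smooth_on_coinduct[where S = "\<lambda>F. \<exists>c r. F = (\<lambda>x. c * x powr r)"])
 fix F :: "real => real" assume "\<exists>c r. F = (\<lambda>x. c * x powr r)"
 then obtain c r where F: "F = (\<lambda>x. c * x powr r)" by blast
 have "(F has_vector_derivative (c * r) * t powr (r - 1)) (at t)" if "t \<in> {0<..}" for t
  unfolding F has_real_derivative_iff_has_vector_derivative[symmetric] using that by (auto intro!: derivative_eq_intros simp: powr_diff)
 then show "\<exists>G'. (\<exists>c r. G' = (\<lambda>x. c * x powr r)) \<and> (\<forall>t\<in>{0<..}. (F has_vector_derivative G' t) (at t))"
  by blast
next
 show "\<exists>c ra. (\<lambda>x. x powr r) = (\<lambda>x. c * x powr ra)" by (intro exI[of _ 1] exI[of _ r]) simp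
qed auto

lemma smooth_on_inverse:
 assumes U: "open U" and F: "smooth_on U F" "!!t. t \<in> U ==> F t > (0::real)"
 shows "smooth_on U (\<lambda>t. inverse (F t))"
proof (rule smooth_on_cong[OF U])
 show "smooth_on U (\<lambda>t. F t powr (-1))" by (rule smooth_on_compose[OF U F(1) _ smooth_on_powr]) (use F(2) in auto)
 show "F t powr (-1) = inverse (F t)" if "t \<in> U" for t using F(2)[OF that] by (simp add: powr_minus)
qed

lemma smooth_on_component:
 fixes F :: "real => real ^ 'n::finite"
 assumes "open U" "smooth_on U F"
 shows "smooth_on U (\<lambda>t. F t $ i)"
proof (rule smooth_on_coinduct[OF assms(1), where S = "\<lambda>G. \<exists>F :: real => real ^ 'n. smooth_on U F \<and> G = (\<lambda>t. F t $ i)"])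
 fix G assume "\<exists>F :: real => real ^ 'n. smooth_on U F \<and> G = (\<lambda>t. F t $ i)"
 then obtain F :: "real => real ^ 'n" where F: "smooth_on U F" "G = (\<lambda>t. F t $ i)" by blast
 have "(G has_vector_derivative vderiv F t $ i) (at t)" if "t \<in> U" for t
  unfolding F(2) by (rule bounded_linear.has_vector_derivative[OF bounded_linear_vec_nth smooth_on_has_vderiv[OF F(1) that]])
 then show "\<exists>G'. (\<exists>F :: real => real ^ 'n. smooth_on U F \<and> G' = (\<lambda>t. F t $ i)) \<and> (\<forall>t\<in>U. (G has_vector_derivative G' t) (at t))"
  using smooth_on_vderiv[OF F(1)] by (intro exI[of _ "\<lambda>t. vderiv F t $ i"]) auto
qed (use assms in auto)

lemma has_vderiv_components:
 fixes F :: "real => real ^ 'n::finite"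
 assumes "!!i. (DERIV (\<lambda>t. F t $ i) t :> D $ i)"
 shows "(F has_vector_derivative D) (at t)"
proof -
 have "F = (\<lambda>t. \<Sum>i\<in>UNIV. F t $ i *\<^sub>R axis i 1)" "D = (\<Sum>i\<in>UNIV. D $ i *\<^sub>R axis i 1)"
  by (auto simp: vec_eq_iff axis_def if_distrib sum.delta cong: if_cong)
 moreover have "((\<lambda>t. \<Sum>i\<in>UNIV. F t $ i *\<^sub>R (axis i 1 :: real ^ 'n)) has_vector_derivative (\<Sum>i\<in>UNIV. D $ i *\<^sub>R axis i 1)) (at t)"
  using assms by (auto intro!: derivative_eq_intros simp: has_real_derivative_iff_has_vector_derivative)
 ultimately show ?thesis by metis
qed

lemma smooth_on_from_components:
 fixes F :: "real => real ^ 'n::finite"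
 assumes U: "open U" and F: "!!i. smooth_on U (\<lambda>t. F t $ i)"
 shows "smooth_on U F"
proof (rule smooth_on_coinduct[OF U, where S = "\<lambda>F :: real => real ^ 'n. \<forall>i. smooth_on U (\<lambda>t. F t $ i)"])
 fix F :: "real => real ^ 'n" assume F: "\<forall>i. smooth_on U (\<lambda>t. F t $ i)"
 have "(F has_vector_derivative (\<chi> i. vderiv (\<lambda>t. F t $ i) t)) (at t)" if "t \<in> U" for t
  by (rule has_vderiv_components) (use smooth_on_has_deriv that F in auto)
 then show "\<exists>G'. (\<forall>i. smooth_on U (\<lambda>t. G' t $ i)) \<and> (\<forall>t\<in>U. (F has_vector_derivative G' t) (at t))"
  using F by (intro exI[of _ "\<lambda>t. \<chi> i. vderiv (\<lambda>t. F t $ i) t"]) (auto intro: smooth_on_vderiv)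
qed (use F in blast)

section \<open>The geometry of the static metric\<close>

locale static_strip =
 fixes a b :: ereal and f :: "real => real"
 assumes ab: "a < b" and smooth: "smooth_on (einterval a b) f" and pos: "!!y. y \<in> einterval a b ==> f y > 0"
begin

abbreviation "f1 \<equiv> vderiv f"
abbreviation "f2 \<equiv> vderiv f1"
abbreviation "g \<equiv> static_metric f"

lemma f_deriv: "y \<in> einterval a b ==> DERIV f y :> f1 y" by (rule smooth_on_has_deriv[OF smooth])

lemma f1_deriv: "y \<in> einterval a b ==> DERIV f1 y :> f2 y"
 by (rule smooth_on_has_deriv[OF smooth_on_vderiv[OF smooth]])

lemma f2_deriv: "y \<in> einterval a b ==> DERIV f2 y :> vderiv f2 y"
 by (rule smooth_on_has_deriv[OF smooth_on_vderiv[OF smooth_on_vderiv[OF smooth]]])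

sublocale warped a b f "\<lambda>y. - 2 * f1 y / (f y) ^ 3" "\<lambda>y. (6 * (f1 y)\<^sup>2 - 2 * f y * f2 y) / (f y) ^ 4"
proof
 show "a < b" by (rule ab)
 fix y assume y: "y \<in> einterval a b"
 then show "f y > 0" by (rule pos)
 have fy: "f y \<noteq> 0" using pos[OF y] by simp
 show "DERIV (inv_sq f) y :> - 2 * f1 y / (f y) ^ 3" unfolding inv_sq_def using f_deriv[OF y] fy
  by (auto intro!: derivative_eq_intros simp: field_simps power2_eq_square power3_eq_cube)
 show "DERIV (\<lambda>y. - 2 * f1 y / (f y) ^ 3) y :> (6 * (f1 y)\<^sup>2 - 2 * f y * f2 y) / (f y) ^ 4"
 proof (rule DERIV_cong[OF DERIV_divide])
  show "DERIV (\<lambda>y. - 2 * f1 y) y :> - 2 * f2 y" by (rule DERIV_cmult[OF f1_deriv[OF y]])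
  show "DERIV (\<lambda>y. (f y) ^ 3) y :> 3 * (f y)\<^sup>2 * f1 y"
   using f_deriv[OF y] by (auto intro!: derivative_eq_intros)
  show "f y ^ 3 \<noteq> 0" using fy by simp
  have "(- 2 * f2 y * f y ^ 3 - - 2 * f1 y * (3 * (f y)\<^sup>2 * f1 y)) = (f y)\<^sup>2 * (6 * (f1 y)\<^sup>2 - 2 * f y * f2 y)"
   by (simp add: algebra_simps power2_eq_square power3_eq_cube)
  moreover have "f y ^ 3 * f y ^ 3 = (f y)\<^sup>2 * f y ^ 4" by (simp flip: power_add)
  ultimately show "(- 2 * f2 y * f y ^ 3 - - 2 * f1 y * (3 * (f y)\<^sup>2 * f1 y)) / (f y ^ 3 * f y ^ 3)
    = (6 * (f1 y)\<^sup>2 - 2 * f y * f2 y) / (f y) ^ 4" using fy by (simp only:) (rule nonzero_mult_divide_mult_cancel_left, simp)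
 qed
next
 have "isCont f y \<and> isCont f1 y \<and> isCont f2 y \<and> f y \<noteq> 0" if "y \<in> einterval a b" for y
  using DERIV_isCont[OF f_deriv[OF that]] DERIV_isCont[OF f1_deriv[OF that]] DERIV_isCont[OF f2_deriv[OF that]] pos[OF that] by auto
 then show "continuous_on (einterval a b) (\<lambda>y. (6 * (f1 y)\<^sup>2 - 2 * f y * f2 y) / (f y) ^ 4)"
  by (intro continuous_at_imp_continuous_on ballI continuous_intros) auto
qed

lemma metric_components: "g p $ 1 $ 1 = 1" "g p $ 1 $ 2 = 0" "g p $ 2 $ 1 = 0" "g p $ 2 $ 2 = - (f (p $ 1))\<^sup>2"
 unfolding static_metric_def by simp_all

lemma metric_form_static: "metric_form g p X X = (X $ 1)\<^sup>2 - (f (p $ 1))\<^sup>2 * (X $ 2)\<^sup>2"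
 unfolding metric_form_def inner_vec_def matrix_vector_mult_def by (simp add: sum_2 metric_components power2_eq_square algebra_simps)

lemma matrix_inv_metric:
 assumes "p $ 1 \<in> K"
 shows "matrix_inv (g p) = vector [vector [1, 0], vector [0, - inverse ((f (p $ 1))\<^sup>2)]]" (is "_ = ?B")
proof -
 have "f (p $ 1) \<noteq> 0" using pos[OF assms] by simp
 then have B: "g p ** ?B = mat 1" "?B ** g p = mat 1"
  by (auto simp: matrix_matrix_mult_def mat_def vec_eq_iff forall_2 sum_2 metric_components)
 have inv: "g p ** matrix_inv (g p) = mat 1 \<and> matrix_inv (g p) ** g p = mat 1"
  unfolding matrix_inv_def by (rule someI[of _ ?B]) (intro conjI B)
 have "matrix_inv (g p) = matrix_inv (g p) ** (g p ** ?B)" unfolding B(1) by simp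
 also have "\<dots> = (matrix_inv (g p) ** g p) ** ?B" by (rule matrix_mul_assoc)
 also have "\<dots> = ?B" using inv by simp
 finally show ?thesis .
qed

lemma shift_component: "(p + s *\<^sub>R axis i 1) $ (1 :: 2) = p $ 1 + (if i = 1 then s else (0 :: real))"
 using exhaust_2[of i] by (auto simp: axis_def)

lemma partial_deriv_first:
 assumes p: "p $ 1 \<in> K" and F: "!!q. q $ 1 \<in> K ==> F q = G (q $ 1)" and G: "DERIV G (p $ 1) :> D"
 shows "partial_deriv i F (p :: real ^ 2) = (if i = 1 then D else 0)"
proof -
 have oK: "open K" by simp
 have "((\<lambda>s. p $ 1 + (if i = 1 then s else 0)) \<longlongrightarrow> p $ 1 + 0) (nhds 0)"
  by (cases "i = 1") (auto intro!: tendsto_eq_intros filterlim_ident)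
 then have "eventually (\<lambda>s. p $ 1 + (if i = 1 then s else 0) \<in> K) (nhds 0)"
  by (rule topological_tendstoD[OF _ oK]) (use p in simp)
 then have ev: "eventually (\<lambda>s. F (p + s *\<^sub>R axis i 1) = G (p $ 1 + (if i = 1 then s else 0))) (nhds 0)"
  by eventually_elim (rule trans[OF F], simp_all only: shift_component)
 have "DERIV (\<lambda>s. p $ 1 + (if i = 1 then s else 0)) 0 :> (if i = 1 then 1 else 0)"
  by (auto intro!: derivative_eq_intros)
 then have "DERIV (\<lambda>s. G (p $ 1 + (if i = 1 then s else 0))) 0 :> D * (if i = 1 then 1 else 0)"
  by (rule DERIV_chain2[rotated]) (use G in \<open>simp split: if_splits\<close>)
 then show ?thesis unfolding partial_deriv_def deriv_cong_ev[OF ev refl] by (auto dest: DERIV_imp_deriv)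
qed

lemma partial_deriv_metric:
 assumes "p $ 1 \<in> K"
 shows "partial_deriv i (\<lambda>q. g q $ j $ l) p = (if i = 1 \<and> j = 2 \<and> l = 2 then - 2 * f (p $ 1) * f1 (p $ 1) else 0)"
proof -
 have 2: "DERIV (\<lambda>y. - (f y)\<^sup>2) (p $ 1) :> - 2 * f (p $ 1) * f1 (p $ 1)"
  using f_deriv[OF assms] by (auto intro!: derivative_eq_intros)
 have "partial_deriv i (\<lambda>q. g q $ 2 $ 2) p = (if i = 1 then - 2 * f (p $ 1) * f1 (p $ 1) else 0)"
  by (rule partial_deriv_first[OF assms _ 2]) (simp add: metric_components)
 moreover have "partial_deriv i (\<lambda>q. c) p = 0" for c using partial_deriv_first[OF assms, of "\<lambda>_. c" "\<lambda>_. c" 0 i] by simp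
 ultimately show ?thesis using exhaust_2[of j] exhaust_2[of l] by (auto simp: metric_components)
qed

lemma christoffel_static:
 assumes "p $ 1 \<in> K"
 shows "christoffel g p k i j = (if k = 1 \<and> i = 2 \<and> j = 2 then f (p $ 1) * f1 (p $ 1)
   else if k = 2 \<and> i \<noteq> j then f1 (p $ 1) / f (p $ 1) else 0)"
proof -
 have "f (p $ 1) \<noteq> 0" using pos[OF assms] by simp
 then show ?thesis unfolding christoffel_def partial_deriv_metric[OF assms] matrix_inv_metric[OF assms] sum_2
  using exhaust_2[of k] exhaust_2[of i] exhaust_2[of j] by (elim disjE) (simp_all add: field_simps power2_eq_square)
qed

lemma partial_deriv_christoffel:
 assumes "p $ 1 \<in> K"
 shows "partial_deriv i (\<lambda>q. christoffel g q k l j) p =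
   (if i = 1 then (if k = 1 \<and> l = 2 \<and> j = 2 then (f1 (p $ 1))\<^sup>2 + f (p $ 1) * f2 (p $ 1)
   else if k = 2 \<and> l \<noteq> j then f2 (p $ 1) / f (p $ 1) - (f1 (p $ 1) / f (p $ 1))\<^sup>2 else 0) else 0)"
proof (rule partial_deriv_first[OF assms])
 show "christoffel g q k l j = (if k = 1 \<and> l = 2 \<and> j = 2 then f (q $ 1) * f1 (q $ 1)
   else if k = 2 \<and> l \<noteq> j then f1 (q $ 1) / f (q $ 1) else 0)" if "q $ 1 \<in> K" for q by (rule christoffel_static[OF that])
 have nz: "f (p $ 1) \<noteq> 0" using pos[OF assms] by simp
 show "DERIV (\<lambda>y. if k = 1 \<and> l = 2 \<and> j = 2 then f y * f1 y else if k = 2 \<and> l \<noteq> j then f1 y / f y else 0) (p $ 1) :> (if k = 1 \<and> l = 2 \<and> j = 2 then (f1 (p $ 1))\<^sup>2 + f (p $ 1) * f2 (p $ 1)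
   else if k = 2 \<and> l \<noteq> j then f2 (p $ 1) / f (p $ 1) - (f1 (p $ 1) / f (p $ 1))\<^sup>2 else 0)"
  using f_deriv[OF assms] f1_deriv[OF assms] nz by (auto intro!: derivative_eq_intros simp: field_simps power2_eq_square)
qed

lemma riemann_static:
 assumes "p $ 1 \<in> K"
 shows "riemann g p l k i j = (if l = k \<or> i = j then 0
   else (if i = 1 then 1 else -1) * (if l = 1 then f (p $ 1) * f2 (p $ 1) else f2 (p $ 1) / f (p $ 1)))"
proof -
 have "f (p $ 1) \<noteq> 0" using pos[OF assms] by simp
 then show ?thesis unfolding riemann_def partial_deriv_christoffel[OF assms] christoffel_static[OF assms] sum_2
  using exhaust_2[of k] exhaust_2[of i] exhaust_2[of j] exhaust_2[of l] by (elim disjE) (simp_all add: field_simps power2_eq_square)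
qed

lemma curvature_static:
 assumes "p $ 1 \<in> K"
 shows "curvature g p X Y Y $ 1 = f (p $ 1) * f2 (p $ 1) * (X $ 1 * Y $ 2 - X $ 2 * Y $ 1) * Y $ 2"
  and "curvature g p X Y Y $ 2 = f2 (p $ 1) / f (p $ 1) * (X $ 1 * Y $ 2 - X $ 2 * Y $ 1) * Y $ 1"
 unfolding curvature_def riemann_static[OF assms] by (simp_all add: sum_2 algebra_simps)

lemma cov_deriv_static:
 assumes "c t $ 1 \<in> K"
 shows "cov_deriv g c X t $ 1 = vderiv X t $ 1 + f (c t $ 1) * f1 (c t $ 1) * velocity c t $ 2 * X t $ 2"
  and "cov_deriv g c X t $ 2 = vderiv X t $ 2 + f1 (c t $ 1) / f (c t $ 1) * (velocity c t $ 1 * X t $ 2 + velocity c t $ 2 * X t $ 1)"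
 unfolding cov_deriv_def christoffel_static[OF assms] by (simp_all add: sum_2 algebra_simps)

end

section \<open>Sign and monotonicity arguments on the unit interval\<close>

lemma nonvanishing_sign:
 fixes h :: "real => real"
 assumes "continuous_on {0..1} h" "!!t. t \<in> {0..1} ==> h t \<noteq> 0"
 obtains s where "\<bar>s\<bar> = (1 :: real)" "!!t. t \<in> {0..1} ==> 0 < s * h t"
proof -
 have conn: "connected (h ` {0..1})" by (rule connected_continuous_image[OF assms(1)]) simp
 have "(\<forall>t\<in>{0..1}. h t > 0) \<or> (\<forall>t\<in>{0..1}. h t < 0)"
 proof (rule ccontr)
  assume "\<not> ?thesis"
  then obtain t1 t2 where t: "t1 \<in> {0..1}" "t2 \<in> {0..1}" "h t1 <= 0" "0 <= h t2" by (auto simp: not_less)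
  then have "0 \<in> h ` {0..1}" using connectedD_interval[OF conn, of "h t1" "h t2" 0] by auto
  then show False using assms(2) by auto
 qed
 then show ?thesis using that[of 1] that[of "-1"] by auto
qed

lemma deriv_zero_const:
 fixes h :: "real => real"
 assumes "!!t. t \<in> {0..1} ==> DERIV h t :> 0" "t \<in> {0..1}" "s \<in> {0..1}"
 shows "h t = h s"
proof -
 have "\<exists>c. \<forall>x\<in>{0..1}. h x = c"
  by (rule has_field_derivative_zero_constant) (use assms(1) in \<open>auto intro: has_field_derivative_at_within\<close>)
 then show ?thesis using assms(2,3) by metis
qed

lemma deriv_pos_less:
 fixes h :: "real => real"
 assumes "!!t. t \<in> {0..1} ==> DERIV h t :> h' t" "!!t. t \<in> {0..1} ==> 0 < h' t"
  and "0 <= s" "s < t" "t <= 1"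
 shows "h s < h t"
proof (rule DERIV_pos_imp_increasing[OF assms(4)])
 fix x assume "s <= x" "x <= t"
 then have "x \<in> {0..1}" using assms by auto
 then show "\<exists>y. (DERIV h x :> y) \<and> 0 < y" using assms(1,2) by blast
qed

text \<open>\<open>A'\<close> has no zero, hence a constant sign \<open>s\<close>, and both
  \<open>s * A + B\<close> and \<open>s * A - B\<close> increase strictly. The roles of
  \<open>A\<close> and \<open>B\<close> are played by \<open>F\<close> along the curve and by
  \<open>x\<close>, in one order for spacelike and in the other for timelike curves.\<close>

lemma dominated_change:
 fixes A B A' B' :: "real => real"
 assumes d: "!!t. t \<in> {0..1} ==> DERIV A t :> A' t" "!!t. t \<in> {0..1} ==> DERIV B t :> B' t"
  and cont: "continuous_on {0..1} A'" and less: "!!t. t \<in> {0..1} ==> \<bar>B' t\<bar> < \<bar>A' t\<bar>"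
 shows "\<bar>B 1 - B 0\<bar> < \<bar>A 1 - A 0\<bar>" and "A 0 <= A 1 ==> t \<in> {0..1} ==> 0 < A' t"
proof -
 obtain s where s: "\<bar>s\<bar> = (1 :: real)" "!!t. t \<in> {0..1} ==> 0 < s * A' t"
  by (rule nonvanishing_sign[OF cont]) (use less in fastforce)+
 have main: "s * A 0 + r * B 0 < s * A 1 + r * B 1" if "\<bar>r\<bar> = 1" for r
 proof (rule deriv_pos_less[where h = "\<lambda>t. s * A t + r * B t" and h' = "\<lambda>t. s * A' t + r * B' t"])
  fix t :: real assume t: "t \<in> {0..1}"
  show "DERIV (\<lambda>t. s * A t + r * B t) t :> s * A' t + r * B' t" by (intro DERIV_add DERIV_cmult d t)
  have "\<bar>r * B' t\<bar> < s * A' t" using less[OF t] s(1) s(2)[OF t] that by (simp add: abs_mult abs_if split: if_splits)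
  then show "0 < s * A' t + r * B' t" by linarith
 qed auto
 have lt: "\<bar>B 1 - B 0\<bar> < s * (A 1 - A 0)" using main[of 1] main[of "-1"] by (auto simp: algebra_simps)
 moreover have "s = 1 \<or> s = -1" using s(1) by linarith
 ultimately show "\<bar>B 1 - B 0\<bar> < \<bar>A 1 - A 0\<bar>" "A 0 <= A 1 ==> t \<in> {0..1} ==> 0 < A' t"
  using s(2)[of t] by auto
qed

lemma le_if_less_scaled: "u <= v" if "!!c. 1 < c ==> u < c * v" "0 <= v" for u v :: real
 using that(1)[of 2] that(1)[of "u / v"] that(2) by (cases "v = 0") (auto simp: not_less[symmetric])

context static_strip
begin

section \<open>Primitives on the base interval\<close>

definition prim :: "(real => real) => real => real" where
 "prim h = (SOME G. \<forall>y\<in>K. (DERIV G y :> h y))"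

lemma prim_deriv:
 assumes "!!y. y \<in> K ==> isCont h y" "y \<in> K"
 shows "DERIV (prim h) y :> h y"
proof -
 have "\<exists>G. \<forall>x::real. a < x --> x < b --> (G has_vector_derivative h x) (at x)"
  by (rule einterval_antiderivative[OF ab]) (use assms(1) in \<open>simp add: einterval_iff\<close>)
 then have "\<exists>G. \<forall>y\<in>K. (DERIV G y :> h y)"
  unfolding einterval_iff has_real_derivative_iff_has_vector_derivative Ball_def by blast
 from someI_ex[OF this] show ?thesis using assms(2) unfolding prim_def by blast
qed

abbreviation "F \<equiv> prim (\<lambda>y. 1 / f y)"

lemma f_cont: "y \<in> K ==> isCont f y" by (rule DERIV_isCont[OF f_deriv])

lemma recip_f_cont: "y \<in> K ==> isCont (\<lambda>y. 1 / f y) y"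
 using f_cont[of y] pos[of y] by (intro continuous_intros) auto

lemma F_deriv: "y \<in> K ==> DERIV F y :> 1 / f y" by (rule prim_deriv[OF recip_f_cont])

lemma prim_diff_integral:
 assumes h: "!!y. y \<in> K ==> isCont h y" and y: "y \<in> K" "z \<in> K" "y <= z"
 shows "integral {y..z} h = prim h z - prim h y"
proof -
 have "(h has_integral prim h z - prim h y) {y..z}"
 proof (rule fundamental_theorem_of_calculus[OF y(3)])
  fix x assume "x \<in> {y..z}"
  then have "x \<in> K" using in_K[OF y(1,2), of x] by simp
  then show "(prim h has_vector_derivative h x) (at x within {y..z})"
   using prim_deriv[OF h] by (auto simp: has_real_derivative_iff_has_vector_derivative[symmetric] intro: has_field_derivative_at_within)
 qed
 then show ?thesis by (rule integral_unique)
qed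

lemma prim_less:
 assumes h: "!!y. y \<in> K ==> isCont h y" "!!y. y \<in> K ==> h y > 0" and y: "y \<in> K" "z \<in> K" "y < z"
 shows "prim h y < prim h z"
proof (rule DERIV_pos_imp_increasing[OF y(3)])
 fix x assume "y <= x" "x <= z"
 then have "x \<in> K" using in_K[OF y(1,2)] by simp
 then show "\<exists>D. (DERIV (prim h) x :> D) \<and> 0 < D" using prim_deriv[OF h(1)] h(2) by blast
qed

lemma F_less: "y \<in> K ==> z \<in> K ==> y < z ==> F y < F z"
 by (rule prim_less[OF recip_f_cont]) (use pos in auto)

lemma integral_F: "y \<in> K ==> z \<in> K ==> y <= z ==> integral {y..z} (\<lambda>y. 1 / f y) = F z - F y"
 by (rule prim_diff_integral[OF recip_f_cont])

subsection \<open>Curves\<close>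

text \<open>The domain \<open>U\<close> is small enough for the height to stay in \<open>K\<close>
  on all of it, so that compositions with \<open>f\<close> are smooth on an open set.\<close>

definition curve_on :: "real set => (real => real ^ 2) => bool" where
 "curve_on U c \<longleftrightarrow> open U \<and> {0..1} \<subseteq> U \<and> smooth_on U c \<and> (\<forall>t\<in>U. c t $ 1 \<in> K)"

lemma joins_curve_on:
 assumes "joins (strip K J) c p q"
 obtains U where "curve_on U c"
proof -
 obtain U where U: "open U" "{0..1} \<subseteq> U" "smooth_on U c" using assms unfolding joins_def smooth_on_unit_def by blast
 have "continuous_on U (\<lambda>t. c t $ 1)"
  using smooth_on_has_deriv[OF smooth_on_component[OF U(1,3)]] by (intro continuous_at_imp_continuous_on) (auto intro: DERIV_isCont)
 then have "open (U \<inter> (\<lambda>t. c t $ 1) -` K)" by (rule continuous_open_preimage) (auto simp: U)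
 moreover have "{0..1} \<subseteq> U \<inter> (\<lambda>t. c t $ 1) -` K" using U(2) assms unfolding joins_def strip_def by auto
 moreover have "smooth_on (U \<inter> (\<lambda>t. c t $ 1) -` K) c" by (rule smooth_on_subset[OF U(3)]) simp
 ultimately show thesis by (intro that[of "U \<inter> (\<lambda>t. c t $ 1) -` K"]) (auto simp: curve_on_def)
qed

lemma velocity_eq: "velocity c = vderiv c" unfolding velocity_def by (rule ext) simp

lemma component_deriv:
 fixes X :: "real => real ^ 2"
 assumes "smooth_on U X" "t \<in> U"
 shows "DERIV (\<lambda>t. X t $ i) t :> vderiv X t $ i" unfolding has_real_derivative_iff_has_vector_derivative
 by (rule bounded_linear.has_vector_derivative[OF bounded_linear_vec_nth smooth_on_has_vderiv[OF assms]])

lemma curve_deriv: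
 assumes "curve_on U c" "t \<in> {0..1}"
 shows "c t $ 1 \<in> K" and "DERIV (\<lambda>t. c t $ i) t :> velocity c t $ i"
  and "DERIV (\<lambda>t. velocity c t $ i) t :> vderiv (velocity c) t $ i"
  and "DERIV (\<lambda>t. F (c t $ 1)) t :> velocity c t $ 1 / f (c t $ 1)"
proof -
 have t: "t \<in> U" "smooth_on U c" using assms unfolding curve_on_def by auto
 show K: "c t $ 1 \<in> K" using assms t unfolding curve_on_def by auto
 show d: "DERIV (\<lambda>t. c t $ i) t :> velocity c t $ i" for i
  unfolding velocity_eq by (rule component_deriv[OF t(2,1)])
 show "DERIV (\<lambda>t. velocity c t $ i) t :> vderiv (velocity c) t $ i"
  unfolding velocity_eq by (rule component_deriv[OF smooth_on_vderiv[OF t(2)] t(1)])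
 show "DERIV (\<lambda>t. F (c t $ 1)) t :> velocity c t $ 1 / f (c t $ 1)"
  using DERIV_chain2[OF F_deriv[OF K] d[of 1]] by simp
qed

lemma curve_velocity_cont: "curve_on U c ==> continuous_on {0..1} (\<lambda>t. velocity c t $ i)"
 by (intro continuous_at_imp_continuous_on ballI DERIV_isCont[OF curve_deriv(3)])

lemma f_along:
 assumes "curve_on U c" "t \<in> {0..1}"
 shows "DERIV (\<lambda>t. f (c t $ 1)) t :> f1 (c t $ 1) * velocity c t $ 1"
  and "DERIV (\<lambda>t. f1 (c t $ 1)) t :> f2 (c t $ 1) * velocity c t $ 1" and "f (c t $ 1) > 0"
 using DERIV_chain2[OF f_deriv curve_deriv(2)[OF assms, of 1]] DERIV_chain2[OF f1_deriv curve_deriv(2)[OF assms, of 1]]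
  curve_deriv(1)[OF assms] pos by auto

lemma slope_cont: "curve_on U c ==> continuous_on {0..1} (\<lambda>t. velocity c t $ 1 / f (c t $ 1))"
 using f_along(3) by (intro continuous_on_divide curve_velocity_cont continuous_at_imp_continuous_on ballI DERIV_isCont[OF f_along(1)]) (auto simp: less_imp_neq[symmetric])

lemma metric_slope:
 assumes "curve_on U c" "t \<in> {0..1}"
 shows "metric_form g (c t) (velocity c t) (velocity c t) = (f (c t $ 1))\<^sup>2 * ((velocity c t $ 1 / f (c t $ 1))\<^sup>2 - (velocity c t $ 2)\<^sup>2)"
 using f_along(3)[OF assms] unfolding metric_form_static by (simp add: field_simps)

lemma metric_sign:
 assumes "curve_on U c" "t \<in> {0..1}"
 shows "0 < metric_form g (c t) (velocity c t) (velocity c t) \<longleftrightarrow> \<bar>velocity c t $ 2\<bar> < \<bar>velocity c t $ 1 / f (c t $ 1)\<bar>"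
  and "metric_form g (c t) (velocity c t) (velocity c t) < 0 \<longleftrightarrow> \<bar>velocity c t $ 1 / f (c t $ 1)\<bar> < \<bar>velocity c t $ 2\<bar>"
  and "metric_form g (c t) (velocity c t) (velocity c t) = 0 \<longleftrightarrow> \<bar>velocity c t $ 1 / f (c t $ 1)\<bar> = \<bar>velocity c t $ 2\<bar>"
proof -
 have sq: "x\<^sup>2 < y\<^sup>2 \<longleftrightarrow> \<bar>x\<bar> < \<bar>y\<bar>" for x y :: real by (simp add: abs_le_square_iff[symmetric] not_le[symmetric])
 show "0 < metric_form g (c t) (velocity c t) (velocity c t) \<longleftrightarrow> \<bar>velocity c t $ 2\<bar> < \<bar>velocity c t $ 1 / f (c t $ 1)\<bar>"
  "metric_form g (c t) (velocity c t) (velocity c t) < 0 \<longleftrightarrow> \<bar>velocity c t $ 1 / f (c t $ 1)\<bar> < \<bar>velocity c t $ 2\<bar>"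
  "metric_form g (c t) (velocity c t) (velocity c t) = 0 \<longleftrightarrow> \<bar>velocity c t $ 1 / f (c t $ 1)\<bar> = \<bar>velocity c t $ 2\<bar>"
  unfolding metric_slope[OF assms] sq[symmetric] using f_along(3)[OF assms]
  by (simp_all only: zero_less_mult_iff mult_less_0_iff mult_eq_0_iff power2_eq_iff abs_eq_iff right_minus_eq, auto)
qed

lemma curve_F_le: "curve_on U c ==> c 0 $ 1 <= c 1 $ 1 ==> F (c 0 $ 1) <= F (c 1 $ 1)"
 using F_less[OF curve_deriv(1) curve_deriv(1), of U c 0 U c 1] by (cases "c 0 $ 1 = c 1 $ 1") auto

lemma spacelike_bound:
 assumes c: "curve_on U u" and s: "spacelike_curve g u"
 shows "\<bar>u 1 $ 2 - u 0 $ 2\<bar> < \<bar>F (u 1 $ 1) - F (u 0 $ 1)\<bar>"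
  and "u 0 $ 1 <= u 1 $ 1 ==> t \<in> {0..1} ==> velocity u t $ 1 > 0"
proof -
 have less: "\<bar>velocity u t $ 2\<bar> < \<bar>velocity u t $ 1 / f (u t $ 1)\<bar>" if "t \<in> {0..1}" for t
  using s metric_sign(1)[OF c that] that unfolding spacelike_curve_def by blast
 note d = dominated_change[OF curve_deriv(4)[OF c] curve_deriv(2)[OF c] slope_cont[OF c] less, simplified]
 show "\<bar>u 1 $ 2 - u 0 $ 2\<bar> < \<bar>F (u 1 $ 1) - F (u 0 $ 1)\<bar>" by (rule d(1))
 show "velocity u t $ 1 > 0" if "u 0 $ 1 <= u 1 $ 1" "t \<in> {0..1}"
  using d(2)[of t] curve_F_le[OF c that(1)] that(2) f_along(3)[OF c that(2)] by (simp add: zero_less_divide_iff)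
qed

lemma timelike_bound:
 assumes c: "curve_on U u" and s: "timelike_curve g u"
 shows "\<bar>F (u 1 $ 1) - F (u 0 $ 1)\<bar> < \<bar>u 1 $ 2 - u 0 $ 2\<bar>"
proof (rule dominated_change(1)[OF curve_deriv(2)[OF c] curve_deriv(4)[OF c] curve_velocity_cont[OF c]])
 show "\<bar>velocity u t $ 1 / f (u t $ 1)\<bar> < \<bar>velocity u t $ 2\<bar>" if "t \<in> {0..1}" for t
  using s metric_sign(2)[OF c that] that unfolding timelike_curve_def by blast
qed

text \<open>The slopes are equal in absolute value and nonzero, so each is strictly dominated by
  \<open>k\<close> times the other for every \<open>k > 1\<close>; the two resulting inequalities
  give equality.\<close>

lemma lightlike_bound:
 assumes c: "curve_on U u" and s: "lightlike_curve g u"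
 shows "\<bar>u 1 $ 2 - u 0 $ 2\<bar> = \<bar>F (u 1 $ 1) - F (u 0 $ 1)\<bar>"
  and "u 0 $ 1 <= u 1 $ 1 ==> t \<in> {0..1} ==> velocity u t $ 1 > 0"
proof -
 let ?w = "\<lambda>t. velocity u t $ 1 / f (u t $ 1)"
 have eq: "\<bar>?w t\<bar> = \<bar>velocity u t $ 2\<bar>" "?w t \<noteq> 0" if t: "t \<in> {0..1}" for t
 proof -
  show eq: "\<bar>?w t\<bar> = \<bar>velocity u t $ 2\<bar>" using s metric_sign(3)[OF c t] t unfolding lightlike_curve_def by blast
  have "velocity u t \<noteq> 0" using s t unfolding lightlike_curve_def by blast
  then show "?w t \<noteq> 0" using eq f_along(3)[OF c t] by (auto simp: vec_eq_iff forall_2)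
 qed
 have less: "\<bar>velocity u t $ 2\<bar> < \<bar>k * ?w t\<bar>" "\<bar>?w t\<bar> < \<bar>k * velocity u t $ 2\<bar>" if "1 < k" "t \<in> {0..1}" for k t
 proof -
  have "0 < \<bar>?w t\<bar>" using eq(2)[OF that(2)] by simp
  from mult_strict_right_mono[OF that(1) this] have "\<bar>?w t\<bar> < k * \<bar>?w t\<bar>" by (simp only: mult_1)
  then show "\<bar>velocity u t $ 2\<bar> < \<bar>k * ?w t\<bar>" "\<bar>?w t\<bar> < \<bar>k * velocity u t $ 2\<bar>"
   unfolding abs_mult eq(1)[OF that(2)] using that(1) by simp_all
 qed
 note d1 = dominated_change[OF DERIV_cmult[OF curve_deriv(4)[OF c]] curve_deriv(2)[OF c] continuous_on_mult_left[OF slope_cont[OF c]] less(1)]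
  and d2 = dominated_change(1)[OF DERIV_cmult[OF curve_deriv(2)[OF c]] curve_deriv(4)[OF c] continuous_on_mult_left[OF curve_velocity_cont[OF c]] less(2)]
 show "\<bar>u 1 $ 2 - u 0 $ 2\<bar> = \<bar>F (u 1 $ 1) - F (u 0 $ 1)\<bar>"
 proof (rule antisym; rule le_if_less_scaled)
  fix k :: real assume k: "1 < k"
  show "\<bar>u 1 $ 2 - u 0 $ 2\<bar> < k * \<bar>F (u 1 $ 1) - F (u 0 $ 1)\<bar>"
   using d1(1)[of k] k by (simp add: abs_mult right_diff_distrib[symmetric])
  show "\<bar>F (u 1 $ 1) - F (u 0 $ 1)\<bar> < k * \<bar>u 1 $ 2 - u 0 $ 2\<bar>"
   using d2[of k] k by (simp add: abs_mult right_diff_distrib[symmetric])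
 qed auto
 show "velocity u t $ 1 > 0" if "u 0 $ 1 <= u 1 $ 1" "t \<in> {0..1}"
  using d1(2)[of 2 t] curve_F_le[OF c that(1)] that(2) f_along(3)[OF c that(2)] by (simp add: zero_less_divide_iff)
qed


subsection \<open>Geodesics\<close>

definition geodesic_on :: "real set => (real => real ^ 2) => bool" where
 "geodesic_on U c \<longleftrightarrow> curve_on U c \<and> (\<forall>t\<in>{0..1}. cov_deriv g c (velocity c) t = 0)"

lemma geodesic_joins_on:
 assumes "geodesic_joins g (strip K J) c p q"
 obtains U where "geodesic_on U c" using assms joins_curve_on unfolding geodesic_joins_def geodesic_on_def by metis

lemma geodesic_acceleration:
 assumes "geodesic_on U u" "t \<in> {0..1}"
 shows "DERIV (\<lambda>t. velocity u t $ 1) t :> - (f (u t $ 1) * f1 (u t $ 1) * (velocity u t $ 2)\<^sup>2)"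
  and "DERIV (\<lambda>t. velocity u t $ 2) t :> - 2 * (f1 (u t $ 1) / f (u t $ 1)) * velocity u t $ 1 * velocity u t $ 2"
proof -
 have c: "curve_on U u" and g: "cov_deriv g u (velocity u) t = 0" using assms unfolding geodesic_on_def by auto
 note K = curve_deriv(1)[OF c assms(2)]
 have "cov_deriv g u (velocity u) t $ 1 = 0" "cov_deriv g u (velocity u) t $ 2 = 0" using g by simp_all
 then have "vderiv (velocity u) t $ 1 = - (f (u t $ 1) * f1 (u t $ 1) * (velocity u t $ 2)\<^sup>2)"
  "vderiv (velocity u) t $ 2 = - 2 * (f1 (u t $ 1) / f (u t $ 1)) * velocity u t $ 1 * velocity u t $ 2"
  unfolding cov_deriv_static[of u t, OF K] by (simp_all add: power2_eq_square algebra_simps)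
 then show "DERIV (\<lambda>t. velocity u t $ 1) t :> - (f (u t $ 1) * f1 (u t $ 1) * (velocity u t $ 2)\<^sup>2)"
  "DERIV (\<lambda>t. velocity u t $ 2) t :> - 2 * (f1 (u t $ 1) / f (u t $ 1)) * velocity u t $ 1 * velocity u t $ 2"
  using curve_deriv(3)[OF c assms(2)] by metis+
qed

lemma geodesic_energy:
 assumes g: "geodesic_on U u" and t: "t \<in> {0..1}" "s \<in> {0..1}"
 shows "metric_form g (u t) (velocity u t) (velocity u t) = metric_form g (u s) (velocity u s) (velocity u s)" unfolding metric_form_static
proof (rule deriv_zero_const[OF _ t, where h = "\<lambda>t. (velocity u t $ 1)\<^sup>2 - (f (u t $ 1))\<^sup>2 * (velocity u t $ 2)\<^sup>2"])
 fix t :: real assume t: "t \<in> {0..1}"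
 have c: "curve_on U u" using g unfolding geodesic_on_def by blast
 have "f (u t $ 1) \<noteq> 0" using f_along(3)[OF c t] by simp
 then show "DERIV (\<lambda>t. (velocity u t $ 1)\<^sup>2 - (f (u t $ 1))\<^sup>2 * (velocity u t $ 2)\<^sup>2) t :> 0"
  using geodesic_acceleration[OF g t] f_along(1)[OF c t] by (auto intro!: derivative_eq_intros simp: field_simps power2_eq_square)
qed

lemma geodesic_momentum:
 assumes g: "geodesic_on U u" and t: "t \<in> {0..1}" "s \<in> {0..1}"
 shows "(f (u t $ 1))\<^sup>2 * velocity u t $ 2 = (f (u s $ 1))\<^sup>2 * velocity u s $ 2"
proof (rule deriv_zero_const[OF _ t, where h = "\<lambda>t. (f (u t $ 1))\<^sup>2 * velocity u t $ 2"])
 fix t :: real assume t: "t \<in> {0..1}"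
 have c: "curve_on U u" using g unfolding geodesic_on_def by blast
 have "f (u t $ 1) \<noteq> 0" using f_along(3)[OF c t] by simp
 then show "DERIV (\<lambda>t. (f (u t $ 1))\<^sup>2 * velocity u t $ 2) t :> 0"
  using geodesic_acceleration[OF g t] f_along(1)[OF c t] by (auto intro!: derivative_eq_intros simp: field_simps power2_eq_square)
qed

text \<open>The metric is constant on the velocity, so only a zero velocity on a null geodesic has
  to be excluded: it makes the momentum vanish, hence both components of the velocity everywhere,
  and the curve would be constant.\<close>

lemma geodesic_types:
 assumes g: "geodesic_on U u" and ne: "u 0 \<noteq> u 1"
 shows "spacelike_curve g u \<or> lightlike_curve g u \<or> timelike_curve g u"
proof -
 have c: "curve_on U u" using g unfolding geodesic_on_def by blast
 let ?E = "\<lambda>t. metric_form g (u t) (velocity u t) (velocity u t)"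
 have E: "?E t = ?E 0" if "t \<in> {0..1}" for t by (rule geodesic_energy[OF g that]) simp
 have "velocity u t \<noteq> 0" if E0: "?E 0 = 0" and t: "t \<in> {0..1}" for t
 proof
  assume "velocity u t = 0"
  then have "(f (u s $ 1))\<^sup>2 * velocity u s $ 2 = 0" if "s \<in> {0..1}" for s using geodesic_momentum[OF g that t] by simp
  then have v2: "velocity u s $ 2 = 0" if "s \<in> {0..1}" for s using that f_along(3)[OF c that] by fastforce
  have v1: "velocity u s $ 1 = 0" if "s \<in> {0..1}" for s using E[OF that] E0 v2[OF that] unfolding metric_form_static by simp
  have "u 1 $ i = u 0 $ i" for i
  proof (rule deriv_zero_const[where h = "\<lambda>t. u t $ i"])
   fix s :: real assume s: "s \<in> {0..1}"
   show "DERIV (\<lambda>t. u t $ i) s :> 0"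
    using curve_deriv(2)[OF c s, of i] v1[OF s] v2[OF s] exhaust_2[of i] by auto
  qed auto
  then show False using ne by (simp add: vec_eq_iff)
 qed
 then show ?thesis unfolding spacelike_curve_def lightlike_curve_def timelike_curve_def using E by (metis linorder_neqE_linordered_idom)
qed

subsection \<open>Jacobi fields\<close>

lemma smooth_cov_deriv:
 assumes c: "curve_on U u" and X: "open U'" "U' \<subseteq> U" "smooth_on U' X"
 shows "smooth_on U' (cov_deriv g u X)"
proof (rule smooth_on_from_components[OF X(1)])
 have u: "smooth_on U' u" "!!t. t \<in> U' ==> u t $ 1 \<in> K"
  using c X(2) smooth_on_subset unfolding curve_on_def by blast+
 note comp = smooth_on_component[OF X(1)]
 have f0: "smooth_on U' (\<lambda>t. f (u t $ 1))" "smooth_on U' (\<lambda>t. f1 (u t $ 1))"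
  by (rule smooth_on_compose[OF X(1) comp[OF u(1)] u(2)], assumption, intro smooth smooth_on_vderiv)+
 have fi: "smooth_on U' (\<lambda>t. inverse (f (u t $ 1)))" by (rule smooth_on_inverse[OF X(1) f0(1)]) (use pos u(2) in auto)
 have vel: "smooth_on U' (velocity u)" unfolding velocity_eq by (rule smooth_on_vderiv[OF u(1)])
 note add = smooth_on_add[OF X(1)] and mult = smooth_on_mult[OF X(1)]
 fix i :: 2
 have 1: "smooth_on U' (\<lambda>t. vderiv X t $ 1 + f (u t $ 1) * f1 (u t $ 1) * velocity u t $ 2 * X t $ 2)"
  by (intro add mult f0 comp vel X(3) smooth_on_vderiv)
 have 2: "smooth_on U' (\<lambda>t. vderiv X t $ 2 + f1 (u t $ 1) * inverse (f (u t $ 1)) * (velocity u t $ 1 * X t $ 2 + velocity u t $ 2 * X t $ 1))"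
  by (intro add mult f0 fi comp vel X(3) smooth_on_vderiv)
 have "i = 1 \<or> i = 2" by (rule exhaust_2)
 then show "smooth_on U' (\<lambda>t. cov_deriv g u X t $ i)"
 proof
  assume "i = 1"
  then show ?thesis using smooth_on_cong[OF X(1) 1] cov_deriv_static(1)[of u _ X] u(2) by simp
 next
  assume "i = 2"
  then show ?thesis using smooth_on_cong[OF X(1) 2] cov_deriv_static(2)[of u _ X] u(2) by (simp add: divide_inverse)
 qed
qed

text \<open>The area form of the field and the velocity is parallel, so along a geodesic its covariant
 derivative is its derivative.\<close>

lemma area_deriv:
 assumes g: "geodesic_on U u" and t: "t \<in> {0..1}"
  and A: "DERIV A t :> A' - f (u t $ 1) * f1 (u t $ 1) * velocity u t $ 2 * B t"
  and B: "DERIV B t :> B' - f1 (u t $ 1) / f (u t $ 1) * (velocity u t $ 1 * B t + velocity u t $ 2 * A t)"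
 shows "((\<lambda>t. f (u t $ 1) * (A t * velocity u t $ 2 - B t * velocity u t $ 1)) has_real_derivative
   f (u t $ 1) * (A' * velocity u t $ 2 - B' * velocity u t $ 1)) (at t)"
proof -
 have c: "curve_on U u" using g unfolding geodesic_on_def by blast
 have "f (u t $ 1) \<noteq> 0" using f_along(3)[OF c t] by simp
 then show ?thesis using geodesic_acceleration[OF g t] f_along(1)[OF c t] A B
  by (auto intro!: derivative_eq_intros simp: field_simps power2_eq_square)
qed

text \<open>The Killing field \<open>\<partial>\<^sub>x\<close> gives the solution \<open>f y'\<close> of the scalar Jacobi equation, which has no
 zeros when \<open>y'\<close> has none; its Wronskian with the solution given by a Jacobi field is constant.\<close>

lemma no_conjugate:
 assumes g: "geodesic_on U u" and v: "!!t. t \<in> {0..1} ==> velocity u t $ 1 > 0"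
 shows "no_conjugate_points g u" unfolding no_conjugate_points_def
proof (rule notI, elim bexE conjE exE)
 fix s0 t0 X u0 assume st: "s0 \<in> {0..1}" "t0 \<in> {0..1}" "s0 \<noteq> t0" and J: "jacobi_field g u X"
  and X0: "X s0 = 0" "X t0 = 0" and u0: "u0 \<in> {0..1}" "X u0 \<noteq> 0"
 have c: "curve_on U u" using g unfolding geodesic_on_def by blast
 obtain U1 where U1: "open U1" "{0..1} \<subseteq> U1" "smooth_on U1 X" using J unfolding jacobi_field_def smooth_on_unit_def by blast
 define U' where "U' = U \<inter> U1"
 have U': "open U'" "U' \<subseteq> U" "smooth_on U' X" "{0..1} \<subseteq> U'"
  using U1 c smooth_on_subset[OF U1(3)] unfolding U'_def curve_on_def by auto
 define W where "W = cov_deriv g u X"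
 define DW where "DW = cov_deriv g u W"
 have W: "smooth_on U' W" unfolding W_def by (rule smooth_cov_deriv[OF c U'(1-3)])
 define y v1 v2 where "y = (\<lambda>t. u t $ 1)" and "v1 = (\<lambda>t. velocity u t $ 1)" and "v2 = (\<lambda>t. velocity u t $ 2)"
 \<comment> \<open>The area spanned by field and velocity measures the part of the field transversal
   to the curve; \<open>z\<close> turns out to be its derivative.\<close>
 define h where "h t = f (y t) * (X t $ 1 * v2 t - X t $ 2 * v1 t)" for t
 define z where "z t = f (y t) * (W t $ 1 * v2 t - W t $ 2 * v1 t)" for t
 define E where "E = metric_form g (u 0) (velocity u 0) (velocity u 0)"
 have K: "y t \<in> K" if "t \<in> {0..1}" for t using curve_deriv(1)[OF c that] unfolding y_def .
 have fp: "f (y t) > 0" if "t \<in> {0..1}" for t by (rule pos[OF K[OF that]])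
 have v1p: "v1 t > 0" if "t \<in> {0..1}" for t using v[OF that] unfolding v1_def .
 have Eq: "E = (v1 t)\<^sup>2 - (f (y t))\<^sup>2 * (v2 t)\<^sup>2" if "t \<in> {0..1}" for t
  using geodesic_energy[OF g that, of 0] unfolding E_def metric_form_static y_def v1_def v2_def by simp
 have dX: "DERIV (\<lambda>t. X t $ 1) t :> W t $ 1 - f (y t) * f1 (y t) * v2 t * X t $ 2"
  "DERIV (\<lambda>t. X t $ 2) t :> W t $ 2 - f1 (y t) / f (y t) * (v1 t * X t $ 2 + v2 t * X t $ 1)"
  if t: "t \<in> {0..1}" for t using component_deriv[OF U'(3), of t] cov_deriv_static[of u t X, OF curve_deriv(1)[OF c t]] t U'(4)
  unfolding W_def y_def v1_def v2_def by (auto simp: algebra_simps)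
 have dW: "DERIV (\<lambda>t. W t $ 1) t :> DW t $ 1 - f (y t) * f1 (y t) * v2 t * W t $ 2"
  "DERIV (\<lambda>t. W t $ 2) t :> DW t $ 2 - f1 (y t) / f (y t) * (v1 t * W t $ 2 + v2 t * W t $ 1)"
  if t: "t \<in> {0..1}" for t using component_deriv[OF W, of t] cov_deriv_static[of u t W, OF curve_deriv(1)[OF c t]] t U'(4)
  unfolding DW_def y_def v1_def v2_def by (auto simp: algebra_simps)
 have DW: "DW t $ 1 = - (f (y t) * f2 (y t) * (X t $ 1 * v2 t - X t $ 2 * v1 t) * v2 t)"
  "DW t $ 2 = - (f2 (y t) / f (y t) * (X t $ 1 * v2 t - X t $ 2 * v1 t) * v1 t)" if t: "t \<in> {0..1}" for t
 proof -
  have "DW t + curvature g (u t) (X t) (velocity u t) (velocity u t) = 0" using J t unfolding jacobi_field_def DW_def W_def by blast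
  then have D: "DW t $ i = - curvature g (u t) (X t) (velocity u t) (velocity u t) $ i" for i
   by (simp add: vec_eq_iff eq_neg_iff_add_eq_0)
  show "DW t $ 1 = - (f (y t) * f2 (y t) * (X t $ 1 * v2 t - X t $ 2 * v1 t) * v2 t)"
   "DW t $ 2 = - (f2 (y t) / f (y t) * (X t $ 1 * v2 t - X t $ 2 * v1 t) * v1 t)"
   unfolding D curvature_static[OF curve_deriv(1)[OF c t]] y_def v1_def v2_def by auto
 qed
 have dh: "DERIV h t :> z t" if "t \<in> {0..1}" for t unfolding h_def z_def y_def v1_def v2_def
  by (rule area_deriv[OF g that dX[OF that, unfolded y_def v1_def v2_def]])
 \<comment> \<open>The scalar Jacobi equation: the right-hand side is \<open>f2 / f * E * h\<close>,
   with \<open>E\<close> the constant value of the metric on the velocity.\<close>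
 have dz: "DERIV z t :> f2 (y t) * (X t $ 1 * v2 t - X t $ 2 * v1 t) * E" if t: "t \<in> {0..1}" for t
 proof -
  have "DERIV z t :> f (y t) * (DW t $ 1 * v2 t - DW t $ 2 * v1 t)" unfolding z_def y_def v1_def v2_def
   by (rule area_deriv[OF g t dW[OF t, unfolded y_def v1_def v2_def]])
  moreover have "f (y t) * (DW t $ 1 * v2 t - DW t $ 2 * v1 t) = f2 (y t) * (X t $ 1 * v2 t - X t $ 2 * v1 t) * E"
   unfolding DW[OF t] Eq[OF t] using fp[OF t] by (simp add: field_simps power2_eq_square)
  ultimately show ?thesis by simp
 qed
 have dv1: "DERIV v1 t :> - (f (y t) * f1 (y t) * (v2 t)\<^sup>2)" if "t \<in> {0..1}" for t
  using geodesic_acceleration(1)[OF g that] unfolding y_def v1_def v2_def .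
 have df: "DERIV (\<lambda>t. f (y t)) t :> f1 (y t) * v1 t" "DERIV (\<lambda>t. f1 (y t)) t :> f2 (y t) * v1 t"
  if "t \<in> {0..1}" for t using f_along(1,2)[OF c that] unfolding y_def v1_def .
 have dk: "DERIV (\<lambda>t. f (y t) * v1 t) t :> f1 (y t) * E" if t: "t \<in> {0..1}" for t
  using df(1)[OF t] dv1[OF t] unfolding Eq[OF t] by (auto intro!: derivative_eq_intros simp: algebra_simps power2_eq_square)
 have wr: "z t * (f (y t) * v1 t) - h t * (f1 (y t) * E) = z s * (f (y s) * v1 s) - h s * (f1 (y s) * E)"
  if "t \<in> {0..1}" "s \<in> {0..1}" for t s
 proof (rule deriv_zero_const[OF _ that, where h = "\<lambda>t. z t * (f (y t) * v1 t) - h t * (f1 (y t) * E)"])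
  fix t :: real assume t: "t \<in> {0..1}"
  show "DERIV (\<lambda>t. z t * (f (y t) * v1 t) - h t * (f1 (y t) * E)) t :> 0"
   by (rule DERIV_cong[OF DERIV_diff[OF DERIV_mult[OF dz[OF t] dk[OF t]] DERIV_mult[OF dh[OF t] DERIV_cmult_right[OF df(2)[OF t]]]]])
    (simp add: h_def algebra_simps)
 qed
 define C where "C = z 0 * (f (y 0) * v1 0) - h 0 * (f1 (y 0) * E)"
 have kp: "f (y t) * v1 t > 0" if "t \<in> {0..1}" for t using fp[OF that] v1p[OF that] by simp
 \<comment> \<open>The quotient of the two solutions has a derivative with the sign of the Wronskian
   \<open>C\<close>, so two zeros of \<open>h\<close> force \<open>C = 0\<close>.\<close>
 have dq: "DERIV (\<lambda>t. h t / (f (y t) * v1 t)) t :> C / (f (y t) * v1 t)\<^sup>2" if t: "t \<in> {0..1}" for t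
  by (rule DERIV_cong[OF DERIV_divide[OF dh[OF t] dk[OF t]]])
   (use fp[OF t] v1p[OF t] wr[OF t, of 0] in \<open>simp_all add: C_def power2_eq_square\<close>)
 have h0: "h s0 = 0" "h t0 = 0" unfolding h_def using X0 by simp_all
 have less: "C = 0" if lt: "s < t" and s: "s \<in> {0..1}" "t \<in> {0..1}" and hs: "h s = 0" "h t = 0" for s t
 proof -
  obtain r where r: "s < r" "r < t" "h t / (f (y t) * v1 t) - h s / (f (y s) * v1 s) = (t - s) * (C / (f (y r) * v1 r)\<^sup>2)"
  proof -
   have "\<exists>r>s. r < t \<and> h t / (f (y t) * v1 t) - h s / (f (y s) * v1 s) = (t - s) * (C / (f (y r) * v1 r)\<^sup>2)"
    by (rule MVT2[OF lt dq]) (use s in auto)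
   then show thesis using that by blast
  qed
  then have "C / (f (y r) * v1 r)\<^sup>2 = 0" using hs lt by auto
  then show "C = 0" using kp[of r] r s by auto
 qed
 have C0: "C = 0" using less[of s0 t0] less[of t0 s0] st h0 by (cases "s0 < t0") auto
 have hz: "h t = 0" if t: "t \<in> {0..1}" for t
 proof -
  have "h t / (f (y t) * v1 t) = h s0 / (f (y s0) * v1 s0)"
   by (rule deriv_zero_const[OF _ t st(1), where h = "\<lambda>t. h t / (f (y t) * v1 t)"]) (use dq C0 in simp)
  then show ?thesis using kp[OF t] h0 by auto
 qed
 have zz: "z t = 0" if t: "t \<in> {0..1}" for t using wr[OF t, of 0] hz[OF t] C0 kp[OF t] unfolding C_def by auto
 \<comment> \<open>With \<open>h = z = 0\<close> the field and its covariant derivative are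
   multiples of the velocity, and the Jacobi equation makes the factor of the field affine in
   \<open>t\<close>. An affine function with two zeros vanishes.\<close>
 have X2: "X t $ 2 = X t $ 1 * v2 t / v1 t" "W t $ 2 = W t $ 1 * v2 t / v1 t" if t: "t \<in> {0..1}" for t
  using hz[OF t] zz[OF t] fp[OF t] v1p[OF t] unfolding h_def z_def by (auto simp: field_simps)
 have DW1: "DW t $ 1 = 0" if t: "t \<in> {0..1}" for t
 proof -
  have "X t $ 1 * v2 t - X t $ 2 * v1 t = 0" using hz[OF t] fp[OF t] unfolding h_def by auto
  then show ?thesis unfolding DW(1)[OF t] by simp
 qed
 have dphi: "DERIV (\<lambda>t. X t $ 1 / v1 t) t :> W t $ 1 / v1 t" if t: "t \<in> {0..1}" for t
  by (rule DERIV_cong[OF DERIV_divide[OF dX(1)[OF t] dv1[OF t]]])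
   (use v1p[OF t] X2(1)[OF t] in \<open>simp_all add: field_simps power2_eq_square\<close>)
 have dpsi: "DERIV (\<lambda>t. W t $ 1 / v1 t) t :> 0" if t: "t \<in> {0..1}" for t
  by (rule DERIV_cong[OF DERIV_divide[OF dW(1)[OF t] dv1[OF t]]])
   (use v1p[OF t] X2(2)[OF t] DW1[OF t] in \<open>simp_all add: field_simps power2_eq_square\<close>)
 define k where "k = W 0 $ 1 / v1 0"
 have psi: "W t $ 1 / v1 t = k" if t: "t \<in> {0..1}" for t unfolding k_def by (rule deriv_zero_const[OF dpsi t]) simp_all
 have phi: "X t $ 1 / v1 t - k * t = X s $ 1 / v1 s - k * s" if "t \<in> {0..1}" "s \<in> {0..1}" for s t
 proof (rule deriv_zero_const[OF _ that, where h = "\<lambda>t. X t $ 1 / v1 t - k * t"])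
  fix t :: real assume t: "t \<in> {0..1}"
  show "DERIV (\<lambda>t. X t $ 1 / v1 t - k * t) t :> 0"
   by (rule DERIV_cong[OF DERIV_diff[OF dphi[OF t] DERIV_cmult[OF DERIV_ident]]]) (use psi[OF t] in simp)
 qed
 have "k = 0" using phi[OF st(1,2)] X0 st(3) by simp
 then have "X u0 $ 1 = 0" using phi[OF u0(1) st(1)] X0 v1p[OF u0(1)] by simp
 then show False using u0 X2(1)[OF u0(1)] by (simp add: vec_eq_iff forall_2)
qed

end

section \<open>Reparametrization to the unit interval\<close>

lemma convex_between:
 fixes u v t :: real
 assumes "t \<in> {0..1}"
 shows "(1 - t) * u + t * v \<in> {min u v..max u v}"
proof -
 have "(1 - t) * min u v + t * min u v <= (1 - t) * u + t * v" "(1 - t) * u + t * v <= (1 - t) * max u v + t * max u v"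
  using assms by (intro add_mono mult_left_mono; simp)+
 then show ?thesis by (simp add: algebra_simps)
qed

text \<open>With \<open>G\<close> a primitive of \<open>1 / w\<close>, the inverse of
  \<open>G\<close> run through at constant speed solves the equation with both ends prescribed. It
  parametrizes straight segments, geodesics that are not timelike, and timelike geodesics, with
  \<open>w\<close> equal to \<open>f\<close>, to \<open>speed e n\<close> and to \<open>V\<close>
  along the trajectory.\<close>

lemma unit_reparametrization:
 fixes G w :: "real => real"
 assumes der: "!!x. l < x ==> x < u ==> DERIV G x :> 1 / w x" "!!x. l < x ==> x < u ==> 0 < w x"
  and ends: "l < p" "p < u" "l < q" "q < u"
 obtains U h where "open U" "{0..1} \<subseteq> U" "!!t. t \<in> U ==> l < h t \<and> h t < u"
  "!!t. t \<in> U ==> DERIV h t :> (G q - G p) * w (h t)" "h 0 = p" "h 1 = q"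
proof -
 obtain h s0 t0 where h: "s0 < G (min p q)" "G (max p q) < t0"
  "!!r. s0 < r ==> r < t0 ==> l < h r \<and> h r < u \<and> G (h r) = r \<and> (DERIV h r :> inverse (1 / w (h r)))"
  "!!x. l < x ==> x < u ==> h (G x) = x"
 proof (rule real_inverse_function[where g = G and g' = "\<lambda>x. 1 / w x"])
  show "l < min p q" "min p q <= max p q" "max p q < u" using ends by auto
 qed (use der in \<open>auto intro: that\<close>)
 define r where "r t = G p + (G q - G p) * t" for t
 define U where "U = {t. s0 < r t \<and> r t < t0}"
 have mono: "G x < G z" if "l < x" "x < z" "z < u" for x z
 proof (rule DERIV_pos_imp_increasing[OF that(2)])
  fix y assume "x <= y" "y <= z"
  then show "\<exists>d. (DERIV G y :> d) \<and> 0 < d" using der[of y] that by (intro exI[of _ "1 / w y"]) auto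
 qed
 have b: "s0 < G p" "G p < t0" "s0 < G q" "G q < t0" using h(1,2) mono[of p q] mono[of q p] ends by (cases p q rule: linorder_cases; simp)+
 show thesis
 proof (rule that[of U "\<lambda>t. h (r t)"])
  show "open U" unfolding U_def r_def by (intro open_Collect_conj open_Collect_less continuous_intros)
  show "{0..1} \<subseteq> U"
  proof
   fix t :: real assume "t \<in> {0..1}"
   then have "(1 - t) * G p + t * G q \<in> {min (G p) (G q)..max (G p) (G q)}" by (rule convex_between)
   moreover have "r t = (1 - t) * G p + t * G q" unfolding r_def by (simp add: algebra_simps)
   ultimately have "min (G p) (G q) <= r t" "r t <= max (G p) (G q)" by simp_all
   then show "t \<in> U" unfolding U_def using b by (auto simp: min_def max_def split: if_splits)
  qed
  fix t assume t: "t \<in> U"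
  show "l < h (r t) \<and> h (r t) < u" using h(3)[of "r t"] t unfolding U_def by auto
  have "DERIV h (r t) :> w (h (r t))" using h(3)[of "r t"] t unfolding U_def by auto
  moreover have "DERIV r t :> G q - G p" unfolding r_def by (auto intro!: derivative_eq_intros)
  ultimately have "DERIV (\<lambda>t. h (r t)) t :> w (h (r t)) * (G q - G p)" by (rule DERIV_chain2)
  then show "DERIV (\<lambda>t. h (r t)) t :> (G q - G p) * w (h (r t))" by (simp add: mult.commute)
 qed (use h(4) ends in \<open>simp_all add: r_def\<close>)
qed

text \<open>\<open>x\<close> is monotone in the direction of the sign of \<open>k\<close>; this
  keeps the coordinate \<open>x\<close> of the constructed curves inside \<open>J\<close>.\<close>

lemma between_ends:
 fixes x w :: "real => real"
 assumes d: "!!t. t \<in> {0..1} ==> DERIV x t :> k * w t" "!!t. t \<in> {0..1} ==> 0 <= w t" and t: "t \<in> {0..1}"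
 shows "x t \<in> {min (x 0) (x 1)..max (x 0) (x 1)}"
proof -
 have mono: "k * x p <= k * x q" if "0 <= p" "p <= q" "q <= 1" for p q
 proof (rule DERIV_nonneg_imp_nondecreasing[OF that(2)])
  fix z assume "p <= z" "z <= q"
  then have z: "z \<in> {0..1}" using that by auto
  show "\<exists>y. (DERIV (\<lambda>x'. k * x x') z :> y) \<and> 0 <= y"
   using DERIV_cmult[OF d(1)[OF z], of k] d(2)[OF z] by (intro exI[of _ "k * (k * w z)"]) (auto simp: mult.assoc[symmetric])
 qed
 have "k * x 0 <= k * x t" "k * x t <= k * x 1" using mono[of 0 t] mono[of t 1] t by auto
 moreover have "x t = x 0" if "k = 0" by (rule deriv_zero_const[OF _ t]) (use d that in auto)
 ultimately show ?thesis by (cases k "0 :: real" rule: linorder_cases) (auto simp: mult_le_cancel_left)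
qed

context static_strip
begin

subsection \<open>Existence and uniqueness of spacelike and lightlike geodesics\<close>

abbreviation "V1 \<equiv> \<lambda>y. - 2 * f1 y / (f y) ^ 3"

lemma V_eq: "V y = inverse (f y * f y)" unfolding inv_sq_def by (simp add: field_simps power2_eq_square)

lemma smooth_V: "smooth_on K V" and smooth_V1: "smooth_on K V1"
proof -
 have oK: "open K" by simp
 note mult = smooth_on_mult[OF oK]
 have fi: "smooth_on K (\<lambda>y. inverse (f y))" by (rule smooth_on_inverse[OF oK smooth pos])
 show "smooth_on K V" by (rule smooth_on_cong[OF oK mult[OF fi fi]]) (simp add: V_eq)
 have "smooth_on K (\<lambda>y. - 2 * f1 y * (inverse (f y) * (inverse (f y) * inverse (f y))))"
  by (intro mult fi smooth_on_const smooth_on_vderiv smooth)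
 then show "smooth_on K V1" by (rule smooth_on_cong[OF oK]) (simp add: power3_eq_cube divide_inverse)
qed

lemma make_curve:
 assumes U: "open U" "{0..1} \<subseteq> U" and y: "!!t. t \<in> U ==> y t \<in> K" "!!t. t \<in> U ==> DERIV y t :> v t"
  and sm: "smooth_on U v" "smooth_on U w" and x: "!!t. t \<in> U ==> DERIV x t :> w t"
 shows "curve_on U (\<lambda>t. vector [y t, x t])"
  and "t \<in> U ==> velocity (\<lambda>t. vector [y t, x t] :: real ^ 2) t = vector [v t, w t]"
proof -
 have y': "smooth_on U y" "smooth_on U x" by (rule smooth_on_antideriv[OF U(1) _ sm(1)] smooth_on_antideriv[OF U(1) _ sm(2)];
    use y x in \<open>simp add: has_real_derivative_iff_has_vector_derivative\<close>)+
 have "smooth_on U (\<lambda>t. (vector [y t, x t] :: real ^ 2) $ i)" for i using exhaust_2[of i] y' by auto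
 then have "smooth_on U (\<lambda>t. vector [y t, x t] :: real ^ 2)" by (rule smooth_on_from_components[OF U(1)])
 then show "curve_on U (\<lambda>t. vector [y t, x t])" using U y unfolding curve_on_def by simp
 assume t: "t \<in> U"
 have "((\<lambda>t. vector [y t, x t] :: real ^ 2) has_vector_derivative vector [v t, w t]) (at t)"
 proof (rule has_vderiv_components)
  fix i :: 2
  show "DERIV (\<lambda>t. (vector [y t, x t] :: real ^ 2) $ i) t :> (vector [v t, w t] :: real ^ 2) $ i"
   using exhaust_2[of i] y(2)[OF t] x[OF t] by auto
 qed
 then show "velocity (\<lambda>t. vector [y t, x t] :: real ^ 2) t = vector [v t, w t]"
  unfolding velocity_def by (rule vector_derivative_at)
qed

text \<open>\<open>k\<close> is the conserved momentum \<open>f\<^sup>2 * x'\<close>, and the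
  equation for \<open>v\<close> is \<open>y'' = - f * f1 * x'\<^sup>2\<close> in terms of
  \<open>V1\<close>. Smoothness follows from \<open>generated\<close>, since the derivative of
  \<open>v\<close> is a function of \<open>y\<close>.\<close>

lemma make_geodesic:
 assumes U: "open U" "{0..1} \<subseteq> U" and y: "!!t. t \<in> U ==> y t \<in> K" "!!t. t \<in> U ==> DERIV y t :> v t"
  and v: "!!t. t \<in> U ==> DERIV v t :> k\<^sup>2 / 2 * V1 (y t)"
  and x: "!!t. t \<in> U ==> DERIV x t :> k * V (y t)"
 shows "geodesic_on U (\<lambda>t. vector [y t, x t])"
proof -
 let ?u = "\<lambda>t. vector [y t, x t] :: real ^ 2"
 have gen: "smooth_on U G" if "G \<in> generated U K y v" for G
 proof (rule smooth_on_generated[OF U(1) _ v _ that])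
  show "y t \<in> K \<and> (DERIV y t :> v t)" if "t \<in> U" for t using y that by blast
  show "(\<lambda>t. k\<^sup>2 / 2 * V1 (y t)) \<in> generated U K y v"
   by (rule generated.mult[OF generated.base[OF smooth_on_const] generated.comp[OF smooth_V1]])
 qed
 have sm: "smooth_on U v" by (rule gen[OF generated.velo])
 have sw: "smooth_on U (\<lambda>t. k * V (y t))"
  by (rule gen[OF generated.mult[OF generated.base[OF smooth_on_const] generated.comp[OF smooth_V]]])
 have c: "curve_on U ?u" "!!t. t \<in> U ==> velocity ?u t = vector [v t, k * V (y t)]"
  by (rule make_curve[OF U y sm sw x]; assumption)+
 have "cov_deriv g ?u (velocity ?u) t = 0" if "t \<in> {0..1}" for t
 proof -
  have t: "t \<in> U" using U that by auto
  have dV: "DERIV (\<lambda>t. k * V (y t)) t :> k * (V1 (y t) * v t)"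
   by (intro DERIV_cmult DERIV_chain2[OF V1[OF y(1)[OF t]] y(2)[OF t]])
  have fp: "f (y t) > 0" by (rule pos[OF y(1)[OF t]])
  have "(velocity ?u has_vector_derivative vector [k\<^sup>2 / 2 * V1 (y t), k * (V1 (y t) * v t)]) (at t)"
  proof (subst vderiv_cong(3)[OF U(1) t c(2)])
   show "((\<lambda>t. vector [v t, k * V (y t)] :: real ^ 2) has_vector_derivative vector [k\<^sup>2 / 2 * V1 (y t), k * (V1 (y t) * v t)]) (at t)"
   proof (rule has_vderiv_components)
    fix i :: 2
    show "((\<lambda>t. (vector [v t, k * V (y t)] :: real ^ 2) $ i) has_real_derivative
      (vector [k\<^sup>2 / 2 * V1 (y t), k * (V1 (y t) * v t)] :: real ^ 2) $ i) (at t)" using exhaust_2[of i] v[OF t] dV by auto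
   qed
  qed
  then have a: "vderiv (velocity ?u) t = vector [k\<^sup>2 / 2 * V1 (y t), k * (V1 (y t) * v t)]" by (rule vector_derivative_at)
  have K: "?u t $ 1 \<in> K" using y(1)[OF t] by simp
  show ?thesis unfolding vec_eq_iff forall_2 cov_deriv_static[of ?u t, OF K] a c(2)[OF t]
   using fp by (simp add: V_eq field_simps power2_eq_square power3_eq_cube)
 qed
 then show ?thesis using c(1) unfolding geodesic_on_def by blast
qed

text \<open>Geodesics with \<open>y' > 0\<close> that are not timelike satisfy \<open>y' = k s\<close> and \<open>x' = k n V\<close> with
 \<open>s\<^sup>2 = e + n\<^sup>2 V\<close>, where \<open>e\<close> is 1 in the spacelike and 0 in the lightlike case.\<close>

definition admissible :: "real => real => bool" where
 "admissible e n \<longleftrightarrow> e = 1 \<or> e = 0 \<and> \<bar>n\<bar> = 1"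

definition speed :: "real => real => real => real" where "speed e n y = sqrt (e + n\<^sup>2 * V y)"

lemma speed_pos:
 assumes "admissible e n" "y \<in> K"
 shows "speed e n y > 0" "e + n\<^sup>2 * V y > 0"
proof -
 have "n\<^sup>2 = 1" if "\<bar>n\<bar> = 1" using that by (metis one_power2 power2_abs)
 then show *: "e + n\<^sup>2 * V y > 0" using assms Vpos[OF assms(2)] unfolding admissible_def by (auto intro: add_pos_nonneg)
 then show "speed e n y > 0" unfolding speed_def by simp
qed

lemma speed_cont:
 assumes "admissible e n" "y \<in> K"
 shows "isCont (\<lambda>y. 1 / speed e n y) y" "isCont (\<lambda>y. n * V y / speed e n y) y"
proof -
 have "isCont V y" by (rule DERIV_isCont[OF V1[OF assms(2)]])
 then show "isCont (\<lambda>y. 1 / speed e n y) y" "isCont (\<lambda>y. n * V y / speed e n y) y"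
  using speed_pos[OF assms] unfolding speed_def by (auto intro!: continuous_intros)
qed

text \<open>In terms of the height, \<open>dt/dy = 1 / (k * speed)\<close> and
  \<open>dx/dy = n * V / speed\<close>: \<open>T_prim\<close> is the parameter up to the factor
  \<open>k\<close>, and \<open>X_prim\<close> is the displacement in \<open>x\<close>, which does
  not involve \<open>k\<close>.\<close>

definition T_prim :: "real => real => real => real" where "T_prim e n = prim (\<lambda>y. 1 / speed e n y)"

definition X_prim :: "real => real => real => real" where
 "X_prim e n = prim (\<lambda>y. n * V y / speed e n y)"

lemma TX_deriv:
 assumes "admissible e n" "y \<in> K"
 shows "DERIV (T_prim e n) y :> 1 / speed e n y" "DERIV (X_prim e n) y :> n * V y / speed e n y"
 unfolding T_prim_def X_prim_def using speed_cont[OF assms(1)] assms(2) by (auto intro: prim_deriv)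

lemma T_prim_less:
 assumes "admissible e n" "y \<in> K" "z \<in> K" "y < z"
 shows "T_prim e n y < T_prim e n z" unfolding T_prim_def by (rule prim_less) (use assms speed_cont speed_pos in auto)

lemma rising_form:
 assumes g: "geodesic_on U u" and v: "!!t. t \<in> {0..1} ==> velocity u t $ 1 > 0"
  and e: "e = 1 \<and> spacelike_curve g u \<or> e = 0 \<and> lightlike_curve g u"
 obtains n k where "admissible e n" "!!t. t \<in> {0..1} ==> T_prim e n (u t $ 1) = T_prim e n (u 0 $ 1) + k * t"
  "!!t. t \<in> {0..1} ==> u t $ 2 - u 0 $ 2 = X_prim e n (u t $ 1) - X_prim e n (u 0 $ 1)"
proof -
 have c: "curve_on U u" using g unfolding geodesic_on_def by blast
 define E where "E = metric_form g (u 0) (velocity u 0) (velocity u 0)"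
 define p where "p = (f (u 0 $ 1))\<^sup>2 * velocity u 0 $ 2"
 have v2: "velocity u t $ 2 = p * V (u t $ 1)" if "t \<in> {0..1}" for t
  using geodesic_momentum[OF g that, of 0] f_along(3)[OF c that] unfolding p_def V_eq by (simp add: field_simps power2_eq_square)
 have v1: "(velocity u t $ 1)\<^sup>2 = E + p\<^sup>2 * V (u t $ 1)" if "t \<in> {0..1}" for t
 proof -
  have "E = metric_form g (u t) (velocity u t) (velocity u t)" unfolding E_def by (rule geodesic_energy[OF g _ that]) simp
  then show ?thesis using f_along(3)[OF c that] v2[OF that] unfolding metric_form_static V_eq by (simp add: field_simps power2_eq_square)
 qed
 \<comment> \<open>Normalization: with \<open>E = k\<^sup>2 * e\<close> and \<open>p = k * n\<close>
   the path depends on \<open>e\<close> and \<open>n\<close> alone, while \<open>k\<close> is the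
   speed of traversal.\<close>
 obtain k n where k: "k > 0" "admissible e n" "E = k\<^sup>2 * e" "p = k * n"
 proof (cases "e = 1")
  case True
  then have "E > 0" using e unfolding spacelike_curve_def E_def by auto
  then show thesis using that[of "sqrt E" "p / sqrt E"] True unfolding admissible_def by simp
 next
  case False
  then have l: "e = 0" "E = 0" using e unfolding lightlike_curve_def E_def by auto
  have "p \<noteq> 0" using v1[of 0] v[of 0] l by auto
  then show thesis using that[of "\<bar>p\<bar>" "sgn p"] l unfolding admissible_def by (simp add: abs_sgn_eq abs_mult_sgn)
 qed
 have s: "velocity u t $ 1 = k * speed e n (u t $ 1)" if "t \<in> {0..1}" for t
 proof -
  have K: "u t $ 1 \<in> K" by (rule curve_deriv(1)[OF c that])
  have "(velocity u t $ 1)\<^sup>2 = (k * speed e n (u t $ 1))\<^sup>2"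
   using v1[OF that] speed_pos(2)[OF k(2) K] k(3,4) unfolding speed_def by (simp add: power_mult_distrib algebra_simps)
  then show ?thesis using v[OF that] k(1) speed_pos(1)[OF k(2) K] by (simp add: power2_eq_iff_nonneg less_imp_le)
 qed
 show thesis
 proof (rule that[OF k(2)])
  fix t :: real assume t: "t \<in> {0..1}"
  have "T_prim e n (u t $ 1) - k * t = T_prim e n (u 0 $ 1) - k * 0"
  proof (rule deriv_zero_const[OF _ t, where h = "\<lambda>t. T_prim e n (u t $ 1) - k * t"])
   fix t :: real assume t: "t \<in> {0..1}"
   have K: "u t $ 1 \<in> K" by (rule curve_deriv(1)[OF c t])
   show "DERIV (\<lambda>t. T_prim e n (u t $ 1) - k * t) t :> 0"
    by (rule DERIV_cong[OF DERIV_diff[OF DERIV_chain2[OF TX_deriv(1)[OF k(2) K] curve_deriv(2)[OF c t]] DERIV_cmult[OF DERIV_ident]]])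
     (use s[OF t] speed_pos(1)[OF k(2) K] in simp)
  qed simp
  then show "T_prim e n (u t $ 1) = T_prim e n (u 0 $ 1) + k * t" by simp
  have "u t $ 2 - X_prim e n (u t $ 1) = u 0 $ 2 - X_prim e n (u 0 $ 1)"
  proof (rule deriv_zero_const[OF _ t, where h = "\<lambda>t. u t $ 2 - X_prim e n (u t $ 1)"])
   fix t :: real assume t: "t \<in> {0..1}"
   have K: "u t $ 1 \<in> K" by (rule curve_deriv(1)[OF c t])
   show "DERIV (\<lambda>t. u t $ 2 - X_prim e n (u t $ 1)) t :> 0"
    by (rule DERIV_cong[OF DERIV_diff[OF curve_deriv(2)[OF c t, of 2] DERIV_chain2[OF TX_deriv(2)[OF k(2) K] curve_deriv(2)[OF c t]]]])
     (use s[OF t] v2[OF t] speed_pos(1)[OF k(2) K] k(4) in simp)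
  qed simp
  then show "u t $ 2 - u 0 $ 2 = X_prim e n (u t $ 1) - X_prim e n (u 0 $ 1)" by simp
 qed
qed

text \<open>For equal signs, clearing denominators and squaring reduces the claim to comparing
  \<open>n\<^sup>2 * (1 + k\<^sup>2 * V)\<close> with
  \<open>k\<^sup>2 * (1 + n\<^sup>2 * V)\<close>, that is, \<open>n\<^sup>2\<close> with
  \<open>k\<^sup>2\<close>. For \<open>e = 0\<close> only \<open>n = -1\<close> and
  \<open>k = 1\<close> occur.\<close>

lemma slope_less:
 assumes "admissible e n" "admissible e k" "n < k" "y \<in> K"
 shows "n * V y / speed e n y < k * V y / speed e k y"
proof -
 note s = speed_pos[OF assms(1,4)] speed_pos[OF assms(2,4)]
 have Vp: "V y > 0" by (rule Vpos[OF assms(4)])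
 have "n * speed e k y < k * speed e n y"
 proof (cases "e = 0")
  case True
  then have "n = -1" "k = 1" using assms(1-3) unfolding admissible_def by (auto simp: abs_if split: if_splits)
  then have "n * speed e k y < 0" "0 < k * speed e n y" using s by auto
  then show ?thesis by linarith
 next
  case False
  then have e: "e = 1" using assms(1) unfolding admissible_def by simp
  have sq: "speed e n y ^ 2 = 1 + n\<^sup>2 * V y" "speed e k y ^ 2 = 1 + k\<^sup>2 * V y" using s(2,4) unfolding speed_def e by simp_all
  consider "n < 0" "0 <= k" | "0 <= n" | "k < 0" using assms(3) by linarith
  then show ?thesis
  proof cases
   case 1
   have "n * speed e k y < 0" using 1 s by (simp add: mult_neg_pos)
   moreover have "0 <= k * speed e n y" using 1 s by simp
   ultimately show ?thesis by linarith
  next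
   case 2
   have "n\<^sup>2 < k\<^sup>2" using 2 assms(3) by (simp add: power_strict_mono)
   then have "(n * speed e k y)\<^sup>2 < (k * speed e n y)\<^sup>2" unfolding power_mult_distrib sq by (simp add: algebra_simps)
   then show ?thesis using 2 assms(3) s by (auto intro: power2_less_imp_less)
  next
   case 3
   have "(- k)\<^sup>2 < (- n)\<^sup>2" using 3 assms(3) by (intro power_strict_mono) auto
   then have "(- k * speed e n y)\<^sup>2 < (- n * speed e k y)\<^sup>2" unfolding power_mult_distrib sq by (simp add: algebra_simps)
   moreover have "0 <= - n * speed e k y" using 3 assms(3) s by (intro mult_nonneg_nonneg) auto
   ultimately have "- k * speed e n y < - n * speed e k y" by (rule power2_less_imp_less)
   then show ?thesis by simp
  qed
 qed
 then show ?thesis using s Vp by (simp add: field_simps)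
qed

lemma X_prim_strict:
 assumes "admissible e n" "admissible e k" "n < k" "y \<in> K" "z \<in> K" "y < z"
 shows "X_prim e n z - X_prim e n y < X_prim e k z - X_prim e k y"
proof -
 have "X_prim e k y - X_prim e n y < X_prim e k z - X_prim e n z"
 proof (rule DERIV_pos_imp_increasing[OF assms(6)])
  fix x assume "y <= x" "x <= z"
  then have x: "x \<in> K" using in_K[OF assms(4,5)] by simp
  show "\<exists>d. (DERIV (\<lambda>x. X_prim e k x - X_prim e n x) x :> d) \<and> 0 < d"
   using DERIV_diff[OF TX_deriv(2)[OF assms(2) x] TX_deriv(2)[OF assms(1) x]] slope_less[OF assms(1-3) x]
   by (intro exI[of _ "k * V x / speed e k x - n * V x / speed e n x"]) auto
 qed
 then show ?thesis by simp
qed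

text \<open>The displacement in \<open>x\<close> determines \<open>n\<close> by strict monotonicity,
  the total change of \<open>T_prim\<close> determines the speed, and the value of
  \<open>T_prim\<close> determines the height at each parameter.\<close>

lemma rising_unique:
 fixes e :: real
 assumes g: "geodesic_on U u" "geodesic_on U' d"
  and v: "!!t. t \<in> {0..1} ==> velocity u t $ 1 > 0" "!!t. t \<in> {0..1} ==> velocity d t $ 1 > 0"
  and e: "e = 1 \<and> spacelike_curve g u \<or> e = 0 \<and> lightlike_curve g u"
   "e = 1 \<and> spacelike_curve g d \<or> e = 0 \<and> lightlike_curve g d" and ends: "u 0 = d 0" "u 1 = d 1" and t: "t \<in> {0..1}"
 shows "u t = d t"
proof -
 have c: "curve_on U u" "curve_on U' d" using g unfolding geodesic_on_def by auto
 obtain n j where 1: "admissible e n" "!!t. t \<in> {0..1} ==> T_prim e n (u t $ 1) = T_prim e n (u 0 $ 1) + j * t"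
  "!!t. t \<in> {0..1} ==> u t $ 2 - u 0 $ 2 = X_prim e n (u t $ 1) - X_prim e n (u 0 $ 1)"
  by (rule rising_form[OF g(1) v(1) e(1)]) (assumption, rule that)
 obtain k k' where 2: "admissible e k" "!!t. t \<in> {0..1} ==> T_prim e k (d t $ 1) = T_prim e k (d 0 $ 1) + k' * t"
  "!!t. t \<in> {0..1} ==> d t $ 2 - d 0 $ 2 = X_prim e k (d t $ 1) - X_prim e k (d 0 $ 1)"
  by (rule rising_form[OF g(2) v(2) e(2)]) (assumption, rule that)
 have K: "u 0 $ 1 \<in> K" "u 1 $ 1 \<in> K" "u t $ 1 \<in> K" "d t $ 1 \<in> K" using curve_deriv(1)[OF c(1)] curve_deriv(1)[OF c(2)] t by auto
 have lt: "u 0 $ 1 < u 1 $ 1"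
  by (rule deriv_pos_less[where h = "\<lambda>t. u t $ 1" and h' = "\<lambda>t. velocity u t $ 1"]) (use v curve_deriv(2)[OF c(1)] in auto)
 have "n = k"
 proof (rule linorder_cases[of n k])
  assume "n < k"
  from X_prim_strict[OF 1(1) 2(1) this K(1,2) lt] show ?thesis using 1(3)[of 1] 2(3)[of 1] ends by simp
 next
  assume "k < n"
  from X_prim_strict[OF 2(1) 1(1) this K(1,2) lt] show ?thesis using 1(3)[of 1] 2(3)[of 1] ends by simp
 qed
 moreover from this have "j = k'" using 1(2)[of 1] 2(2)[of 1] ends by simp
 ultimately have "T_prim e n (u t $ 1) = T_prim e n (d t $ 1)" using 1(2)[OF t] 2(2)[OF t] ends by simp
 then have eq: "u t $ 1 = d t $ 1"
  using T_prim_less[OF 1(1) K(3,4)] T_prim_less[OF 1(1) K(4,3)] by (metis less_irrefl linorder_neqE_linordered_idom)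
 then have "u t $ 2 = d t $ 2" using 1(3)[OF t] 2(3)[OF t] ends \<open>n = k\<close> by simp
 then show ?thesis using eq by (simp add: vec_eq_iff forall_2)
qed

lemma rising_exists:
 assumes ad: "admissible e n" and y: "y0 \<in> K" "y1 \<in> K" "y0 < y1" and X: "x1 - x0 = X_prim e n y1 - X_prim e n y0"
 obtains U c where "geodesic_on U c" "c 0 = vector [y0, x0]" "c 1 = vector [y1, x1]"
  "!!t. t \<in> {0..1} ==> c t $ 2 \<in> {min x0 x1..max x0 x1}"
proof -
 obtain l where l: "l \<in> K" "l < y0" by (rule K_lt[OF y(1)])
 obtain u where u: "u \<in> K" "y1 < u" by (rule K_gt[OF y(2)])
 have lu: "z \<in> K" if "l < z" "z < u" for z using in_K[OF l(1) u(1)] that by simp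
 define k where "k = T_prim e n y1 - T_prim e n y0"
 obtain U yt where oU: "open U" and sub: "{0..1} \<subseteq> U" and lyu: "!!t. t \<in> U ==> l < yt t \<and> yt t < u"
  and dy: "!!t. t \<in> U ==> DERIV yt t :> k * speed e n (yt t)" and yends: "yt 0 = y0" "yt 1 = y1"
  unfolding k_def
 proof (rule unit_reparametrization[where G = "T_prim e n" and w = "speed e n"])
  show "DERIV (T_prim e n) x :> 1 / speed e n x" "0 < speed e n x" if "l < x" "x < u" for x
   using TX_deriv(1)[OF ad lu[OF that]] speed_pos(1)[OF ad lu[OF that]] by simp_all
  show "l < y0" "y0 < u" "l < y1" "y1 < u" using l u y by auto
 qed blast
 define xt where "xt t = x0 + (X_prim e n (yt t) - X_prim e n y0)" for t
 have yK: "yt t \<in> K" if "t \<in> U" for t using lyu[OF that] lu by simp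
 have dx: "DERIV xt t :> k * n * V (yt t)" if t: "t \<in> U" for t
 proof -
  have "DERIV (\<lambda>t. x0 + (X_prim e n (yt t) - X_prim e n y0)) t :> 0 + (n * V (yt t) / speed e n (yt t) * (k * speed e n (yt t)) - 0)"
   by (intro DERIV_add DERIV_diff DERIV_const DERIV_chain2[OF TX_deriv(2)[OF ad yK[OF t]] dy[OF t]])
  then show ?thesis unfolding xt_def using speed_pos(1)[OF ad yK[OF t]] by (simp add: mult_ac)
 qed
 have ends: "yt 0 = y0" "yt 1 = y1" "xt 0 = x0" "xt 1 = x1" unfolding xt_def yends using X by auto
 have G: "geodesic_on U (\<lambda>t. vector [yt t, xt t])"
 proof (rule make_geodesic[OF oU sub yK dy _ dx])
  fix t assume t: "t \<in> U"
  have "DERIV (\<lambda>t. sqrt (e + n\<^sup>2 * V (yt t))) t :> k * n\<^sup>2 * V1 (yt t) / 2"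
   by (rule DERIV_cong[OF DERIV_chain2[OF DERIV_real_sqrt[OF speed_pos(2)[OF ad yK[OF t]]]
      DERIV_add[OF DERIV_const DERIV_cmult[OF DERIV_chain2[OF V1[OF yK[OF t]] dy[OF t]]]]]])
    (use speed_pos[OF ad yK[OF t]] in \<open>simp add: speed_def field_simps\<close>)
  from DERIV_cmult[OF this, of k]
  show "DERIV (\<lambda>t. k * speed e n (yt t)) t :> (k * n)\<^sup>2 / 2 * V1 (yt t)"
   unfolding speed_def by (simp add: power2_eq_square mult_ac)
 qed auto
 show thesis
 proof (rule that[OF G])
  fix t :: real assume t: "t \<in> {0..1}"
  have "xt t \<in> {min (xt 0) (xt 1)..max (xt 0) (xt 1)}"
   by (rule between_ends[where w = "\<lambda>t. V (yt t)", OF dx _ t]) (use sub less_imp_le[OF Vpos[OF yK]] in auto)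
  then show "(vector [yt t, xt t] :: real ^ 2) $ 2 \<in> {min x0 x1..max x0 x1}" unfolding ends by simp
 qed (use ends in auto)
qed

end

lemma between_in_einterval:
 assumes "x0 \<in> einterval c d" "x1 \<in> einterval c d" "x \<in> {min x0 x1..max x0 x1}"
 shows "x \<in> einterval c d"
proof -
 have "min x0 x1 \<in> einterval c d" "max x0 x1 \<in> einterval c d" using assms by (auto simp: min_def max_def)
 then have "c < ereal (min x0 x1)" "ereal (max x0 x1) < d" by (simp_all add: einterval_iff)
 moreover have "ereal (min x0 x1) <= ereal x" "ereal x <= ereal (max x0 x1)"
  using assms(3) unfolding atLeastAtMost_iff ereal_less_eq(3) by blast+
 ultimately have "c < ereal x" "ereal x < d" by (blast intro: less_le_trans le_less_trans)+
 then show ?thesis by (simp add: einterval_iff)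
qed

context static_strip
begin

section \<open>Points of the strip joined by curves and by geodesics\<close>

lemma F_abs: "y0 \<in> K ==> y1 \<in> K ==> y0 <= y1 ==> \<bar>F y1 - F y0\<bar> = F y1 - F y0"
 using F_less[of y0 y1] by (cases "y0 = y1") auto

lemma joinsI:
 assumes c: "curve_on U u" and J: "u 0 $ 2 \<in> einterval c d" "u 1 $ 2 \<in> einterval c d"
  and b: "!!t. t \<in> {0..1} ==> u t $ 2 \<in> {min (u 0 $ 2) (u 1 $ 2)..max (u 0 $ 2) (u 1 $ 2)}"
 shows "joins (strip K (einterval c d)) u (u 0) (u 1)" unfolding joins_def smooth_on_unit_def
proof (intro conjI refl subsetI)
 show "\<exists>U. open U \<and> {0..1} \<subseteq> U \<and> smooth_on U u" using c unfolding curve_on_def by blast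
 fix q assume "q \<in> u ` {0..1}"
 then obtain t where t: "t \<in> {0..1}" "q = u t" by blast
 then show "q \<in> strip K (einterval c d)"
  unfolding strip_def using curve_deriv(1)[OF c t(1)] between_in_einterval[OF J b[OF t(1)]] by simp
qed

lemma straight_curve:
 assumes y: "y0 \<in> K" "y1 \<in> K"
 obtains U q where "curve_on U q" "q 0 = vector [y0, x0]" "q 1 = vector [y1, x1]"
  "!!t. t \<in> {0..1} ==> q t $ 2 \<in> {min x0 x1..max x0 x1}"
  "!!t. t \<in> {0..1} ==> velocity q t = vector [(F y1 - F y0) * f (q t $ 1), x1 - x0]"
proof -
 have mK: "min y0 y1 \<in> K" "max y0 y1 \<in> K" using y by (auto simp: min_def max_def)
 obtain l where l: "l \<in> K" "l < min y0 y1" by (rule K_lt[OF mK(1)])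
 obtain u where u: "u \<in> K" "max y0 y1 < u" by (rule K_gt[OF mK(2)])
 have lu: "z \<in> K" if "l < z" "z < u" for z using in_K[OF l(1) u(1)] that by simp
 define k where "k = F y1 - F y0"
 obtain U yt where oU: "open U" and sub: "{0..1} \<subseteq> U" and lyu: "!!t. t \<in> U ==> l < yt t \<and> yt t < u"
  and dy: "!!t. t \<in> U ==> DERIV yt t :> k * f (yt t)" and yends: "yt 0 = y0" "yt 1 = y1"
  unfolding k_def
 proof (rule unit_reparametrization[where G = F and w = f])
  show "DERIV F x :> 1 / f x" "0 < f x" if "l < x" "x < u" for x
   using F_deriv[OF lu[OF that]] pos[OF lu[OF that]] by simp_all
  show "l < y0" "y0 < u" "l < y1" "y1 < u" using l u by auto
 qed blast
 define xt where "xt t = x0 + (x1 - x0) * t" for t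
 have yK: "yt t \<in> K" if "t \<in> U" for t using lyu[OF that] lu by simp
 have dx: "DERIV xt t :> x1 - x0" for t unfolding xt_def by (auto intro!: derivative_eq_intros)
 have dv: "DERIV (\<lambda>t. k * f (yt t)) t :> k * (f1 (yt t) * (k * f (yt t)))" if "t \<in> U" for t
  by (intro DERIV_cmult DERIV_chain2[OF f_deriv[OF yK[OF that]] dy[OF that]])
 have "smooth_on U (\<lambda>t. k * f (yt t))"
 proof (rule smooth_on_generated[OF oU _ dv _ generated.velo])
  show "yt t \<in> K \<and> (DERIV yt t :> k * f (yt t))" if "t \<in> U" for t using yK dy that by blast
  show "(\<lambda>t. k * (f1 (yt t) * (k * f (yt t)))) \<in> generated U K yt (\<lambda>t. k * f (yt t))"
   by (rule generated.mult[OF generated.base[OF smooth_on_const] generated.mult[OF generated.comp[OF smooth_on_vderiv[OF smooth]] generated.velo]])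
 qed
 have c: "curve_on U (\<lambda>t. vector [yt t, xt t])"
  "!!t. t \<in> U ==> velocity (\<lambda>t. vector [yt t, xt t] :: real ^ 2) t = vector [k * f (yt t), x1 - x0]"
  by (rule make_curve[OF oU sub yK dy \<open>smooth_on U _\<close> smooth_on_const dx]; assumption)+
 have ends: "yt 0 = y0" "yt 1 = y1" "xt 0 = x0" "xt 1 = x1" unfolding xt_def yends by auto
 show thesis
 proof (rule that[OF c(1)])
  fix t :: real assume t: "t \<in> {0..1}"
  have xt: "xt t = (1 - t) * x0 + t * x1" unfolding xt_def by (simp add: algebra_simps)
  show "(vector [yt t, xt t] :: real ^ 2) $ 2 \<in> {min x0 x1..max x0 x1}" unfolding vector_2 xt by (rule convex_between[OF t])
  show "velocity (\<lambda>t. vector [yt t, xt t] :: real ^ 2) t = vector [(F y1 - F y0) * f ((vector [yt t, xt t] :: real ^ 2) $ 1), x1 - x0]"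
   using c(2)[of t] t sub unfolding k_def by auto
 qed (use ends in auto)
qed

lemma straight_joins:
 assumes p: "p \<in> strip K (einterval c d)" "q \<in> strip K (einterval c d)"
 obtains u where "joins (strip K (einterval c d)) u p q"
  "!!t. t \<in> {0..1} ==> velocity u t = vector [(F (q $ 1) - F (p $ 1)) * f (u t $ 1), q $ 2 - p $ 2]"
  "!!t. t \<in> {0..1} ==> metric_form g (u t) (velocity u t) (velocity u t)
    = (f (u t $ 1))\<^sup>2 * ((F (q $ 1) - F (p $ 1))\<^sup>2 - (q $ 2 - p $ 2)\<^sup>2) \<and> f (u t $ 1) > 0"
proof -
 have y: "p $ 1 \<in> K" "q $ 1 \<in> K" and x: "p $ 2 \<in> einterval c d" "q $ 2 \<in> einterval c d" using p unfolding strip_def by auto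
 obtain U u where u: "curve_on U u" "u 0 = vector [p $ 1, p $ 2]" "u 1 = vector [q $ 1, q $ 2]"
  "!!t. t \<in> {0..1} ==> u t $ 2 \<in> {min (p $ 2) (q $ 2)..max (p $ 2) (q $ 2)}"
  "!!t. t \<in> {0..1} ==> velocity u t = vector [(F (q $ 1) - F (p $ 1)) * f (u t $ 1), q $ 2 - p $ 2]"
  by (rule straight_curve[OF y]) (rule that)
 have pq: "u 0 = p" "u 1 = q" using u(2,3) by (simp_all add: vec_eq_iff forall_2)
 show thesis
 proof (rule that)
  show "joins (strip K (einterval c d)) u p q" using joinsI[OF u(1), of c d] u(4) x unfolding pq by blast
  fix t :: real assume t: "t \<in> {0..1}"
  show "velocity u t = vector [(F (q $ 1) - F (p $ 1)) * f (u t $ 1), q $ 2 - p $ 2]" by (rule u(5)[OF t])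
  show "metric_form g (u t) (velocity u t) (velocity u t)
    = (f (u t $ 1))\<^sup>2 * ((F (q $ 1) - F (p $ 1))\<^sup>2 - (q $ 2 - p $ 2)\<^sup>2) \<and> f (u t $ 1) > 0"
   unfolding metric_form_static u(5)[OF t] using f_along(3)[OF u(1) t] by (simp add: power_mult_distrib, simp add: algebra_simps)
 qed
qed

lemma related_iff:
 assumes pq: "p \<in> strip K (einterval c d)" "q \<in> strip K (einterval c d)"
 shows spacelike_iff: "spacelike_related g (strip K (einterval c d)) p q \<longleftrightarrow> \<bar>q $ 2 - p $ 2\<bar> < \<bar>F (q $ 1) - F (p $ 1)\<bar>"
  and timelike_iff: "timelike_related g (strip K (einterval c d)) p q \<longleftrightarrow> \<bar>F (q $ 1) - F (p $ 1)\<bar> < \<bar>q $ 2 - p $ 2\<bar>"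
  and lightlike_iff: "p \<noteq> q ==> lightlike_related g (strip K (einterval c d)) p q \<longleftrightarrow> \<bar>F (q $ 1) - F (p $ 1)\<bar> = \<bar>q $ 2 - p $ 2\<bar>"
proof -
 let ?M = "strip K (einterval c d)"
 obtain u where u: "joins ?M u p q"
  "!!t. t \<in> {0..1} ==> velocity u t = vector [(F (q $ 1) - F (p $ 1)) * f (u t $ 1), q $ 2 - p $ 2]"
  "!!t. t \<in> {0..1} ==> metric_form g (u t) (velocity u t) (velocity u t)
    = (f (u t $ 1))\<^sup>2 * ((F (q $ 1) - F (p $ 1))\<^sup>2 - (q $ 2 - p $ 2)\<^sup>2) \<and> f (u t $ 1) > 0"
  by (rule straight_joins[OF pq]) (rule that)
 have bounds: "spacelike_curve g e ==> \<bar>q $ 2 - p $ 2\<bar> < \<bar>F (q $ 1) - F (p $ 1)\<bar>"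
  "timelike_curve g e ==> \<bar>F (q $ 1) - F (p $ 1)\<bar> < \<bar>q $ 2 - p $ 2\<bar>"
  "lightlike_curve g e ==> \<bar>F (q $ 1) - F (p $ 1)\<bar> = \<bar>q $ 2 - p $ 2\<bar>" if j: "joins ?M e p q" for e
 proof -
  obtain U where "curve_on U e" by (rule joins_curve_on[OF j])
  note b = spacelike_bound(1)[OF this] timelike_bound[OF this] lightlike_bound(1)[OF this]
  have "e 0 = p" "e 1 = q" using j unfolding joins_def by auto
  with b show "spacelike_curve g e ==> \<bar>q $ 2 - p $ 2\<bar> < \<bar>F (q $ 1) - F (p $ 1)\<bar>"
   "timelike_curve g e ==> \<bar>F (q $ 1) - F (p $ 1)\<bar> < \<bar>q $ 2 - p $ 2\<bar>"
   "lightlike_curve g e ==> \<bar>F (q $ 1) - F (p $ 1)\<bar> = \<bar>q $ 2 - p $ 2\<bar>" by simp_all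
 qed
 have sq: "x\<^sup>2 < y\<^sup>2 \<longleftrightarrow> \<bar>x\<bar> < \<bar>y\<bar>" for x y :: real by (simp add: abs_le_square_iff[symmetric] not_le[symmetric])
 show "spacelike_related g ?M p q \<longleftrightarrow> \<bar>q $ 2 - p $ 2\<bar> < \<bar>F (q $ 1) - F (p $ 1)\<bar>"
 proof
  assume "\<bar>q $ 2 - p $ 2\<bar> < \<bar>F (q $ 1) - F (p $ 1)\<bar>"
  then have "spacelike_curve g u" unfolding sq[symmetric] spacelike_curve_def using u(3) by (metis diff_gt_0_iff_gt mult_pos_pos zero_less_power)
  then show "spacelike_related g ?M p q" using u(1) unfolding spacelike_related_def by blast
 qed (use bounds(1) in \<open>auto simp: spacelike_related_def\<close>)
 show "timelike_related g ?M p q \<longleftrightarrow> \<bar>F (q $ 1) - F (p $ 1)\<bar> < \<bar>q $ 2 - p $ 2\<bar>"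
 proof
  assume "\<bar>F (q $ 1) - F (p $ 1)\<bar> < \<bar>q $ 2 - p $ 2\<bar>"
  then have "timelike_curve g u" unfolding sq[symmetric] timelike_curve_def using u(3) by (metis diff_less_0_iff_less mult_pos_neg zero_less_power)
  then show "timelike_related g ?M p q" using u(1) unfolding timelike_related_def by blast
 qed (use bounds(2) in \<open>auto simp: timelike_related_def\<close>)
 assume ne: "p \<noteq> q"
 show "lightlike_related g ?M p q \<longleftrightarrow> \<bar>F (q $ 1) - F (p $ 1)\<bar> = \<bar>q $ 2 - p $ 2\<bar>"
 proof
  assume eq: "\<bar>F (q $ 1) - F (p $ 1)\<bar> = \<bar>q $ 2 - p $ 2\<bar>"
  have "q $ 2 - p $ 2 \<noteq> 0"
  proof
   assume 0: "q $ 2 - p $ 2 = 0"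
   have "p $ 1 = q $ 1" using F_less[of "p $ 1" "q $ 1"] F_less[of "q $ 1" "p $ 1"] pq eq 0 unfolding strip_def
    by (cases "p $ 1" "q $ 1" rule: linorder_cases) auto
   then show False using 0 ne by (simp add: vec_eq_iff forall_2)
  qed
  then have "velocity u t \<noteq> 0" if "t \<in> {0..1}" for t using u(2)[OF that] by (auto simp: vec_eq_iff forall_2)
  moreover have "(F (q $ 1) - F (p $ 1))\<^sup>2 = (q $ 2 - p $ 2)\<^sup>2" using eq by (metis power2_abs)
  ultimately have "lightlike_curve g u" unfolding lightlike_curve_def using u(3) by simp
  then show "lightlike_related g ?M p q" using u(1) unfolding lightlike_related_def by blast
 qed (use bounds(3) in \<open>auto simp: lightlike_related_def\<close>)
qed

lemma geodesic_type_of_ends: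
 assumes g: "geodesic_joins g (strip K J) u p q" and ne: "p \<noteq> q"
 shows "\<bar>q $ 2 - p $ 2\<bar> < \<bar>F (q $ 1) - F (p $ 1)\<bar> ==> spacelike_curve g u"
  and "\<bar>F (q $ 1) - F (p $ 1)\<bar> = \<bar>q $ 2 - p $ 2\<bar> ==> lightlike_curve g u"
  and "\<bar>F (q $ 1) - F (p $ 1)\<bar> < \<bar>q $ 2 - p $ 2\<bar> ==> timelike_curve g u"
proof -
 obtain U where U: "geodesic_on U u" by (rule geodesic_joins_on[OF g])
 then have c: "curve_on U u" unfolding geodesic_on_def by blast
 have pq: "u 0 = p" "u 1 = q" using g unfolding geodesic_joins_def joins_def by auto
 have types: "spacelike_curve g u \<or> lightlike_curve g u \<or> timelike_curve g u" by (rule geodesic_types[OF U]) (use pq ne in simp)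
 note b = spacelike_bound(1)[OF c] lightlike_bound(1)[OF c] timelike_bound[OF c]
 show "\<bar>q $ 2 - p $ 2\<bar> < \<bar>F (q $ 1) - F (p $ 1)\<bar> ==> spacelike_curve g u"
  "\<bar>F (q $ 1) - F (p $ 1)\<bar> = \<bar>q $ 2 - p $ 2\<bar> ==> lightlike_curve g u"
  "\<bar>F (q $ 1) - F (p $ 1)\<bar> < \<bar>q $ 2 - p $ 2\<bar> ==> timelike_curve g u" using types b unfolding pq by auto
qed

lemma unique_rising:
 assumes p: "p \<in> strip K (einterval c d)" "q \<in> strip K (einterval c d)" and ne: "p \<noteq> q" and le: "p $ 1 <= q $ 1"
  and ty: "e = 1 \<and> \<bar>q $ 2 - p $ 2\<bar> < \<bar>F (q $ 1) - F (p $ 1)\<bar> \<or> e = 0 \<and> \<bar>F (q $ 1) - F (p $ 1)\<bar> = \<bar>q $ 2 - p $ 2\<bar>"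
  and ad: "admissible e n" and X: "q $ 2 - p $ 2 = X_prim e n (q $ 1) - X_prim e n (p $ 1)"
 shows "unique_geodesic g (strip K (einterval c d)) p q"
  and "geodesic_joins g (strip K (einterval c d)) u p q ==> no_conjugate_points g u"
proof -
 let ?M = "strip K (einterval c d)"
 have y: "p $ 1 \<in> K" "q $ 1 \<in> K" and x: "p $ 2 \<in> einterval c d" "q $ 2 \<in> einterval c d" using p unfolding strip_def by auto
 have type: "e = 1 \<and> spacelike_curve g u \<or> e = 0 \<and> lightlike_curve g u" if "geodesic_joins g ?M u p q" for u
  using geodesic_type_of_ends(1,2)[OF that ne] ty by blast
 have rise: "velocity u t $ 1 > 0" if j: "geodesic_joins g ?M u p q" and c: "curve_on U u" and t: "t \<in> {0..1}" for u U t
 proof -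
  have "u 0 $ 1 <= u 1 $ 1" using j le unfolding geodesic_joins_def joins_def by auto
  then show ?thesis using type[OF j] spacelike_bound(2)[OF c _ _ t] lightlike_bound(2)[OF c _ _ t] by blast
 qed
 have lt: "p $ 1 < q $ 1"
 proof (rule ccontr)
  assume "\<not> ?thesis"
  then have eq: "p $ 1 = q $ 1" using le by simp
  then have "q $ 2 = p $ 2" using ty by auto
  then show False using ne eq by (simp add: vec_eq_iff forall_2)
 qed
 show "unique_geodesic g ?M p q" unfolding unique_geodesic_def
 proof (intro conjI allI impI ballI)
  obtain U u where u: "geodesic_on U u" "u 0 = vector [p $ 1, p $ 2]" "u 1 = vector [q $ 1, q $ 2]"
   "!!t. t \<in> {0..1} ==> u t $ 2 \<in> {min (p $ 2) (q $ 2)..max (p $ 2) (q $ 2)}"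
   by (rule rising_exists[OF ad y lt X]) (rule that)
  have pq: "u 0 = p" "u 1 = q" using u(2,3) by (simp_all add: vec_eq_iff forall_2)
  have "curve_on U u" using u(1) unfolding geodesic_on_def by blast
  from joinsI[OF this, of c d] have "joins ?M u p q" using u(4) x unfolding pq by blast
  then show "\<exists>u. geodesic_joins g ?M u p q" using u(1) unfolding geodesic_joins_def geodesic_on_def by blast
 next
  fix u w t assume h: "geodesic_joins g ?M u p q \<and> geodesic_joins g ?M w p q" and t: "t \<in> {0..1::real}"
  then have j: "geodesic_joins g ?M u p q" "geodesic_joins g ?M w p q" by auto
  obtain U where U: "geodesic_on U u" by (rule geodesic_joins_on[OF j(1)])
  obtain U' where U': "geodesic_on U' w" by (rule geodesic_joins_on[OF j(2)])
  have c: "curve_on U u" "curve_on U' w" using U U' unfolding geodesic_on_def by auto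
  show "u t = w t" by (rule rising_unique[OF U U' rise[OF j(1) c(1)] rise[OF j(2) c(2)] type[OF j(1)] type[OF j(2)] _ _ t])
    (use j in \<open>auto simp: geodesic_joins_def joins_def\<close>)
 qed
 assume j: "geodesic_joins g ?M u p q"
 obtain U where U: "geodesic_on U u" by (rule geodesic_joins_on[OF j])
 then have c: "curve_on U u" unfolding geodesic_on_def by blast
 show "no_conjugate_points g u" by (rule no_conjugate[OF U rise[OF j c]])
qed

lemma lightlike_parameter:
 assumes y: "y0 \<in> K" "y1 \<in> K" and n: "\<bar>n\<bar> = 1"
 shows "X_prim 0 n y1 - X_prim 0 n y0 = n * (F y1 - F y0)"
proof -
 have ad: "admissible 0 n" using n unfolding admissible_def by simp
 have ordered: "X_prim 0 n y1 - X_prim 0 n y0 = n * (F y1 - F y0)" if y: "y0 \<in> K" "y1 \<in> K" "y0 <= y1" for y0 y1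
 proof -
  have "n * V y / speed 0 n y = n * (1 / f y)" if "y \<in> K" for y
  proof -
   have "speed 0 n y = 1 / f y" unfolding speed_def inv_sq_def using pos[OF that] n by (simp add: real_sqrt_mult real_sqrt_divide)
   then show ?thesis unfolding inv_sq_def using pos[OF that] by (simp add: power2_eq_square)
  qed
  then have "integral {y0..y1} (\<lambda>y. n * V y / speed 0 n y) = integral {y0..y1} (\<lambda>y. n * (1 / f y))"
   using in_K[OF y(1,2)] by (intro integral_cong) auto
  also have "\<dots> = n * integral {y0..y1} (\<lambda>y. 1 / f y)" by (rule integral_mult_right)
  finally show ?thesis unfolding X_prim_def integral_F[OF y] using prim_diff_integral[OF speed_cont(2)[OF ad] y] by simp
 qed
 show ?thesis using ordered[OF y] ordered[OF y(2,1)] by (cases "y0 <= y1") (auto simp: algebra_simps)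
qed

text \<open>The displacement \<open>G n\<close> is continuous and odd in \<open>n\<close> and comes
  close to \<open>F y1 - F y0\<close> for large \<open>n\<close>, so the intermediate value theorem
  reaches every \<open>T\<close> that is smaller in absolute value.\<close>

lemma spacelike_parameter:
 assumes y: "y0 \<in> K" "y1 \<in> K" "y0 < y1" and T: "\<bar>T\<bar> < F y1 - F y0"
 obtains n where "T = X_prim 1 n y1 - X_prim 1 n y0"
proof -
 have ad: "admissible 1 n" for n unfolding admissible_def by simp
 define G where "G n = integral (cbox y0 y1) (\<lambda>y. n * V y / speed 1 n y)" for n
 have y': "y0 <= y1" using y by simp
 have inK: "x \<in> K" if "x \<in> {y0..y1}" for x using in_K[OF y(1,2)] that by auto
 have G: "G n = X_prim 1 n y1 - X_prim 1 n y0" for n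
  unfolding G_def X_prim_def using prim_diff_integral[OF speed_cont(2)[OF ad] y(1,2) y'] by simp
 have odd: "G (- n) = - G n" for n unfolding G_def speed_def by simp
 have cV: "continuous_on {y0..y1} V" by (rule continuous_on_subset[OF contV sub_K[OF y(1,2)]])
 \<comment> \<open>With \<open>r = 1 / f\<close>,
   \<open>sqrt (1 + N\<^sup>2 * r\<^sup>2) <= 1 + N * r\<close> shows that the integrand falls short
   of \<open>1 / f\<close> by at most \<open>1 / N\<close>; this \<open>N\<close> makes the total
   loss \<open>(y1 - y0) / N\<close> equal to the available
   \<open>F y1 - F y0 - \<bar>T\<bar>\<close>.\<close>
 define N where "N = (y1 - y0) / (F y1 - F y0 - \<bar>T\<bar>)"
 have N: "N > 0" unfolding N_def using y T by simp
 have lower: "F y1 - F y0 - (y1 - y0) / N <= G N"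
 proof -
  have pw: "1 / f x - 1 / N <= N * V x / speed 1 N x" if "x \<in> {y0..y1}" for x
  proof -
   define r where "r = 1 / f x"
   have r: "r > 0" "V x = r\<^sup>2" unfolding r_def inv_sq_def using pos[OF inK[OF that]] by (auto simp: power_divide)
   have Nr: "0 < 1 + N * r" using N r by (simp add: add_pos_pos)
   have "speed 1 N x <= 1 + N * r" unfolding speed_def r(2)
    by (rule real_le_lsqrt) (use N r in \<open>auto simp: power2_eq_square algebra_simps\<close>)
   then have "N * V x / (1 + N * r) <= N * V x / speed 1 N x"
    using speed_pos(1)[OF ad[of N] inK[OF that]] N r Nr by (intro divide_left_mono mult_pos_pos) auto
   moreover have "r - 1 / N <= N * V x / (1 + N * r)"
   proof -
    have "(r - 1 / N) * (1 + N * r) = N * V x - 1 / N" using N unfolding r(2) by (simp add: field_simps power2_eq_square)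
    then have "(r - 1 / N) * (1 + N * r) <= N * V x" using N by simp
    then show ?thesis using Nr by (simp add: pos_le_divide_eq)
   qed
   ultimately show ?thesis unfolding r_def by linarith
  qed
  have i1: "((\<lambda>y. 1 / f y) has_integral F y1 - F y0) {y0..y1}"
  proof (rule fundamental_theorem_of_calculus[OF y'])
   fix x assume "x \<in> {y0..y1}"
   then show "(F has_vector_derivative 1 / f x) (at x within {y0..y1})"
    using F_deriv[OF inK] by (auto simp: has_real_derivative_iff_has_vector_derivative[symmetric] intro: has_field_derivative_at_within)
  qed
  have "((\<lambda>y. 1 / f y - 1 / N) has_integral F y1 - F y0 - (y1 - y0) / N) {y0..y1}"
   using has_integral_diff[OF i1 has_integral_const_real[of "1 / N" y0 y1]] y' by simp
  moreover have "((\<lambda>x. N * V x / speed 1 N x) has_integral G N) {y0..y1}"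
  proof -
   have "continuous_on {y0..y1} (\<lambda>x. N * V x / speed 1 N x)"
    using speed_cont(2)[OF ad inK] by (intro continuous_at_imp_continuous_on) auto
   then show ?thesis unfolding G_def using integrable_continuous_real integrable_integral by fastforce
  qed
  ultimately show ?thesis by (rule has_integral_le) (rule pw)
 qed
 have "(y1 - y0) / N = F y1 - F y0 - \<bar>T\<bar>" unfolding N_def using y T by simp
 then have ge: "\<bar>T\<bar> <= G N" using lower by simp
 have "continuous_on {-N..N} G" unfolding G_def
 proof (rule integral_continuous_on_param)
  have c: "continuous_on ({-N..N} \<times> cbox y0 y1) (\<lambda>z. V (snd z))"
   by (rule continuous_on_compose2[OF cV continuous_on_snd[OF continuous_on_id]]) auto
  have nz: "sqrt (1 + (fst z)\<^sup>2 * V (snd z)) \<noteq> 0" if "z \<in> {-N..N} \<times> cbox y0 y1" for z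
   using speed_pos(1)[OF ad[of "fst z"] inK[of "snd z"]] that unfolding speed_def by auto
  have "continuous_on ({-N..N} \<times> cbox y0 y1) (\<lambda>z. fst z * V (snd z) / sqrt (1 + (fst z)\<^sup>2 * V (snd z)))"
   using nz by (intro continuous_intros c) auto
  then show "continuous_on ({-N..N} \<times> cbox y0 y1) (\<lambda>(n, y). n * V y / speed 1 n y)"
   unfolding speed_def by (simp add: case_prod_beta)
 qed
 moreover have "G (- N) <= T" "T <= G N" "- N <= N" using ge odd[of N] N by auto
 ultimately obtain n where "G n = T" using IVT'[of G "-N" T N] by blast
 then show thesis using that[of n] G[of n] by simp
qed

end

lemma open_margin:
 assumes "open W" "{p..r} \<subseteq> W" "p <= (r :: real)"
 obtains l u where "l < p" "r < u" "{l<..<u} \<subseteq> W"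
proof -
 have W: "p \<in> W" "r \<in> W" using assms(2,3) by auto
 obtain e where e: "e > 0" "ball p e \<subseteq> W" by (rule openE[OF assms(1) W(1)])
 obtain e' where e': "e' > 0" "ball r e' \<subseteq> W" by (rule openE[OF assms(1) W(2)])
 have "{p - e<..<r + e'} \<subseteq> W"
 proof
  fix x assume x: "x \<in> {p - e<..<r + e'}"
  consider "x < p" | "x \<in> {p..r}" | "r < x" by force
  then show "x \<in> W" using x e e' assms(2) by cases (auto simp: dist_real_def subset_iff)
 qed
 then show thesis using that[of "p - e" "r + e'"] e e' by simp
qed

context static_strip
begin

subsection \<open>Timelike geodesics as graphs over \<open>x\<close>\<close>

lemma hint_zero_iff:
 assumes y: "y0 \<in> K" "y1 \<in> K" and X: "0 < X"
 shows "I 0 y0 y1 < ereal X \<and> I 0 y1 y0 < ereal X \<longleftrightarrow> \<bar>F y1 - F y0\<bar> < X"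
proof -
 have H: "I 0 u v = ereal (F v - F u)" if uv: "u \<in> K" "v \<in> K" "u <= v" for u v
 proof -
  have K: "x \<in> K" if "x \<in> {u..v}" for x using in_K[OF uv(1,2)] that by simp
  have "integral {u..v} (helem f 0) = integral {u..v} (\<lambda>y. 1 / f y)"
  proof (rule integral_cong)
   fix x assume "x \<in> {u..v}"
   from pos[OF K[OF this]] show "helem f 0 x = 1 / f x" unfolding helem_def inv_sq_def by (simp add: real_sqrt_divide power2_eq_square)
  qed
  then show ?thesis using hint_real(1)[OF uv(3) sub_K[OF uv(1,2)], of 0] Vpos K integral_F[OF uv] by auto
 qed
 show ?thesis
 proof (cases "y0 <= y1")
  case True
  then show ?thesis using H[OF y True] F_abs[OF y True] X by (simp add: hint_empty)
 next
  case False
  then have le: "y1 <= y0" by simp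
  then show ?thesis using H[OF y(2,1) le] F_abs[OF y(2,1) le] X by (simp add: hint_empty abs_minus_commute)
 qed
qed

text \<open>On a timelike curve \<open>x\<close> never stops, so up to the sign \<open>j\<close> it
  serves as parameter. With \<open>k\<close> the constant momentum, the \<open>y\<close>-velocity
  divided by \<open>k\<close> is \<open>V * dy/dx\<close>, the \<open>p\<close> of the first order
  system.\<close>

lemma geodesic_imp_connects:
 assumes g: "geodesic_on U c'" and tl: "timelike_curve g c'"
 shows "connects (c' 0 $ 1) (c' 1 $ 1) \<bar>c' 1 $ 2 - c' 0 $ 2\<bar>"
proof -
 have c: "curve_on U c'" using g unfolding geodesic_on_def by blast
 have v2: "velocity c' t $ 2 \<noteq> 0" if "t \<in> {0..1}" for t using tl that unfolding timelike_curve_def metric_form_static by force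
 obtain j where j: "\<bar>j\<bar> = 1" "!!t. t \<in> {0..1} ==> 0 < j * velocity c' t $ 2"
  by (rule nonvanishing_sign[OF curve_velocity_cont[OF c] v2]) (auto intro: that)
 have oU: "open U" "{0..1} \<subseteq> U" and sm: "smooth_on U c'" using c unfolding curve_on_def by auto
 have cd: "DERIV (\<lambda>t. c' t $ i) t :> velocity c' t $ i"
  "DERIV (\<lambda>t. velocity c' t $ i) t :> vderiv (velocity c') t $ i" if "t \<in> U" for t i
  unfolding velocity_eq by (rule component_deriv[OF sm that] component_deriv[OF smooth_on_vderiv[OF sm] that])+
 have "continuous_on U (\<lambda>t. j * velocity c' t $ 2)"
  by (intro continuous_on_mult_left continuous_at_imp_continuous_on ballI DERIV_isCont[OF cd(2)])
 then have "open (U \<inter> (\<lambda>t. j * velocity c' t $ 2) -` {0<..})" by (rule continuous_open_preimage) (auto simp: oU)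
 moreover have "{0..1} \<subseteq> U \<inter> (\<lambda>t. j * velocity c' t $ 2) -` {0<..}" using oU j(2) by auto
 ultimately obtain l u where lu: "l < 0" "1 < u" "{l<..<u} \<subseteq> U \<inter> (\<lambda>t. j * velocity c' t $ 2) -` {0<..}"
  by (rule open_margin) (auto intro: that)
 have in_lu: "t \<in> U" "0 < j * velocity c' t $ 2" if "l < t" "t < u" for t using lu(3) that by auto
 define X where "X t = j * (c' t $ 2 - c' 0 $ 2)" for t
 have dX: "DERIV X t :> j * velocity c' t $ 2" if "l < t" "t < u" for t
  unfolding X_def by (rule DERIV_cong[OF DERIV_cmult[OF DERIV_diff[OF cd(1)[OF in_lu(1)[OF that]] DERIV_const]]]) simp
 obtain h s t where h: "s < X 0" "X 1 < t"
  "!!r. s < r ==> r < t ==> l < h r \<and> h r < u \<and> X (h r) = r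
      \<and> (DERIV h r :> inverse (j * velocity c' (h r) $ 2))"
  "!!x. l < x ==> x < u ==> h (X x) = x"
 proof (rule real_inverse_function[where g = X and g' = "\<lambda>t. j * velocity c' t $ 2"])
  show "l < 0" "0 <= (1::real)" "1 < u" using lu by auto
 qed (use dX in_lu in \<open>auto intro: that\<close>)
 have X01: "X 0 = 0" "0 < X 1"
 proof -
  show "X 0 = 0" unfolding X_def by simp
  have "X 0 < X 1" by (rule deriv_pos_less[where h = X and h' = "\<lambda>t. j * velocity c' t $ 2"]) (use dX j(2) lu in auto)
  then show "0 < X 1" using \<open>X 0 = 0\<close> by simp
 qed
 have "\<bar>X 1\<bar> = \<bar>c' 1 $ 2 - c' 0 $ 2\<bar>" unfolding X_def using j(1) by (simp add: abs_mult)
 then have T: "X 1 = \<bar>c' 1 $ 2 - c' 0 $ 2\<bar>" using X01 by simp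
 have h01: "h 0 = 0" "h (X 1) = 1" using h(4)[of 0] h(4)[of 1] lu X01 by auto
 have hmono: "h q <= h r" if "0 <= q" "q <= r" "r <= X 1" for q r
 proof (rule DERIV_nonneg_imp_nondecreasing[OF that(2)])
  fix z assume "q <= z" "z <= r"
  then have z: "s < z" "z < t" using that h(1,2) X01 by auto
  show "\<exists>d. (DERIV h z :> d) \<and> 0 <= d"
   using h(3)[OF z] in_lu(2)[of "h z"] positive_imp_inverse_positive[OF in_lu(2)[of "h z"]]
   by (intro exI[of _ "inverse (j * velocity c' (h z) $ 2)"] conjI) (auto intro: less_imp_le simp del: inverse_mult_distrib)
 qed
 have hr: "h r \<in> {0..1}" "s < r" "r < t" if "r \<in> {0..X 1}" for r using hmono[of 0 r] hmono[of r "X 1"] h01 h(1,2) X01 that by auto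
 define k where "k = (f (c' 0 $ 1))\<^sup>2 * (j * velocity c' 0 $ 2)"
 have k: "k = (f (c' t $ 1))\<^sup>2 * (j * velocity c' t $ 2)" if "t \<in> {0..1}" for t
  using geodesic_momentum[OF g that, of 0] unfolding k_def by (simp add: mult_ac)
 have k0: "k > 0" unfolding k_def using j(2)[of 0] f_along(3)[OF c, of 0] by simp
 have "sol (\<lambda>r. c' (h r) $ 1) (\<lambda>r. velocity c' (h r) $ 1 / k) (X 1)" unfolding sol_def
 proof (intro ballI conjI)
  fix r assume r: "r \<in> {0..X 1}"
  note hr = hr[OF r]
  have dh: "DERIV h r :> inverse (j * velocity c' (h r) $ 2)" using h(3)[OF hr(2,3)] by blast
  have fp: "f (c' (h r) $ 1) > 0" by (rule f_along(3)[OF c hr(1)])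
  note kr = k[OF hr(1)] and vr = j(2)[OF hr(1)]
  show "c' (h r) $ 1 \<in> K" by (rule curve_deriv(1)[OF c hr(1)])
  have "DERIV (\<lambda>r. c' (h r) $ 1) r :> velocity c' (h r) $ 1 * inverse (j * velocity c' (h r) $ 2)"
   by (rule DERIV_chain2[OF curve_deriv(2)[OF c hr(1)] dh])
  moreover have "velocity c' (h r) $ 1 * inverse (j * velocity c' (h r) $ 2) = velocity c' (h r) $ 1 / k / V (c' (h r) $ 1)"
   unfolding kr V_eq using fp vr by (simp add: field_simps power2_eq_square)
  ultimately show "((\<lambda>r. c' (h r) $ 1) has_real_derivative velocity c' (h r) $ 1 / k / V (c' (h r) $ 1)) (at r within {0..X 1})"
   by (auto intro: has_field_derivative_at_within)
  let ?a = "- (f (c' (h r) $ 1) * f1 (c' (h r) $ 1) * (velocity c' (h r) $ 2)\<^sup>2)"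
  have "DERIV (\<lambda>r. velocity c' (h r) $ 1 / k) r :> ?a * inverse (j * velocity c' (h r) $ 2) / k"
   by (rule DERIV_cdivide[OF DERIV_chain2[OF geodesic_acceleration(1)[OF g hr(1)] dh]])
  moreover have "?a * inverse (j * velocity c' (h r) $ 2) / k = V1 (c' (h r) $ 1) / (2 * V (c' (h r) $ 1))"
  proof -
   define w where "w = j * velocity c' (h r) $ 2"
   have "j\<^sup>2 = 1" using j(1) by (metis one_power2 power2_abs)
   then have w: "(velocity c' (h r) $ 2)\<^sup>2 = w\<^sup>2" "w > 0" using vr unfolding w_def by (simp_all add: power_mult_distrib)
   show ?thesis unfolding kr V_eq w_def[symmetric] w(1) using fp w(2) by (simp add: field_simps power2_eq_square power3_eq_cube)
  qed
  ultimately show "((\<lambda>r. velocity c' (h r) $ 1 / k) has_real_derivative V1 (c' (h r) $ 1) / (2 * V (c' (h r) $ 1))) (at r within {0..X 1})"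
   by (auto intro: has_field_derivative_at_within)
 qed
 then show ?thesis unfolding connects_def T[symmetric]
  by (intro exI[of _ "\<lambda>r. c' (h r) $ 1"] exI[of _ "\<lambda>r. velocity c' (h r) $ 1 / k"]) (simp add: h01)
qed

text \<open>A trajectory is given on \<open>[0, d]\<close> only; the clamped flow continues it a
  little beyond both ends, as smoothness on a neighbourhood requires. The affine parameter is
  recovered by solving \<open>S' = k * V (Y S)\<close>, because along a geodesic \<open>x'\<close>
  is the momentum times \<open>V\<close>.\<close>

lemma connects_imp_geodesic:
 assumes conn: "connects y0 y1 d" and d: "0 < d" and j: "\<bar>j\<bar> = 1" and x: "x1 - x0 = j * d"
 obtains U u where "geodesic_on U u" "u 0 = vector [y0, x0]" "u 1 = vector [y1, x1]"
  "!!t. t \<in> {0..1} ==> u t $ 2 \<in> {min x0 x1..max x0 x1}"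
proof -
 obtain y p where s: "sol y p d" "y 0 = y0" "y d = y1" using conn unfolding connects_def by blast
 obtain l0 r0 where lr0: "l0 \<in> K" "r0 \<in> K" "!!x. x \<in> {0..d} ==> l0 <= y x \<and> y x <= r0"
  by (rule sol_range[OF s(1) less_imp_le[OF d]]) (rule that)
 obtain l where l: "l \<in> K" "l < l0" by (rule K_lt[OF lr0(1)])
 obtain r where r: "r \<in> K" "r0 < r" by (rule K_gt[OF lr0(2)])
 have yr: "l < y x \<and> y x < r" if "x \<in> {0..d}" for x using lr0(3)[OF that] l r by linarith
 have lr: "l <= r" using yr[of 0] d by auto
 have X: "0 < d + 1" using d by simp
 obtain YY PP :: "real => real => real" where flow:
  "!!q. \<bar>q\<bar> <= \<bar>p 0\<bar> ==> YY q 0 = y0 \<and> PP q 0 = q"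
  "!!q x. \<bar>q\<bar> <= \<bar>p 0\<bar> ==> x \<in> {- (d + 1)<..<d + 1} ==>
    (DERIV (YY q) x :> PP q x / V (clampI l r (YY q x)))
   \<and> (DERIV (PP q) x :> V1 (clampI l r (YY q x)) / (2 * V (clampI l r (YY q x))))"
  "!!q T. \<bar>q\<bar> <= \<bar>p 0\<bar> ==> T < d + 1 ==> csol l r (YY q) (PP q) T"
  by (rule flow_exists[OF l(1) r(1) lr abs_ge_zero X]) (rule that)
 define Y where "Y = YY (p 0)"
 define P where "P = PP (p 0)"
 have i: "Y 0 = y0" "P 0 = p 0" using flow(1)[of "p 0"] unfolding Y_def P_def by auto
 have cs: "csol l r y p d" by (rule sol_csol[OF s(1)]) (use yr in \<open>auto intro: less_imp_le\<close>)
 have cY: "csol l r Y P d" unfolding Y_def P_def by (rule flow(3)) simp_all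
 have Yy: "Y x = y x" if "x \<in> {0..d}" for x using csol_unique[OF l(1) r(1) lr cY cs _ _ that] i s by simp
 have dY: "DERIV Y x :> P x / V (clampI l r (Y x))"
  "DERIV P x :> V1 (clampI l r (Y x)) / (2 * V (clampI l r (Y x)))" if "x \<in> {- (d + 1)<..<d + 1}" for x
  using flow(2)[OF order_refl that] unfolding Y_def P_def by auto
 have "continuous_on {- (d + 1)<..<d + 1} Y" by (intro continuous_at_imp_continuous_on ballI DERIV_isCont[OF dY(1)])
 then have "open ({- (d + 1)<..<d + 1} \<inter> Y -` {l<..<r})" by (rule continuous_open_preimage) auto
 moreover have "{0..d} \<subseteq> {- (d + 1)<..<d + 1} \<inter> Y -` {l<..<r}" using Yy yr d by auto
 ultimately obtain c v where ab: "c < 0" "d < v" "{c<..<v} \<subseteq> {- (d + 1)<..<d + 1} \<inter> Y -` {l<..<r}"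
  by (rule open_margin) (use d in \<open>auto intro: that\<close>)
 have Y': "Y x \<in> K" "DERIV Y x :> P x / V (Y x)" "DERIV P x :> V1 (Y x) / (2 * V (Y x))"
  if x: "c < x" "x < v" for x
 proof -
  have m: "x \<in> {- (d + 1)<..<d + 1}" "l < Y x" "Y x < r" using ab(3) x by auto
  then have cl: "clampI l r (Y x) = Y x" by simp
  show "Y x \<in> K" using in_K[OF l(1) r(1)] m by simp
  show "DERIV Y x :> P x / V (Y x)" "DERIV P x :> V1 (Y x) / (2 * V (Y x))"
   using dY[OF m(1)] unfolding cl by auto
 qed
 have "\<exists>T. \<forall>x. ereal c < ereal x --> ereal x < ereal v --> (T has_vector_derivative 1 / V (Y x)) (at x)"
 proof (rule einterval_antiderivative)
  show "ereal c < ereal v" using ab d by simp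
  fix x assume "ereal c < ereal x" "ereal x < ereal v"
  then have x: "c < x" "x < v" by auto
  have "isCont (\<lambda>x. V (Y x)) x" by (rule DERIV_isCont[OF DERIV_chain2[OF V1[OF Y'(1)[OF x]] Y'(2)[OF x]]])
  then show "isCont (\<lambda>x. 1 / V (Y x)) x" using Vpos[OF Y'(1)[OF x]] by (intro continuous_intros) auto
 qed
 then obtain T where dT: "!!x. c < x ==> x < v ==> DERIV T x :> 1 / V (Y x)"
  by (auto simp: has_real_derivative_iff_has_vector_derivative)
 define k where "k = T d - T 0"
 obtain U S where oU: "open U" and sub: "{0..1} \<subseteq> U" and Sr': "!!t. t \<in> U ==> c < S t \<and> S t < v"
  and dS: "!!t. t \<in> U ==> DERIV S t :> k * V (Y (S t))" and ends: "S 0 = 0" "S 1 = d"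
  unfolding k_def
 proof (rule unit_reparametrization[where G = T and w = "\<lambda>x. V (Y x)"])
  show "c < 0" "0 < v" "c < d" "d < v" using ab d by auto
 qed (use dT Vpos[OF Y'(1)] in \<open>auto intro: that[unfolded k_def]\<close>)
 have Sr: "c < S t" "S t < v" if "t \<in> U" for t using Sr'[OF that] by auto
 have YK: "Y (S t) \<in> K" if "t \<in> U" for t by (rule Y'(1)[OF Sr[OF that]])
 have Vnz: "V (Y (S t)) > 0" if "t \<in> U" for t by (rule Vpos[OF YK[OF that]])
 have s2: "j\<^sup>2 = 1" using j by (metis one_power2 power2_abs)
 have G: "geodesic_on U (\<lambda>t. vector [Y (S t), x0 + j * S t])"
 proof (rule make_geodesic[OF oU sub YK])
  fix t assume t: "t \<in> U"
  note nz = Vnz[OF t]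
  show "DERIV (\<lambda>t. Y (S t)) t :> k * P (S t)"
   by (rule DERIV_cong[OF DERIV_chain2[OF Y'(2)[OF Sr[OF t]] dS[OF t]]]) (use nz in simp)
  show "DERIV (\<lambda>t. k * P (S t)) t :> (j * k)\<^sup>2 / 2 * V1 (Y (S t))"
   by (rule DERIV_cong[OF DERIV_cmult[OF DERIV_chain2[OF Y'(3)[OF Sr[OF t]] dS[OF t]]]])
    (use nz s2 in \<open>simp add: power_mult_distrib power2_eq_square\<close>)
  show "DERIV (\<lambda>t. x0 + j * S t) t :> (j * k) * V (Y (S t))"
   by (rule DERIV_cong[OF DERIV_add[OF DERIV_const DERIV_cmult[OF dS[OF t]]]]) simp
 qed auto
 show thesis
 proof (rule that[OF G])
  show "vector [Y (S 0), x0 + j * S 0] = (vector [y0, x0] :: real ^ 2)" using ends i by simp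
  show "vector [Y (S 1), x0 + j * S 1] = (vector [y1, x1] :: real ^ 2)" using ends Yy[of d] s d x by (simp add: algebra_simps)
  fix t :: real assume t: "t \<in> {0..1}"
  have "S t \<in> {min (S 0) (S 1)..max (S 0) (S 1)}"
   by (rule between_ends[where w = "\<lambda>t. V (Y (S t))", OF dS _ t]) (use sub less_imp_le[OF Vnz] in auto)
  moreover have "j = 1 \<or> j = -1" using j by linarith
  ultimately have "x0 + j * S t \<in> {min x0 x1..max x0 x1}" using x ends d by auto
  then show "(vector [Y (S t), x0 + j * S t] :: real ^ 2) $ 2 \<in> {min x0 x1..max x0 x1}" by simp
 qed
qed

lemma interval_length:
 assumes "x0 \<in> einterval c d" "x1 \<in> einterval c d"
 shows "ereal \<bar>x1 - x0\<bar> < d - c" using assms by (cases c; cases d) (auto simp: einterval_iff abs_if)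

lemma interval_pair:
 assumes "c < d" "0 < X" "ereal X < d - c"
 obtains x0 where "x0 \<in> einterval c d" "x0 + X \<in> einterval c d"
proof (cases c)
 case (real c')
 show thesis
 proof (cases d)
  case (real d')
  then show thesis using that[of "c' + (d' - c' - X) / 2"] assms \<open>c = ereal c'\<close> by (auto simp: einterval_iff field_simps)
 next
  case PInf
  then show thesis using that[of "c' + 1"] assms \<open>c = ereal c'\<close> by (auto simp: einterval_iff)
 qed (use assms in auto)
next
 case MInf
 show thesis
 proof (cases d)
  case (real d')
  then show thesis using that[of "d' - X - 1"] assms MInf by (auto simp: einterval_iff)
 next
  case PInf
  then show thesis using that[of 0] MInf by (auto simp: einterval_iff)
 qed (use assms in auto)
qed (use assms in auto)

text \<open>\<open>d - c\<close> is the length of \<open>J\<close> in the extended reals. The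
  positive distances in \<open>x\<close> between points of the strip are exactly those less than
  \<open>d - c\<close>, so pairs of points and triples \<open>y0\<close>, \<open>y1\<close>,
  \<open>X\<close> correspond.\<close>

lemma all_timelike_connected_iff:
 assumes cd: "c < d"
 shows "(\<forall>u\<in>strip K (einterval c d). \<forall>v\<in>strip K (einterval c d).
   timelike_related g (strip K (einterval c d)) u v --> (\<exists>w. geodesic_joins g (strip K (einterval c d)) w u v))
  \<longleftrightarrow> condition_C a b f (d - c) \<or> condition_R a b f (d - c)" (is "?L \<longleftrightarrow> _")
proof -
 let ?M = "strip K (einterval c d)"
 have L0: "0 < d - c" using cd by (cases c; cases d) auto
 show ?thesis unfolding all_connected_iff[OF L0, symmetric]
 proof (intro iffI ballI allI impI)
  fix y0 y1 X assume h: ?L and y: "y0 \<in> K" "y1 \<in> K" and X: "0 < X" "ereal X < d - c"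
   and H: "I 0 y0 y1 < ereal X" "I 0 y1 y0 < ereal X"
  obtain x0 where x0: "x0 \<in> einterval c d" "x0 + X \<in> einterval c d" by (rule interval_pair[OF cd X])
  define u v :: "real ^ 2" where "u = vector [y0, x0]" and "v = vector [y1, x0 + X]"
  have uv: "u \<in> ?M" "v \<in> ?M" unfolding u_def v_def strip_def using y x0 by auto
  have lt: "\<bar>F (v $ 1) - F (u $ 1)\<bar> < \<bar>v $ 2 - u $ 2\<bar>"
   using hint_zero_iff[OF y X(1)] H X(1) unfolding u_def v_def by simp
  then obtain w where w: "geodesic_joins g ?M w u v" using h uv timelike_iff[OF uv] by blast
  have "u \<noteq> v" using lt by auto
  then have tl: "timelike_curve g w" using geodesic_type_of_ends(3)[OF w _ lt] by simp
  obtain U where "geodesic_on U w" by (rule geodesic_joins_on[OF w])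
  from geodesic_imp_connects[OF this tl] show "connects y0 y1 X" using w X(1) unfolding geodesic_joins_def joins_def u_def v_def by simp
 next
  fix u v assume conn: "\<forall>y0\<in>K. \<forall>y1\<in>K. \<forall>X>0. ereal X < d - c --> I 0 y0 y1 < ereal X -->
    I 0 y1 y0 < ereal X --> connects y0 y1 X" and uv: "u \<in> ?M" "v \<in> ?M" and tl: "timelike_related g ?M u v"
  have lt: "\<bar>F (v $ 1) - F (u $ 1)\<bar> < \<bar>v $ 2 - u $ 2\<bar>" using tl timelike_iff[OF uv] by simp
  have y: "u $ 1 \<in> K" "v $ 1 \<in> K" and x: "u $ 2 \<in> einterval c d" "v $ 2 \<in> einterval c d" using uv unfolding strip_def by auto
  have X: "0 < \<bar>v $ 2 - u $ 2\<bar>" using lt by linarith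
  have cn: "connects (u $ 1) (v $ 1) \<bar>v $ 2 - u $ 2\<bar>" using conn y X interval_length[OF x] hint_zero_iff[OF y X] lt by blast
  have sg: "\<bar>sgn (v $ 2 - u $ 2)\<bar> = 1" "v $ 2 - u $ 2 = sgn (v $ 2 - u $ 2) * \<bar>v $ 2 - u $ 2\<bar>"
   using X by (auto simp: sgn_if)
  obtain U w where w: "geodesic_on U w" "w 0 = vector [u $ 1, u $ 2]" "w 1 = vector [v $ 1, v $ 2]"
   "!!t. t \<in> {0..1} ==> w t $ 2 \<in> {min (u $ 2) (v $ 2)..max (u $ 2) (v $ 2)}"
   by (rule connects_imp_geodesic[OF cn X sg]) (rule that)
  have pq: "w 0 = u" "w 1 = v" using w(2,3) by (simp_all add: vec_eq_iff forall_2)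
  have "curve_on U w" using w(1) unfolding geodesic_on_def by blast
  from joinsI[OF this, of c d] have "joins ?M w u v" using w(4) x unfolding pq by blast
  then show "\<exists>w. geodesic_joins g ?M w u v" using w(1) unfolding geodesic_joins_def geodesic_on_def by blast
 qed
qed

end

theorem corollary5:
  fixes a b c d :: ereal and f :: "real \<Rightarrow> real" and K J :: "real set" and y0 x0 y0' x0' :: real
  assumes "a < b" and "K = einterval a b" and "c < d" and "J = einterval c d" and "smooth_on K f" and "\<forall>y\<in>K. f y > 0"
    and "y0 \<in> K" and "x0 \<in> J" and "y0' \<in> K" and "x0' \<in> J" and "(y0, x0) \<noteq> (y0', x0')" and "y0 \<le> y0'"
  shows "(let g = static_metric f; M = strip K J;
          p = vector [y0, x0]; q = vector [y0', x0'];
          I = integral {y0..y0'} (\<lambda>y. 1 / f y)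
      in
        ((spacelike_related g M p q \<longleftrightarrow> I > dist x0 x0') \<and>
         (spacelike_related g M p q \<longrightarrow>
            unique_geodesic g M p q \<and>
            (\<forall>\<gamma>. geodesic_joins g M \<gamma> p q \<longrightarrow> spacelike_curve g \<gamma> \<and> no_conjugate_points g \<gamma>)))
      \<and> ((lightlike_related g M p q \<longleftrightarrow> I = dist x0 x0') \<and>
         (lightlike_related g M p q \<longrightarrow>
            unique_geodesic g M p q \<and>
            (\<forall>\<gamma>. geodesic_joins g M \<gamma> p q \<longrightarrow> lightlike_curve g \<gamma> \<and> no_conjugate_points g \<gamma>)))
      \<and> ((timelike_related g M p q \<longleftrightarrow> I < dist x0 x0') \<and>
         ((\<forall>u\<in>M. \<forall>v\<in>M. timelike_related g M u v \<longrightarrow> (\<exists>\<gamma>. geodesic_joins g M \<gamma> u v))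
            \<longleftrightarrow> condition_C a b f (d - c) \<or> condition_R a b f (d - c)) \<and>
         (\<forall>u\<in>M. \<forall>v\<in>M. timelike_related g M u v \<longrightarrow>
            (\<forall>\<gamma>. geodesic_joins g M \<gamma> u v \<longrightarrow> timelike_curve g \<gamma>))))"
proof -
 note KJ = assms(2,4)
 interpret S: static_strip a b f by (rule static_strip.intro) (use assms in auto)
 define p q :: "real ^ 2" where "p = vector [y0, x0]" and "q = vector [y0', x0']"
 let ?M = "strip (einterval a b) (einterval c d)"
 let ?g = "static_metric f"
 have y: "y0 \<in> einterval a b" "y0' \<in> einterval a b" using assms by auto
 have pq: "p \<in> ?M" "q \<in> ?M" unfolding p_def q_def strip_def using assms by auto
 have ne: "p \<noteq> q" using assms(11) unfolding p_def q_def by (auto simp: vec_eq_iff forall_2)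
 have le: "p $ 1 <= q $ 1" unfolding p_def q_def using assms(12) by simp
 have I: "integral {y0..y0'} (\<lambda>y. 1 / f y) = \<bar>S.F (q $ 1) - S.F (p $ 1)\<bar>"
  unfolding p_def q_def using S.integral_F[OF y assms(12)] S.F_abs[OF y assms(12)] by simp
 have D: "dist x0 x0' = \<bar>q $ 2 - p $ 2\<bar>" unfolding p_def q_def by (simp add: dist_real_def abs_minus_commute)
 have K': "p $ 1 \<in> einterval a b" "q $ 1 \<in> einterval a b" using y unfolding p_def q_def by auto
 have sp: "unique_geodesic ?g ?M p q \<and> (\<forall>\<gamma>. geodesic_joins ?g ?M \<gamma> p q --> spacelike_curve ?g \<gamma> \<and> no_conjugate_points ?g \<gamma>)"
  if lt: "\<bar>q $ 2 - p $ 2\<bar> < \<bar>S.F (q $ 1) - S.F (p $ 1)\<bar>"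
 proof -
  have lt': "\<bar>q $ 2 - p $ 2\<bar> < S.F (q $ 1) - S.F (p $ 1)" using lt S.F_abs[OF K' le] by simp
  have "p $ 1 \<noteq> q $ 1" using lt' by auto
  then have "p $ 1 < q $ 1" using le by simp
  then obtain \<nu> where \<nu>: "q $ 2 - p $ 2 = S.X_prim 1 \<nu> (q $ 1) - S.X_prim 1 \<nu> (p $ 1)"
   by (rule S.spacelike_parameter[OF K' _ lt'])
  have "S.admissible 1 \<nu>" unfolding S.admissible_def by simp
  from S.unique_rising[OF pq ne le _ this \<nu>] lt show ?thesis using S.geodesic_type_of_ends(1)[OF _ ne lt] by auto
 qed
 have li: "unique_geodesic ?g ?M p q \<and> (\<forall>\<gamma>. geodesic_joins ?g ?M \<gamma> p q --> lightlike_curve ?g \<gamma> \<and> no_conjugate_points ?g \<gamma>)"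
  if eq: "\<bar>S.F (q $ 1) - S.F (p $ 1)\<bar> = \<bar>q $ 2 - p $ 2\<bar>"
 proof -
  define \<nu> :: real where "\<nu> = (if q $ 2 < p $ 2 then -1 else 1)"
  have \<nu>1: "\<bar>\<nu>\<bar> = 1" unfolding \<nu>_def by simp
  have "S.X_prim 0 \<nu> (q $ 1) - S.X_prim 0 \<nu> (p $ 1) = \<nu> * (S.F (q $ 1) - S.F (p $ 1))"
   by (rule S.lightlike_parameter[OF K' \<nu>1])
  then have \<nu>: "q $ 2 - p $ 2 = S.X_prim 0 \<nu> (q $ 1) - S.X_prim 0 \<nu> (p $ 1)"
   using eq S.F_abs[OF K' le] unfolding \<nu>_def by (auto split: if_splits)
  have "S.admissible 0 \<nu>" unfolding S.admissible_def using \<nu>1 by simp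
  from S.unique_rising[OF pq ne le _ this \<nu>] eq show ?thesis using S.geodesic_type_of_ends(2)[OF _ ne eq] by auto
 qed
 have ti: "timelike_curve ?g \<gamma>"
  if "u \<in> ?M" "v \<in> ?M" "timelike_related ?g ?M u v" "geodesic_joins ?g ?M \<gamma> u v" for u v \<gamma>
 proof -
  have lt: "\<bar>S.F (v $ 1) - S.F (u $ 1)\<bar> < \<bar>v $ 2 - u $ 2\<bar>" using that S.timelike_iff[OF that(1,2)] by simp
  then have "u \<noteq> v" by auto
  from S.geodesic_type_of_ends(3)[OF that(4) this lt] show ?thesis .
 qed
 show ?thesis
  unfolding Let_def KJ p_def[symmetric] q_def[symmetric] I D S.spacelike_iff[OF pq] S.lightlike_iff[OF pq ne] S.timelike_iff[OF pq]
   S.all_timelike_connected_iff[OF assms(3)] using sp li ti by blast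
qed

end
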